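(* Let $\mu$ be a symmetric Lévy measure on $\mathbb{R}$ and $m:\mathbb{R}\times\mathbb{R}\to\mathbb{R}$ a Borel measurable function such that: (A1) there exists $\beta>1$ such that $q^U(\xi)\le \beta q^L(\xi)$ for all sufficiently large $|\xi|$; (A2) $m(x,u)\ge 0$ and $m(x,-u)=m(x,u)$ for all $x,u\in\mathbb{R}$; (A3) there exist $c,\epsilon>0$ such that $\sup_x m(x,u)\le c(1\wedge|u|^\epsilon)$ for all $u$, where $\epsilon$ is small enough that $\int_{\mathbb{R}}(|u|^\epsilon\wedge 1)\,\mu(du)=\infty$. Let $p_t(x,y)=p_t^0(x,y)+(p^0\star\Psi)_t(x,y)$ be the function given by the parametrix construction. Then: 1. The function $p_t(x,y)$ is continuous in $(t,x,y)\in(0,\infty)\times\mathbb{R}\times\mathbb{R}$. 2. There exist constants $d_1,d_2>0$ and a family of probability measures $\{Q_t,\ t\ge0\}$ such that, with $f_{up}(x)=d_1e^{-d_2|x|\log(1+|x|)}$, $$p_t(x,y)\le\rho_t\big(f_{up}(\rho_t\,\cdot)*Q_t\big)(y-x),\qquad t\in(0,1],\ x,y\in\mathbb{R}.$$ 3. The derivative $\partial_tp_t(x,y)$ exists and is continuous in $(t,x,y)\in(0,\infty)\times\mathbb{R}\times\mathbb{R}$. 4. There exist constants $C,\tilde d_1,\tilde d_2>0$ and a family of probability measures $\{\tilde Q_t,\ t\ge0\}$ such that, with $\tilde f_{up}(x)=\tilde d_1e^{-\tilde d_2|x|\log(1+|x|)}$, $$|\partial_tp_t(x,y)|\le C\,t^{-1}\rho_t\big(\tilde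 f_{up}(\rho_t\,\cdot)*\tilde Q_t\big)(y-x),\qquad t\in(0,1],\ x,y\in\mathbb{R}.$$
   Context: A Lévy measure $\mu$ on $\mathbb{R}$ satisfies $\mu(\{0\})=0$ and $\int_{\mathbb{R}}(1\wedge u^2)\,\mu(du)<\infty$; symmetric means invariant under $u\mapsto -u$. Notation: $a\wedge b=\min(a,b)$; for a function $f$ and a measure $Q$, $(f*Q)(x)=\int f(x-w)\,Q(dw)$. $q(\xi)=\int_{\mathbb{R}}(1-\cos(\xi u))\,\mu(du)$, $\quad q^U(\xi)=\int_{\mathbb{R}}((\xi u)^2\wedge1)\,\mu(du)$, $\quad q^L(\xi)=\int_{|u\xi|\le1}(\xi u)^2\,\mu(du)$. The function $q^U$ is continuous and nondecreasing on $[0,\infty)$, and under (A1) it is strictly increasing on some $[a,\infty)$ and unbounded. Put $\rho_t=(q^U)^{-1}(1/t)$, $t\in(0,1]$, i.e. $\rho_t>0$ solves $q^U(\rho_t)=1/t$ (the largest solution, should there be several). Under (A1), $p_t(x)=\frac1{2\pi}\int_{\mathbb{R}}e^{-ix\xi-tq(\xi)}\,d\xi$ is the transition density of the Lévy process with characteristic exponent $q$, and $p_t^0(x,y):=p_t(y-x)$ (the one-argument function $p_t(\cdot)$ is distinct from $p_t(x,y)$). Perturbation operator: $\mathfrak{L}(x,D)f(x)=\int_{\mathbb{R}}(f(x+u)-f(x))\,m(x,u)\,\mu(du)$; integrals of this kind against kernels symmetric in $u$ are understood in the symmetric (principal value) sense, i.e. as $\frac12\int(f(x+u)+f(x-u)-2f(x))\,m(x,u)\,\mu(du)$.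 Put $\Phi_t(x,y)=\mathfrak{L}(x,D)p_t^0(x,y)$ (acting in $x$). Space-time convolution: $(f\star g)_t(x,y)=\int_0^t\int_{\mathbb{R}}f_{t-\tau}(x,z)\,g_\tau(z,y)\,dz\,d\tau$; $\Phi^{\star1}=\Phi$, $\Phi^{\star(k+1)}=\Phi^{\star k}\star\Phi$; $\Psi_t(x,y)=\sum_{k\ge1}\Phi_t^{\star k}(x,y)$; the convolutions are well defined and the series converges under (A1)-(A3). *)

theory Defs
  imports "HOL-Probability.Probability"
begin

definition levy_measure :: "real measure \<Rightarrow> bool" where
  "levy_measure \<mu> \<longleftrightarrow> sets \<mu> = sets borel \<and> emeasure \<mu> {0} = 0 \<and>
     (\<integral>\<^sup>+u. ennreal (min 1 (u\<^sup>2)) \<partial>\<mu>) < \<infinity>"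

definition symmetric_measure :: "real measure \<Rightarrow> bool" where
  "symmetric_measure \<mu> \<longleftrightarrow> distr \<mu> borel uminus = \<mu>"

definition levy_q :: "real measure \<Rightarrow> real \<Rightarrow> real" where
  "levy_q \<mu> \<xi> = (\<integral>u. 1 - cos (\<xi> * u) \<partial>\<mu>)"

definition levy_qU :: "real measure \<Rightarrow> real \<Rightarrow> real" where
  "levy_qU \<mu> \<xi> = (\<integral>u. min ((\<xi> * u)\<^sup>2) 1 \<partial>\<mu>)"

definition levy_qL :: "real measure \<Rightarrow> real \<Rightarrow> real" where
  "levy_qL \<mu> \<xi> = set_lebesgue_integral \<mu> {u. \<bar>u * \<xi>\<bar> \<le> 1} (\<lambda>u. (\<xi> * u)\<^sup>2)"

definition levy_rho :: "real measure \<Rightarrow> real \<Rightarrow> real" where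
  "levy_rho \<mu> t = (GREATEST r. 0 < r \<and> levy_qU \<mu> r = 1 / t)"

(* Since q is even, the Fourier integral is real; Re only changes the type. *)
definition levy_density :: "real measure \<Rightarrow> real \<Rightarrow> real \<Rightarrow> real" where
  "levy_density \<mu> t x =
     Re (1 / (2 * of_real pi) *
       (\<integral>\<xi>. exp (- (\<i> * of_real (x * \<xi>)) - of_real (t * levy_q \<mu> \<xi>)) \<partial>lborel))"

definition levy_p0 :: "real measure \<Rightarrow> real \<Rightarrow> real \<Rightarrow> real \<Rightarrow> real" where
  "levy_p0 \<mu> t x y = levy_density \<mu> t (y - x)"

(* The integral of (f(x+u) - f(x)) m(x,u) \<mu>(du) in the symmetric (principal value) sense,
   for a kernel m(x,u) that is even in u. *)
definition perturbation_op ::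
    "real measure \<Rightarrow> (real \<Rightarrow> real \<Rightarrow> real) \<Rightarrow> (real \<Rightarrow> real) \<Rightarrow> real \<Rightarrow> real" where
  "perturbation_op \<mu> m f x = 1 / 2 * (\<integral>u. (f (x + u) + f (x - u) - 2 * f x) * m x u \<partial>\<mu>)"

definition parametrix_Phi ::
    "real measure \<Rightarrow> (real \<Rightarrow> real \<Rightarrow> real) \<Rightarrow> real \<Rightarrow> real \<Rightarrow> real \<Rightarrow> real" where
  "parametrix_Phi \<mu> m t x y = perturbation_op \<mu> m (\<lambda>x'. levy_p0 \<mu> t x' y) x"

definition spacetime_conv ::
    "(real \<Rightarrow> real \<Rightarrow> real \<Rightarrow> real) \<Rightarrow> (real \<Rightarrow> real \<Rightarrow> real \<Rightarrow> real) \<Rightarrow> real \<Rightarrow> real \<Rightarrow> real \<Rightarrow> real" where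
  "spacetime_conv f g t x y =
     set_lebesgue_integral lborel {0<..<t} (\<lambda>\<tau>. \<integral>z. f (t - \<tau>) x z * g \<tau> z y \<partial>lborel)"

(* The exponent is shifted by one: index k stands for the (k+1)-fold convolution power. *)
primrec spacetime_conv_pow ::
    "(real \<Rightarrow> real \<Rightarrow> real \<Rightarrow> real) \<Rightarrow> nat \<Rightarrow> real \<Rightarrow> real \<Rightarrow> real \<Rightarrow> real" where
  "spacetime_conv_pow f 0 = f"
| "spacetime_conv_pow f (Suc k) = spacetime_conv (spacetime_conv_pow f k) f"

definition parametrix_Psi ::
    "real measure \<Rightarrow> (real \<Rightarrow> real \<Rightarrow> real) \<Rightarrow> real \<Rightarrow> real \<Rightarrow> real \<Rightarrow> real" where
  "parametrix_Psi \<mu> m t x y = (\<Sum>k. spacetime_conv_pow (parametrix_Phi \<mu> m) k t x y)"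

definition parametrix_p ::
    "real measure \<Rightarrow> (real \<Rightarrow> real \<Rightarrow> real) \<Rightarrow> real \<Rightarrow> real \<Rightarrow> real \<Rightarrow> real" where
  "parametrix_p \<mu> m t x y =
     levy_p0 \<mu> t x y + spacetime_conv (levy_p0 \<mu>) (parametrix_Psi \<mu> m) t x y"

definition conv_measure :: "(real \<Rightarrow> real) \<Rightarrow> real measure \<Rightarrow> real \<Rightarrow> real" where
  "conv_measure f Q x = (\<integral>w. f (x - w) \<partial>Q)"

definition f_up :: "real \<Rightarrow> real \<Rightarrow> real \<Rightarrow> real" where
  "f_up d1 d2 x = d1 * exp (- d2 * \<bar>x\<bar> * ln (1 + \<bar>x\<bar>))"

end

theory Submission
  imports Defs
begin

text \<open>
  The measures \<open>Q\<^sub>t\<close> are free, and this reduces the pointwise bounds to integral bounds.  Suppose that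
  \<open>F \<ge> 0\<close> varies slowly on the scale \<open>1 / \<rho>\<^sub>t\<close>, in the sense that
  \<open>F (v + w) \<le> (1 + \<rho>\<^sub>t \<bar>w\<bar>)\<^sup>2 F v\<close>, and that \<open>\<integral> F\<close> is bounded independently of \<open>t\<close>.  With
  \<open>Q\<^sub>t = F dv / \<integral> F\<close>, the function \<open>\<rho>\<^sub>t (f_up (\<rho>\<^sub>t \<cdot>) * Q\<^sub>t)\<close> is at least a multiple of the mean of
  \<open>F\<close> over a window of width \<open>1 / \<rho>\<^sub>t\<close>, hence at least \<open>F\<close> once \<open>d\<^sub>1\<close> is large
  (\<open>harnack_le_conv_measure\<close>).  It therefore suffices to dominate \<open>p\<^sub>t(x, y)\<close> and \<open>t \<partial>\<^sub>t p\<^sub>t(x, y)\<close> by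
  \<open>H\<^sub>t(y - x)\<close> for slowly varying \<open>H\<^sub>t\<close> with bounded integrals.  Slow variation costs nothing: convolving
  with \<open>\<rho>\<^sub>t / (1 + \<rho>\<^sub>t \<bar>w\<bar>)\<^sup>2\<close> produces it and multiplies the integral by a constant only.

  For the unperturbed density, the integrals of \<open>\<bar>\<partial>\<^sub>t\<^sup>i \<partial>\<^sub>x\<^sup>j p\<^sup>0\<^sub>t\<bar>\<close> are at most \<open>C t\<^sup>-\<^sup>i \<rho>\<^sub>t\<^sup>j\<close>
  (\<open>heat_deriv_L1\<close>).  On the Fourier side \<open>t q\<close> is split at the jump size \<open>1 / \<rho>\<^sub>t\<close>.  Jumps larger than that
  have total rate at most \<open>1 / t\<close>; they act by averaging translates, so that their multipliers are
  bounded on \<open>L\<^sup>1\<close>.  The smaller jumps contribute, after rescaling by \<open>\<rho>\<^sub>t\<close>, a smooth symbol whose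
  derivatives are controlled uniformly in \<open>t\<close> and which by (A1) grows at least like a power; here two
  integrations by parts are enough.  A Sobolev inequality in time and space turns the integral bounds
  into a pointwise one by a local mean of all these derivatives, whose mollification is the envelope of \<open>p\<^sup>0\<close>
  (\<open>heat_le_envelope\<close>).

  For \<open>\<Phi>\<close>, a second difference with step \<open>u\<close> is at most \<open>min ((\<rho>\<^sub>t u)\<^sup>2) 1\<close> times translates of that
  envelope, and (A1) gives \<open>\<integral> (\<bar>u\<bar>\<^sup>\<epsilon> \<and> 1) ((\<rho>\<^sub>t u)\<^sup>2 \<and> 1) \<mu>(du) \<le> C t\<^sup>\<delta>\<^sup>-\<^sup>1\<close> for some \<open>\<delta> > 0\<close>
  (\<open>perturbation_mass\<close>).  The singularity at \<open>t = 0\<close> is integrable.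

  Space-time convolution of majorants of sizes \<open>t\<^sup>\<kappa>\<^sup>-\<^sup>1\<close> and \<open>t\<^sup>\<lambda>\<^sup>-\<^sup>1\<close> gives one of size \<open>t\<^sup>\<kappa>\<^sup>+\<^sup>\<lambda>\<^sup>-\<^sup>1\<close> with a
  Beta function as additional factor; since \<open>B(\<delta>, k\<delta>) \<rightarrow> 0\<close>, the parametrix series converges by the ratio test.
  Derivatives in time are carried along by the substitution \<open>\<tau> = t s\<close>, under which \<open>t \<partial>\<^sub>t\<close> obeys
  \<open>t \<partial>\<^sub>t (f \<star> k) = f \<star> k + (t \<partial>\<^sub>t f) \<star> k + f \<star> (t \<partial>\<^sub>t k)\<close> without boundary terms.  So \<open>f\<close> and
  \<open>t \<partial>\<^sub>t f\<close> are estimated together, as a pair with one common majorant (\<open>kernel_pair_conv\<close>,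
  \<open>kernel_pair_parametrix\<close>); continuity follows by dominated convergence.
\<close>

section \<open>Calculus and integration on the real line\<close>

lemma has_real_derivative_integral:
  fixes f f' :: "real \<Rightarrow> 'a \<Rightarrow> real"
  assumes t: "a < t" "t < b"
    and meas: "\<And>s. a < s \<Longrightarrow> s < b \<Longrightarrow> f s \<in> borel_measurable M"
    and meas': "f' t \<in> borel_measurable M"
    and int: "\<And>s. a < s \<Longrightarrow> s < b \<Longrightarrow> integrable M (f s)"
    and deriv: "\<And>s \<omega>. a < s \<Longrightarrow> s < b \<Longrightarrow> \<omega> \<in> space M \<Longrightarrow>
      ((\<lambda>s. f s \<omega>) has_real_derivative f' s \<omega>) (at s)"
    and bound: "\<And>s \<omega>. a < s \<Longrightarrow> s < b \<Longrightarrow> \<omega> \<in> space M \<Longrightarrow> \<bar>f' s \<omega>\<bar> \<le> w \<omega>"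
    and w: "integrable M w"
  shows "((\<lambda>s. \<integral>\<omega>. f s \<omega> \<partial>M) has_real_derivative (\<integral>\<omega>. f' t \<omega> \<partial>M)) (at t)"
proof -
  let ?F = "\<lambda>s. \<integral>\<omega>. f s \<omega> \<partial>M"
  have "((\<lambda>s. (?F s - ?F t) / (s - t)) \<longlongrightarrow> (\<integral>\<omega>. f' t \<omega> \<partial>M)) (at t within {a<..<b})"
    unfolding tendsto_at_iff_sequentially
  proof safe
    fix X assume X: "\<forall>i. X i \<in> {a<..<b} - {t}" "X \<longlonglongrightarrow> t"
    have Xi: "a < X i" "X i < b" "X i \<noteq> t" for i using X(1) by auto
    let ?q = "\<lambda>i \<omega>. (f (X i) \<omega> - f t \<omega>) / (X i - t)"
    have lim: "(\<lambda>i. \<integral>\<omega>. ?q i \<omega> \<partial>M) \<longlonglongrightarrow> (\<integral>\<omega>. f' t \<omega> \<partial>M)"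
    proof (rule integral_dominated_convergence[where w=w])
      show "f' t \<in> borel_measurable M" by fact
      show "?q i \<in> borel_measurable M" for i
        using meas[OF Xi(1,2)] meas[OF t] by measurable
      show "integrable M w" by fact
      show "AE \<omega> in M. (\<lambda>i. ?q i \<omega>) \<longlonglongrightarrow> f' t \<omega>"
      proof (rule AE_I2)
        fix \<omega> assume o: "\<omega> \<in> space M"
        have "((\<lambda>s. (f s \<omega> - f t \<omega>) / (s - t)) \<longlongrightarrow> f' t \<omega>) (at t)"
          using deriv[OF t o] by (simp add: has_field_derivative_iff)
        from this[unfolded tendsto_at_iff_sequentially, rule_format, of X] Xi X(2)
        show "(\<lambda>i. ?q i \<omega>) \<longlonglongrightarrow> f' t \<omega>" by (auto simp: comp_def)
      qed
      show "AE \<omega> in M. norm (?q i \<omega>) \<le> w \<omega>" for i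
      proof (rule AE_I2)
        fix \<omega> assume o: "\<omega> \<in> space M"
        have "norm (f (X i) \<omega> - f t \<omega>) \<le> w \<omega> * norm (X i - t)"
        proof (rule field_differentiable_bound[of "{a<..<b}" "\<lambda>s. f s \<omega>" "\<lambda>s. f' s \<omega>"])
          show "convex {a<..<b}" by simp
          show "((\<lambda>s. f s \<omega>) has_field_derivative f' z \<omega>) (at z within {a<..<b})"
            if "z \<in> {a<..<b}" for z
            using deriv[of z \<omega>] o that has_field_derivative_at_within by auto
          show "norm (f' z \<omega>) \<le> w \<omega>" if "z \<in> {a<..<b}" for z
            using bound[of z \<omega>] o that by auto
        qed (use Xi t in auto)
        then show "norm (?q i \<omega>) \<le> w \<omega>"
          using Xi by (auto simp: divide_simps)
      qed
    qed
    have eq: "(\<integral>\<omega>. ?q i \<omega> \<partial>M) = (?F (X i) - ?F t) / (X i - t)" for i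
    proof -
      have "(\<integral>\<omega>. f (X i) \<omega> - f t \<omega> \<partial>M) = ?F (X i) - ?F t"
        by (rule Bochner_Integration.integral_diff[OF int[OF Xi(1,2)] int[OF t]])
      then show ?thesis by simp
    qed
    show "((\<lambda>s. (?F s - ?F t) / (s - t)) \<circ> X) \<longlonglongrightarrow> (\<integral>\<omega>. f' t \<omega> \<partial>M)"
      unfolding comp_def using lim[unfolded eq] .
  qed
  moreover have "at t within {a<..<b} = at t"
    using t by (intro at_within_open) auto
  ultimately show ?thesis by (simp add: has_field_derivative_iff)
qed

text \<open>
  Two applications of the mean value inequality: to \<open>D1\<close> between \<open>v - s\<close> and \<open>v + s\<close>, then to
  \<open>s \<mapsto> D (v + s) + D (v - s)\<close>.
\<close>

lemma second_difference_bound: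
  fixes D D1 D2 :: "real \<Rightarrow> real"
  assumes D1: "\<And>x. (D has_real_derivative D1 x) (at x)"
    and D2: "\<And>x. (D1 has_real_derivative D2 x) (at x)"
    and K: "\<And>w. \<bar>w\<bar> \<le> \<bar>u\<bar> \<Longrightarrow> \<bar>D2 (v + w)\<bar> \<le> K"
  shows "\<bar>D (v + u) + D (v - u) - 2 * D v\<bar> \<le> 2 * K * u\<^sup>2"
proof -
  let ?I = "{-\<bar>u\<bar>..\<bar>u\<bar>}"
  have K0: "0 \<le> K" using K[of 0] by auto
  have d1: "\<bar>D1 (v + s) - D1 (v - s)\<bar> \<le> 2 * K * \<bar>u\<bar>" if s: "s \<in> ?I" for s
  proof -
    have "norm (D1 (v + s) - D1 (v - s)) \<le> K * norm ((v + s) - (v - s))"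
    proof (rule field_differentiable_bound[of "{v-\<bar>u\<bar>..v+\<bar>u\<bar>}" D1 D2])
      show "norm (D2 z) \<le> K" if "z \<in> {v-\<bar>u\<bar>..v+\<bar>u\<bar>}" for z
        using K[of "z - v"] that by (auto simp: abs_le_iff)
      show "(D1 has_field_derivative D2 z) (at z within {v-\<bar>u\<bar>..v+\<bar>u\<bar>})" for z
        using D2 has_field_derivative_at_within by blast
    qed (use s in auto)
    also have "\<dots> \<le> K * (2 * \<bar>u\<bar>)" using s K0 by (intro mult_left_mono) auto
    finally show ?thesis by (simp add: algebra_simps)
  qed
  have "norm ((D (v + u) + D (v - u)) - (D (v + 0) + D (v - 0))) \<le> (2 * K * \<bar>u\<bar>) * norm (u - 0)"
  proof (rule field_differentiable_bound[of ?I "\<lambda>s. D (v + s) + D (v - s)" "\<lambda>s. D1 (v + s) - D1 (v - s)"])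
    show "((\<lambda>s. D (v + s) + D (v - s)) has_field_derivative D1 (v + z) - D1 (v - z)) (at z within ?I)" for z
    proof -
      have "((\<lambda>s. D (v + s)) has_real_derivative D1 (v + z) * 1) (at z within ?I)"
        by (rule DERIV_chain2[OF D1]) (auto intro!: derivative_eq_intros)
      moreover have "((\<lambda>s. D (v - s)) has_real_derivative D1 (v - z) * -1) (at z within ?I)"
        by (rule DERIV_chain2[OF D1]) (auto intro!: derivative_eq_intros)
      ultimately show ?thesis using DERIV_add by fastforce
    qed
    show "norm (D1 (v + z) - D1 (v - z)) \<le> 2 * K * \<bar>u\<bar>" if "z \<in> ?I" for z
      using d1[OF that] by simp
  qed auto
  then show ?thesis by (simp add: power2_eq_square abs_mult mult.assoc)
qed

text \<open>
  The one-dimensional Sobolev inequality: the oscillation of \<open>g\<close> is at most \<open>\<integral> \<bar>g'\<bar>\<close>, and somewhere \<open>\<bar>g\<bar>\<close>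
  is at most its mean.  It converts integral bounds for derivatives into pointwise bounds.
\<close>

lemma sobolev_Icc:
  fixes g g' :: "real \<Rightarrow> real"
  assumes ab: "a < b" and c: "c \<in> {a..b}"
    and d: "\<And>x. x \<in> {a..b} \<Longrightarrow> (g has_real_derivative g' x) (at x)"
    and cont: "continuous_on {a..b} g'"
  shows "ennreal \<bar>g c\<bar> \<le> (\<integral>\<^sup>+x\<in>{a..b}. ennreal (\<bar>g x\<bar> / (b - a) + \<bar>g' x\<bar>) \<partial>lborel)"
proof -
  have contg: "continuous_on {a..b} g"
    by (meson DERIV_isCont continuous_at_imp_continuous_on d)
  have i': "set_integrable lborel {a..b} (\<lambda>x. \<bar>g' x\<bar>)"
    by (rule borel_integrable_atLeastAtMost') (intro continuous_intros cont)
  have i: "set_integrable lborel {a..b} (\<lambda>x. \<bar>g x\<bar>)"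
    by (rule borel_integrable_atLeastAtMost') (intro continuous_intros contg)
  define J where "J = (LINT x:{a..b}|lborel. \<bar>g' x\<bar>)"
  have FTC: "\<bar>g y - g x\<bar> \<le> J" if "x \<in> {a..b}" "y \<in> {a..b}" "x \<le> y" for x y
  proof -
    have sub: "{x..y} \<subseteq> {a..b}" using that by auto
    have "set_integrable lborel {x..y} g'"
      by (rule borel_integrable_atLeastAtMost') (rule continuous_on_subset[OF cont sub])
    then have "(LINT z:{x..y}|lborel. g' z) = g y - g x"
      using integral_FTC_Icc[of x y g g'] that sub d continuous_on_subset[OF cont sub]
      by (auto simp: set_lebesgue_integral_def has_real_derivative_iff_has_vector_derivative has_vector_derivative_at_within)
    moreover have "\<bar>LINT z:{x..y}|lborel. g' z\<bar> \<le> (LINT z:{x..y}|lborel. \<bar>g' z\<bar>)"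
      using set_integral_norm_bound[OF \<open>set_integrable lborel {x..y} g'\<close>] by simp
    moreover have "(LINT z:{x..y}|lborel. \<bar>g' z\<bar>) \<le> J"
      unfolding J_def unfolding set_lebesgue_integral_def
      by (rule integral_mono') (use sub i' in \<open>auto simp: set_integrable_def split: split_indicator\<close>)
    ultimately show ?thesis by linarith
  qed
  have pt: "\<bar>g c\<bar> \<le> \<bar>g x\<bar> + J" if "x \<in> {a..b}" for x
    using FTC[OF that c] FTC[OF c that] by linarith
  have "(b - a) * (\<bar>g c\<bar> - J) = (LINT x:{a..b}|lborel. (\<bar>g c\<bar> - J))"
    using ab by (simp add: set_lebesgue_integral_def)
  also have "\<dots> \<le> (LINT x:{a..b}|lborel. \<bar>g x\<bar>)"
  proof (rule set_integral_mono[OF _ i])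
    show "set_integrable lborel {a..b} (\<lambda>x. \<bar>g c\<bar> - J)"
      by (rule borel_integrable_atLeastAtMost') simp
  qed (use pt in fastforce)
  finally have "\<bar>g c\<bar> \<le> (LINT x:{a..b}|lborel. \<bar>g x\<bar>) / (b - a) + J"
    using ab by (simp add: field_simps)
  also have "\<dots> = (LINT x:{a..b}|lborel. \<bar>g x\<bar> / (b - a) + \<bar>g' x\<bar>)"
    unfolding J_def using i i' by (subst set_integral_add) (auto intro: set_integrable_divide)
  finally have "ennreal \<bar>g c\<bar> \<le> ennreal (LINT x:{a..b}|lborel. \<bar>g x\<bar> / (b - a) + \<bar>g' x\<bar>)"
    by (rule ennreal_leI)
  also have "\<dots> = (\<integral>\<^sup>+x. ennreal (indicator {a..b} x *\<^sub>R (\<bar>g x\<bar> / (b - a) + \<bar>g' x\<bar>)) \<partial>lborel)"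
    unfolding set_lebesgue_integral_def
  proof (rule nn_integral_eq_integral[symmetric])
    show "integrable lborel (\<lambda>x. indicator {a..b} x *\<^sub>R (\<bar>g x\<bar> / (b - a) + \<bar>g' x\<bar>))"
      using set_integral_add(1)[OF set_integrable_divide[OF i] i', of "b - a"]
      by (simp add: set_integrable_def)
  qed (use ab in \<open>auto intro!: AE_I2\<close>)
  also have "\<dots> = (\<integral>\<^sup>+x\<in>{a..b}. ennreal (\<bar>g x\<bar> / (b - a) + \<bar>g' x\<bar>) \<partial>lborel)"
    by (intro nn_integral_cong) (auto split: split_indicator)
  finally show ?thesis .
qed

lemma nn_integral_scaled_cauchy:
  assumes "r > 0"
  shows "(\<integral>\<^sup>+w. ennreal (r / (1 + (r * w)\<^sup>2)) \<partial>lborel) = ennreal pi"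
proof -
  have i: "integrable lborel (\<lambda>x::real. inverse (1 + x\<^sup>2))" "(\<integral>x. inverse (1 + (x::real)\<^sup>2) \<partial>lborel) = pi"
    using integrable_inverse_1_plus_square LBINT_inverse_1_plus_square
    by (auto simp: set_integrable_def interval_lebesgue_integral_def set_lebesgue_integral_def)
  have "ennreal pi = (\<integral>\<^sup>+x. ennreal (inverse (1 + x\<^sup>2)) \<partial>lborel)"
    using i by (subst nn_integral_eq_integral) auto
  also have "\<dots> = ennreal r * (\<integral>\<^sup>+w. ennreal (inverse (1 + (0 + r * w)\<^sup>2)) \<partial>lborel)"
    using assms by (subst nn_integral_real_affine[where c=r and t=0]) auto
  also have "\<dots> = (\<integral>\<^sup>+w. ennreal (r / (1 + (r * w)\<^sup>2)) \<partial>lborel)"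
    using assms by (subst nn_integral_cmult[symmetric]) (auto simp: ennreal_mult[symmetric] divide_inverse)
  finally show ?thesis by simp
qed

lemma nn_integral_shift:
  fixes F :: "real \<Rightarrow> ennreal"
  assumes [measurable]: "F \<in> borel_measurable borel"
  shows "(\<integral>\<^sup>+x. F (a + x) \<partial>lborel) = (\<integral>\<^sup>+x. F x \<partial>lborel)"
    "(\<integral>\<^sup>+x. F (x + a) \<partial>lborel) = (\<integral>\<^sup>+x. F x \<partial>lborel)"
    "(\<integral>\<^sup>+x. F (x - a) \<partial>lborel) = (\<integral>\<^sup>+x. F x \<partial>lborel)"
    "(\<integral>\<^sup>+x. F (a - x) \<partial>lborel) = (\<integral>\<^sup>+x. F x \<partial>lborel)"
  using nn_integral_real_affine[of F 1 a] nn_integral_real_affine[of F 1 "-a"] nn_integral_real_affine[of F "-1" a]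
  by (auto simp: add.commute)

lemma integrable_of_nn_bound:
  fixes f :: "'a \<Rightarrow> real"
  assumes "f \<in> borel_measurable M" "(\<integral>\<^sup>+x. ennreal \<bar>f x\<bar> \<partial>M) \<le> ennreal c"
  shows "integrable M f"
  by (rule integrableI_bounded) (use assms in \<open>auto intro: le_less_trans\<close>)

lemma abs_integral_le_nn_integral: "ennreal \<bar>\<integral>x. f x \<partial>M\<bar> \<le> (\<integral>\<^sup>+x. ennreal \<bar>f x\<bar> \<partial>M)" for f :: "'a \<Rightarrow> real"
proof (cases "integrable M f")
  case True
  then show ?thesis using integral_norm_bound_ennreal[OF True] by simp
next
  case False
  then show ?thesis by (simp add: not_integrable_integral_eq)
qed

lemma Beta_nn_integral:
  assumes "0 < a" "0 < b"
  shows "(\<integral>\<^sup>+s\<in>{0<..<1}. ennreal ((1 - s) powr (a - 1) * s powr (b - 1)) \<partial>lborel) = ennreal (Beta b a)"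
proof -
  have *: "((\<lambda>t::real. t powr (b - 1) * (1 - t) powr (a - 1)) has_integral Beta b a) {0<..<1}"
    using has_integral_Beta_real[of b a] assms by (simp add: has_integral_Icc_iff_Ioo)
  have "(\<integral>\<^sup>+s. ennreal (indicator {0<..<1} s * (s powr (b - 1) * (1 - s) powr (a - 1))) \<partial>lborel) = ennreal (Beta b a)"
  proof (rule nn_integral_has_integral_lborel)
    show "((\<lambda>t. indicator {0<..<1} t * (t powr (b - 1) * (1 - t) powr (a - 1))) has_integral Beta b a) UNIV"
      using *[unfolded has_integral_restrict_UNIV[of "{0<..<1}", symmetric]]
      by (rule has_integral_eq[rotated]) (auto simp: indicator_def)
  qed auto
  then show ?thesis
    by (subst (asm) nn_integral_cong[where v = "\<lambda>s. ennreal ((1 - s) powr (a - 1) * s powr (b - 1)) * indicator {0<..<1} s"])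
       (auto split: split_indicator simp: mult.commute)
qed

section \<open>Slowly varying functions\<close>

text \<open>
  A Harnack inequality at the length scale \<open>1 / r\<close>.  The polynomial factor, rather than a bound on
  windows of width \<open>1 / r\<close> only, makes the condition stable under sums, mixtures, translations and
  changes of scale with no loss beyond the constant \<open>L\<close>.
\<close>

definition harnack :: "real \<Rightarrow> real \<Rightarrow> (real \<Rightarrow> ennreal) \<Rightarrow> bool" where
  "harnack r L F \<longleftrightarrow> (\<forall>v w. F (v + w) \<le> ennreal (L * (1 + r * \<bar>w\<bar>)\<^sup>2) * F v)"

lemma harnackD: "harnack r L F \<Longrightarrow> F (v + w) \<le> ennreal (L * (1 + r * \<bar>w\<bar>)\<^sup>2) * F v"
  by (simp add: harnack_def)

lemma harnack_near:
  assumes "harnack r L F" "0 \<le> L" "0 < r" "r * \<bar>v - z\<bar> \<le> 1"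
  shows "F v \<le> ennreal (4 * L) * F z"
proof -
  have "F v \<le> ennreal (L * (1 + r * \<bar>v - z\<bar>)\<^sup>2) * F z"
    using harnackD[OF assms(1), of z "v - z"] by simp
  also have "\<dots> \<le> ennreal (4 * L) * F z"
  proof (intro mult_right_mono ennreal_leI)
    have "(1 + r * \<bar>v - z\<bar>)\<^sup>2 \<le> 2\<^sup>2" using assms by (intro power_mono) auto
    then have "L * (1 + r * \<bar>v - z\<bar>)\<^sup>2 \<le> L * 2\<^sup>2" using assms(2) by (rule mult_left_mono)
    then show "L * (1 + r * \<bar>v - z\<bar>)\<^sup>2 \<le> 4 * L" by simp
  qed auto
  finally show ?thesis .
qed

lemma harnack_scale_mono:
  assumes "harnack r L F" "0 \<le> r" "r \<le> A * r'" "1 \<le> A" "0 \<le> L" "L * A\<^sup>2 \<le> L'"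
  shows "harnack r' L' F"
  unfolding harnack_def
proof safe
  fix v w
  have r': "0 \<le> r'" using assms by (meson dual_order.trans less_le_trans not_le zero_less_one mult_pos_neg)
  have "L * (1 + r * \<bar>w\<bar>)\<^sup>2 \<le> L * (A * (1 + r' * \<bar>w\<bar>))\<^sup>2"
  proof (intro mult_left_mono power_mono)
    have "r * \<bar>w\<bar> \<le> A * r' * \<bar>w\<bar>" using assms by (intro mult_right_mono) auto
    then show "1 + r * \<bar>w\<bar> \<le> A * (1 + r' * \<bar>w\<bar>)" using assms by (simp add: algebra_simps)
  qed (use assms in auto)
  also have "\<dots> = (L * A\<^sup>2) * (1 + r' * \<bar>w\<bar>)\<^sup>2" by (simp add: power_mult_distrib)
  also have "\<dots> \<le> L' * (1 + r' * \<bar>w\<bar>)\<^sup>2" using assms by (intro mult_right_mono) auto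
  finally have "ennreal (L * (1 + r * \<bar>w\<bar>)\<^sup>2) * F v \<le> ennreal (L' * (1 + r' * \<bar>w\<bar>)\<^sup>2) * F v"
    by (intro mult_right_mono ennreal_leI) auto
  with harnackD[OF assms(1), of v w] show "F (v + w) \<le> ennreal (L' * (1 + r' * \<bar>w\<bar>)\<^sup>2) * F v"
    by (rule order_trans)
qed

lemma harnack_nn_integral:
  assumes h: "\<And>a. a \<in> space M \<Longrightarrow> harnack r L (F a)"
    and [measurable]: "\<And>v. (\<lambda>a. F a v) \<in> borel_measurable M"
  shows "harnack r L (\<lambda>v. \<integral>\<^sup>+a. F a v \<partial>M)"
  unfolding harnack_def
proof safe
  fix v w
  have "(\<integral>\<^sup>+a. F a (v + w) \<partial>M) \<le> (\<integral>\<^sup>+a. ennreal (L * (1 + r * \<bar>w\<bar>)\<^sup>2) * F a v \<partial>M)"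
    using h harnackD by (intro nn_integral_mono) blast
  then show "(\<integral>\<^sup>+a. F a (v + w) \<partial>M) \<le> ennreal (L * (1 + r * \<bar>w\<bar>)\<^sup>2) * (\<integral>\<^sup>+a. F a v \<partial>M)"
    by (simp add: nn_integral_cmult)
qed

lemma harnack_cmult: "harnack r L F \<Longrightarrow> harnack r L (\<lambda>v. c * F v)"
  unfolding harnack_def by (metis mult.left_commute mult_left_mono zero_le)

lemma harnack_add: "harnack r L F \<Longrightarrow> harnack r L G \<Longrightarrow> harnack r L (\<lambda>v. F v + G v)"
  unfolding harnack_def by (metis add_mono distrib_left)

lemma harnack_translate: "harnack r L F \<Longrightarrow> harnack r L (\<lambda>v. F (v + a))"
  unfolding harnack_def by (metis add.assoc add.commute)

text \<open>
  \<open>F\<close> is comparable to \<open>F v\<close> on a window of length \<open>1 / r\<close>, so its integral is at least of order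
  \<open>F v / r\<close>.
\<close>

lemma harnack_sup:
  assumes h: "harnack r L F" "0 \<le> L" "0 < r" and [measurable]: "F \<in> borel_measurable borel"
  shows "F v \<le> ennreal (4 * L * r) * (\<integral>\<^sup>+z. F z \<partial>lborel)"
proof -
  have "F v = F v * (ennreal r * ennreal (1 / r))"
    using assms by (simp add: ennreal_mult[symmetric])
  also have "\<dots> = ennreal r * (\<integral>\<^sup>+z. F v * indicator {v..v + 1/r} z \<partial>lborel)"
    using assms by (simp add: nn_integral_cmult_indicator mult_ac)
  also have "\<dots> \<le> ennreal r * (\<integral>\<^sup>+z. ennreal (4 * L) * F z \<partial>lborel)"
  proof (intro mult_left_mono nn_integral_mono)
    fix z show "F v * indicator {v..v + 1/r} z \<le> ennreal (4 * L) * F z"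
    proof (cases "z \<in> {v..v + 1/r}")
      case True
      then have "\<bar>v - z\<bar> \<le> 1 / r" by auto
      then have "r * \<bar>v - z\<bar> \<le> 1" using assms by (simp add: field_simps)
      with harnack_near[OF h(1) h(2) h(3) this] True show ?thesis by simp
    qed simp
  qed simp
  also have "\<dots> = ennreal r * ennreal (4 * L) * (\<integral>\<^sup>+z. F z \<partial>lborel)"
    by (subst nn_integral_cmult) (auto simp: mult.assoc)
  also have "ennreal r * ennreal (4 * L) = ennreal (4 * L * r)"
    using assms by (simp add: ennreal_mult[symmetric] mult_ac)
  finally show ?thesis .
qed

definition bump :: "real \<Rightarrow> real \<Rightarrow> real" where
  "bump r w = r / (1 + r * \<bar>w\<bar>)\<^sup>2"

lemma bump_nonneg: "0 < r \<Longrightarrow> 0 \<le> bump r w"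
  by (simp add: bump_def)

lemma bump_meas[measurable]: "(\<lambda>x. bump (f x) (g x)) \<in> borel_measurable M"
  if [measurable]: "f \<in> borel_measurable M" "g \<in> borel_measurable M"
  unfolding bump_def by measurable

lemma bump_integral_le: "0 < r \<Longrightarrow> (\<integral>\<^sup>+w. ennreal (bump r w) \<partial>lborel) \<le> 4"
proof -
  assume r: "0 < r"
  have "(\<integral>\<^sup>+w. ennreal (bump r w) \<partial>lborel) \<le> (\<integral>\<^sup>+w. ennreal (r / (1 + (r * w)\<^sup>2)) \<partial>lborel)"
  proof (intro nn_integral_mono ennreal_leI)
    fix w
    have "1 + (r * w)\<^sup>2 \<le> (1 + r * \<bar>w\<bar>)\<^sup>2"
      using r by (simp add: power2_eq_square algebra_simps)
    moreover have "0 < 1 + (r * w)\<^sup>2" by (intro add_pos_nonneg) auto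
    ultimately show "bump r w \<le> r / (1 + (r * w)\<^sup>2)"
      unfolding bump_def using r by (intro divide_left_mono mult_pos_pos) auto
  qed
  also have "\<dots> = ennreal pi" by (rule nn_integral_scaled_cauchy[OF r])
  also have "\<dots> \<le> ennreal 4" using pi_less_4 by (intro ennreal_leI) auto
  finally show ?thesis by simp
qed

text \<open>
  Because \<open>1 + r \<bar>v\<bar> \<le> (1 + r \<bar>v + w\<bar>) (1 + r \<bar>w\<bar>)\<close>.
\<close>

lemma bump_harnack: "0 < r \<Longrightarrow> bump r (v + w) \<le> (1 + r * \<bar>w\<bar>)\<^sup>2 * bump r v"
proof -
  assume r: "0 < r"
  have pos: "0 < (1 + r * \<bar>x\<bar>)\<^sup>2" for x
    using r by (intro zero_less_power add_pos_nonneg mult_nonneg_nonneg) auto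
  have "\<bar>v\<bar> \<le> \<bar>v + w\<bar> + \<bar>w\<bar>" by simp
  then have "r * \<bar>v\<bar> \<le> r * \<bar>v + w\<bar> + r * \<bar>w\<bar>" using r by (metis distrib_left mult_le_cancel_left_pos)
  moreover have "0 \<le> (r * \<bar>v + w\<bar>) * (r * \<bar>w\<bar>)" using r by auto
  ultimately have "1 + r * \<bar>v\<bar> \<le> (1 + r * \<bar>v + w\<bar>) * (1 + r * \<bar>w\<bar>)" by (simp add: algebra_simps)
  then have "(1 + r * \<bar>v\<bar>)\<^sup>2 \<le> ((1 + r * \<bar>v + w\<bar>) * (1 + r * \<bar>w\<bar>))\<^sup>2"
    using r by (intro power_mono) auto
  then have "r * (1 + r * \<bar>v\<bar>)\<^sup>2 \<le> r * ((1 + r * \<bar>w\<bar>)\<^sup>2 * (1 + r * \<bar>v + w\<bar>)\<^sup>2)"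
    using r by (intro mult_left_mono) (auto simp: power_mult_distrib mult.commute)
  then have "r \<le> (r * ((1 + r * \<bar>w\<bar>)\<^sup>2 * (1 + r * \<bar>v + w\<bar>)\<^sup>2)) / (1 + r * \<bar>v\<bar>)\<^sup>2"
    using pos[of v] by (simp only: pos_le_divide_eq)
  also have "\<dots> = (1 + r * \<bar>w\<bar>)\<^sup>2 * (r / (1 + r * \<bar>v\<bar>)\<^sup>2) * (1 + r * \<bar>v + w\<bar>)\<^sup>2" by simp
  finally have "r \<le> (1 + r * \<bar>w\<bar>)\<^sup>2 * (r / (1 + r * \<bar>v\<bar>)\<^sup>2) * (1 + r * \<bar>v + w\<bar>)\<^sup>2" .
  then show ?thesis unfolding bump_def
    using pos[of "v + w"] by (simp only: pos_divide_le_eq)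
qed

lemma bump_near:
  assumes r: "0 < r" and w: "r * \<bar>w\<bar> \<le> 1"
  shows "r \<le> 4 * bump r w"
proof -
  have "(1 + r * \<bar>w\<bar>)\<^sup>2 \<le> 2\<^sup>2" using r w by (intro power_mono) auto
  then have "r * (1 + r * \<bar>w\<bar>)\<^sup>2 \<le> r * 4" using r by (intro mult_left_mono) auto
  moreover have "0 < (1 + r * \<bar>w\<bar>)\<^sup>2" using r by (intro zero_less_power add_pos_nonneg mult_nonneg_nonneg) auto
  ultimately show ?thesis
    unfolding bump_def by (simp only: times_divide_eq_right pos_le_divide_eq mult.commute[of r 4])
qed

definition mollify :: "real \<Rightarrow> (real \<Rightarrow> ennreal) \<Rightarrow> real \<Rightarrow> ennreal" where
  "mollify r F v = (\<integral>\<^sup>+z. ennreal (bump r (v - z)) * F z \<partial>lborel)"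

text \<open>
  The Harnack inequality with constant exactly \<open>1\<close> is inherited from \<open>bump\<close>, whatever \<open>F\<close> is.  Repeated
  convolutions would otherwise let the constant grow; mollifying after each one resets it.
\<close>

lemma harnack_mollify:
  assumes "0 < r" and [measurable]: "F \<in> borel_measurable borel"
  shows "harnack r 1 (mollify r F)"
  unfolding mollify_def
proof (rule harnack_nn_integral)
  show "harnack r 1 (\<lambda>v. ennreal (bump r (v - z)) * F z)" for z
    unfolding harnack_def
  proof safe
    fix v w
    have "ennreal (bump r (v + w - z)) \<le> ennreal ((1 + r * \<bar>w\<bar>)\<^sup>2) * ennreal (bump r (v - z))"
      using bump_harnack[OF assms(1), of "v - z" w] bump_nonneg[OF assms(1)]
      by (subst ennreal_mult[symmetric]) (auto intro!: ennreal_leI simp: algebra_simps)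
    then show "ennreal (bump r (v + w - z)) * F z \<le> ennreal (1 * (1 + r * \<bar>w\<bar>)\<^sup>2) * (ennreal (bump r (v - z)) * F z)"
      by (simp add: mult.assoc[symmetric] mult_right_mono)
  qed
qed measurable

lemma nn_integral_mollify_le:
  assumes r: "0 < r" and [measurable]: "F \<in> borel_measurable borel"
  shows "(\<integral>\<^sup>+v. mollify r F v \<partial>lborel) \<le> 4 * (\<integral>\<^sup>+z. F z \<partial>lborel)"
proof -
  have "(\<integral>\<^sup>+v. mollify r F v \<partial>lborel) = (\<integral>\<^sup>+z. \<integral>\<^sup>+v. ennreal (bump r (v - z)) * F z \<partial>lborel \<partial>lborel)"
    unfolding mollify_def by (rule lborel_pair.Fubini') measurable
  also have "\<dots> = (\<integral>\<^sup>+z. (\<integral>\<^sup>+v. ennreal (bump r v) \<partial>lborel) * F z \<partial>lborel)"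
    by (intro nn_integral_cong) (simp add: nn_integral_multc nn_integral_shift(3)[of "\<lambda>v. ennreal (bump r v)"])
  also have "\<dots> \<le> (\<integral>\<^sup>+z. 4 * F z \<partial>lborel)"
    using bump_integral_le[OF r] by (intro nn_integral_mono mult_right_mono) auto
  finally show ?thesis by (simp add: nn_integral_cmult)
qed

lemma harnack_le_mollify:
  assumes h: "harnack r L F" "0 \<le> L" "0 < r" and [measurable]: "F \<in> borel_measurable borel"
  shows "F v \<le> ennreal (16 * L) * mollify r F v"
proof -
  have "F v = F v * (ennreal r * ennreal (1 / r))"
    using assms by (simp add: ennreal_mult[symmetric])
  also have "\<dots> = (\<integral>\<^sup>+z. ennreal r * F v * indicator {v..v + 1/r} z \<partial>lborel)"
    using assms by (subst nn_integral_cmult_indicator) (auto simp: mult_ac)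
  also have "\<dots> \<le> (\<integral>\<^sup>+z. ennreal (16 * L) * (ennreal (bump r (v - z)) * F z) \<partial>lborel)"
  proof (intro nn_integral_mono)
    fix z show "ennreal r * F v * indicator {v..v + 1/r} z \<le> ennreal (16 * L) * (ennreal (bump r (v - z)) * F z)"
    proof (cases "z \<in> {v..v + 1/r}")
      case True
      then have "\<bar>v - z\<bar> \<le> 1 / r" by auto
      then have r1: "r * \<bar>v - z\<bar> \<le> 1" using assms by (simp add: field_simps)
      have "r \<le> 4 * bump r (v - z)" by (rule bump_near[OF h(3) r1])
      then have "ennreal r * F v \<le> ennreal (4 * bump r (v - z)) * (ennreal (4 * L) * F z)"
        using harnack_near[OF h(1) h(2) h(3) r1] by (intro mult_mono ennreal_leI) auto
      also have "\<dots> = ennreal (4 * bump r (v - z)) * ennreal (4 * L) * F z" by (simp only: mult.assoc)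
      also have "ennreal (4 * bump r (v - z)) * ennreal (4 * L) = ennreal (4 * bump r (v - z) * (4 * L))"
        using h by (intro ennreal_mult[symmetric]) (auto simp: bump_nonneg)
      also have "4 * bump r (v - z) * (4 * L) = 16 * L * bump r (v - z)" by simp
      also have "ennreal (16 * L * bump r (v - z)) = ennreal (16 * L) * ennreal (bump r (v - z))"
        using h by (intro ennreal_mult) (auto simp: bump_nonneg)
      also have "\<dots> * F z = ennreal (16 * L) * (ennreal (bump r (v - z)) * F z)" by (simp only: mult.assoc)
      finally show ?thesis using True by simp
    qed simp
  qed
  also have "\<dots> = ennreal (16 * L) * mollify r F v"
    unfolding mollify_def by (rule nn_integral_cmult) measurable
  finally show ?thesis .
qed

section \<open>Majorants on a time scale\<close>

text \<open>
  The abstract properties of \<open>\<rho>\<close> on which the parametrix estimates rest.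
\<close>

locale time_scale =
  fixes T :: real and \<rho> :: "real \<Rightarrow> real" and A :: real
  assumes T_pos: "0 < T"
    and \<rho>_meas[measurable]: "\<rho> \<in> borel_measurable borel"
    and \<rho>_pos: "0 < t \<Longrightarrow> 0 < \<rho> t"
    and \<rho>_anti: "0 < s \<Longrightarrow> s \<le> t \<Longrightarrow> \<rho> t \<le> \<rho> s"
    and \<rho>_half: "0 < t \<Longrightarrow> t \<le> T \<Longrightarrow> \<rho> (t / 2) \<le> A * \<rho> t"
    and A_ge: "1 \<le> A"
begin

text \<open>
  Families of slowly varying functions whose integral is at most \<open>c t\<^sup>\<kappa>\<^sup>-\<^sup>1\<close>.  The density has \<open>\<kappa> = 1\<close>,
  the perturbation term some \<open>\<kappa> > 0\<close>; space-time convolution adds the exponents.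
\<close>

definition kern :: "real \<Rightarrow> real \<Rightarrow> (real \<Rightarrow> real \<Rightarrow> ennreal) \<Rightarrow> bool" where
  "kern \<kappa> c h \<longleftrightarrow> 0 \<le> c \<and> (\<lambda>(t, v). h t v) \<in> borel_measurable borel \<and>
    (\<forall>t. 0 < t \<and> t \<le> T \<longrightarrow> (\<integral>\<^sup>+v. h t v \<partial>lborel) \<le> ennreal (c * t powr (\<kappa> - 1)) \<and> harnack (\<rho> t) 1 (h t))"

lemma kern_measurable:
  assumes "kern \<kappa> c h"
  shows "f \<in> borel_measurable M \<Longrightarrow> g \<in> borel_measurable M \<Longrightarrow>
    (\<lambda>x. h (f x) (g x)) \<in> borel_measurable M"
proof -
  assume that[measurable]: "f \<in> borel_measurable M" "g \<in> borel_measurable M"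
  have [measurable]: "(\<lambda>(t, v). h t v) \<in> borel_measurable (borel \<Otimes>\<^sub>M borel)"
    using assms by (simp add: kern_def borel_prod)
  have "(\<lambda>x. case (f x, g x) of (t, v) \<Rightarrow> h t v) \<in> borel_measurable M" by measurable
  then show "(\<lambda>x. h (f x) (g x)) \<in> borel_measurable M" by simp
qed

lemma kernD:
  assumes "kern \<kappa> c h" "0 < t" "t \<le> T"
  shows "(\<integral>\<^sup>+v. h t v \<partial>lborel) \<le> ennreal (c * t powr (\<kappa> - 1))" "harnack (\<rho> t) 1 (h t)"
  using assms by (auto simp: kern_def)

lemma kern_sup:
  assumes k: "kern \<kappa> c h" and t: "0 < t" "t \<le> T"
  shows "h t v \<le> ennreal (4 * \<rho> t * (c * t powr (\<kappa> - 1)))"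
proof -
  note [measurable] = kern_measurable[OF k]
  have c: "0 \<le> c" using k by (simp add: kern_def)
  have "h t v \<le> ennreal (4 * 1 * \<rho> t) * (\<integral>\<^sup>+v. h t v \<partial>lborel)"
    by (rule harnack_sup[OF kernD(2)[OF k t]]) (use \<rho>_pos t in auto)
  also have "\<dots> \<le> ennreal (4 * \<rho> t) * ennreal (c * t powr (\<kappa> - 1))"
    using kernD(1)[OF k t] by (intro mult_mono) auto
  also have "\<dots> = ennreal (4 * \<rho> t * (c * t powr (\<kappa> - 1)))"
    using c \<rho>_pos[OF t(1)] by (subst ennreal_mult) auto
  finally show ?thesis .
qed

lemma kern_mollify:
  assumes m: "(\<lambda>(t, v). F t v) \<in> borel_measurable borel"
    and L1: "\<And>t. 0 < t \<Longrightarrow> t \<le> T \<Longrightarrow> (\<integral>\<^sup>+v. F t v \<partial>lborel) \<le> ennreal (c * t powr (\<kappa> - 1))"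
    and c: "0 \<le> c" and L: "0 \<le> L"
  shows "kern \<kappa> (64 * L * c) (\<lambda>t v. ennreal (16 * L) * mollify (\<rho> t) (F t) v)"
  unfolding kern_def
proof (intro conjI allI impI)
  have [measurable]: "(\<lambda>x. F (f x) (g x)) \<in> borel_measurable M"
    if [measurable]: "f \<in> borel_measurable M" "g \<in> borel_measurable M" for f g and M :: "'b measure"
  proof -
    have "(\<lambda>(t, v). F t v) \<in> borel_measurable (borel \<Otimes>\<^sub>M borel)"
      using m by (simp add: borel_prod)
    from measurable_compose[OF measurable_Pair[OF that] this] show ?thesis by simp
  qed
  show "0 \<le> 64 * L * c" using c L by simp
  have "(\<lambda>x. ennreal (16 * L) * mollify (\<rho> (fst x)) (F (fst x)) (snd x)) \<in> borel_measurable (borel \<Otimes>\<^sub>M borel)"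
    unfolding mollify_def by measurable
  then show "(\<lambda>(t, v). ennreal (16 * L) * mollify (\<rho> t) (F t) v) \<in> borel_measurable borel"
    by (simp add: borel_prod split_beta)
  fix t assume t: "0 < t \<and> t \<le> T"
  show "harnack (\<rho> t) 1 (\<lambda>v. ennreal (16 * L) * mollify (\<rho> t) (F t) v)"
    using t \<rho>_pos by (intro harnack_cmult harnack_mollify) auto
  have [measurable]: "mollify (\<rho> t) (F t) \<in> borel_measurable borel"
    unfolding mollify_def by measurable
  have "(\<integral>\<^sup>+v. ennreal (16 * L) * mollify (\<rho> t) (F t) v \<partial>lborel)
      = ennreal (16 * L) * (\<integral>\<^sup>+v. mollify (\<rho> t) (F t) v \<partial>lborel)"
    by (rule nn_integral_cmult) measurable
  also have "\<dots> \<le> ennreal (16 * L) * (4 * ennreal (c * t powr (\<kappa> - 1)))"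
    using t \<rho>_pos L1 by (intro mult_left_mono order_trans[OF nn_integral_mollify_le]) auto
  also have "\<dots> = ennreal (16 * L) * (ennreal 4 * ennreal (c * t powr (\<kappa> - 1)))" by simp
  also have "\<dots> = ennreal (16 * L) * ennreal (4 * (c * t powr (\<kappa> - 1)))"
    using c by (subst ennreal_mult) auto
  also have "\<dots> = ennreal (16 * L * (4 * (c * t powr (\<kappa> - 1))))"
    using c L by (intro ennreal_mult[symmetric]) auto
  also have "16 * L * (4 * (c * t powr (\<kappa> - 1))) = 64 * L * c * t powr (\<kappa> - 1)" by simp
  finally show "(\<integral>\<^sup>+v. ennreal (16 * L) * mollify (\<rho> t) (F t) v \<partial>lborel) \<le> ennreal (64 * L * c * t powr (\<kappa> - 1))" .
qed

text \<open>
  Space-time convolution of translation invariant kernels, in the variable \<open>s = \<tau> / t\<close>.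
\<close>

definition conv :: "(real \<Rightarrow> real \<Rightarrow> ennreal) \<Rightarrow> (real \<Rightarrow> real \<Rightarrow> ennreal) \<Rightarrow> real \<Rightarrow> real \<Rightarrow> ennreal" where
  "conv h g t v = (\<integral>\<^sup>+s\<in>{0<..<1}. ennreal t * (\<integral>\<^sup>+w. h (t * (1 - s)) (v - w) * g (t * s) w \<partial>lborel) \<partial>lborel)"

text \<open>
  One of the two times \<open>t (1 - s)\<close>, \<open>t s\<close> is at least \<open>t / 2\<close>.  The corresponding factor is bounded by its
  supremum, which involves \<open>\<rho>\<close> at a time no smaller than \<open>t / 2\<close>, and the other factor is integrated.
\<close>

lemma conv_inner_bound:
  assumes h: "kern \<kappa>1 c1 h" and g: "kern \<kappa>2 c2 g"
    and t: "0 < t" "t \<le> T" and s: "0 < s" "s < 1"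
  shows "(\<integral>\<^sup>+w. h (t * (1 - s)) (v - w) * g (t * s) w \<partial>lborel)
     \<le> ennreal (4 * \<rho> (t / 2) * c1 * c2 * (t * (1 - s)) powr (\<kappa>1 - 1) * (t * s) powr (\<kappa>2 - 1))"
proof -
  note [measurable] = kern_measurable[OF h] kern_measurable[OF g]
  have c: "0 \<le> c1" "0 \<le> c2" using h g by (auto simp: kern_def)
  let ?a = "t * (1 - s)" and ?b = "t * s"
  have "t * s \<le> T * 1" "t * (1 - s) \<le> T * 1" using t s by (intro mult_mono; simp)+
  then have ab: "0 < ?a" "?a \<le> T" "0 < ?b" "?b \<le> T" using t s by auto
  have r2: "0 < \<rho> (t / 2)" using t \<rho>_pos by auto
  show ?thesis
  proof (cases "s \<le> 1 / 2")
    case True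
    have "t / 2 \<le> ?a" using t True by (auto simp: field_simps)
    then have r: "\<rho> ?a \<le> \<rho> (t / 2)" using t by (intro \<rho>_anti) auto
    have "(\<integral>\<^sup>+w. h ?a (v - w) * g ?b w \<partial>lborel)
        \<le> (\<integral>\<^sup>+w. ennreal (4 * \<rho> (t / 2) * (c1 * ?a powr (\<kappa>1 - 1))) * g ?b w \<partial>lborel)"
    proof (intro nn_integral_mono mult_right_mono)
      fix w
      have "h ?a (v - w) \<le> ennreal (4 * \<rho> ?a * (c1 * ?a powr (\<kappa>1 - 1)))"
        by (rule kern_sup[OF h]) (use ab in auto)
      also have "\<dots> \<le> ennreal (4 * \<rho> (t / 2) * (c1 * ?a powr (\<kappa>1 - 1)))"
        using r c by (intro ennreal_leI mult_right_mono mult_left_mono) auto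
      finally show "h ?a (v - w) \<le> ennreal (4 * \<rho> (t / 2) * (c1 * ?a powr (\<kappa>1 - 1)))" .
    qed simp
    also have "\<dots> \<le> ennreal (4 * \<rho> (t / 2) * (c1 * ?a powr (\<kappa>1 - 1))) * ennreal (c2 * ?b powr (\<kappa>2 - 1))"
      using kernD(1)[OF g, of ?b] ab by (simp add: nn_integral_cmult mult_left_mono)
    also have "\<dots> = ennreal (4 * \<rho> (t / 2) * c1 * c2 * ?a powr (\<kappa>1 - 1) * ?b powr (\<kappa>2 - 1))"
      using c r2 by (subst ennreal_mult[symmetric]) (auto simp: mult_ac)
    finally show ?thesis .
  next
    case False
    have "t / 2 \<le> ?b" using t False by (auto simp: field_simps)
    then have r: "\<rho> ?b \<le> \<rho> (t / 2)" using t by (intro \<rho>_anti) auto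
    have "(\<integral>\<^sup>+w. h ?a (v - w) * g ?b w \<partial>lborel)
        \<le> (\<integral>\<^sup>+w. h ?a (v - w) * ennreal (4 * \<rho> (t / 2) * (c2 * ?b powr (\<kappa>2 - 1))) \<partial>lborel)"
    proof (intro nn_integral_mono mult_left_mono)
      fix w
      have "g ?b w \<le> ennreal (4 * \<rho> ?b * (c2 * ?b powr (\<kappa>2 - 1)))"
        by (rule kern_sup[OF g]) (use ab in auto)
      also have "\<dots> \<le> ennreal (4 * \<rho> (t / 2) * (c2 * ?b powr (\<kappa>2 - 1)))"
        using r c by (intro ennreal_leI mult_right_mono mult_left_mono) auto
      finally show "g ?b w \<le> ennreal (4 * \<rho> (t / 2) * (c2 * ?b powr (\<kappa>2 - 1)))" .
    qed simp
    also have "\<dots> \<le> ennreal (c1 * ?a powr (\<kappa>1 - 1)) * ennreal (4 * \<rho> (t / 2) * (c2 * ?b powr (\<kappa>2 - 1)))"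
      using kernD(1)[OF h, of ?a] ab
      by (simp add: nn_integral_multc mult_right_mono nn_integral_shift(4)[of "h ?a"])
    also have "\<dots> = ennreal (4 * \<rho> (t / 2) * c1 * c2 * ?a powr (\<kappa>1 - 1) * ?b powr (\<kappa>2 - 1))"
      using c r2 by (subst ennreal_mult[symmetric]) (auto simp: mult_ac)
    finally show ?thesis .
  qed
qed

lemma conv_meas:
  assumes h: "kern \<kappa>1 c1 h" and g: "kern \<kappa>2 c2 g"
  shows "(\<lambda>(t, v). conv h g t v) \<in> borel_measurable borel"
proof -
  note [measurable] = kern_measurable[OF h] kern_measurable[OF g]
  have "(\<lambda>x. conv h g (fst x) (snd x)) \<in> borel_measurable (borel \<Otimes>\<^sub>M borel)"
    unfolding conv_def by measurable
  then show ?thesis by (simp add: borel_prod split_beta)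
qed

lemma conv_L1:
  assumes h: "kern \<kappa>1 c1 h" and g: "kern \<kappa>2 c2 g" and \<kappa>: "0 < \<kappa>1" "0 < \<kappa>2"
    and t: "0 < t" "t \<le> T"
  shows "(\<integral>\<^sup>+v. conv h g t v \<partial>lborel) \<le> ennreal ((c1 * c2 * Beta \<kappa>2 \<kappa>1) * t powr (\<kappa>1 + \<kappa>2 - 1))"
proof -
  note [measurable] = kern_measurable[OF h] kern_measurable[OF g]
  have c: "0 \<le> c1" "0 \<le> c2" using h g by (auto simp: kern_def)
  have "(\<integral>\<^sup>+v. conv h g t v \<partial>lborel) =
     (\<integral>\<^sup>+s. \<integral>\<^sup>+v. ennreal t * (\<integral>\<^sup>+w. h (t * (1 - s)) (v - w) * g (t * s) w \<partial>lborel) * indicator {0<..<1} s \<partial>lborel \<partial>lborel)"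
    unfolding conv_def by (rule lborel_pair.Fubini') measurable
  also have "\<dots> \<le> (\<integral>\<^sup>+s. ennreal (c1 * c2 * t powr (\<kappa>1 + \<kappa>2 - 1)) *
      (ennreal ((1 - s) powr (\<kappa>1 - 1) * s powr (\<kappa>2 - 1)) * indicator {0<..<1} s) \<partial>lborel)"
  proof (rule nn_integral_mono)
    fix s
    show "(\<integral>\<^sup>+v. ennreal t * (\<integral>\<^sup>+w. h (t * (1 - s)) (v - w) * g (t * s) w \<partial>lborel) * indicator {0<..<1} s \<partial>lborel)
      \<le> ennreal (c1 * c2 * t powr (\<kappa>1 + \<kappa>2 - 1)) *
      (ennreal ((1 - s) powr (\<kappa>1 - 1) * s powr (\<kappa>2 - 1)) * indicator {0<..<1} s)"
    proof (cases "s \<in> {0<..<1}")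
      case True
      then have s: "0 < s" "s < 1" by auto
      have "t * s \<le> T * 1" "t * (1 - s) \<le> T * 1" using t s by (intro mult_mono; simp)+
      then have ab: "0 < t * (1 - s)" "t * (1 - s) \<le> T" "0 < t * s" "t * s \<le> T" using t s by auto
      have "(\<integral>\<^sup>+v. ennreal t * (\<integral>\<^sup>+w. h (t * (1 - s)) (v - w) * g (t * s) w \<partial>lborel) \<partial>lborel)
         = ennreal t * (\<integral>\<^sup>+v. \<integral>\<^sup>+w. h (t * (1 - s)) (v - w) * g (t * s) w \<partial>lborel \<partial>lborel)"
        by (rule nn_integral_cmult) measurable
      also have "(\<integral>\<^sup>+v. \<integral>\<^sup>+w. h (t * (1 - s)) (v - w) * g (t * s) w \<partial>lborel \<partial>lborel)
         = (\<integral>\<^sup>+w. \<integral>\<^sup>+v. h (t * (1 - s)) (v - w) * g (t * s) w \<partial>lborel \<partial>lborel)"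
        by (rule lborel_pair.Fubini') measurable
      also have "\<dots> = (\<integral>\<^sup>+w. (\<integral>\<^sup>+v. h (t * (1 - s)) v \<partial>lborel) * g (t * s) w \<partial>lborel)"
        by (intro nn_integral_cong) (simp add: nn_integral_multc nn_integral_shift(3)[of "h (t * (1 - s))"])
      also have "\<dots> = (\<integral>\<^sup>+v. h (t * (1 - s)) v \<partial>lborel) * (\<integral>\<^sup>+w. g (t * s) w \<partial>lborel)"
        by (rule nn_integral_cmult) measurable
      also have "\<dots> \<le> ennreal (c1 * (t * (1 - s)) powr (\<kappa>1 - 1)) * ennreal (c2 * (t * s) powr (\<kappa>2 - 1))"
        using kernD(1)[OF h, of "t * (1 - s)"] kernD(1)[OF g, of "t * s"] ab by (intro mult_mono) auto
      also have "ennreal t * \<dots> = ennreal (t * (c1 * (t * (1 - s)) powr (\<kappa>1 - 1)) * (c2 * (t * s) powr (\<kappa>2 - 1)))"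
        using t c by (simp add: ennreal_mult mult_ac)
      also have "t * (c1 * (t * (1 - s)) powr (\<kappa>1 - 1)) * (c2 * (t * s) powr (\<kappa>2 - 1))
         = c1 * c2 * t powr (\<kappa>1 + \<kappa>2 - 1) * ((1 - s) powr (\<kappa>1 - 1) * s powr (\<kappa>2 - 1))"
      proof -
        have "\<kappa>1 + \<kappa>2 - 1 = 1 + (\<kappa>1 - 1) + (\<kappa>2 - 1)" by simp
        then have "t powr (\<kappa>1 + \<kappa>2 - 1) = t powr (1 + (\<kappa>1 - 1) + (\<kappa>2 - 1))" by (rule arg_cong)
        also have "\<dots> = t * t powr (\<kappa>1 - 1) * t powr (\<kappa>2 - 1)" using t by (simp only: powr_add) simp
        finally show ?thesis using t s by (simp add: powr_mult mult_ac)
      qed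
      also have "ennreal \<dots> = ennreal (c1 * c2 * t powr (\<kappa>1 + \<kappa>2 - 1)) * ennreal ((1 - s) powr (\<kappa>1 - 1) * s powr (\<kappa>2 - 1))"
        using c by (intro ennreal_mult) auto
      finally show ?thesis using True by (simp add: mult_left_mono)
    qed simp
  qed
  also have "\<dots> = ennreal (c1 * c2 * t powr (\<kappa>1 + \<kappa>2 - 1)) * ennreal (Beta \<kappa>2 \<kappa>1)"
    by (subst nn_integral_cmult) (use Beta_nn_integral[OF \<kappa>] in auto)
  also have "\<dots> = ennreal ((c1 * c2 * Beta \<kappa>2 \<kappa>1) * t powr (\<kappa>1 + \<kappa>2 - 1))"
    using c by (subst ennreal_mult'[symmetric]) (auto simp: mult_ac)
  finally show ?thesis .
qed

text \<open>
  As the larger of the two times is at least \<open>t / 2\<close>, its scale is at most \<open>A \<rho>\<^sub>t\<close>; translating the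
  convolution in that factor costs the constant \<open>A\<^sup>2\<close>.
\<close>

lemma conv_harnack:
  assumes h: "kern \<kappa>1 c1 h" and g: "kern \<kappa>2 c2 g" and t: "0 < t" "t \<le> T"
  shows "harnack (\<rho> t) (A\<^sup>2) (conv h g t)"
  unfolding conv_def[abs_def]
proof (rule harnack_nn_integral)
  note [measurable] = kern_measurable[OF h] kern_measurable[OF g]
  show "(\<lambda>s. ennreal t * (\<integral>\<^sup>+w. h (t * (1 - s)) (v - w) * g (t * s) w \<partial>lborel) * indicator {0<..<1} s) \<in> borel_measurable lborel" for v
    by measurable
  fix s
  show "harnack (\<rho> t) (A\<^sup>2) (\<lambda>v. ennreal t * (\<integral>\<^sup>+w. h (t * (1 - s)) (v - w) * g (t * s) w \<partial>lborel) * indicator {0<..<1} s)"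
  proof (cases "s \<in> {0<..<1}")
    case True
    then have s: "0 < s" "s < 1" by auto
    have "t * s \<le> T * 1" "t * (1 - s) \<le> T * 1" using t s by (intro mult_mono; simp)+
    then have ab: "0 < t * (1 - s)" "t * (1 - s) \<le> T" "0 < t * s" "t * s \<le> T" using t s by auto
    have big: "harnack (\<rho> t) (A\<^sup>2) F" if "harnack (\<rho> a) 1 F" "t / 2 \<le> a" for a F
    proof (rule harnack_scale_mono[OF that(1)])
      show "0 \<le> \<rho> a" using \<rho>_pos[of a] t that by simp
      show "\<rho> a \<le> A * \<rho> t" using \<rho>_anti[of "t/2" a] \<rho>_half[of t] that t by simp
    qed (use A_ge in auto)
    have "harnack (\<rho> t) (A\<^sup>2) (\<lambda>v. \<integral>\<^sup>+w. h (t * (1 - s)) (v - w) * g (t * s) w \<partial>lborel)"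
    proof (cases "s \<le> 1 / 2")
      case True
      have "t / 2 \<le> t * (1 - s)" using t True by (auto simp: field_simps)
      then have *: "harnack (\<rho> t) (A\<^sup>2) (h (t * (1 - s)))"
        using kernD(2)[OF h, of "t * (1 - s)"] ab big by blast
      show ?thesis
      proof (rule harnack_nn_integral)
        fix w show "harnack (\<rho> t) (A\<^sup>2) (\<lambda>v. h (t * (1 - s)) (v - w) * g (t * s) w)"
          using harnack_cmult[OF harnack_translate[OF *, of "-w"], of "g (t * s) w"]
          by (simp add: mult.commute)
      qed measurable
    next
      case False
      have "t / 2 \<le> t * s" using t False by (auto simp: field_simps)
      then have *: "harnack (\<rho> t) (A\<^sup>2) (g (t * s))"
        using kernD(2)[OF g, of "t * s"] ab big by blast
      have eq: "(\<integral>\<^sup>+w. h (t * (1 - s)) (v - w) * g (t * s) w \<partial>lborel) = (\<integral>\<^sup>+w. h (t * (1 - s)) w * g (t * s) (v - w) \<partial>lborel)" for v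
        using nn_integral_shift(4)[of "\<lambda>w. h (t * (1 - s)) (v - w) * g (t * s) w" v] by simp
      show ?thesis unfolding eq
      proof (rule harnack_nn_integral)
        fix w show "harnack (\<rho> t) (A\<^sup>2) (\<lambda>v. h (t * (1 - s)) w * g (t * s) (v - w))"
          using harnack_cmult[OF harnack_translate[OF *, of "-w"]] by simp
      qed measurable
    qed
    then show ?thesis using True harnack_cmult by auto
  next
    case False
    then show ?thesis by (simp add: harnack_def)
  qed
qed

end

section \<open>Space-time convolution of dominated kernels\<close>

definition measurable3 :: "(real \<Rightarrow> real \<Rightarrow> real \<Rightarrow> real) \<Rightarrow> bool" where
  "measurable3 f \<longleftrightarrow> (\<lambda>(t, x, y). f t x y) \<in> borel_measurable borel"

lemma measurable3D:
  assumes "measurable3 f"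
  shows "a \<in> borel_measurable M \<Longrightarrow> b \<in> borel_measurable M \<Longrightarrow> c \<in> borel_measurable M \<Longrightarrow>
    (\<lambda>w. f (a w) (b w) (c w)) \<in> borel_measurable M"
proof -
  assume [measurable]: "a \<in> borel_measurable M" "b \<in> borel_measurable M" "c \<in> borel_measurable M"
  have "(\<lambda>(t, x, y). f t x y) \<in> borel_measurable (borel \<Otimes>\<^sub>M (borel \<Otimes>\<^sub>M borel))"
    using assms by (simp add: measurable3_def borel_prod)
  then have "(\<lambda>w. case (a w, b w, c w) of (t, x, y) \<Rightarrow> f t x y) \<in> borel_measurable M"
    by (rule measurable_compose[rotated]) measurable
  then show ?thesis by simp
qed

lemma measurable3I:
  "(\<lambda>p. f (fst p) (fst (snd p)) (snd (snd p))) \<in> borel_measurable (borel \<Otimes>\<^sub>M (borel \<Otimes>\<^sub>M borel)) \<Longrightarrow> measurable3 f"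
  unfolding measurable3_def by (simp add: borel_prod split_beta)

lemma measurable3_spacetime_conv:
  assumes "measurable3 f" "measurable3 k"
  shows "measurable3 (spacetime_conv f k)"
proof (rule measurable3I)
  note [measurable] = measurable3D[OF assms(1)] measurable3D[OF assms(2)]
  show "(\<lambda>p. spacetime_conv f k (fst p) (fst (snd p)) (snd (snd p))) \<in> borel_measurable (borel \<Otimes>\<^sub>M (borel \<Otimes>\<^sub>M borel))"
    unfolding spacetime_conv_def set_lebesgue_integral_def indicator_def greaterThanLessThan_iff
    by measurable
qed

text \<open>
  The inner integral of the space-time convolution at \<open>\<tau> = t s\<close>.  The domain of integration in \<open>s\<close> no longer
  depends on \<open>t\<close>, which is what allows differentiation in \<open>t\<close> under both integrals.
\<close>

definition conv_slice :: "(real \<Rightarrow> real \<Rightarrow> real \<Rightarrow> real) \<Rightarrow> (real \<Rightarrow> real \<Rightarrow> real \<Rightarrow> real) \<Rightarrow> real \<Rightarrow> real \<Rightarrow> real \<Rightarrow> real \<Rightarrow> real" where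
  "conv_slice f k t x y s = (\<integral>z. f (t * (1 - s)) x z * k (t * s) z y \<partial>lborel)"

lemma spacetime_conv_eq_slices:
  assumes t: "0 < t"
  shows "spacetime_conv f k t x y = t * (\<integral>s. indicator {0<..<1} s * conv_slice f k t x y s \<partial>lborel)"
proof -
  have "spacetime_conv f k t x y = \<bar>t\<bar> *\<^sub>R (\<integral>s. indicator {0<..<t} (0 + t * s) *\<^sub>R
      (\<integral>z. f (t - (0 + t * s)) x z * k (0 + t * s) z y \<partial>lborel) \<partial>lborel)"
    unfolding spacetime_conv_def set_lebesgue_integral_def
    using t by (intro lborel_integral_real_affine) simp
  also have "\<dots> = t * (\<integral>s. indicator {0<..<1} s * conv_slice f k t x y s \<partial>lborel)"
  proof -
    have "indicator {0<..<t} (0 + t * s) *\<^sub>R (\<integral>z. f (t - (0 + t * s)) x z * k (0 + t * s) z y \<partial>lborel)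
        = indicator {0<..<1} s * conv_slice f k t x y s" for s
    proof -
      have "0 + t * s \<in> {0<..<t} \<longleftrightarrow> s \<in> {0<..<1}"
        using t by (simp add: zero_less_mult_iff)
      then have "indicator {0<..<t} (0 + t * s) = (indicator {0<..<1} s :: real)"
        by (simp only: indicator_def)
      moreover have "t - (0 + t * s) = t * (1 - s)" "0 + t * s = t * s" by (simp_all add: right_diff_distrib)
      ultimately show ?thesis by (simp add: conv_slice_def)
    qed
    then show ?thesis using t by simp
  qed
  finally show ?thesis .
qed

context time_scale
begin

text \<open>
  The majorant at time \<open>t\<close> controls a whole window of times \<open>t'\<close>; derivatives and limits in time are then
  dominated by one function of the space variable.
\<close>

definition dominated :: "(real \<Rightarrow> real \<Rightarrow> ennreal) \<Rightarrow> (real \<Rightarrow> real \<Rightarrow> real \<Rightarrow> real) \<Rightarrow> bool" where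
  "dominated h f \<longleftrightarrow> (\<forall>t t' x y. 0 < t \<and> t \<le> T \<and> t / 2 \<le> t' \<and> t' \<le> 2 * t \<longrightarrow> ennreal \<bar>f t' x y\<bar> \<le> h t (y - x))"

lemma dominatedD:
  "dominated h f \<Longrightarrow> 0 < t \<Longrightarrow> t \<le> T \<Longrightarrow> t / 2 \<le> t' \<Longrightarrow> t' \<le> 2 * t \<Longrightarrow> ennreal \<bar>f t' x y\<bar> \<le> h t (y - x)"
  by (simp add: dominated_def)

text \<open>
  Continuity in \<open>(t, y)\<close>, and jointly in \<open>x\<close> if \<open>R\<close> holds: \<open>\<Phi>\<close> depends on \<open>x\<close> through the merely measurable
  \<open>m\<close>, and in a convolution only the left factor has to be continuous in \<open>x\<close>.  Sequences stay in the
  window in which a majorant at \<open>(t, y - x)\<close> applies.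
\<close>

definition seqcont :: "bool \<Rightarrow> (real \<Rightarrow> real \<Rightarrow> real \<Rightarrow> real) \<Rightarrow> bool" where
  "seqcont R f \<longleftrightarrow> (\<forall>t x y tn xn yn. 0 < t \<and> t < T \<and> tn \<longlonglongrightarrow> t \<and> xn \<longlonglongrightarrow> x \<and> yn \<longlonglongrightarrow> y \<and>
     (\<forall>n. t / 2 \<le> tn n \<and> tn n \<le> 2 * t \<and> \<bar>xn n - x\<bar> \<le> 1 \<and> \<bar>yn n - y\<bar> \<le> 1 \<and> (R \<or> xn n = x)) \<longrightarrow>
     (\<lambda>n. f (tn n) (xn n) (yn n)) \<longlonglongrightarrow> f t x y)"

lemma seqcontD:
  assumes "seqcont R f" "0 < t" "t < T" "tn \<longlonglongrightarrow> t" "xn \<longlonglongrightarrow> x" "yn \<longlonglongrightarrow> y"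
    and "\<And>n. t / 2 \<le> tn n" "\<And>n. tn n \<le> 2 * t" "\<And>n. \<bar>xn n - x\<bar> \<le> 1" "\<And>n. \<bar>yn n - y\<bar> \<le> 1"
    and "\<And>n. R \<or> xn n = x"
  shows "(\<lambda>n. f (tn n) (xn n) (yn n)) \<longlonglongrightarrow> f t x y"
proof -
  have n: "\<forall>n. t / 2 \<le> tn n \<and> tn n \<le> 2 * t \<and> \<bar>xn n - x\<bar> \<le> 1 \<and> \<bar>yn n - y\<bar> \<le> 1 \<and> (R \<or> xn n = x)"
    using assms(7-) by blast
  show ?thesis
    by (rule assms(1)[unfolded seqcont_def, THEN spec, THEN spec, THEN spec, THEN spec, THEN spec, THEN spec, THEN mp])
       (intro conjI assms n)
qed

lemma seqcont_add:
  assumes "seqcont R f" "seqcont R g"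
  shows "seqcont R (\<lambda>t x y. f t x y + g t x y)"
  unfolding seqcont_def
proof (intro allI impI, elim conjE)
  fix t x y :: real and tn xn yn :: "nat \<Rightarrow> real"
  assume *: "0 < t" "t < T" "tn \<longlonglongrightarrow> t" "xn \<longlonglongrightarrow> x" "yn \<longlonglongrightarrow> y"
    and n: "\<forall>n. t / 2 \<le> tn n \<and> tn n \<le> 2 * t \<and> \<bar>xn n - x\<bar> \<le> 1 \<and> \<bar>yn n - y\<bar> \<le> 1 \<and> (R \<or> xn n = x)"
  show "(\<lambda>n. f (tn n) (xn n) (yn n) + g (tn n) (xn n) (yn n)) \<longlonglongrightarrow> f t x y + g t x y"
    by (intro tendsto_add seqcontD[OF assms(1) *] seqcontD[OF assms(2) *]) (use n in blast)+
qed

text \<open>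
  A kernel \<open>f\<close> together with \<open>f' = t \<partial>\<^sub>t f\<close>, under one common majorant \<open>h\<close>.
\<close>

definition kernel_pair where
  "kernel_pair R h f f' \<longleftrightarrow> measurable3 f \<and> measurable3 f' \<and> dominated h f \<and> dominated h f' \<and>
     seqcont R f \<and> seqcont R f' \<and>
     (\<forall>t x y. 0 < t \<and> t < T \<longrightarrow> ((\<lambda>s. f s x y) has_real_derivative f' t x y / t) (at t))"

lemma slice_times:
  assumes "0 < t" "t \<le> T" "0 < s" "s < 1"
  shows "0 < t * (1 - s)" "t * (1 - s) \<le> T" "0 < t * s" "t * s \<le> T"
    "t < T \<Longrightarrow> t * (1 - s) < T" "t < T \<Longrightarrow> t * s < T"
proof -
  have *: "t * s \<le> t * 1" "t * (1 - s) \<le> t * 1" using assms by (intro mult_left_mono; simp)+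
  show "0 < t * (1 - s)" "0 < t * s" using assms by auto
  show "t * (1 - s) \<le> T" "t * s \<le> T" "t < T \<Longrightarrow> t * (1 - s) < T" "t < T \<Longrightarrow> t * s < T"
    using assms(2) * by linarith+
qed

lemma slice_times':
  fixes t t' s :: real
  assumes "t / 2 \<le> t'" "t' \<le> 2 * t" "0 < s" "s < 1"
  shows "(t * (1 - s)) / 2 \<le> t' * (1 - s)" "t' * (1 - s) \<le> 2 * (t * (1 - s))"
    "(t * s) / 2 \<le> t' * s" "t' * s \<le> 2 * (t * s)"
  using assms mult_right_mono[OF assms(1), of s] mult_right_mono[OF assms(1), of "1 - s"]
    mult_right_mono[OF assms(2), of s] mult_right_mono[OF assms(2), of "1 - s"] by auto

lemma conv_integrand_le:
  assumes fh: "dominated h f" and kg: "dominated g k"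
    and t: "0 < t" "t \<le> T" and t': "t / 2 \<le> t'" "t' \<le> 2 * t" and s: "0 < s" "s < 1"
  shows "ennreal \<bar>f (t' * (1 - s)) x z * k (t' * s) z y\<bar> \<le> h (t * (1 - s)) (z - x) * g (t * s) (y - z)"
  unfolding abs_mult using slice_times[OF t s] slice_times'[OF t' s]
  by (subst ennreal_mult) (auto intro!: mult_mono dominatedD[OF fh] dominatedD[OF kg])

lemma conv_slice_nn_le:
  assumes h: "kern \<kappa>1 c1 h" and g: "kern \<kappa>2 c2 g" and fh: "dominated h f" and kg: "dominated g k"
    and t: "0 < t" "t \<le> T" and t': "t / 2 \<le> t'" "t' \<le> 2 * t" and s: "0 < s" "s < 1"
  shows "(\<integral>\<^sup>+z. ennreal \<bar>f (t' * (1 - s)) x z * k (t' * s) z y\<bar> \<partial>lborel)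
     \<le> (\<integral>\<^sup>+w. h (t * (1 - s)) ((y - x) - w) * g (t * s) w \<partial>lborel)"
proof -
  note [measurable] = kern_measurable[OF h] kern_measurable[OF g]
  have "(\<integral>\<^sup>+z. ennreal \<bar>f (t' * (1 - s)) x z * k (t' * s) z y\<bar> \<partial>lborel)
      \<le> (\<integral>\<^sup>+z. h (t * (1 - s)) (z - x) * g (t * s) (y - z) \<partial>lborel)"
    using conv_integrand_le[OF fh kg t t' s] by (intro nn_integral_mono) auto
  also have "\<dots> = (\<integral>\<^sup>+w. h (t * (1 - s)) ((y - w) - x) * g (t * s) (y - (y - w)) \<partial>lborel)"
    by (rule nn_integral_shift(4)[symmetric]) measurable
  finally show ?thesis by (simp add: algebra_simps)
qed

text \<open>
  An integrable majorant in \<open>s\<close> of the slices, uniform in the space variables.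
\<close>

definition slice_bound where
  "slice_bound \<kappa>1 c1 \<kappa>2 c2 t s = 4 * \<rho> (t / 2) * c1 * c2 * t powr (\<kappa>1 - 1) * t powr (\<kappa>2 - 1) *
     (indicator {0<..<1} s * ((1 - s) powr (\<kappa>1 - 1) * s powr (\<kappa>2 - 1)))"

lemma slice_bound_integrable:
  assumes "0 < \<kappa>1" "0 < \<kappa>2"
  shows "integrable lborel (slice_bound \<kappa>1 c1 \<kappa>2 c2 t)"
  unfolding slice_bound_def[abs_def]
proof (rule integrable_mult_right)
  have *: "(\<integral>\<^sup>+s. ennreal \<bar>indicator {0<..<1} s * ((1 - s) powr (\<kappa>1 - 1) * s powr (\<kappa>2 - 1))\<bar> \<partial>lborel)
      = (\<integral>\<^sup>+s\<in>{0<..<1}. ennreal ((1 - s) powr (\<kappa>1 - 1) * s powr (\<kappa>2 - 1)) \<partial>lborel)"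
    by (intro nn_integral_cong) (auto split: split_indicator)
  show "integrable lborel (\<lambda>s. indicator {0<..<1} s * ((1 - s) powr (\<kappa>1 - 1) * s powr (\<kappa>2 - 1)))"
    by (rule integrable_of_nn_bound[where c="Beta \<kappa>2 \<kappa>1"])
       (unfold * Beta_nn_integral[OF assms], measurable)
qed

lemma conv_inner_le_slice_bound:
  assumes h: "kern \<kappa>1 c1 h" and g: "kern \<kappa>2 c2 g"
    and t: "0 < t" "t \<le> T" and s: "0 < s" "s < 1"
  shows "(\<integral>\<^sup>+w. h (t * (1 - s)) (v - w) * g (t * s) w \<partial>lborel) \<le> ennreal (slice_bound \<kappa>1 c1 \<kappa>2 c2 t s)"
proof -
  have "4 * \<rho> (t / 2) * c1 * c2 * (t * (1 - s)) powr (\<kappa>1 - 1) * (t * s) powr (\<kappa>2 - 1) = slice_bound \<kappa>1 c1 \<kappa>2 c2 t s"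
    using t s by (simp add: slice_bound_def powr_mult)
  with conv_inner_bound[OF h g t s] show ?thesis by simp
qed

lemma conv_slice_bound:
  assumes h: "kern \<kappa>1 c1 h" and g: "kern \<kappa>2 c2 g" and fh: "dominated h f" and kg: "dominated g k"
    and t: "0 < t" "t \<le> T" and t': "t / 2 \<le> t'" "t' \<le> 2 * t" and s: "0 < s" "s < 1"
  shows "\<bar>conv_slice f k t' x y s\<bar> \<le> slice_bound \<kappa>1 c1 \<kappa>2 c2 t s"
proof -
  have "0 \<le> c1" "0 \<le> c2" "0 < \<rho> (t / 2)" using h g \<rho>_pos t by (auto simp: kern_def)
  then have nn: "0 \<le> slice_bound \<kappa>1 c1 \<kappa>2 c2 t s" by (simp add: slice_bound_def)
  have "ennreal \<bar>conv_slice f k t' x y s\<bar> \<le> ennreal (slice_bound \<kappa>1 c1 \<kappa>2 c2 t s)"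
    unfolding conv_slice_def
    by (rule order_trans[OF abs_integral_le_nn_integral])
       (rule order_trans[OF conv_slice_nn_le[OF assms] conv_inner_le_slice_bound[OF h g t s]])
  then show ?thesis using nn by (simp add: ennreal_le_iff)
qed

lemma spacetime_conv_dominated:
  assumes h: "kern \<kappa>1 c1 h" and g: "kern \<kappa>2 c2 g" and fh: "dominated h f" and kg: "dominated g k"
    and t: "0 < t" "t \<le> T" and t': "t / 2 \<le> t'" "t' \<le> 2 * t"
  shows "ennreal \<bar>spacetime_conv f k t' x y\<bar> \<le> 2 * conv h g t (y - x)"
proof -
  have t'0: "0 < t'" using t t' by auto
  note [measurable] = kern_measurable[OF h] kern_measurable[OF g]
  have "ennreal \<bar>spacetime_conv f k t' x y\<bar>
      = ennreal t' * ennreal \<bar>\<integral>s. indicator {0<..<1} s * conv_slice f k t' x y s \<partial>lborel\<bar>"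
    using t'0 by (simp add: spacetime_conv_eq_slices abs_mult ennreal_mult)
  also have "\<dots> \<le> ennreal (2 * t) * (\<integral>\<^sup>+s. ennreal \<bar>indicator {0<..<1} s * conv_slice f k t' x y s\<bar> \<partial>lborel)"
    using t' by (intro mult_mono ennreal_leI abs_integral_le_nn_integral) auto
  also have "\<dots> \<le> ennreal (2 * t) * (\<integral>\<^sup>+s\<in>{0<..<1}. (\<integral>\<^sup>+w. h (t * (1 - s)) ((y - x) - w) * g (t * s) w \<partial>lborel) \<partial>lborel)"
  proof (intro mult_left_mono nn_integral_mono)
    fix s
    show "ennreal \<bar>indicator {0<..<1} s * conv_slice f k t' x y s\<bar>
      \<le> (\<integral>\<^sup>+w. h (t * (1 - s)) ((y - x) - w) * g (t * s) w \<partial>lborel) * indicator {0<..<1} s"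
    proof (cases "s \<in> {0<..<1}")
      case True
      then have "0 < s" "s < 1" by auto
      from order_trans[OF abs_integral_le_nn_integral conv_slice_nn_le[OF h g fh kg t t' this]] True
      show ?thesis by (simp add: conv_slice_def)
    qed simp
  qed simp
  also have "\<dots> = 2 * conv h g t (y - x)"
    unfolding conv_def using t
    by (simp add: ennreal_mult nn_integral_cmult mult.assoc)
  finally show ?thesis .
qed

text \<open>
  Slow variation absorbs a displacement of \<open>x\<close> and \<open>y\<close> by at most \<open>1\<close> into a constant, so that a single
  integrable function of \<open>z\<close> dominates the integrands at all nearby points.
\<close>

lemma conv_dominator:
  assumes h: "kern \<kappa>1 c1 h" and g: "kern \<kappa>2 c2 g" and t: "0 < t" "t \<le> T" and s: "0 < s" "s < 1"
  obtains w where "integrable lborel w"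
    "\<And>f k t' x' y' z. dominated h f \<Longrightarrow> dominated g k \<Longrightarrow> t / 2 \<le> t' \<Longrightarrow> t' \<le> 2 * t \<Longrightarrow>
       \<bar>x' - x\<bar> \<le> 1 \<Longrightarrow> \<bar>y' - y\<bar> \<le> 1 \<Longrightarrow> \<bar>f (t' * (1 - s)) x' z * k (t' * s) z y'\<bar> \<le> w z"
proof -
  note [measurable] = kern_measurable[OF h] kern_measurable[OF g]
  let ?a = "t * (1 - s)" and ?b = "t * s"
  note ab = slice_times[OF t s]
  let ?C = "(1 + \<rho> ?a)\<^sup>2 * (1 + \<rho> ?b)\<^sup>2"
  have r: "0 < \<rho> ?a" "0 < \<rho> ?b" using \<rho>_pos ab by auto
  define W where "W z = h ?a (z - x) * g ?b (y - z)" for z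
  have [measurable]: "W \<in> borel_measurable borel" unfolding W_def by measurable
  have "(\<integral>\<^sup>+z. W z \<partial>lborel) = (\<integral>\<^sup>+w. h ?a ((y - x) - w) * g ?b w \<partial>lborel)"
    using nn_integral_shift(4)[of W y] by (simp add: W_def algebra_simps)
  also have "\<dots> < \<infinity>"
    using conv_inner_le_slice_bound[OF h g t s, of "y - x"] by (rule le_less_trans) simp
  finally have fin: "(\<integral>\<^sup>+z. W z \<partial>lborel) < \<infinity>" .
  have "h ?a v < top" "g ?b v < top" for v
    using kern_sup[OF h ab(1,2), of v] kern_sup[OF g ab(3,4), of v] by (auto intro: le_less_trans)
  then have Wfin: "W z < top" for z by (simp add: W_def ennreal_mult_less_top)
  then have Wr: "ennreal (enn2real (W z)) = W z" for z by simp
  show thesis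
  proof
    show "integrable lborel (\<lambda>z. ?C * enn2real (W z))"
    proof (rule integrable_mult_right, rule integrableI_bounded)
      show "(\<integral>\<^sup>+z. ennreal (norm (enn2real (W z))) \<partial>lborel) < \<infinity>"
        using fin by (simp add: Wr)
    qed measurable
    fix f k t' x' y' z
    assume fh: "dominated h f" and kg: "dominated g k" and t': "t / 2 \<le> t'" "t' \<le> 2 * t"
      and x': "\<bar>x' - x\<bar> \<le> 1" and y': "\<bar>y' - y\<bar> \<le> 1"
    have "h ?a (z - x') \<le> ennreal (1 * (1 + \<rho> ?a * \<bar>x - x'\<bar>)\<^sup>2) * h ?a (z - x)"
      using harnackD[OF kernD(2)[OF h ab(1,2)], of "z - x" "x - x'"] by simp
    also have "\<dots> \<le> ennreal ((1 + \<rho> ?a)\<^sup>2) * h ?a (z - x)"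
    proof (intro mult_right_mono ennreal_leI)
      have "\<rho> ?a * \<bar>x - x'\<bar> \<le> \<rho> ?a * 1" using x' r by (intro mult_left_mono) auto
      then show "1 * (1 + \<rho> ?a * \<bar>x - x'\<bar>)\<^sup>2 \<le> (1 + \<rho> ?a)\<^sup>2" using r by (auto intro!: power_mono)
    qed simp
    finally have 1: "h ?a (z - x') \<le> ennreal ((1 + \<rho> ?a)\<^sup>2) * h ?a (z - x)" .
    have "g ?b (y' - z) \<le> ennreal (1 * (1 + \<rho> ?b * \<bar>y' - y\<bar>)\<^sup>2) * g ?b (y - z)"
      using harnackD[OF kernD(2)[OF g ab(3,4)], of "y - z" "y' - y"] by simp
    also have "\<dots> \<le> ennreal ((1 + \<rho> ?b)\<^sup>2) * g ?b (y - z)"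
    proof (intro mult_right_mono ennreal_leI)
      have "\<rho> ?b * \<bar>y' - y\<bar> \<le> \<rho> ?b * 1" using y' r by (intro mult_left_mono) auto
      then show "1 * (1 + \<rho> ?b * \<bar>y' - y\<bar>)\<^sup>2 \<le> (1 + \<rho> ?b)\<^sup>2" using r by (auto intro!: power_mono)
    qed simp
    finally have 2: "g ?b (y' - z) \<le> ennreal ((1 + \<rho> ?b)\<^sup>2) * g ?b (y - z)" .
    have "ennreal \<bar>f (t' * (1 - s)) x' z * k (t' * s) z y'\<bar> \<le> h ?a (z - x') * g ?b (y' - z)"
      by (rule conv_integrand_le[OF fh kg t t' s])
    also have "\<dots> \<le> (ennreal ((1 + \<rho> ?a)\<^sup>2) * h ?a (z - x)) * (ennreal ((1 + \<rho> ?b)\<^sup>2) * g ?b (y - z))"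
      using 1 2 by (intro mult_mono) auto
    also have "\<dots> = ennreal ((1 + \<rho> ?a)\<^sup>2) * ennreal ((1 + \<rho> ?b)\<^sup>2) * W z"
      unfolding W_def by (simp only: mult_ac)
    also have "\<dots> = ennreal ?C * ennreal (enn2real (W z))"
      by (simp only: Wr) (simp add: ennreal_mult)
    also have "\<dots> = ennreal (?C * enn2real (W z))" by (rule ennreal_mult[symmetric]) auto
    finally show "\<bar>f (t' * (1 - s)) x' z * k (t' * s) z y'\<bar> \<le> ?C * enn2real (W z)"
      by (simp add: ennreal_le_iff)
  qed
qed

lemma conv_slice_tendsto:
  assumes h: "kern \<kappa>1 c1 h" and g: "kern \<kappa>2 c2 g" and fh: "dominated h f" and kg: "dominated g k"
    and "measurable3 f" "measurable3 k"
    and cf: "seqcont R f" and ck: "seqcont False k"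
    and t: "0 < t" "t < T" and lim: "tn \<longlonglongrightarrow> t" "xn \<longlonglongrightarrow> x" "yn \<longlonglongrightarrow> y"
    and near: "\<And>n. t / 2 \<le> tn n \<and> tn n \<le> 2 * t \<and> \<bar>xn n - x\<bar> \<le> 1 \<and> \<bar>yn n - y\<bar> \<le> 1 \<and> (R \<or> xn n = x)"
    and s: "0 < s" "s < 1"
  shows "(\<lambda>n. conv_slice f k (tn n) (xn n) (yn n) s) \<longlonglongrightarrow> conv_slice f k t x y s"
proof -
  note [measurable] = measurable3D[OF assms(5)] measurable3D[OF assms(6)]
  have tT: "t \<le> T" using t by simp
  obtain w where w: "integrable lborel w"
    "\<And>f k t' x' y' z. dominated h f \<Longrightarrow> dominated g k \<Longrightarrow> t / 2 \<le> t' \<Longrightarrow> t' \<le> 2 * t \<Longrightarrow>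
       \<bar>x' - x\<bar> \<le> 1 \<Longrightarrow> \<bar>y' - y\<bar> \<le> 1 \<Longrightarrow> \<bar>f (t' * (1 - s)) x' z * k (t' * s) z y'\<bar> \<le> w z"
    using conv_dominator[OF h g t(1) tT s, of x y] by blast
  note ab = slice_times[OF t(1) tT s]
  show ?thesis unfolding conv_slice_def
  proof (rule integral_dominated_convergence[where w=w])
    show "AE z in lborel. (\<lambda>n. f (tn n * (1 - s)) (xn n) z * k (tn n * s) z (yn n))
        \<longlonglongrightarrow> f (t * (1 - s)) x z * k (t * s) z y"
    proof (intro AE_I2 tendsto_mult)
      fix z
      have "t * (1 - s) / 2 \<le> tn n * (1 - s)" "tn n * (1 - s) \<le> 2 * (t * (1 - s))"
        "t * s / 2 \<le> tn n * s" "tn n * s \<le> 2 * (t * s)" for n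
        using slice_times'[of t "tn n" s] near[of n] s by auto
      note bds = this
      show "(\<lambda>n. f (tn n * (1 - s)) (xn n) z) \<longlonglongrightarrow> f (t * (1 - s)) x z"
        by (rule seqcontD[OF cf]) (use ab t lim near bds in \<open>auto intro!: tendsto_intros\<close>)
      show "(\<lambda>n. k (tn n * s) z (yn n)) \<longlonglongrightarrow> k (t * s) z y"
        by (rule seqcontD[OF ck]) (use ab t lim near bds in \<open>auto intro!: tendsto_intros\<close>)
    qed
    show "AE z in lborel. norm (f (tn n * (1 - s)) (xn n) z * k (tn n * s) z (yn n)) \<le> w z" for n
      using w(2)[OF fh kg] near[of n] by auto
  qed (use w in measurable)
qed

lemma conv_slice_measurable:
  assumes "measurable3 f" "measurable3 k"
  shows "conv_slice f k t x y \<in> borel_measurable borel"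
proof -
  note [measurable] = measurable3D[OF assms(1)] measurable3D[OF assms(2)]
  show ?thesis unfolding conv_slice_def[abs_def] by measurable
qed

lemma seqcont_spacetime_conv:
  assumes h: "kern \<kappa>1 c1 h" and g: "kern \<kappa>2 c2 g" and \<kappa>: "0 < \<kappa>1" "0 < \<kappa>2"
    and fh: "dominated h f" and kg: "dominated g k"
    and m: "measurable3 f" "measurable3 k"
    and cf: "seqcont R f" and ck: "seqcont False k"
  shows "seqcont R (spacetime_conv f k)"
  unfolding seqcont_def
proof (intro allI impI, elim conjE)
  fix t x y :: real and tn xn yn :: "nat \<Rightarrow> real"
  assume t: "0 < t" "t < T" and lim: "tn \<longlonglongrightarrow> t" "xn \<longlonglongrightarrow> x" "yn \<longlonglongrightarrow> y"
    and near: "\<forall>n. t / 2 \<le> tn n \<and> tn n \<le> 2 * t \<and> \<bar>xn n - x\<bar> \<le> 1 \<and> \<bar>yn n - y\<bar> \<le> 1 \<and> (R \<or> xn n = x)"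
  have tT: "t \<le> T" using t by simp
  have tn: "0 < tn n" for n using near t by (metis half_gt_zero less_le_trans)
  note [measurable] = conv_slice_measurable[OF m]
  have "(\<lambda>n. tn n * (\<integral>s. indicator {0<..<1} s * conv_slice f k (tn n) (xn n) (yn n) s \<partial>lborel))
     \<longlonglongrightarrow> t * (\<integral>s. indicator {0<..<1} s * conv_slice f k t x y s \<partial>lborel)"
  proof (intro tendsto_mult lim integral_dominated_convergence[where w="slice_bound \<kappa>1 c1 \<kappa>2 c2 t"])
    show "integrable lborel (slice_bound \<kappa>1 c1 \<kappa>2 c2 t)" by (rule slice_bound_integrable[OF \<kappa>])
    show "AE s in lborel. (\<lambda>n. indicator {0<..<1} s * conv_slice f k (tn n) (xn n) (yn n) s)
       \<longlonglongrightarrow> indicator {0<..<1} s * conv_slice f k t x y s"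
    proof (rule AE_I2)
      fix s show "(\<lambda>n. indicator {0<..<1} s * conv_slice f k (tn n) (xn n) (yn n) s)
         \<longlonglongrightarrow> indicator {0<..<1} s * conv_slice f k t x y s"
        using conv_slice_tendsto[OF h g fh kg m cf ck t lim spec[OF near]]
        by (cases "s \<in> {0<..<1}") auto
    qed
    show "AE s in lborel. norm (indicator {0<..<1} s * conv_slice f k (tn n) (xn n) (yn n) s) \<le> slice_bound \<kappa>1 c1 \<kappa>2 c2 t s" for n
    proof (rule AE_I2)
      fix s show "norm (indicator {0<..<1} s * conv_slice f k (tn n) (xn n) (yn n) s) \<le> slice_bound \<kappa>1 c1 \<kappa>2 c2 t s"
      proof (cases "s \<in> {0<..<1}")
        case True
        then show ?thesis
          using conv_slice_bound[OF h g fh kg t(1) tT, of "tn n" s "xn n" "yn n"] near by auto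
      next
        case False then show ?thesis by (simp add: slice_bound_def)
      qed
    qed
  qed measurable
  then show "(\<lambda>n. spacetime_conv f k (tn n) (xn n) (yn n)) \<longlonglongrightarrow> spacetime_conv f k t x y"
    using t tn by (simp add: spacetime_conv_eq_slices)
qed

text \<open>
  The chain rule cancels the inner factors: \<open>f\<close> at time \<open>t (1 - s)\<close> has \<open>t\<close>-derivative
  \<open>f' / (t (1 - s)) \<cdot> (1 - s) = f' / t\<close>, and likewise for \<open>k\<close>.  No singularity at \<open>s = 0\<close> or \<open>s = 1\<close> appears.
\<close>

lemma conv_slice_deriv:
  assumes h: "kern \<kappa>1 c1 h" and g: "kern \<kappa>2 c2 g"
    and fp: "kernel_pair R h f f'" and kp: "kernel_pair R' g k k'"
    and t: "0 < t" "t < T" and s: "0 < s" "s < 1"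
  shows "((\<lambda>t. conv_slice f k t x y s) has_real_derivative
     (conv_slice f' k t x y s + conv_slice f k' t x y s) / t) (at t)"
proof -
  have fh: "dominated h f" "dominated h f'" and kg: "dominated g k" "dominated g k'"
    and m: "measurable3 f" "measurable3 f'" "measurable3 k" "measurable3 k'"
    using fp kp by (auto simp: kernel_pair_def)
  note [measurable] = m[THEN measurable3D]
  have tT: "t \<le> T" using t by simp
  obtain w where w: "integrable lborel w"
    "\<And>f k t' x' y' z. dominated h f \<Longrightarrow> dominated g k \<Longrightarrow> t / 2 \<le> t' \<Longrightarrow> t' \<le> 2 * t \<Longrightarrow>
       \<bar>x' - x\<bar> \<le> 1 \<Longrightarrow> \<bar>y' - y\<bar> \<le> 1 \<Longrightarrow> \<bar>f (t' * (1 - s)) x' z * k (t' * s) z y'\<bar> \<le> w z"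
    using conv_dominator[OF h g t(1) tT s, of x y] by blast
  have int: "integrable lborel (\<lambda>z. F (r * (1 - s)) x z * K (r * s) z y)"
    if "dominated h F" "dominated g K" "t / 2 \<le> r" "r \<le> 2 * t" "measurable3 F" "measurable3 K" for F K r
  proof (rule Bochner_Integration.integrable_bound[OF w(1)])
    note [measurable] = that(5,6)[THEN measurable3D]
    show "(\<lambda>z. F (r * (1 - s)) x z * K (r * s) z y) \<in> borel_measurable lborel" by measurable
    show "AE z in lborel. norm (F (r * (1 - s)) x z * K (r * s) z y) \<le> norm (w z)"
    proof (rule AE_I2)
      fix z show "norm (F (r * (1 - s)) x z * K (r * s) z y) \<le> norm (w z)"
        using w(2)[OF that(1,2,3,4), of x y z] by simp
    qed
  qed
  let ?D = "\<lambda>r z. (f' (r * (1 - s)) x z * k (r * s) z y + f (r * (1 - s)) x z * k' (r * s) z y) / r"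
  have "((\<lambda>t. \<integral>z. f (t * (1 - s)) x z * k (t * s) z y \<partial>lborel) has_real_derivative (\<integral>z. ?D t z \<partial>lborel)) (at t)"
  proof (rule has_real_derivative_integral[where a="t/2" and b="min (2 * t) T" and w="\<lambda>z. 4 / t * w z"])
    show "t / 2 < t" "t < min (2 * t) T" using t by auto
    fix r assume r: "t / 2 < r" "r < min (2 * t) T"
    then have r': "t / 2 \<le> r" "r \<le> 2 * t" "0 < r" "r < T" using t by auto
    show "integrable lborel (\<lambda>z. f (r * (1 - s)) x z * k (r * s) z y)"
      using fh kg m r' by (intro int) auto
    fix z
    note ab = slice_times[OF r'(3) less_imp_le[OF r'(4)] s]
    have "((\<lambda>r. f (r * (1 - s)) x z) has_real_derivative f' (r * (1 - s)) x z / (r * (1 - s)) * (1 - s)) (at r)"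
      by (rule DERIV_chain2[where f="\<lambda>q. f q x z"])
         (use fp ab r' in \<open>auto simp: kernel_pair_def intro!: derivative_eq_intros\<close>)
    moreover have "((\<lambda>r. k (r * s) z y) has_real_derivative k' (r * s) z y / (r * s) * s) (at r)"
      by (rule DERIV_chain2[where f="\<lambda>q. k q z y"])
         (use kp ab r' in \<open>auto simp: kernel_pair_def intro!: derivative_eq_intros\<close>)
    ultimately have "((\<lambda>r. f (r * (1 - s)) x z * k (r * s) z y) has_real_derivative
        f' (r * (1 - s)) x z / (r * (1 - s)) * (1 - s) * k (r * s) z y
        + k' (r * s) z y / (r * s) * s * f (r * (1 - s)) x z) (at r)"
      by (rule DERIV_mult)
    then show "((\<lambda>r. f (r * (1 - s)) x z * k (r * s) z y) has_real_derivative ?D r z) (at r)"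
      using s r' by (simp add: add_divide_distrib mult.commute)
    have "\<bar>?D r z\<bar> \<le> (w z + w z) / r"
      using w(2)[OF fh(2) kg(1) r'(1,2), of x y z] w(2)[OF fh(1) kg(2) r'(1,2), of x y z] r'
      by (simp add: abs_divide divide_right_mono)
    also have "\<dots> \<le> (w z + w z) / (t / 2)"
      using w(2)[OF fh(2) kg(1) r'(1,2), of x y z] t r by (intro divide_left_mono) auto
    finally show "\<bar>?D r z\<bar> \<le> 4 / t * w z" by simp
  qed (use w in auto)
  also have "(\<integral>z. ?D t z \<partial>lborel) = (conv_slice f' k t x y s + conv_slice f k' t x y s) / t"
    unfolding conv_slice_def
    using int[OF fh(2) kg(1) _ _ m(2,3), of t] int[OF fh(1) kg(2) _ _ m(1,4), of t] t by simp
  finally show ?thesis unfolding conv_slice_def .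
qed

text \<open>
  The Leibniz rule for \<open>t \<partial>\<^sub>t\<close> with its estimate.  The summand \<open>f \<star> k\<close> itself comes from the Jacobian \<open>t\<close> of
  the substitution \<open>\<tau> = t s\<close>.
\<close>

theorem kernel_pair_conv:
  assumes h: "kern \<kappa>1 c1 h" and g: "kern \<kappa>2 c2 g" and \<kappa>: "0 < \<kappa>1" "0 < \<kappa>2"
    and fp: "kernel_pair R h f f'" and kp: "kernel_pair False g k k'"
  obtains H where "kern (\<kappa>1 + \<kappa>2) (384 * A\<^sup>2 * (c1 * c2 * Beta \<kappa>2 \<kappa>1)) H"
    "kernel_pair R H (spacetime_conv f k)
      (\<lambda>t x y. spacetime_conv f k t x y + spacetime_conv f' k t x y + spacetime_conv f k' t x y)"
proof -
  have fh: "dominated h f" "dominated h f'" and kg: "dominated g k" "dominated g k'"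
    and m: "measurable3 f" "measurable3 f'" "measurable3 k" "measurable3 k'"
    and cf: "seqcont R f" "seqcont R f'" and ck: "seqcont False k" "seqcont False k'"
    using fp kp by (auto simp: kernel_pair_def)
  note [measurable] = m[THEN measurable3D]
  let ?V = "\<lambda>t x y. spacetime_conv f k t x y + spacetime_conv f' k t x y + spacetime_conv f k' t x y"
  have c: "0 \<le> c1" "0 \<le> c2" using h g by (auto simp: kern_def)
  have B: "0 \<le> Beta \<kappa>2 \<kappa>1" using \<kappa> by (simp add: Beta_def)
  \<comment> \<open>Three convolutions, each at most \<open>2 * conv h g t\<close>; the factor \<open>2\<close> stems from \<open>t' \<le> 2 * t\<close>.\<close>
  define F where "F t v = 6 * conv h g t v" for t v
  define H where "H t v = ennreal (16 * A\<^sup>2) * mollify (\<rho> t) (F t) v" for t v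
  have Fm: "(\<lambda>(t, v). F t v) \<in> borel_measurable borel"
    using conv_meas[OF h g] unfolding F_def split_beta by measurable
  have [measurable]: "(\<lambda>v. F t v) \<in> borel_measurable borel" for t
  proof -
    have "(\<lambda>p. F (fst p) (snd p)) \<in> borel_measurable (borel \<Otimes>\<^sub>M borel)"
      using Fm by (simp add: case_prod_unfold borel_prod)
    from measurable_compose[OF _ this, of "\<lambda>v. (t, v)" borel] show ?thesis by simp
  qed
  have hF: "harnack (\<rho> t) (A\<^sup>2) (F t)" if "0 < t" "t \<le> T" for t
    unfolding F_def[abs_def] by (intro harnack_cmult conv_harnack[OF h g that])
  have "kern (\<kappa>1 + \<kappa>2) (64 * A\<^sup>2 * (6 * (c1 * c2 * Beta \<kappa>2 \<kappa>1))) H"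
    unfolding H_def[abs_def]
  proof (rule kern_mollify[OF Fm])
    fix t assume t: "0 < t" "t \<le> T"
    have [measurable]: "conv h g t \<in> borel_measurable borel"
    proof -
      have "(\<lambda>p. conv h g (fst p) (snd p)) \<in> borel_measurable (borel \<Otimes>\<^sub>M borel)"
        using conv_meas[OF h g] by (simp add: case_prod_unfold borel_prod)
      from measurable_compose[OF _ this, of "\<lambda>v. (t, v)" borel] show ?thesis by simp
    qed
    have "(\<integral>\<^sup>+v. F t v \<partial>lborel) = 6 * (\<integral>\<^sup>+v. conv h g t v \<partial>lborel)"
      unfolding F_def by (rule nn_integral_cmult) measurable
    also have "\<dots> \<le> ennreal 6 * ennreal ((c1 * c2 * Beta \<kappa>2 \<kappa>1) * t powr (\<kappa>1 + \<kappa>2 - 1))"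
      using conv_L1[OF h g \<kappa> t] by (simp add: mult_left_mono)
    also have "\<dots> = ennreal (6 * (c1 * c2 * Beta \<kappa>2 \<kappa>1) * t powr (\<kappa>1 + \<kappa>2 - 1))"
      using c B by (subst ennreal_mult[symmetric]) (auto simp: mult.assoc)
    finally show "(\<integral>\<^sup>+v. F t v \<partial>lborel) \<le> ennreal (6 * (c1 * c2 * Beta \<kappa>2 \<kappa>1) * t powr (\<kappa>1 + \<kappa>2 - 1))" .
  qed (use c B in auto)
  then have kH: "kern (\<kappa>1 + \<kappa>2) (384 * A\<^sup>2 * (c1 * c2 * Beta \<kappa>2 \<kappa>1)) H" by (simp add: mult_ac)
  have FH: "F t v \<le> H t v" if "0 < t" "t \<le> T" for t v
    unfolding H_def using hF[OF that] \<rho>_pos that by (intro harnack_le_mollify) auto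
  have dom: "ennreal \<bar>spacetime_conv a b t' x y\<bar> \<le> 2 * conv h g t (y - x)"
    if "dominated h a" "dominated g b" "0 < t" "t \<le> T" "t / 2 \<le> t'" "t' \<le> 2 * t" for a b t t' x y
    by (rule spacetime_conv_dominated[OF h g that])
  have "kernel_pair R H (spacetime_conv f k) ?V"
    unfolding kernel_pair_def
  proof (intro conjI allI impI)
    show "measurable3 (spacetime_conv f k)" using m by (intro measurable3_spacetime_conv)
    show "measurable3 ?V"
    proof (rule measurable3I)
      note [measurable] = measurable3_spacetime_conv[OF m(1,3), THEN measurable3D]
        measurable3_spacetime_conv[OF m(2,3), THEN measurable3D]
        measurable3_spacetime_conv[OF m(1,4), THEN measurable3D]
      show "(\<lambda>p. ?V (fst p) (fst (snd p)) (snd (snd p))) \<in> borel_measurable (borel \<Otimes>\<^sub>M borel \<Otimes>\<^sub>M borel)"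
        by measurable
    qed
    show "dominated H (spacetime_conv f k)"
      unfolding dominated_def
    proof (intro allI impI, elim conjE)
      fix t t' x y assume t: "0 < t" "t \<le> T" "t / 2 \<le> t'" "t' \<le> 2 * t"
      have "ennreal \<bar>spacetime_conv f k t' x y\<bar> \<le> 2 * conv h g t (y - x)"
        by (rule dom[OF fh(1) kg(1) t])
      also have "\<dots> \<le> F t (y - x)" unfolding F_def by (intro mult_right_mono) auto
      also note FH[OF t(1,2)]
      finally show "ennreal \<bar>spacetime_conv f k t' x y\<bar> \<le> H t (y - x)" .
    qed
    show "dominated H ?V"
      unfolding dominated_def
    proof (intro allI impI, elim conjE)
      fix t t' x y assume t: "0 < t" "t \<le> T" "t / 2 \<le> t'" "t' \<le> 2 * t"
      let ?c = "conv h g t (y - x)"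
      have "ennreal \<bar>?V t' x y\<bar> \<le> ennreal (\<bar>spacetime_conv f k t' x y\<bar> + \<bar>spacetime_conv f' k t' x y\<bar> + \<bar>spacetime_conv f k' t' x y\<bar>)"
        by (intro ennreal_leI) simp
      also have "\<dots> = ennreal \<bar>spacetime_conv f k t' x y\<bar> + ennreal \<bar>spacetime_conv f' k t' x y\<bar> + ennreal \<bar>spacetime_conv f k' t' x y\<bar>"
        by simp
      also have "\<dots> \<le> 2 * ?c + 2 * ?c + 2 * ?c"
        by (intro add_mono dom fh kg t)
      also have "\<dots> = F t (y - x)" unfolding F_def by (simp flip: distrib_right)
      also note FH[OF t(1,2)]
      finally show "ennreal \<bar>?V t' x y\<bar> \<le> H t (y - x)" .
    qed
    show "seqcont R (spacetime_conv f k)"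
      by (rule seqcont_spacetime_conv[OF h g \<kappa> fh(1) kg(1) m(1,3) cf(1) ck(1)])
    show "seqcont R ?V"
      by (intro seqcont_add seqcont_spacetime_conv[OF h g \<kappa>] fh kg m cf ck)
    fix t x y assume "0 < t \<and> t < T"
    then have t: "0 < t" "t < T" "t \<le> T" by auto
    let ?i = "indicator {0<..<1} :: real \<Rightarrow> real"
    let ?S = "\<lambda>f k t. \<integral>s. ?i s * conv_slice f k t x y s \<partial>lborel"
    note [measurable] = conv_slice_measurable[OF m(1,3)] conv_slice_measurable[OF m(2,3)] conv_slice_measurable[OF m(1,4)]
    have int: "integrable lborel (\<lambda>s. ?i s * conv_slice a b r x y s)"
      if "dominated h a" "dominated g b" "t / 2 \<le> r" "r \<le> 2 * t" "measurable3 a" "measurable3 b" for a b r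
    proof (rule Bochner_Integration.integrable_bound[OF slice_bound_integrable[OF \<kappa>, of c1 c2 t]])
      show "(\<lambda>s. ?i s * conv_slice a b r x y s) \<in> borel_measurable lborel"
        using conv_slice_measurable[OF that(5,6)] by measurable
      show "AE s in lborel. norm (?i s * conv_slice a b r x y s) \<le> norm (slice_bound \<kappa>1 c1 \<kappa>2 c2 t s)"
      proof (rule AE_I2)
        fix s show "norm (?i s * conv_slice a b r x y s) \<le> norm (slice_bound \<kappa>1 c1 \<kappa>2 c2 t s)"
          using conv_slice_bound[OF h g that(1,2) t(1,3) that(3,4), of s x y]
          by (cases "s \<in> {0<..<1}") (auto intro: order_trans[OF _ abs_ge_self])
      qed
    qed
    have "((\<lambda>r. ?S f k r) has_real_derivative
       (\<integral>s. ?i s * ((conv_slice f' k t x y s + conv_slice f k' t x y s) / t) \<partial>lborel)) (at t)"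
    proof (rule has_real_derivative_integral[where a="t/2" and b="min (2 * t) T" and
          w="\<lambda>s. 4 / t * slice_bound \<kappa>1 c1 \<kappa>2 c2 t s"])
      show "t / 2 < t" "t < min (2 * t) T" using t by auto
      show "integrable lborel (\<lambda>s. 4 / t * slice_bound \<kappa>1 c1 \<kappa>2 c2 t s)"
        by (intro integrable_mult_right slice_bound_integrable[OF \<kappa>])
      fix r assume r: "t / 2 < r" "r < min (2 * t) T"
      then have r': "t / 2 \<le> r" "r \<le> 2 * t" "0 < r" "r < T" using t by auto
      show "integrable lborel (\<lambda>s. ?i s * conv_slice f k r x y s)"
        using fh kg m r' by (intro int) auto
      fix s
      let ?b = "slice_bound \<kappa>1 c1 \<kappa>2 c2 t s"
      show "((\<lambda>r. ?i s * conv_slice f k r x y s) has_real_derivative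
          ?i s * ((conv_slice f' k r x y s + conv_slice f k' r x y s) / r)) (at r)"
        using conv_slice_deriv[OF h g fp kp r'(3,4), of s x y]
        by (cases "s \<in> {0<..<1}") (auto intro!: DERIV_cmult)
      show "\<bar>?i s * ((conv_slice f' k r x y s + conv_slice f k' r x y s) / r)\<bar> \<le> 4 / t * ?b"
      proof (cases "s \<in> {0<..<1}")
        case True
        then have s: "0 < s" "s < 1" by auto
        have b: "\<bar>conv_slice f' k r x y s\<bar> \<le> ?b" "\<bar>conv_slice f k' r x y s\<bar> \<le> ?b"
          using conv_slice_bound[OF h g fh(2) kg(1) t(1,3) r'(1,2) s] conv_slice_bound[OF h g fh(1) kg(2) t(1,3) r'(1,2) s] by auto
        have "\<bar>(conv_slice f' k r x y s + conv_slice f k' r x y s) / r\<bar> \<le> (?b + ?b) / r"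
          using b r' by (simp add: abs_divide divide_right_mono)
        also have "\<dots> \<le> (?b + ?b) / (t / 2)"
          using b t r by (intro divide_left_mono) auto
        finally show ?thesis using True by simp
      next
        case False then show ?thesis by (simp add: slice_bound_def)
      qed
    qed measurable
    also have "(\<integral>s. ?i s * ((conv_slice f' k t x y s + conv_slice f k' t x y s) / t) \<partial>lborel) = (?S f' k t + ?S f k' t) / t"
      using int[OF fh(2) kg(1) _ _ m(2,3), of t] int[OF fh(1) kg(2) _ _ m(1,4), of t] t
      by (simp add: distrib_left)
    finally have d: "((\<lambda>r. ?S f k r) has_real_derivative (?S f' k t + ?S f k' t) / t) (at t)" .
    have "((\<lambda>r. r * ?S f k r) has_real_derivative 1 * ?S f k t + (?S f' k t + ?S f k' t) / t * t) (at t)"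
      by (rule DERIV_mult[OF DERIV_ident d])
    moreover have "1 * ?S f k t + (?S f' k t + ?S f k' t) / t * t = ?V t x y / t"
    proof -
      have "?V t x y = t * (?S f k t + (?S f' k t + ?S f k' t))"
        using t by (simp add: spacetime_conv_eq_slices distrib_left)
      then show ?thesis using t by simp
    qed
    ultimately have "((\<lambda>r. r * ?S f k r) has_real_derivative ?V t x y / t) (at t)" by simp
    then show "((\<lambda>s. spacetime_conv f k s x y) has_real_derivative ?V t x y / t) (at t)"
    proof (rule has_field_derivative_transform_within_open[where S="{0<..}"])
      show "r * ?S f k r = spacetime_conv f k r x y" if "r \<in> {0<..}" for r
        using that by (simp add: spacetime_conv_eq_slices)
    qed (use t in auto)
  qed
  with kH show thesis by (rule that)
qed

end

section \<open>Majorization by convolutions with probability measures\<close>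

lemma f_up_bounds: "0 \<le> d1 \<Longrightarrow> 0 \<le> d2 \<Longrightarrow> 0 \<le> f_up d1 d2 x \<and> f_up d1 d2 x \<le> d1"
  unfolding f_up_def by (auto intro!: mult_left_le)

lemma f_up_measurable[measurable]: "f_up d1 d2 \<in> borel_measurable borel"
  unfolding f_up_def[abs_def] by measurable

lemma f_up_near: "0 \<le> d1 \<Longrightarrow> \<bar>x\<bar> \<le> 1 \<Longrightarrow> d1 / 2 \<le> f_up d1 1 x"
proof -
  assume d1: "0 \<le> d1" and x: "\<bar>x\<bar> \<le> 1"
  have "\<bar>x\<bar> * ln (1 + \<bar>x\<bar>) \<le> 1 * ln 2" using x by (intro mult_mono) auto
  then have "exp (- ln 2) \<le> exp (- 1 * \<bar>x\<bar> * ln (1 + \<bar>x\<bar>))" by simp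
  then have "d1 * exp (- ln 2) \<le> f_up d1 1 x" unfolding f_up_def using d1 by (intro mult_left_mono)
  then show ?thesis by (simp add: exp_minus)
qed

text \<open>
  \<open>Q\<close> is \<open>F\<close> normalized.  On the window \<open>\<bar>v - z\<bar> \<le> 1 / r\<close> the function \<open>f_up\<close> is at least half of its
  maximum and \<open>F z \<ge> F v / 4\<close>; the constant \<open>8 c\<close> compensates these two losses and the normalization.
\<close>

lemma harnack_le_conv_measure:
  assumes h: "harnack r 1 F" and r: "0 < r" and [measurable]: "F \<in> borel_measurable borel"
    and c: "0 < c" and N: "(\<integral>\<^sup>+z. F z \<partial>lborel) \<le> ennreal c"
  obtains Q where "prob_space Q" "sets Q = sets borel"
    "\<And>v. F v \<le> ennreal (r * conv_measure (\<lambda>z. f_up (8 * c) 1 (r * z)) Q v)"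
proof (cases "(\<integral>\<^sup>+z. F z \<partial>lborel) = 0")
  case True
  have "F v = 0" for v using harnack_sup[OF h _ r, of v] True by simp
  moreover have "prob_space (return borel (0::real))" by (rule prob_space_return) simp
  ultimately show ?thesis by (intro that[of "return borel 0"]) auto
next
  case False
  obtain n where n: "(\<integral>\<^sup>+z. F z \<partial>lborel) = ennreal n" "0 < n" "n \<le> c"
    using N False c by (cases "\<integral>\<^sup>+z. F z \<partial>lborel" rule: ennreal_cases)
      (auto simp: ennreal_le_iff top_unique)
  let ?Q = "density lborel (\<lambda>z. ennreal (1 / n) * F z)"
  have prob: "prob_space ?Q"
  proof
    have "emeasure ?Q (space ?Q) = ennreal (1 / n) * (\<integral>\<^sup>+z. F z \<partial>lborel)"
      by (simp add: emeasure_density nn_integral_cmult)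
    also have "\<dots> = 1" using n by (simp add: ennreal_mult[symmetric])
    finally show "emeasure ?Q (space ?Q) = 1" .
  qed
  then interpret Q: prob_space ?Q .
  have le: "F v \<le> ennreal (r * conv_measure (\<lambda>z. f_up (8 * c) 1 (r * z)) ?Q v)" for v
  proof -
    let ?\<phi> = "\<lambda>z. f_up (8 * c) 1 (r * (v - z))"
    have \<phi>: "0 \<le> ?\<phi> z" "?\<phi> z \<le> 8 * c" for z using f_up_bounds[of "8 * c" 1] c by auto
    have "F v = F v * (ennreal r * ennreal (1 / r))"
      using r by (simp add: ennreal_mult[symmetric])
    also have "\<dots> = ennreal r * (\<integral>\<^sup>+z. F v * indicator {v..v + 1/r} z \<partial>lborel)"
      using r by (subst nn_integral_cmult_indicator) (auto simp: mult_ac)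
    also have "\<dots> \<le> ennreal r * (\<integral>\<^sup>+z. ennreal (1 / n) * F z * ennreal (?\<phi> z) \<partial>lborel)"
    proof (intro mult_left_mono nn_integral_mono)
      fix z show "F v * indicator {v..v + 1/r} z \<le> ennreal (1 / n) * F z * ennreal (?\<phi> z)"
      proof (cases "z \<in> {v..v + 1/r}")
        case True
        then have "\<bar>v - z\<bar> \<le> 1 / r" by auto
        then have r1: "r * \<bar>v - z\<bar> \<le> 1" using r by (simp add: field_simps)
        then have "\<bar>r * (v - z)\<bar> \<le> 1" using r by (simp add: abs_mult)
        from f_up_near[of "8 * c", OF _ this] c have "4 * c \<le> ?\<phi> z" by simp
        then have "4 * n \<le> ?\<phi> z" using n by linarith
        then have "4 \<le> 1 / n * ?\<phi> z" using n by (simp add: field_simps)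
        then have "ennreal 4 \<le> ennreal (1 / n * ?\<phi> z)" by (rule ennreal_leI)
        also have "\<dots> = ennreal (1 / n) * ennreal (?\<phi> z)" using n \<phi> by (intro ennreal_mult) auto
        finally have 4: "ennreal 4 \<le> ennreal (1 / n) * ennreal (?\<phi> z)" .
        have "F v \<le> ennreal 4 * F z"
          using harnack_near[OF h _ r r1] by simp
        also have "\<dots> \<le> (ennreal (1 / n) * ennreal (?\<phi> z)) * F z" by (rule mult_right_mono[OF 4]) simp
        finally show ?thesis using True by (simp add: mult_ac)
      qed simp
    qed simp
    also have "(\<integral>\<^sup>+z. ennreal (1 / n) * F z * ennreal (?\<phi> z) \<partial>lborel) = (\<integral>\<^sup>+z. ennreal (?\<phi> z) \<partial>?Q)"
      by (rule nn_integral_density[symmetric]) measurable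
    also have "\<dots> = ennreal (\<integral>z. ?\<phi> z \<partial>?Q)"
    proof (rule nn_integral_eq_integral)
      show "integrable ?Q ?\<phi>"
        by (rule Q.integrable_const_bound[where B="8 * c"]) (use \<phi> in auto)
    qed (use \<phi> in auto)
    also have "ennreal r * ennreal (\<integral>z. ?\<phi> z \<partial>?Q) = ennreal (r * (\<integral>z. ?\<phi> z \<partial>?Q))"
      using r \<phi> by (intro ennreal_mult[symmetric] integral_nonneg_AE) auto
    finally show ?thesis by (simp add: conv_measure_def)
  qed
  show ?thesis by (rule that[OF prob _ le]) simp
qed

section \<open>The parametrix series\<close>

text \<open>
  The integrands \<open>(1 - s)\<^sup>k\<^sup>\<delta>\<^sup>-\<^sup>1 s\<^sup>\<delta>\<^sup>-\<^sup>1\<close> decrease to \<open>0\<close> on \<open>{0<..<1}\<close>, so that no asymptotics of the Gamma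
  function is involved.
\<close>

lemma Beta_tendsto_0:
  fixes \<delta> :: real
  assumes \<delta>: "0 < \<delta>"
  shows "(\<lambda>k. Beta \<delta> (real (Suc k) * \<delta>)) \<longlonglongrightarrow> 0"
proof -
  define G where "G a s = indicator {0<..<1} s * ((1 - s) powr (a - 1) * s powr (\<delta> - 1))" for a s :: real
  have G: "integrable lborel (G a)" "(\<integral>s. G a s \<partial>lborel) = Beta \<delta> a" if a: "0 < a" for a
  proof -
    have B: "0 \<le> Beta \<delta> a" using a \<delta> by (simp add: Beta_def)
    have *: "(\<integral>\<^sup>+s. ennreal (G a s) \<partial>lborel) = ennreal (Beta \<delta> a)"
      unfolding G_def Beta_nn_integral[OF a \<delta>, symmetric]
      by (intro nn_integral_cong) (auto split: split_indicator)
    have m: "G a \<in> borel_measurable lborel" unfolding G_def[abs_def] by measurable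
    have nn: "0 \<le> G a s" for s by (simp add: G_def)
    show "integrable lborel (G a)" using * m nn
      by (intro integrableI_nn_integral_finite[where x="Beta \<delta> a"]) (auto intro: B)
    then show "(\<integral>s. G a s \<partial>lborel) = Beta \<delta> a"
      using * nn B by (subst (asm) nn_integral_eq_integral) (auto intro: integral_nonneg_AE)
  qed
  have "(\<lambda>k. \<integral>s. G (real (Suc k) * \<delta>) s \<partial>lborel) \<longlonglongrightarrow> (\<integral>s. 0 \<partial>(lborel :: real measure))"
  proof (rule integral_dominated_convergence[where w="G \<delta>"])
    show "integrable lborel (G \<delta>)" by (rule G[OF \<delta>])
    show "AE s in lborel. norm (G (real (Suc k) * \<delta>) s) \<le> G \<delta> s" for k
    proof (rule AE_I2)
      fix s show "norm (G (real (Suc k) * \<delta>) s) \<le> G \<delta> s"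
      proof (cases "s \<in> {0<..<1}")
        case True
        have "\<delta> \<le> real (Suc k) * \<delta>" using \<delta> by (simp add: distrib_right)
        then have "(1 - s) powr (real (Suc k) * \<delta> - 1) \<le> (1 - s) powr (\<delta> - 1)"
          using True by (intro powr_mono') auto
        then show ?thesis using True by (simp add: G_def mult_right_mono)
      qed (simp add: G_def)
    qed
    show "AE s in lborel. (\<lambda>k. G (real (Suc k) * \<delta>) s) \<longlonglongrightarrow> 0"
    proof (rule AE_I2)
      fix s show "(\<lambda>k. G (real (Suc k) * \<delta>) s) \<longlonglongrightarrow> 0"
      proof (cases "s \<in> {0<..<1}")
        case True
        let ?q = "(1 - s) powr \<delta>"
        have "?q < 1 powr \<delta>" using True \<delta> by (intro powr_less_mono2) auto
        then have q: "0 \<le> ?q" "?q < 1" by auto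
        have "(1 - s) powr (real (Suc k) * \<delta> - 1) = ?q ^ Suc k / (1 - s)" for k
        proof -
          have "(1 - s) powr (real (Suc k) * \<delta> - 1) = (1 - s) powr (\<delta> * real (Suc k)) / (1 - s) powr 1"
            by (simp only: powr_diff mult.commute)
          also have "(1 - s) powr (\<delta> * real (Suc k)) = ?q powr real (Suc k)" by (simp only: powr_powr)
          also have "\<dots> = ?q ^ Suc k" using True by (intro powr_realpow) auto
          finally show ?thesis using True by simp
        qed
        moreover have "(\<lambda>k. ?q ^ Suc k / (1 - s) * s powr (\<delta> - 1)) \<longlonglongrightarrow> 0 / (1 - s) * s powr (\<delta> - 1)"
          using True by (intro tendsto_intros LIMSEQ_Suc LIMSEQ_power_zero) (use q in auto)
        ultimately show ?thesis using True by (simp add: G_def del: power_Suc of_nat_Suc)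
      qed (simp add: G_def)
    qed
  qed (auto simp: G_def[abs_def])
  then show ?thesis using G(2) \<delta> by simp
qed

context time_scale
begin

lemma kernel_pair_deriv:
  "kernel_pair R h f f' \<Longrightarrow> 0 < t \<Longrightarrow> t < T \<Longrightarrow> ((\<lambda>s. f s x y) has_real_derivative f' t x y / t) (at t)"
  by (simp add: kernel_pair_def)

lemma kern_weaken:
  assumes k: "kern \<kappa>' c h" and le: "\<kappa> \<le> \<kappa>'"
  shows "kern \<kappa> (c * T powr (\<kappa>' - \<kappa>)) h"
  unfolding kern_def
proof (intro conjI allI impI)
  have c: "0 \<le> c" using k by (simp add: kern_def)
  then show "0 \<le> c * T powr (\<kappa>' - \<kappa>)" by simp
  show "(\<lambda>(t, v). h t v) \<in> borel_measurable borel" using k by (simp add: kern_def)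
  fix t assume t: "0 < t \<and> t \<le> T"
  then show "harnack (\<rho> t) 1 (h t)" using kernD(2)[OF k] by simp
  have "t powr (\<kappa>' - 1) = t powr (\<kappa>' - \<kappa>) * t powr (\<kappa> - 1)"
    by (simp flip: powr_add)
  also have "\<dots> \<le> T powr (\<kappa>' - \<kappa>) * t powr (\<kappa> - 1)"
    using t le by (intro mult_right_mono powr_mono2) auto
  finally have "c * t powr (\<kappa>' - 1) \<le> c * T powr (\<kappa>' - \<kappa>) * t powr (\<kappa> - 1)"
    using c by (simp add: mult_left_mono mult.assoc)
  with kernD(1)[OF k, of t] t show "(\<integral>\<^sup>+v. h t v \<partial>lborel) \<le> ennreal (c * T powr (\<kappa>' - \<kappa>) * t powr (\<kappa> - 1))"
    by (auto intro: order_trans ennreal_leI)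
qed

lemma kern_add:
  assumes h: "kern \<kappa> c h" and g: "kern \<kappa> d g"
  shows "kern \<kappa> (c + d) (\<lambda>t v. h t v + g t v)"
  unfolding kern_def
proof (intro conjI allI impI)
  have c: "0 \<le> c" "0 \<le> d" using h g by (auto simp: kern_def)
  then show "0 \<le> c + d" by simp
  note [measurable] = kern_measurable[OF h] kern_measurable[OF g]
  show "(\<lambda>(t, v). h t v + g t v) \<in> borel_measurable borel"
    using h g unfolding kern_def case_prod_unfold by auto
  fix t assume t: "0 < t \<and> t \<le> T"
  then show "harnack (\<rho> t) 1 (\<lambda>v. h t v + g t v)" using kernD(2)[OF h] kernD(2)[OF g] by (intro harnack_add) auto
  have "(\<integral>\<^sup>+v. h t v + g t v \<partial>lborel) = (\<integral>\<^sup>+v. h t v \<partial>lborel) + (\<integral>\<^sup>+v. g t v \<partial>lborel)"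
    by (rule nn_integral_add) measurable
  also have "\<dots> \<le> ennreal (c * t powr (\<kappa> - 1)) + ennreal (d * t powr (\<kappa> - 1))"
    using kernD(1)[OF h, of t] kernD(1)[OF g, of t] t by (intro add_mono) auto
  also have "\<dots> = ennreal ((c + d) * t powr (\<kappa> - 1))" using c by (simp add: distrib_right)
  finally show "(\<integral>\<^sup>+v. h t v + g t v \<partial>lborel) \<le> ennreal ((c + d) * t powr (\<kappa> - 1))" .
qed

lemma kernel_pair_add:
  assumes f: "kernel_pair R h f f'" and k: "kernel_pair R g k k'"
  shows "kernel_pair R (\<lambda>t v. h t v + g t v) (\<lambda>t x y. f t x y + k t x y) (\<lambda>t x y. f' t x y + k' t x y)"
proof -
  have fh: "dominated h f" "dominated h f'" and kg: "dominated g k" "dominated g k'"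
    and m: "measurable3 f" "measurable3 f'" "measurable3 k" "measurable3 k'"
    and cf: "seqcont R f" "seqcont R f'" and ck: "seqcont R k" "seqcont R k'"
    using f k by (auto simp: kernel_pair_def)
  have dom: "dominated (\<lambda>t v. h t v + g t v) (\<lambda>t x y. a t x y + b t x y)" if "dominated h a" "dominated g b" for a b
    unfolding dominated_def
  proof (intro allI impI, elim conjE)
    fix t t' x y assume t: "0 < t" "t \<le> T" "t / 2 \<le> t'" "t' \<le> 2 * t"
    have "ennreal \<bar>a t' x y + b t' x y\<bar> \<le> ennreal (\<bar>a t' x y\<bar> + \<bar>b t' x y\<bar>)" by (intro ennreal_leI) simp
    also have "\<dots> = ennreal \<bar>a t' x y\<bar> + ennreal \<bar>b t' x y\<bar>" by simp
    also have "\<dots> \<le> h t (y - x) + g t (y - x)"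
      using dominatedD[OF that(1) t] dominatedD[OF that(2) t] by (intro add_mono)
    finally show "ennreal \<bar>a t' x y + b t' x y\<bar> \<le> h t (y - x) + g t (y - x)" .
  qed
  have meas: "measurable3 (\<lambda>t x y. a t x y + b t x y)" if "measurable3 a" "measurable3 b" for a b
    using that unfolding measurable3_def case_prod_unfold by auto
  show ?thesis unfolding kernel_pair_def
  proof (intro conjI allI impI dom meas seqcont_add fh kg m cf ck)
    fix t x y assume "0 < t \<and> t < T"
    then have "((\<lambda>s. f s x y + k s x y) has_real_derivative f' t x y / t + k' t x y / t) (at t)"
      using f k by (intro DERIV_add) (auto simp: kernel_pair_def)
    then show "((\<lambda>s. f s x y + k s x y) has_real_derivative (f' t x y + k' t x y) / t) (at t)"
      by (simp add: add_divide_distrib)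
  qed
qed

text \<open>
  The majorants are summed as well; the supremum bound \<open>kern_sup\<close> supplies the summable constants for
  Tannery's theorem and for termwise differentiation.
\<close>

lemma kernel_pair_suminf:
  assumes H: "\<And>k. kern (real (Suc k) * \<delta>) (c k) (H k)" and \<delta>: "0 < \<delta>"
    and fp: "\<And>k. kernel_pair R (H k) (f k) (f' k)"
    and c: "\<And>r. 0 \<le> r \<Longrightarrow> summable (\<lambda>k. c k * r ^ k)"
  shows "kern \<delta> (\<Sum>k. c k * (T powr \<delta>) ^ k) (\<lambda>t v. \<Sum>k. H k t v)"
    "kernel_pair R (\<lambda>t v. \<Sum>k. H k t v) (\<lambda>t x y. \<Sum>k. f k t x y) (\<lambda>t x y. \<Sum>k. f' k t x y)"
proof -
  have c0: "0 \<le> c k" for k using H[of k] by (simp add: kern_def)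
  have pw: "t powr (real (Suc k) * \<delta> - 1) = (t powr \<delta>) ^ k * t powr (\<delta> - 1)" if "0 < t" for t k
  proof -
    have "t powr (real (Suc k) * \<delta> - 1) = t powr (\<delta> * real k + (\<delta> - 1))" by (simp add: algebra_simps)
    also have "\<dots> = (t powr \<delta>) powr real k * t powr (\<delta> - 1)" by (simp only: powr_add powr_powr)
    also have "(t powr \<delta>) powr real k = (t powr \<delta>) ^ k" using that by (intro powr_realpow) auto
    finally show ?thesis .
  qed
  note Hm = kern_measurable[OF H]
  have [measurable]: "(\<lambda>x. H k (a x) (b x)) \<in> borel_measurable M"
    if "a \<in> borel_measurable M" "b \<in> borel_measurable M" for k a b and M :: "'z measure"
    by (rule Hm[OF that])
  show "kern \<delta> (\<Sum>k. c k * (T powr \<delta>) ^ k) (\<lambda>t v. \<Sum>k. H k t v)"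
    unfolding kern_def
  proof (intro conjI allI impI)
    show "0 \<le> (\<Sum>k. c k * (T powr \<delta>) ^ k)" using c[of "T powr \<delta>"] c0 by (intro suminf_nonneg) auto
    have "(\<lambda>p. \<Sum>k. H k (fst p) (snd p)) \<in> borel_measurable (borel \<Otimes>\<^sub>M borel)" by measurable
    then show "(\<lambda>(t, v). \<Sum>k. H k t v) \<in> borel_measurable borel" by (simp add: borel_prod case_prod_unfold)
    fix t assume "0 < t \<and> t \<le> T"
    then have t: "0 < t" "t \<le> T" by auto
    show "harnack (\<rho> t) 1 (\<lambda>v. \<Sum>k. H k t v)"
      unfolding harnack_def
    proof (intro allI)
      fix v w
      have "(\<Sum>k. H k t (v + w)) \<le> (\<Sum>k. ennreal (1 * (1 + \<rho> t * \<bar>w\<bar>)\<^sup>2) * H k t v)"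
        using harnackD[OF kernD(2)[OF H t]] by (intro suminf_le summableI) auto
      then show "(\<Sum>k. H k t (v + w)) \<le> ennreal (1 * (1 + \<rho> t * \<bar>w\<bar>)\<^sup>2) * (\<Sum>k. H k t v)" by simp
    qed
    have "(\<integral>\<^sup>+v. (\<Sum>k. H k t v) \<partial>lborel) = (\<Sum>k. \<integral>\<^sup>+v. H k t v \<partial>lborel)"
      by (rule nn_integral_suminf) measurable
    also have "\<dots> \<le> (\<Sum>k. ennreal (c k * (T powr \<delta>) ^ k) * ennreal (t powr (\<delta> - 1)))"
    proof (intro suminf_le summableI)
      fix k
      have "(\<integral>\<^sup>+v. H k t v \<partial>lborel) \<le> ennreal (c k * ((t powr \<delta>) ^ k * t powr (\<delta> - 1)))"
        using kernD(1)[OF H t, of k] by (simp only: pw[OF t(1)])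
      also have "\<dots> \<le> ennreal (c k * (T powr \<delta>) ^ k * t powr (\<delta> - 1))"
        unfolding mult.assoc using c0 t \<delta>
        by (intro ennreal_leI mult_left_mono mult_right_mono power_mono powr_mono2) auto
      also have "\<dots> = ennreal (c k * (T powr \<delta>) ^ k) * ennreal (t powr (\<delta> - 1))"
        using c0 by (intro ennreal_mult) auto
      finally show "(\<integral>\<^sup>+v. H k t v \<partial>lborel) \<le> ennreal (c k * (T powr \<delta>) ^ k) * ennreal (t powr (\<delta> - 1))" .
    qed
    also have "\<dots> = ennreal (\<Sum>k. c k * (T powr \<delta>) ^ k) * ennreal (t powr (\<delta> - 1))"
      using c[of "T powr \<delta>"] c0 by (simp add: suminf_ennreal2)
    also have "\<dots> = ennreal ((\<Sum>k. c k * (T powr \<delta>) ^ k) * t powr (\<delta> - 1))"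
      using c[of "T powr \<delta>"] c0 by (intro ennreal_mult[symmetric] suminf_nonneg) auto
    finally show "(\<integral>\<^sup>+v. (\<Sum>k. H k t v) \<partial>lborel) \<le> ennreal ((\<Sum>k. c k * (T powr \<delta>) ^ k) * t powr (\<delta> - 1))" .
  qed
  define M where "M t k = 4 * \<rho> t * (c k * t powr (real (Suc k) * \<delta> - 1))" for t k
  have M: "summable (M t)" if "0 < t" for t
  proof -
    have "summable (\<lambda>k. (4 * \<rho> t * t powr (\<delta> - 1)) * (c k * (t powr \<delta>) ^ k))"
      by (intro summable_mult c) auto
    moreover have "M t = (\<lambda>k. (4 * \<rho> t * t powr (\<delta> - 1)) * (c k * (t powr \<delta>) ^ k))"
      unfolding M_def[abs_def] pw[OF that] by (simp only: mult_ac)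
    ultimately show ?thesis by simp
  qed
  have dom: "dominated (H k) (f k)" "dominated (H k) (f' k)" for k using fp by (auto simp: kernel_pair_def)
  have bd: "\<bar>F t' x y\<bar> \<le> M t k" if "dominated (H k) F" "0 < t" "t \<le> T" "t / 2 \<le> t'" "t' \<le> 2 * t" for F k t t' x y
  proof -
    have "0 \<le> M t k" using \<rho>_pos[OF that(2)] c0 by (simp add: M_def)
    moreover have "ennreal \<bar>F t' x y\<bar> \<le> ennreal (M t k)"
      unfolding M_def by (rule order_trans[OF dominatedD[OF that] kern_sup[OF H that(2,3)]])
    ultimately show ?thesis by (simp add: ennreal_le_iff)
  qed
  have domS: "dominated (\<lambda>t v. \<Sum>k. H k t v) (\<lambda>t x y. \<Sum>k. F k t x y)" if "\<And>k. dominated (H k) (F k)" for F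
    unfolding dominated_def
  proof (intro allI impI, elim conjE)
    fix t t' x y assume t: "0 < t" "t \<le> T" "t / 2 \<le> t'" "t' \<le> 2 * t"
    have s: "summable (\<lambda>k. \<bar>F k t' x y\<bar>)"
      by (rule summable_comparison_test'[OF M[OF t(1)], of 0]) (use bd[OF that t] in auto)
    have "ennreal \<bar>\<Sum>k. F k t' x y\<bar> \<le> ennreal (\<Sum>k. \<bar>F k t' x y\<bar>)"
      by (intro ennreal_leI summable_rabs s)
    also have "\<dots> = (\<Sum>k. ennreal \<bar>F k t' x y\<bar>)" using s by (simp add: suminf_ennreal2)
    also have "\<dots> \<le> (\<Sum>k. H k t (y - x))" using dominatedD[OF that t] by (intro suminf_le summableI) auto
    finally show "ennreal \<bar>\<Sum>k. F k t' x y\<bar> \<le> (\<Sum>k. H k t (y - x))" .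
  qed
  have measS: "measurable3 (\<lambda>t x y. \<Sum>k. F k t x y)" if "\<And>k. measurable3 (F k)" for F
    using that unfolding measurable3_def case_prod_unfold by (intro borel_measurable_suminf)
  have contS: "seqcont R (\<lambda>t x y. \<Sum>k. F k t x y)" if "\<And>k. seqcont R (F k)" "\<And>k. dominated (H k) (F k)" for F
    unfolding seqcont_def
  proof (intro allI impI, elim conjE)
    fix t x y :: real and tn xn yn :: "nat \<Rightarrow> real"
    assume t: "0 < t" "t < T" and lim: "tn \<longlonglongrightarrow> t" "xn \<longlonglongrightarrow> x" "yn \<longlonglongrightarrow> y"
      and near: "\<forall>n. t / 2 \<le> tn n \<and> tn n \<le> 2 * t \<and> \<bar>xn n - x\<bar> \<le> 1 \<and> \<bar>yn n - y\<bar> \<le> 1 \<and> (R \<or> xn n = x)"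
    have "eventually (\<lambda>n. summable (\<lambda>k. norm (F k (tn n) (xn n) (yn n)))) sequentially \<and>
           summable (\<lambda>k. norm (F k t x y)) \<and>
           ((\<lambda>n. suminf (\<lambda>k. F k (tn n) (xn n) (yn n))) \<longlongrightarrow> suminf (\<lambda>k. F k t x y)) sequentially"
    proof (rule tannerys_theorem[where M="M t"])
      show "(\<lambda>n. F k (tn n) (xn n) (yn n)) \<longlonglongrightarrow> F k t x y" for k
        by (rule seqcontD[OF that(1) t lim]) (use near in blast)+
      show "\<forall>\<^sub>F (k, n) in sequentially \<times>\<^sub>F sequentially. norm (F k (tn n) (xn n) (yn n)) \<le> M t k"
        using bd[OF that(2) t(1)] near t by (intro always_eventually) auto
    qed (use M t in auto)
    then show "(\<lambda>n. \<Sum>k. F k (tn n) (xn n) (yn n)) \<longlonglongrightarrow> (\<Sum>k. F k t x y)" by simp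
  qed
  show "kernel_pair R (\<lambda>t v. \<Sum>k. H k t v) (\<lambda>t x y. \<Sum>k. f k t x y) (\<lambda>t x y. \<Sum>k. f' k t x y)"
    unfolding kernel_pair_def
  proof (intro conjI allI impI domS measS contS)
    fix t x y assume "0 < t \<and> t < T"
    then have t: "0 < t" "t \<le> T" "t < T" by auto
    let ?S = "{t/2<..<min (2 * t) T}"
    have "((\<lambda>s. \<Sum>k. f k s x y) has_real_derivative (\<Sum>k. f' k t x y / t)) (at t)"
    proof (rule has_field_derivative_series'(2)[where f="\<lambda>k s. f k s x y" and f'="\<lambda>k s. f' k s x y / s" and S="?S" and x0=t])
      show "((\<lambda>s. f k s x y) has_field_derivative f' k s x y / s) (at s within ?S)" if "s \<in> ?S" for k s
        by (rule has_field_derivative_at_within, rule kernel_pair_deriv[OF fp]) (use that t in auto)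
      show "uniformly_convergent_on ?S (\<lambda>n s. \<Sum>i<n. f' i s x y / s)"
      proof (rule Weierstrass_m_test'[where M="\<lambda>k. M t k * (2 / t)"])
        fix k s assume s: "s \<in> ?S"
        have "\<bar>f' k s x y\<bar> * (1 / s) \<le> M t k * (2 / t)"
        proof (rule mult_mono)
          show "\<bar>f' k s x y\<bar> \<le> M t k" using bd[OF dom(2) t(1,2)] s by auto
          then show "0 \<le> M t k" using abs_ge_zero order_trans by blast
          show "1 / s \<le> 2 / t" "0 \<le> 1 / s" using s t by (auto simp: field_simps)
        qed
        moreover have "0 < s" using s t by auto
        ultimately show "norm (f' k s x y / s) \<le> M t k * (2 / t)" by simp
      next
        show "summable (\<lambda>k. M t k * (2 / t))" using M[OF t(1)] by (rule summable_mult2)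
      qed
      show "summable (\<lambda>k. f k t x y)"
        by (rule summable_comparison_test'[OF M[OF t(1)], of 0]) (use bd[OF dom(1) t(1,2)] t in auto)
    qed (use t in \<open>auto simp: interior_open\<close>)
    moreover have "summable (\<lambda>k. f' k t x y)"
      by (rule summable_comparison_test'[OF M[OF t(1)], of 0]) (use bd[OF dom(2) t(1,2)] t in auto)
    ultimately show "((\<lambda>s. \<Sum>k. f k s x y) has_real_derivative (\<Sum>k. f' k t x y) / t) (at t)"
      by (simp add: suminf_divide)
  qed (use fp dom in \<open>auto simp: kernel_pair_def\<close>)
qed

text \<open>
  The \<open>k\<close>-th convolution power of \<open>\<Phi>\<close> has a majorant with exponent \<open>(k + 1) \<delta>\<close> and a constant that is
  multiplied by a fixed multiple of \<open>B(\<delta>, (k + 1) \<delta>)\<close> at each step.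
\<close>

theorem kernel_pair_parametrix:
  assumes g: "kern \<delta> c g" and \<delta>: "0 < \<delta>" and \<Phi>: "kernel_pair False g \<Phi> \<Phi>'"
    and G: "kern 1 c0 G" and f0: "kernel_pair True G f0 f0'"
  obtains C H p' where "kern 1 C H"
    "kernel_pair True H (\<lambda>t x y. f0 t x y + spacetime_conv f0 (\<lambda>t x y. \<Sum>k. spacetime_conv_pow \<Phi> k t x y) t x y) p'"
proof -
  define cc where "cc = rec_nat c (\<lambda>k a. 384 * A\<^sup>2 * (a * c * Beta \<delta> (real (Suc k) * \<delta>)))"
  have cc: "cc 0 = c" "cc (Suc k) = 384 * A\<^sup>2 * (cc k * c * Beta \<delta> (real (Suc k) * \<delta>))" for k
    by (simp_all add: cc_def)
  have c: "0 \<le> c" using g by (simp add: kern_def)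
  have "\<exists>H F. kern (real (Suc k) * \<delta>) (cc k) H \<and> kernel_pair False H (spacetime_conv_pow \<Phi> k) F" for k
  proof (induction k)
    case 0
    show ?case using g \<Phi> by (auto simp: cc(1))
  next
    case (Suc k)
    then obtain H F where IH: "kern (real (Suc k) * \<delta>) (cc k) H" "kernel_pair False H (spacetime_conv_pow \<Phi> k) F" by blast
    have pos: "0 < real (Suc k) * \<delta>" using \<delta> by simp
    obtain H' where "kern (real (Suc k) * \<delta> + \<delta>) (384 * A\<^sup>2 * (cc k * c * Beta \<delta> (real (Suc k) * \<delta>))) H'"
      "kernel_pair False H' (spacetime_conv (spacetime_conv_pow \<Phi> k) \<Phi>)
      (\<lambda>t x y. spacetime_conv (spacetime_conv_pow \<Phi> k) \<Phi> t x y + spacetime_conv F \<Phi> t x y + spacetime_conv (spacetime_conv_pow \<Phi> k) \<Phi>' t x y)"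
      by (rule kernel_pair_conv[OF IH(1) g pos \<delta> IH(2) \<Phi>])
    moreover have "real (Suc k) * \<delta> + \<delta> = real (Suc (Suc k)) * \<delta>" by (simp add: algebra_simps)
    ultimately show ?case unfolding cc(2) spacetime_conv_pow.simps by auto
  qed
  then obtain H F where HF: "\<And>k. kern (real (Suc k) * \<delta>) (cc k) (H k)"
    "\<And>k. kernel_pair False (H k) (spacetime_conv_pow \<Phi> k) (F k)" by metis
  have cc0: "0 \<le> cc k" for k using HF(1)[of k] by (simp add: kern_def)
  have sum: "summable (\<lambda>k. cc k * r ^ k)" if r: "0 \<le> r" for r
  proof -
    have "(\<lambda>k. 384 * A\<^sup>2 * c * r * Beta \<delta> (real (Suc k) * \<delta>)) \<longlonglongrightarrow> 384 * A\<^sup>2 * c * r * 0"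
      by (intro tendsto_mult_left Beta_tendsto_0 \<delta>)
    then have "\<forall>\<^sub>F k in sequentially. 384 * A\<^sup>2 * c * r * Beta \<delta> (real (Suc k) * \<delta>) < 1 / 2"
      by (rule order_tendstoD) simp
    then obtain N where N: "\<And>k. N \<le> k \<Longrightarrow> 384 * A\<^sup>2 * c * r * Beta \<delta> (real (Suc k) * \<delta>) < 1 / 2"
      by (auto simp: eventually_sequentially)
    show ?thesis
    proof (rule summable_ratio_test[where c="1/2" and N=N])
      fix k assume k: "N \<le> k"
      have "cc (Suc k) * r ^ Suc k = (384 * A\<^sup>2 * c * r * Beta \<delta> (real (Suc k) * \<delta>)) * (cc k * r ^ k)"
        unfolding cc(2) by (simp add: mult_ac)
      also have "\<dots> \<le> 1 / 2 * (cc k * r ^ k)"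
        using N[OF k] cc0 r by (intro mult_right_mono) auto
      finally show "norm (cc (Suc k) * r ^ Suc k) \<le> 1 / 2 * norm (cc k * r ^ k)"
        using cc0 r by simp
    qed simp
  qed
  let ?\<Psi> = "\<lambda>t x y. \<Sum>k. spacetime_conv_pow \<Phi> k t x y"
  note S = kernel_pair_suminf[OF HF(1) \<delta> HF(2) sum]
  obtain E p1 where E: "kern (1 + \<delta>) (384 * A\<^sup>2 * (c0 * (\<Sum>k. cc k * (T powr \<delta>) ^ k) * Beta \<delta> 1)) E"
    "kernel_pair True E (spacetime_conv f0 ?\<Psi>) p1"
    by (rule kernel_pair_conv[OF G S(1) _ \<delta> f0 S(2)]) auto
  show thesis
    by (rule that[OF kern_add[OF G kern_weaken[OF E(1)]] kernel_pair_add[OF f0 E(2)]]) (use \<delta> in simp)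
qed

theorem kernel_pair_continuous:
  assumes fp: "kernel_pair True h f f'"
  shows "continuous_on ({0<..<T} \<times> UNIV \<times> UNIV) (\<lambda>(t, x, y). f t x y)"
    "continuous_on ({0<..<T} \<times> UNIV \<times> UNIV) (\<lambda>(t, x, y). deriv (\<lambda>s. f s x y) t)"
    "0 < t \<Longrightarrow> t < T \<Longrightarrow> (\<lambda>s. f s x y) field_differentiable at t"
    "0 < t \<Longrightarrow> t < T \<Longrightarrow> deriv (\<lambda>s. f s x y) t = f' t x y / t"
proof -
  have d: "((\<lambda>s. f s x y) has_real_derivative f' t x y / t) (at t)" if "0 < t" "t < T" for t x y
    using fp that by (auto simp: kernel_pair_def)
  show "(\<lambda>s. f s x y) field_differentiable at t" if "0 < t" "t < T" for t x y
    using d[OF that] by (auto simp: field_differentiable_def)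
  show eq: "deriv (\<lambda>s. f s x y) t = f' t x y / t" if "0 < t" "t < T" for t x y
    using d[OF that] by (rule DERIV_imp_deriv)
  have cont: "continuous_on ({0<..<T} \<times> UNIV \<times> UNIV) (\<lambda>(t, x, y). F t x y)" if F: "seqcont True F" for F
    unfolding continuous_on_sequentially
  proof (intro allI ballI impI, elim conjE)
    fix u :: "nat \<Rightarrow> real \<times> real \<times> real" and a
    assume a: "a \<in> {0<..<T} \<times> UNIV \<times> UNIV" and u: "\<forall>n. u n \<in> {0<..<T} \<times> UNIV \<times> UNIV" and lim: "u \<longlonglongrightarrow> a"
    obtain t x y where txy: "a = (t, x, y)" by (cases a) auto
    have t: "0 < t" "t < T" using a txy by auto
    have l: "(\<lambda>n. fst (u n)) \<longlonglongrightarrow> t" "(\<lambda>n. fst (snd (u n))) \<longlonglongrightarrow> x" "(\<lambda>n. snd (snd (u n))) \<longlonglongrightarrow> y"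
      using tendsto_fst[OF lim] tendsto_fst[OF tendsto_snd[OF lim]] tendsto_snd[OF tendsto_snd[OF lim]] txy by auto
    have "\<forall>\<^sub>F n in sequentially. t / 2 < fst (u n) \<and> fst (u n) < 2 * t \<and> dist (fst (snd (u n))) x < 1 \<and> dist (snd (snd (u n))) y < 1"
      using t by (intro eventually_conj order_tendstoD[OF l(1)] tendstoD[OF l(2)] tendstoD[OF l(3)]) auto
    then obtain N where N: "\<And>n. N \<le> n \<Longrightarrow> t / 2 < fst (u n) \<and> fst (u n) < 2 * t \<and> dist (fst (snd (u n))) x < 1 \<and> dist (snd (snd (u n))) y < 1"
      unfolding eventually_sequentially by blast
    have N': "t / 2 < fst (u (n + N))" "fst (u (n + N)) < 2 * t" "\<bar>fst (snd (u (n + N))) - x\<bar> < 1" "\<bar>snd (snd (u (n + N))) - y\<bar> < 1" for n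
      using N[of "n + N"] by (auto simp: dist_real_def)
    have "(\<lambda>n. F (fst (u (n + N))) (fst (snd (u (n + N)))) (snd (snd (u (n + N))))) \<longlonglongrightarrow> F t x y"
      by (rule seqcontD[OF F t]) (use l N' in \<open>auto intro: LIMSEQ_ignore_initial_segment less_imp_le\<close>)
    then have "(\<lambda>n. F (fst (u n)) (fst (snd (u n))) (snd (snd (u n)))) \<longlonglongrightarrow> F t x y"
      by (rule LIMSEQ_offset)
    then show "((\<lambda>(t, x, y). F t x y) \<circ> u) \<longlonglongrightarrow> (case a of (t, x, y) \<Rightarrow> F t x y)"
      by (simp add: comp_def txy case_prod_unfold)
  qed
  show "continuous_on ({0<..<T} \<times> UNIV \<times> UNIV) (\<lambda>(t, x, y). f t x y)"
    using fp by (intro cont) (simp add: kernel_pair_def)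
  have c': "continuous_on ({0<..<T} \<times> UNIV \<times> UNIV) (\<lambda>(t, x, y). f' t x y)"
    using fp by (intro cont) (simp add: kernel_pair_def)
  have "continuous_on ({0<..<T} \<times> (UNIV :: (real \<times> real) set)) (\<lambda>p. (case p of (t, x, y) \<Rightarrow> f' t x y) / fst p)"
    by (intro continuous_intros c'[simplified]) auto
  then show "continuous_on ({0<..<T} \<times> UNIV \<times> UNIV) (\<lambda>(t, x, y). deriv (\<lambda>s. f s x y) t)"
    unfolding UNIV_Times_UNIV
  proof (rule continuous_on_eq)
    fix p assume "p \<in> {0<..<T} \<times> (UNIV :: (real \<times> real) set)"
    then show "(case p of (t, x, y) \<Rightarrow> f' t x y) / fst p = (case p of (t, x, y) \<Rightarrow> deriv (\<lambda>s. f s x y) t)"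
      by (cases p) (simp add: eq split_beta)
  qed
qed

theorem kernel_pair_conv_measure_bound:
  assumes k: "kern 1 c h" and fp: "kernel_pair R h f f'" and T: "1 \<le> T"
  obtains d Q where "0 < d" "\<And>t. prob_space (Q t)" "\<And>t. sets (Q t) = sets borel"
    "\<And>t x y. 0 < t \<Longrightarrow> t \<le> 1 \<Longrightarrow> \<bar>f t x y\<bar> \<le> \<rho> t * conv_measure (\<lambda>z. f_up d 1 (\<rho> t * z)) (Q t) (y - x)"
    "\<And>t x y. 0 < t \<Longrightarrow> t \<le> 1 \<Longrightarrow> \<bar>f' t x y\<bar> \<le> \<rho> t * conv_measure (\<lambda>z. f_up d 1 (\<rho> t * z)) (Q t) (y - x)"
proof -
  have c: "0 \<le> c" using k by (simp add: kern_def)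
  define d where "d = 8 * (c + 1)"
  have "\<exists>Q. prob_space Q \<and> sets Q = sets (borel :: real measure) \<and> (0 < t \<and> t \<le> 1 \<longrightarrow>
      (\<forall>v. h t v \<le> ennreal (\<rho> t * conv_measure (\<lambda>z. f_up d 1 (\<rho> t * z)) Q v)))" for t
  proof (cases "0 < t \<and> t \<le> 1")
    case True
    then have t: "0 < t" "t \<le> T" using T by auto
    have "c * t powr (1 - 1) \<le> c + 1" using t by simp
    then have N: "(\<integral>\<^sup>+v. h t v \<partial>lborel) \<le> ennreal (c + 1)"
      by (rule order_trans[OF kernD(1)[OF k t] ennreal_leI])
    have "(\<lambda>v. h t v) \<in> borel_measurable borel"
      by (rule kern_measurable[OF k]; rule measurable_const measurable_ident_sets; simp)
    then have mh: "h t \<in> borel_measurable borel" .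
    have c1: "0 < c + 1" using c by simp
    obtain Q where "prob_space Q" "sets Q = sets borel"
      "\<And>v. h t v \<le> ennreal (\<rho> t * conv_measure (\<lambda>z. f_up (8 * (c + 1)) 1 (\<rho> t * z)) Q v)"
      by (rule harnack_le_conv_measure[OF kernD(2)[OF k t] \<rho>_pos[OF t(1)] mh c1 N]) (rule that)
    then show ?thesis unfolding d_def by (intro exI[of _ Q]) simp
  next
    case False
    have "prob_space (return borel (0::real))" by (rule prob_space_return) simp
    with False show ?thesis by (intro exI[of _ "return borel 0"]) auto
  qed
  then obtain Q where Q: "\<And>t. prob_space (Q t)" "\<And>t. sets (Q t) = sets (borel :: real measure)"
    "\<And>t v. 0 < t \<Longrightarrow> t \<le> 1 \<Longrightarrow> h t v \<le> ennreal (\<rho> t * conv_measure (\<lambda>z. f_up d 1 (\<rho> t * z)) (Q t) v)"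
    by metis
  have le: "\<bar>F t x y\<bar> \<le> \<rho> t * conv_measure (\<lambda>z. f_up d 1 (\<rho> t * z)) (Q t) (y - x)"
    if "dominated h F" "0 < t" "t \<le> 1" for F t x y
  proof -
    have "0 \<le> \<rho> t * conv_measure (\<lambda>z. f_up d 1 (\<rho> t * z)) (Q t) (y - x)"
      unfolding conv_measure_def using \<rho>_pos[OF that(2)] f_up_bounds[of d 1] c
      by (intro mult_nonneg_nonneg integral_nonneg_AE) (auto simp: d_def)
    moreover have "ennreal \<bar>F t x y\<bar> \<le> ennreal (\<rho> t * conv_measure (\<lambda>z. f_up d 1 (\<rho> t * z)) (Q t) (y - x))"
      by (rule order_trans[OF dominatedD[OF that(1,2)] Q(3)[OF that(2,3)]]) (use that T in auto)
    ultimately show ?thesis by (simp add: ennreal_le_iff)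
  qed
  show thesis
  proof (rule that[of d Q])
    show "0 < d" using c by (simp add: d_def)
    have "dominated h f" "dominated h f'" using fp by (simp_all add: kernel_pair_def)
    note le[OF this(1)] le[OF this(2)]
    then show "0 < t \<Longrightarrow> t \<le> 1 \<Longrightarrow> \<bar>f t x y\<bar> \<le> \<rho> t * conv_measure (\<lambda>z. f_up d 1 (\<rho> t * z)) (Q t) (y - x)"
      "0 < t \<Longrightarrow> t \<le> 1 \<Longrightarrow> \<bar>f' t x y\<bar> \<le> \<rho> t * conv_measure (\<lambda>z. f_up d 1 (\<rho> t * z)) (Q t) (y - x)" for t x y
      by blast+
  qed (use Q in auto)
qed

end

section \<open>The scale function of a Levy measure\<close>

locale levy =
  fixes \<mu> :: "real measure"
  assumes levy: "levy_measure \<mu>"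
begin

lemma sets_mu[measurable_cong, simp]: "sets \<mu> = sets borel"
  using levy by (simp add: levy_measure_def)

lemma space_mu[simp]: "space \<mu> = UNIV"
  using sets_eq_imp_space_eq[OF sets_mu] by simp

lemma integrable_min: "integrable \<mu> (\<lambda>u. min 1 (u\<^sup>2))"
  by (rule integrableI_bounded) (use levy in \<open>auto simp: levy_measure_def\<close>)

lemma integrable_levy:
  assumes [measurable]: "f \<in> borel_measurable borel" and b: "\<And>u. \<bar>f u\<bar> \<le> K * min 1 (u\<^sup>2)"
  shows "integrable \<mu> f"
  by (rule Bochner_Integration.integrable_bound[OF integrable_mult_right[OF integrable_min, of K]])
     (use b in \<open>auto intro!: AE_I2 order_trans[OF _ abs_ge_self]\<close>)

lemma sigma_finite_mu: "sigma_finite_measure \<mu>"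
proof
  let ?B = "\<lambda>n::nat. {u::real. 1 / (real n + 1) \<le> \<bar>u\<bar>}"
  have fin: "emeasure \<mu> (?B n) < \<infinity>" for n
  proof -
    let ?k = "(real n + 1)\<^sup>2"
    have "emeasure \<mu> (?B n) = (\<integral>\<^sup>+u. indicator (?B n) u \<partial>\<mu>)"
      by (rule nn_integral_indicator[symmetric]) simp
    also have "\<dots> \<le> (\<integral>\<^sup>+u. ennreal ?k * ennreal (min 1 (u\<^sup>2)) \<partial>\<mu>)"
    proof (rule nn_integral_mono)
      fix u :: real
      show "indicator (?B n) u \<le> ennreal ?k * ennreal (min 1 (u\<^sup>2))"
      proof (cases "u \<in> ?B n")
        case True
        then have "1 \<le> (real n + 1) * \<bar>u\<bar>" by (simp add: field_simps)
        then have "1\<^sup>2 \<le> ((real n + 1) * \<bar>u\<bar>)\<^sup>2" by (rule power_mono) simp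
        then have "1 \<le> ?k * u\<^sup>2" by (simp add: power_mult_distrib)
        moreover have "1 \<le> ?k * 1" by simp
        ultimately have "1 \<le> ?k * min 1 (u\<^sup>2)" by (simp add: min_def)
        then have "ennreal 1 \<le> ennreal (?k * min 1 (u\<^sup>2))" by (rule ennreal_leI)
        with True show ?thesis by (simp add: ennreal_mult)
      qed simp
    qed
    also have "\<dots> = ennreal ?k * (\<integral>\<^sup>+u. ennreal (min 1 (u\<^sup>2)) \<partial>\<mu>)"
      by (rule nn_integral_cmult) measurable
    also have "\<dots> < \<infinity>" using levy by (simp add: levy_measure_def ennreal_mult_less_top)
    finally show ?thesis .
  qed
  let ?A = "insert {0} (range ?B)"
  have "\<Union>?A = UNIV"
  proof (rule UNIV_eq_I[symmetric])
    fix u :: real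
    show "u \<in> \<Union>?A"
    proof (cases "u = 0")
      case False
      then obtain n :: nat where "1 / \<bar>u\<bar> < real n" using reals_Archimedean2 by blast
      then have "1 \<le> \<bar>u\<bar> * (real n + 1)" using False by (simp add: field_simps)
      then have "1 / (real n + 1) \<le> \<bar>u\<bar>" by (simp add: divide_le_eq)
      then show ?thesis by auto
    qed simp
  qed
  moreover have "emeasure \<mu> {0} = 0" using levy by (simp add: levy_measure_def)
  ultimately show "\<exists>A. countable A \<and> A \<subseteq> sets \<mu> \<and> \<Union> A = space \<mu> \<and> (\<forall>a\<in>A. emeasure \<mu> a \<noteq> \<infinity>)"
    using fin by (intro exI[of _ ?A]) (auto simp: less_top)
qed

sublocale sigma_finite_measure \<mu> by (rule sigma_finite_mu)

lemma min_scaled_le: "min ((\<xi> * u)\<^sup>2) 1 \<le> max 1 (\<xi>\<^sup>2) * min 1 (u\<^sup>2)" for \<xi> u :: real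
proof (cases "u\<^sup>2 \<le> 1")
  case True
  have "(\<xi> * u)\<^sup>2 \<le> max 1 (\<xi>\<^sup>2) * u\<^sup>2" by (simp add: power_mult_distrib mult_right_mono)
  moreover have "min 1 (u\<^sup>2) = u\<^sup>2" using True by simp
  ultimately show ?thesis by simp
next
  case False
  then have "min 1 (u\<^sup>2) = 1" by simp
  then show ?thesis by simp
qed

lemma qU_integrable: "integrable \<mu> (\<lambda>u. min ((\<xi> * u)\<^sup>2) 1)"
  by (rule integrable_levy[where K="max 1 (\<xi>\<^sup>2)"]) (use min_scaled_le in auto)

lemma qL_integrable: "integrable \<mu> (\<lambda>u. indicator {u. \<bar>u * \<xi>\<bar> \<le> 1} u * (\<xi> * u)\<^sup>2)"
proof (rule integrable_levy[where K="max 1 (\<xi>\<^sup>2)"])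
  fix u
  have "\<bar>indicator {u. \<bar>u * \<xi>\<bar> \<le> 1} u * (\<xi> * u)\<^sup>2\<bar> \<le> min ((\<xi> * u)\<^sup>2) 1"
    by (auto simp: indicator_def mult.commute abs_square_le_1)
  also note min_scaled_le
  finally show "\<bar>indicator {u. \<bar>u * \<xi>\<bar> \<le> 1} u * (\<xi> * u)\<^sup>2\<bar> \<le> max 1 (\<xi>\<^sup>2) * min 1 (u\<^sup>2)" .
qed measurable

lemma qL_eq: "levy_qL \<mu> \<xi> = (\<integral>u. indicator {u. \<bar>u * \<xi>\<bar> \<le> 1} u * (\<xi> * u)\<^sup>2 \<partial>\<mu>)"
  by (simp add: levy_qL_def set_lebesgue_integral_def)

lemma qL_nonneg: "0 \<le> levy_qL \<mu> \<xi>"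
  unfolding qL_eq by (intro integral_nonneg_AE) auto

lemma qU_nonneg: "0 \<le> levy_qU \<mu> \<xi>"
  unfolding levy_qU_def by (intro integral_nonneg_AE) auto

lemma qL_le_qU: "levy_qL \<mu> \<xi> \<le> levy_qU \<mu> \<xi>"
  unfolding qL_eq levy_qU_def
  by (intro integral_mono qL_integrable qU_integrable)
     (auto simp: indicator_def mult.commute abs_square_le_1)

lemma qU_mono: "0 \<le> \<xi> \<Longrightarrow> \<xi> \<le> \<xi>' \<Longrightarrow> levy_qU \<mu> \<xi> \<le> levy_qU \<mu> \<xi>'"
  unfolding levy_qU_def
  by (intro integral_mono qU_integrable min.mono) (auto simp: power_mult_distrib intro!: mult_right_mono power_mono)

lemma qU_scale: "1 \<le> l \<Longrightarrow> levy_qU \<mu> (l * \<xi>) \<le> l\<^sup>2 * levy_qU \<mu> \<xi>"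
proof -
  assume l: "1 \<le> l"
  have "levy_qU \<mu> (l * \<xi>) \<le> (\<integral>u. l\<^sup>2 * min ((\<xi> * u)\<^sup>2) 1 \<partial>\<mu>)"
    unfolding levy_qU_def
  proof (intro integral_mono qU_integrable integrable_mult_right)
    fix u
    have "1 \<le> l\<^sup>2" using l by simp
    then show "min ((l * \<xi> * u)\<^sup>2) 1 \<le> l\<^sup>2 * min ((\<xi> * u)\<^sup>2) 1"
      by (auto simp: min_def power_mult_distrib mult.assoc)
  qed
  then show ?thesis by (simp add: levy_qU_def)
qed

lemma qU_continuous: "continuous_on S (levy_qU \<mu>)"
  unfolding continuous_on_sequentially
proof (intro allI ballI impI, elim conjE)
  fix X :: "nat \<Rightarrow> real" and a assume "X \<longlonglongrightarrow> a"
  then obtain B where B: "\<And>n. \<bar>X n\<bar> \<le> B" using convergent_imp_bounded[of X] by (auto simp: bounded_iff)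
  show "(levy_qU \<mu> \<circ> X) \<longlonglongrightarrow> levy_qU \<mu> a"
    unfolding comp_def levy_qU_def
  proof (rule integral_dominated_convergence[where w="\<lambda>u. max 1 (B\<^sup>2) * min 1 (u\<^sup>2)"])
    show "AE u in \<mu>. (\<lambda>n. min ((X n * u)\<^sup>2) 1) \<longlonglongrightarrow> min ((a * u)\<^sup>2) 1"
      using \<open>X \<longlonglongrightarrow> a\<close> by (intro AE_I2 tendsto_intros)
    show "AE u in \<mu>. norm (min ((X n * u)\<^sup>2) 1) \<le> max 1 (B\<^sup>2) * min 1 (u\<^sup>2)" for n
    proof (rule AE_I2)
      fix u
      have "(X n)\<^sup>2 \<le> B\<^sup>2" using B[of n] by (simp add: power2_le_iff_abs_le order_trans[OF abs_ge_zero B])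
      then have "max 1 ((X n)\<^sup>2) * min 1 (u\<^sup>2) \<le> max 1 (B\<^sup>2) * min 1 (u\<^sup>2)" by (intro mult_right_mono) auto
      with min_scaled_le[of "X n" u] show "norm (min ((X n * u)\<^sup>2) 1) \<le> max 1 (B\<^sup>2) * min 1 (u\<^sup>2)" by simp
    qed
  qed (use integrable_min in auto)
qed

lemma qL_ratio:
  assumes "0 < \<xi>" "\<xi> \<le> \<xi>'"
  shows "(\<xi> / \<xi>')\<^sup>2 * levy_qL \<mu> \<xi>' \<le> levy_qL \<mu> \<xi>"
proof -
  have "(\<xi> / \<xi>')\<^sup>2 * levy_qL \<mu> \<xi>' = (\<integral>u. (\<xi> / \<xi>')\<^sup>2 * (indicator {u. \<bar>u * \<xi>'\<bar> \<le> 1} u * (\<xi>' * u)\<^sup>2) \<partial>\<mu>)"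
    by (simp add: qL_eq)
  also have "\<dots> \<le> levy_qL \<mu> \<xi>"
    unfolding qL_eq
  proof (intro integral_mono qL_integrable integrable_mult_right)
    fix u
    have "\<bar>u * \<xi>\<bar> \<le> \<bar>u * \<xi>'\<bar>" using assms by (simp add: abs_mult mult_left_mono)
    then show "(\<xi> / \<xi>')\<^sup>2 * (indicator {u. \<bar>u * \<xi>'\<bar> \<le> 1} u * (\<xi>' * u)\<^sup>2) \<le> indicator {u. \<bar>u * \<xi>\<bar> \<le> 1} u * (\<xi> * u)\<^sup>2"
      using assms by (auto simp: indicator_def power_mult_distrib power_divide)
  qed
  finally show ?thesis .
qed

text \<open>
  Passing from \<open>\<xi>\<close> to \<open>2 \<xi>\<close> multiplies the integrand of \<open>q\<^sup>U\<close> by \<open>4\<close> where \<open>\<bar>2 \<xi> u\<bar> \<le> 1\<close>, hence increases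
  \<open>q\<^sup>U\<close> by at least \<open>3 / 4\<close> of \<open>q\<^sup>L(2 \<xi>)\<close>.
\<close>

lemma qU_doubling:
  assumes "0 < \<beta>" "levy_qU \<mu> (2 * \<xi>) \<le> \<beta> * levy_qL \<mu> (2 * \<xi>)"
  shows "levy_qU \<mu> \<xi> \<le> (1 - 3 / (4 * \<beta>)) * levy_qU \<mu> (2 * \<xi>)"
proof -
  have "3 / 4 * levy_qL \<mu> (2 * \<xi>) = (\<integral>u. 3 / 4 * (indicator {u. \<bar>u * (2 * \<xi>)\<bar> \<le> 1} u * (2 * \<xi> * u)\<^sup>2) \<partial>\<mu>)"
    by (simp add: qL_eq)
  also have "\<dots> \<le> (\<integral>u. min ((2 * \<xi> * u)\<^sup>2) 1 - min ((\<xi> * u)\<^sup>2) 1 \<partial>\<mu>)"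
  proof (intro integral_mono Bochner_Integration.integrable_diff qU_integrable integrable_mult_right qL_integrable)
    fix u
    have e: "(2 * \<xi> * u)\<^sup>2 = 4 * (\<xi> * u)\<^sup>2" by (simp add: power_mult_distrib)
    show "3 / 4 * (indicator {u. \<bar>u * (2 * \<xi>)\<bar> \<le> 1} u * (2 * \<xi> * u)\<^sup>2) \<le> min ((2 * \<xi> * u)\<^sup>2) 1 - min ((\<xi> * u)\<^sup>2) 1"
    proof (cases "\<bar>u * (2 * \<xi>)\<bar> \<le> 1")
      case True
      then have "(2 * \<xi> * u)\<^sup>2 \<le> 1" by (simp add: abs_square_le_1 mult_ac)
      then show ?thesis using True e zero_le_power2[of "\<xi> * u"] by (simp add: min_def)
    next
      case False
      then show ?thesis using e zero_le_power2[of "\<xi> * u"] by (auto simp: min_def)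
    qed
  qed
  also have "\<dots> = levy_qU \<mu> (2 * \<xi>) - levy_qU \<mu> \<xi>"
    unfolding levy_qU_def by (intro Bochner_Integration.integral_diff qU_integrable)
  finally have "3 / 4 * levy_qL \<mu> (2 * \<xi>) \<le> levy_qU \<mu> (2 * \<xi>) - levy_qU \<mu> \<xi>" .
  moreover have "levy_qU \<mu> (2 * \<xi>) * (3 / (4 * \<beta>)) \<le> 3 / 4 * levy_qL \<mu> (2 * \<xi>)"
    using assms by (simp add: field_simps)
  ultimately show ?thesis by (simp add: algebra_simps)
qed

end

text \<open>
  The measure \<open>\<mu> = 0\<close> satisfies (A1) as well, but has no \<open>\<rho>\<^sub>t\<close>.
\<close>

locale levy_A1 = levy +
  assumes A1: "\<exists>\<beta>>1. \<forall>\<^sub>F \<xi> in at_infinity. levy_qU \<mu> \<xi> \<le> \<beta> * levy_qL \<mu> \<xi>"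
    and nontrivial: "0 < levy_qU \<mu> 1"
begin

lemma qU_pos: "0 < \<xi> \<Longrightarrow> 0 < levy_qU \<mu> \<xi>"
proof (cases "1 \<le> \<xi>")
  case True
  then show ?thesis using qU_mono[of 1 \<xi>] nontrivial by simp
next
  case False
  assume "0 < \<xi>"
  with False have "levy_qU \<mu> (1 / \<xi> * \<xi>) \<le> (1 / \<xi>)\<^sup>2 * levy_qU \<mu> \<xi>" by (intro qU_scale) (auto simp: field_simps)
  then have "0 < (1 / \<xi>)\<^sup>2 * levy_qU \<mu> \<xi>" using nontrivial \<open>0 < \<xi>\<close> by simp
  then show ?thesis by (simp add: zero_less_mult_iff)
qed

text \<open>
  On a compact part of \<open>{0<..}\<close> the quotient \<open>q\<^sup>U / q\<^sup>L\<close> is bounded in any case, so that (A1) extends to every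
  half-line \<open>{a..}\<close> with \<open>a > 0\<close>.  This makes all estimates available on time intervals \<open>{0<..T}\<close> with
  arbitrary \<open>T\<close>.
\<close>

lemma qU_le_qL_on:
  assumes a: "0 < a"
  obtains \<beta> where "1 < \<beta>" "\<And>\<xi>. a \<le> \<xi> \<Longrightarrow> levy_qU \<mu> \<xi> \<le> \<beta> * levy_qL \<mu> \<xi>"
proof -
  obtain \<beta> b where \<beta>: "1 < \<beta>" and b: "\<And>\<xi>. b \<le> \<bar>\<xi>\<bar> \<Longrightarrow> levy_qU \<mu> \<xi> \<le> \<beta> * levy_qL \<mu> \<xi>"
    using A1 by (auto simp: eventually_at_infinity)
  define x0 where "x0 = max b (max a 1)"
  have x0: "0 < x0" "a \<le> x0" "b \<le> x0" by (auto simp: x0_def)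
  have qx: "levy_qU \<mu> x0 \<le> \<beta> * levy_qL \<mu> x0" using b[of x0] x0 by simp
  then have L: "0 < levy_qL \<mu> x0" using qU_pos[OF x0(1)] \<beta> by (smt (verit) mult_nonneg_nonpos)
  define B where "B = max \<beta> (levy_qU \<mu> x0 * (x0 / a)\<^sup>2 / levy_qL \<mu> x0)"
  show thesis
  proof (rule that[of B])
    show "1 < B" using \<beta> by (simp add: B_def)
    fix \<xi> assume \<xi>: "a \<le> \<xi>"
    show "levy_qU \<mu> \<xi> \<le> B * levy_qL \<mu> \<xi>"
    proof (cases "x0 \<le> \<xi>")
      case True
      then have "levy_qU \<mu> \<xi> \<le> \<beta> * levy_qL \<mu> \<xi>" using b[of \<xi>] x0 by simp
      also have "\<dots> \<le> B * levy_qL \<mu> \<xi>" using qL_nonneg by (intro mult_right_mono) (auto simp: B_def)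
      finally show ?thesis .
    next
      case False
      have "levy_qU \<mu> \<xi> \<le> levy_qU \<mu> x0" using False \<xi> a by (intro qU_mono) auto
      also have "\<dots> = levy_qU \<mu> x0 * (x0 / a)\<^sup>2 / levy_qL \<mu> x0 * ((a / x0)\<^sup>2 * levy_qL \<mu> x0)"
        using L a x0 by (simp add: field_simps)
      also have "\<dots> \<le> B * ((\<xi> / x0)\<^sup>2 * levy_qL \<mu> x0)"
      proof (rule mult_mono)
        show "(a / x0)\<^sup>2 * levy_qL \<mu> x0 \<le> (\<xi> / x0)\<^sup>2 * levy_qL \<mu> x0"
          using a \<xi> x0 L by (intro mult_right_mono power_mono divide_right_mono) auto
      qed (use L \<beta> in \<open>auto simp: B_def\<close>)
      also have "\<dots> \<le> B * levy_qL \<mu> \<xi>"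
        using qL_ratio[of \<xi> x0] False \<xi> a \<beta> by (intro mult_left_mono) (auto simp: B_def)
      finally show ?thesis .
    qed
  qed
qed

text \<open>
  Iterating the doubling inequality, \<open>q\<^sup>U\<close> grows at least like a power.
\<close>

lemma qU_growth:
  assumes a: "0 < a"
  obtains c \<alpha> where "0 < c" "c \<le> 1" "0 < \<alpha>" "\<And>l \<xi>. a \<le> \<xi> \<Longrightarrow> 1 \<le> l \<Longrightarrow> c * l powr \<alpha> * levy_qU \<mu> \<xi> \<le> levy_qU \<mu> (l * \<xi>)"
proof -
  obtain \<beta> where \<beta>: "1 < \<beta>" "\<And>\<xi>. a \<le> \<xi> \<Longrightarrow> levy_qU \<mu> \<xi> \<le> \<beta> * levy_qL \<mu> \<xi>"
    using qU_le_qL_on[OF a] by blast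
  define \<theta> where "\<theta> = 1 - 3 / (4 * \<beta>)"
  have \<theta>: "0 < \<theta>" "\<theta> < 1" using \<beta>(1) by (auto simp: \<theta>_def field_simps)
  have dbl: "levy_qU \<mu> \<xi> \<le> \<theta> * levy_qU \<mu> (2 * \<xi>)" if "a \<le> \<xi>" for \<xi>
    unfolding \<theta>_def using \<beta>(1) a that by (intro qU_doubling \<beta>(2)) auto
  have pow: "levy_qU \<mu> \<xi> \<le> \<theta> ^ n * levy_qU \<mu> (2 ^ n * \<xi>)" if \<xi>: "a \<le> \<xi>" for \<xi> n
  proof (induction n)
    case (Suc n)
    have "1 * a \<le> 2 ^ n * \<xi>" using \<xi> a by (intro mult_mono) auto
    then have "levy_qU \<mu> (2 ^ n * \<xi>) \<le> \<theta> * levy_qU \<mu> (2 * (2 ^ n * \<xi>))" by (intro dbl) simp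
    then have "\<theta> ^ n * levy_qU \<mu> (2 ^ n * \<xi>) \<le> \<theta> ^ n * (\<theta> * levy_qU \<mu> (2 * (2 ^ n * \<xi>)))"
      using \<theta> by (intro mult_left_mono) auto
    with Suc show ?case by (simp add: mult_ac)
  qed simp
  \<comment> \<open>chosen so that \<open>2 powr \<alpha> = 1 / \<theta>\<close>, the gain per doubling\<close>
  define \<alpha> where "\<alpha> = - ln \<theta> / ln 2"
  have \<alpha>: "0 < \<alpha>" unfolding \<alpha>_def using \<theta> by (intro divide_pos_pos) auto
  have two: "2 powr \<alpha> = 1 / \<theta>"
    using \<theta> by (simp add: powr_def \<alpha>_def exp_minus inverse_eq_divide)
  show thesis
  proof (rule that[of \<theta> \<alpha>])
    fix l \<xi> :: real assume \<xi>: "a \<le> \<xi>" and l: "1 \<le> l"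
    define N where "N = (LEAST N. l < 2 ^ N)"
    have N: "l < 2 ^ N"
      unfolding N_def using real_arch_pow[of 2 l] by (auto intro: LeastI_ex)
    obtain n where n: "N = Suc n" using N l by (cases N) auto
    have "\<not> l < 2 ^ n" using not_less_Least[of n "\<lambda>N. l < 2 ^ N"] n by (simp add: N_def)
    then have nl: "2 ^ n \<le> l" by simp
    have "l powr \<alpha> \<le> (2 ^ Suc n) powr \<alpha>" using N n l \<alpha> by (intro powr_mono2) auto
    also have "\<dots> = (2 powr real (Suc n)) powr \<alpha>" by (simp only: powr_realpow[symmetric] zero_less_numeral)
    also have "\<dots> = (2 powr \<alpha>) powr real (Suc n)" by (simp only: powr_powr mult.commute)
    also have "\<dots> = (1 / \<theta>) ^ Suc n" unfolding two using \<theta> by (intro powr_realpow) auto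
    finally have "\<theta> * l powr \<alpha> * levy_qU \<mu> \<xi> \<le> \<theta> * (1 / \<theta>) ^ Suc n * levy_qU \<mu> \<xi>"
      using \<theta> qU_nonneg by (intro mult_right_mono mult_left_mono) auto
    also have "\<dots> \<le> \<theta> * (1 / \<theta>) ^ Suc n * (\<theta> ^ n * levy_qU \<mu> (2 ^ n * \<xi>))"
      using \<theta> by (intro mult_left_mono pow \<xi>) auto
    also have "\<dots> = levy_qU \<mu> (2 ^ n * \<xi>)" using \<theta> by (simp add: power_divide)
    also have "\<dots> \<le> levy_qU \<mu> (l * \<xi>)" using nl \<xi> a l by (intro qU_mono mult_right_mono) auto
    finally show "\<theta> * l powr \<alpha> * levy_qU \<mu> \<xi> \<le> levy_qU \<mu> (l * \<xi>)" .
  qed (use \<theta> \<alpha> in auto)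
qed

lemma qU_0: "levy_qU \<mu> 0 = 0" by (simp add: levy_qU_def)

text \<open>
  Growth makes \<open>q\<^sup>U\<close> exceed \<open>1 / t\<close>, and the set of solutions is compact, so that the largest one exists.
\<close>

lemma rho_root:
  assumes t: "0 < t"
  shows "0 < levy_rho \<mu> t" "levy_qU \<mu> (levy_rho \<mu> t) = 1 / t"
proof -
  obtain c \<alpha> where c': "0 < c" "0 < \<alpha>"
    "\<And>l \<xi>. 1 \<le> \<xi> \<Longrightarrow> 1 \<le> l \<Longrightarrow> c * l powr \<alpha> * levy_qU \<mu> \<xi> \<le> levy_qU \<mu> (l * \<xi>)"
    using qU_growth[of 1] by (metis zero_less_one)
  note c = c'(1,2) c'(3)[of 1, simplified]
  define R where "R = max 1 ((2 / (t * c * levy_qU \<mu> 1)) powr (1 / \<alpha>))"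
  have K: "0 < 2 / (t * c * levy_qU \<mu> 1)" using t c nontrivial by simp
  have R: "1 / t < levy_qU \<mu> R"
  proof -
    have "2 / (t * c * levy_qU \<mu> 1) = ((2 / (t * c * levy_qU \<mu> 1)) powr (1 / \<alpha>)) powr \<alpha>"
      using K c by (simp add: powr_powr)
    also have "\<dots> \<le> R powr \<alpha>" using c by (intro powr_mono2) (auto simp: R_def)
    finally have "2 / t \<le> c * R powr \<alpha> * levy_qU \<mu> 1" using t c nontrivial by (simp add: field_simps)
    also have "\<dots> \<le> levy_qU \<mu> R" by (rule c(3)) (simp add: R_def)
    finally have "2 / t \<le> levy_qU \<mu> R" .
    moreover have "1 / t < 2 / t" using t by (simp add: divide_strict_right_mono)
    ultimately show ?thesis by linarith
  qed
  define S where "S = {r \<in> {0..R}. levy_qU \<mu> r = 1 / t}"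
  have "\<exists>r. 0 \<le> r \<and> r \<le> R \<and> levy_qU \<mu> r = 1 / t"
    by (rule IVT') (use R qU_0 t qU_continuous in \<open>auto simp: R_def\<close>)
  then have "S \<noteq> {}" by (auto simp: S_def)
  moreover have "compact S"
  proof -
    have "closed S" unfolding S_def by (intro continuous_closed_preimage_constant qU_continuous) auto
    moreover have "bounded S" by (rule bounded_subset[of "{0..R}"]) (auto simp: S_def)
    ultimately show ?thesis by (simp add: compact_eq_bounded_closed)
  qed
  ultimately have "\<exists>s\<in>S. \<forall>t\<in>S. t \<le> s" by (intro compact_attains_sup)
  then obtain r where r: "r \<in> S" "\<And>s. s \<in> S \<Longrightarrow> s \<le> r" by (elim bexE) simp
  have "r \<noteq> 0" using r(1) qU_0 t by (intro notI) (simp add: S_def)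
  then have r0: "0 < r" using r(1) by (simp add: S_def)
  have "levy_rho \<mu> t = r"
    unfolding levy_rho_def
  proof (rule Greatest_equality)
    show "0 < r \<and> levy_qU \<mu> r = 1 / t" using r r0 by (auto simp: S_def)
    fix s assume s: "0 < s \<and> levy_qU \<mu> s = 1 / t"
    have "s \<le> R"
    proof (rule ccontr)
      assume "\<not> s \<le> R"
      then have "levy_qU \<mu> R \<le> levy_qU \<mu> s" by (intro qU_mono) (auto simp: R_def)
      with s R show False by simp
    qed
    with s r show "s \<le> r" by (auto simp: S_def)
  qed
  with r r0 show "0 < levy_rho \<mu> t" "levy_qU \<mu> (levy_rho \<mu> t) = 1 / t" by (auto simp: S_def)
qed

lemma qU_less_imp: "0 \<le> r \<Longrightarrow> levy_qU \<mu> s < levy_qU \<mu> r \<Longrightarrow> s < r"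
  using qU_mono[of r s] by (meson not_le)

lemma rho_anti: "0 < s \<Longrightarrow> s \<le> t \<Longrightarrow> levy_rho \<mu> t \<le> levy_rho \<mu> s"
proof (cases "s = t")
  case False
  assume s: "0 < s" "s \<le> t"
  then have "1 / t < 1 / s" using False by (simp add: field_simps)
  then have "levy_qU \<mu> (levy_rho \<mu> t) < levy_qU \<mu> (levy_rho \<mu> s)" using rho_root[of s] rho_root[of t] s by simp
  moreover have "0 \<le> levy_rho \<mu> s" using rho_root(1)[of s] s by simp
  ultimately show ?thesis using qU_less_imp by fastforce
qed simp

lemma rho_half:
  assumes T: "0 < T"
  obtains A where "1 \<le> A" "\<And>t. 0 < t \<Longrightarrow> t \<le> T \<Longrightarrow> levy_rho \<mu> (t / 2) \<le> A * levy_rho \<mu> t"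
proof -
  obtain c \<alpha> where c: "0 < c" "c \<le> 1" "0 < \<alpha>"
    "\<And>l \<xi>. levy_rho \<mu> T \<le> \<xi> \<Longrightarrow> 1 \<le> l \<Longrightarrow> c * l powr \<alpha> * levy_qU \<mu> \<xi> \<le> levy_qU \<mu> (l * \<xi>)"
    using qU_growth[OF rho_root(1)[OF T]] by blast
  \<comment> \<open>\<open>3\<close> instead of \<open>2\<close> makes the inequality strict, so that it can be inverted although \<open>q\<^sup>U\<close> need not be injective\<close>
  define A where "A = (3 / c) powr (1 / \<alpha>)"
  have "1 powr (1 / \<alpha>) \<le> (3 / c) powr (1 / \<alpha>)"
    using c by (intro powr_mono2) (auto simp: field_simps)
  then have A: "1 \<le> A" by (simp add: A_def)
  have A\<alpha>: "A powr \<alpha> = 3 / c" using c by (simp add: A_def powr_powr)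
  show thesis
  proof (rule that[OF A])
    fix t assume t: "0 < t" "t \<le> T"
    have "levy_qU \<mu> (levy_rho \<mu> (t / 2)) = 2 / t" using rho_root(2)[of "t / 2"] t by simp
    also have "\<dots> < 3 / t" using t by (simp add: divide_strict_right_mono)
    also have "\<dots> = c * A powr \<alpha> * levy_qU \<mu> (levy_rho \<mu> t)" using c rho_root(2)[OF t(1)] by (simp add: A\<alpha>)
    also have "\<dots> \<le> levy_qU \<mu> (A * levy_rho \<mu> t)" by (rule c(4)[OF rho_anti[OF t] A])
    finally have "levy_qU \<mu> (levy_rho \<mu> (t / 2)) < levy_qU \<mu> (A * levy_rho \<mu> t)" .
    moreover have "0 \<le> A * levy_rho \<mu> t" using A rho_root(1)[OF t(1)] by simp
    ultimately show "levy_rho \<mu> (t / 2) \<le> A * levy_rho \<mu> t" using qU_less_imp by fastforce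
  qed
qed

text \<open>
  With \<open>r = \<rho>\<^sub>t\<close>, the integral is split at \<open>\<bar>u\<bar> = r\<^sup>-\<^sup>1\<^sup>/\<^sup>2\<close>.  Below it, \<open>\<bar>u\<bar>\<^sup>\<epsilon>\<close> gains a negative power of
  \<open>r\<close> over \<open>q\<^sup>U(r) = 1 / t\<close>.  Above it, at most \<open>q\<^sup>U(\<surd>r)\<close> remains, which is
  smaller than \<open>q\<^sup>U(r)\<close> by a power of \<open>r\<close>.
  Finally \<open>r\<^sup>2 \<ge> const / t\<close>, since \<open>q\<^sup>U\<close> grows at most quadratically.
\<close>

lemma perturbation_mass:
  assumes T: "0 < T" and \<epsilon>: "0 < \<epsilon>"
  obtains C \<delta> where "0 < \<delta>" "0 \<le> C" "\<And>t. 0 < t \<Longrightarrow> t \<le> T \<Longrightarrow>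
    (\<integral>\<^sup>+u. ennreal (min 1 (\<bar>u\<bar> powr \<epsilon>) * min ((levy_rho \<mu> t * u)\<^sup>2) 1) \<partial>\<mu>) \<le> ennreal (C * t powr (\<delta> - 1))"
proof -
  define a where "a = levy_rho \<mu> T"
  have a: "0 < a" using rho_root(1)[OF T] by (simp add: a_def)
  obtain c \<alpha> where c: "0 < c" "c \<le> 1" "0 < \<alpha>"
    "\<And>l \<xi>. a \<le> \<xi> \<Longrightarrow> 1 \<le> l \<Longrightarrow> c * l powr \<alpha> * levy_qU \<mu> \<xi> \<le> levy_qU \<mu> (l * \<xi>)"
    using qU_growth[OF a] by blast
  define R0 where "R0 = max 1 (a\<^sup>2)"
  define \<kappa> where "\<kappa> = min \<epsilon> \<alpha> / 2"
  have \<kappa>: "0 < \<kappa>" "2 * \<kappa> \<le> \<epsilon>" "2 * \<kappa> \<le> \<alpha>" using \<epsilon> c by (auto simp: \<kappa>_def)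
  define C1 where "C1 = 2 / c + R0 powr \<kappa>"
  have C1: "0 \<le> C1" using c by (simp add: C1_def)
  have le: "min 1 (\<bar>u\<bar> powr \<epsilon>) * m \<le> m" if "0 \<le> m" for u m :: real
    using that by (intro mult_left_le_one_le) auto
  have M1: "(\<integral>u. min 1 (\<bar>u\<bar> powr \<epsilon>) * min ((r * u)\<^sup>2) 1 \<partial>\<mu>) \<le> C1 * r powr (- \<kappa>) * levy_qU \<mu> r"
    and I: "integrable \<mu> (\<lambda>u. min 1 (\<bar>u\<bar> powr \<epsilon>) * min ((r * u)\<^sup>2) 1)" if r: "a \<le> r" for r
  proof -
    show I: "integrable \<mu> (\<lambda>u. min 1 (\<bar>u\<bar> powr \<epsilon>) * min ((r * u)\<^sup>2) 1)"
    proof (rule Bochner_Integration.integrable_bound[OF qU_integrable[of r]])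
      show "AE u in \<mu>. norm (min 1 (\<bar>u\<bar> powr \<epsilon>) * min ((r * u)\<^sup>2) 1) \<le> norm (min ((r * u)\<^sup>2) 1)"
      proof (rule AE_I2)
        fix u :: real
        have "0 \<le> min ((r * u)\<^sup>2) 1" "0 \<le> min 1 (\<bar>u\<bar> powr \<epsilon>)" by auto
        then show "norm (min 1 (\<bar>u\<bar> powr \<epsilon>) * min ((r * u)\<^sup>2) 1) \<le> norm (min ((r * u)\<^sup>2) 1)"
          using le[of "min ((r * u)\<^sup>2) 1" u] by (simp only: real_norm_def abs_mult abs_of_nonneg)
      qed
    qed measurable
    have r0: "0 < r" using a r by simp
    show "(\<integral>u. min 1 (\<bar>u\<bar> powr \<epsilon>) * min ((r * u)\<^sup>2) 1 \<partial>\<mu>) \<le> C1 * r powr (- \<kappa>) * levy_qU \<mu> r"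
    proof (cases "R0 \<le> r")
      case True
      then have r1: "1 \<le> r" "a\<^sup>2 \<le> r" by (auto simp: R0_def)
      let ?s = "sqrt r"
      have s: "1 \<le> ?s" "a \<le> ?s" "?s * ?s = r" using r1 a by (auto simp: real_le_rsqrt)
      have "(\<integral>u. min 1 (\<bar>u\<bar> powr \<epsilon>) * min ((r * u)\<^sup>2) 1 \<partial>\<mu>)
          \<le> (\<integral>u. r powr (- \<kappa>) * min ((r * u)\<^sup>2) 1 + min ((?s * u)\<^sup>2) 1 \<partial>\<mu>)"
      proof (intro integral_mono I Bochner_Integration.integrable_add integrable_mult_right qU_integrable)
        fix u
        show "min 1 (\<bar>u\<bar> powr \<epsilon>) * min ((r * u)\<^sup>2) 1 \<le> r powr (- \<kappa>) * min ((r * u)\<^sup>2) 1 + min ((?s * u)\<^sup>2) 1"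
        proof (cases "\<bar>u\<bar> * ?s \<le> 1")
          case True
          have "\<bar>u\<bar> \<le> 1 / ?s" using True s by (simp add: field_simps)
          also have "1 / ?s = r powr (- (1 / 2))" using r1 by (simp add: powr_minus powr_half_sqrt inverse_eq_divide)
          finally have u: "\<bar>u\<bar> \<le> r powr (- (1 / 2))" .
          have "\<bar>u\<bar> powr \<epsilon> \<le> (r powr (- (1 / 2))) powr \<epsilon>" using u \<epsilon> by (intro powr_mono2) auto
          also have "\<dots> = r powr (- (\<epsilon> / 2))" by (simp add: powr_powr)
          also have "\<dots> \<le> r powr (- \<kappa>)" using r1 \<kappa> by (intro powr_mono) auto
          finally have "min 1 (\<bar>u\<bar> powr \<epsilon>) * min ((r * u)\<^sup>2) 1 \<le> r powr (- \<kappa>) * min ((r * u)\<^sup>2) 1"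
            by (intro mult_right_mono) auto
          then show ?thesis by (smt (verit) zero_le_power2 min_def)
        next
          case False
          then have "1 \<le> \<bar>?s * u\<bar>" using s by (simp add: abs_mult mult.commute)
          then have "1 \<le> (?s * u)\<^sup>2" by (metis one_le_power power2_abs)
          then have "min ((?s * u)\<^sup>2) 1 = 1" by simp
          moreover have "min 1 (\<bar>u\<bar> powr \<epsilon>) * min ((r * u)\<^sup>2) 1 \<le> 1 * 1" by (intro mult_mono) auto
          moreover have "0 \<le> r powr (- \<kappa>) * min ((r * u)\<^sup>2) 1" by simp
          ultimately show ?thesis by linarith
        qed
      qed
      also have "\<dots> = r powr (- \<kappa>) * levy_qU \<mu> r + levy_qU \<mu> ?s"
        unfolding levy_qU_def by (subst Bochner_Integration.integral_add) (auto intro!: qU_integrable)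
      also have "levy_qU \<mu> ?s \<le> 1 / c * r powr (- \<kappa>) * levy_qU \<mu> r"
      proof -
        have "c * ?s powr \<alpha> * levy_qU \<mu> ?s \<le> levy_qU \<mu> r" using c(4)[OF s(2,1)] s(3) by simp
        moreover have "?s powr \<alpha> = r powr (\<alpha> / 2)" using r1 by (simp add: powr_half_sqrt[symmetric] powr_powr)
        moreover have "r powr \<kappa> \<le> r powr (\<alpha> / 2)" using r1 \<kappa> by (intro powr_mono) auto
        ultimately have "c * r powr \<kappa> * levy_qU \<mu> ?s \<le> levy_qU \<mu> r"
          using c qU_nonneg[of ?s] by (smt (verit) mult_left_mono mult_right_mono)
        then show ?thesis using c r0 by (simp add: powr_minus field_simps)
      qed
      also have "r powr (- \<kappa>) * levy_qU \<mu> r + 1 / c * r powr (- \<kappa>) * levy_qU \<mu> r = (1 + 1 / c) * (r powr (- \<kappa>) * levy_qU \<mu> r)"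
        by (simp add: algebra_simps)
      also have "\<dots> \<le> C1 * (r powr (- \<kappa>) * levy_qU \<mu> r)"
      proof (rule mult_right_mono)
        have "1 \<le> 1 / c" using c by simp
        then have "1 + 1 / c \<le> 2 / c" by (simp add: field_simps)
        then show "1 + 1 / c \<le> C1" by (simp add: C1_def add_increasing2)
      qed (simp add: qU_nonneg)
      finally show ?thesis by (simp add: mult.assoc)
    next
      case False
      have "(\<integral>u. min 1 (\<bar>u\<bar> powr \<epsilon>) * min ((r * u)\<^sup>2) 1 \<partial>\<mu>) \<le> 1 * levy_qU \<mu> r"
        unfolding levy_qU_def mult_1
        by (intro integral_mono I qU_integrable le) auto
      also have "1 \<le> C1 * r powr (- \<kappa>)"
      proof -
        have "1 = r powr \<kappa> * r powr (- \<kappa>)" using r0 by (simp flip: powr_add)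
        also have "\<dots> \<le> C1 * r powr (- \<kappa>)"
        proof (rule mult_right_mono)
          have "r powr \<kappa> \<le> R0 powr \<kappa>" using False r0 \<kappa> by (intro powr_mono2) auto
          also have "\<dots> \<le> C1" using c by (simp add: C1_def)
          finally show "r powr \<kappa> \<le> C1" .
        qed simp
        finally show ?thesis .
      qed
      then have "1 * levy_qU \<mu> r \<le> C1 * r powr (- \<kappa>) * levy_qU \<mu> r"
        by (intro mult_right_mono qU_nonneg)
      finally show ?thesis .
    qed
  qed
  define K where "K = levy_qU \<mu> a / a\<^sup>2"
  have K: "0 < K" using qU_pos[OF a] a by (simp add: K_def)
  define C where "C = C1 * (1 / K) powr (- (\<kappa> / 2))"
  show thesis
  proof (rule that[of "\<kappa> / 2" C])
    show "0 < \<kappa> / 2" "0 \<le> C" using \<kappa> C1 by (auto simp: C_def)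
    fix t assume t: "0 < t" "t \<le> T"
    let ?r = "levy_rho \<mu> t"
    have r: "a \<le> ?r" unfolding a_def by (rule rho_anti[OF t])
    have r0: "0 < ?r" using rho_root(1)[OF t(1)] .
    have "1 / t = levy_qU \<mu> (?r / a * a)" using rho_root(2)[OF t(1)] a by simp
    also have "\<dots> \<le> (?r / a)\<^sup>2 * levy_qU \<mu> a" using a r by (intro qU_scale) auto
    also have "\<dots> = K * ?r\<^sup>2" by (simp add: K_def power_divide)
    finally have "1 / K * (1 / t) \<le> 1 / K * (K * ?r\<^sup>2)" using K by (intro mult_left_mono) auto
    then have "1 / K * (1 / t) \<le> ?r\<^sup>2" using K by simp
    then have "(?r\<^sup>2) powr (- (\<kappa> / 2)) \<le> (1 / K * (1 / t)) powr (- (\<kappa> / 2))"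
      using K t \<kappa> by (intro powr_mono2') auto
    moreover have "(?r\<^sup>2) powr (- (\<kappa> / 2)) = ?r powr (- \<kappa>)"
    proof -
      have "?r\<^sup>2 = ?r powr 2" using r0 by simp
      then have "(?r\<^sup>2) powr (- (\<kappa> / 2)) = ?r powr (2 * (- (\<kappa> / 2)))" by (simp only: powr_powr)
      then show ?thesis by simp
    qed
    moreover have "(1 / K * (1 / t)) powr (- (\<kappa> / 2)) = (1 / K) powr (- (\<kappa> / 2)) * t powr (\<kappa> / 2)"
    proof -
      have "(1 / t) powr (- (\<kappa> / 2)) = t powr (\<kappa> / 2)"
        using t by (simp add: powr_divide powr_minus)
      then show ?thesis using K t by (subst powr_mult) auto
    qed
    ultimately have *: "?r powr (- \<kappa>) \<le> (1 / K) powr (- (\<kappa> / 2)) * t powr (\<kappa> / 2)" by simp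
    have "(\<integral>\<^sup>+u. ennreal (min 1 (\<bar>u\<bar> powr \<epsilon>) * min ((?r * u)\<^sup>2) 1) \<partial>\<mu>)
      = ennreal (\<integral>u. min 1 (\<bar>u\<bar> powr \<epsilon>) * min ((?r * u)\<^sup>2) 1 \<partial>\<mu>)"
      by (rule nn_integral_eq_integral[OF I[OF r]]) simp
    also have "\<dots> \<le> ennreal (C1 * ?r powr (- \<kappa>) * levy_qU \<mu> ?r)"
      by (rule ennreal_leI[OF M1[OF r]])
    also have "\<dots> \<le> ennreal (C1 * ((1 / K) powr (- (\<kappa> / 2)) * t powr (\<kappa> / 2)) * (1 / t))"
      unfolding rho_root(2)[OF t(1)] using * C1 t by (intro ennreal_leI mult_right_mono mult_left_mono) auto
    also have "C1 * ((1 / K) powr (- (\<kappa> / 2)) * t powr (\<kappa> / 2)) * (1 / t) = C * t powr (\<kappa> / 2 - 1)"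
      using t by (simp add: C_def powr_diff)
    finally show "(\<integral>\<^sup>+u. ennreal (min 1 (\<bar>u\<bar> powr \<epsilon>) * min ((?r * u)\<^sup>2) 1) \<partial>\<mu>) \<le> ennreal (C * t powr (\<kappa> / 2 - 1))" .
  qed
qed

text \<open>
  Off \<open>{0<..}\<close> the value of \<open>levy_rho\<close> is unspecified; the cut-off gives a Borel function on the whole line.
\<close>

definition rho0 :: "real \<Rightarrow> real" where
  "rho0 t = (if 0 < t then levy_rho \<mu> t else 0)"

lemma rho0_measurable: "rho0 \<in> borel_measurable borel"
proof -
  define g where "g x = - levy_rho \<mu> (exp x)" for x
  have "mono g" unfolding g_def mono_def using rho_anti by auto
  then have [measurable]: "g \<in> borel_measurable borel" by (rule borel_measurable_mono)
  have "rho0 = (\<lambda>t. if 0 < t then - g (ln t) else 0)"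
    by (auto simp: rho0_def g_def)
  then show ?thesis by simp
qed

lemma time_scale_rho:
  assumes T: "0 < T"
  obtains A where "time_scale T rho0 A"
proof -
  obtain A where A: "1 \<le> A" "\<And>t. 0 < t \<Longrightarrow> t \<le> T \<Longrightarrow> levy_rho \<mu> (t / 2) \<le> A * levy_rho \<mu> t"
    using rho_half[OF T] by blast
  have "time_scale T rho0 A"
    by standard (use T A rho_root rho_anti rho0_measurable in \<open>auto simp: rho0_def\<close>)
  then show thesis by (rule that)
qed

end

section \<open>Fourier multipliers of jump type\<close>

definition fint :: "(real \<Rightarrow> real) \<Rightarrow> real \<Rightarrow> complex" where
  "fint A x = (\<integral>\<xi>. A \<xi> *\<^sub>R cis (- (x * \<xi>)) \<partial>lborel)"

text \<open>
  The \<open>L\<^sup>1\<close> norm of the Fourier transform.  The integral is extended, so that infinite norms are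
  allowed.
\<close>

definition fnorm :: "(real \<Rightarrow> real) \<Rightarrow> ennreal" where
  "fnorm A = (\<integral>\<^sup>+x. ennreal (norm (fint A x)) \<partial>lborel)"

lemma cis_measurable[measurable]: "cis \<in> borel_measurable borel"
  by (intro borel_measurable_continuous_onI continuous_intros)

lemma fint_measurable[measurable]:
  assumes [measurable]: "A \<in> borel_measurable borel"
  shows "fint A \<in> borel_measurable borel"
  unfolding fint_def[abs_def] by measurable

lemma fint_integrable:
  assumes A: "integrable lborel A" and [measurable]: "f \<in> borel_measurable borel"
  shows "integrable lborel (\<lambda>\<xi>. A \<xi> *\<^sub>R cis (f \<xi>))"
proof (rule Bochner_Integration.integrable_bound[OF A])
  have [measurable]: "A \<in> borel_measurable borel" using A by auto
  show "(\<lambda>\<xi>. A \<xi> *\<^sub>R cis (f \<xi>)) \<in> borel_measurable lborel" by measurable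
qed auto

lemma fnorm_cmult: "fnorm (\<lambda>\<xi>. c * A \<xi>) = ennreal \<bar>c\<bar> * fnorm A" if [measurable]: "A \<in> borel_measurable borel"
proof -
  have "fint (\<lambda>\<xi>. c * A \<xi>) x = c *\<^sub>R fint A x" for x
    unfolding fint_def by (simp flip: scaleR_scaleR)
  then show ?thesis unfolding fnorm_def by (simp add: ennreal_mult nn_integral_cmult)
qed

lemma fnorm_add:
  assumes "integrable lborel A" "integrable lborel B"
  shows "fnorm (\<lambda>\<xi>. A \<xi> + B \<xi>) \<le> fnorm A + fnorm B"
proof -
  have [measurable]: "A \<in> borel_measurable borel" "B \<in> borel_measurable borel" using assms by auto
  have "fint (\<lambda>\<xi>. A \<xi> + B \<xi>) x = fint A x + fint B x" for x
    unfolding fint_def using fint_integrable[OF assms(1)] fint_integrable[OF assms(2)]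
    by (simp add: scaleR_add_left)
  then have "fnorm (\<lambda>\<xi>. A \<xi> + B \<xi>) \<le> (\<integral>\<^sup>+x. ennreal (norm (fint A x)) + ennreal (norm (fint B x)) \<partial>lborel)"
    unfolding fnorm_def
    by (intro nn_integral_mono) (auto simp flip: ennreal_plus intro!: ennreal_leI norm_triangle_ineq)
  then show ?thesis unfolding fnorm_def by (simp add: nn_integral_add)
qed

lemma fnorm_sum:
  assumes "finite I" "\<And>i. i \<in> I \<Longrightarrow> integrable lborel (A i)"
  shows "fnorm (\<lambda>\<xi>. \<Sum>i\<in>I. A i \<xi>) \<le> (\<Sum>i\<in>I. fnorm (A i))"
  using assms
proof (induction I rule: finite_induct)
  case empty
  show ?case by (simp add: fnorm_def fint_def)
next
  case (insert i I)
  have "fnorm (\<lambda>\<xi>. \<Sum>i\<in>insert i I. A i \<xi>) = fnorm (\<lambda>\<xi>. A i \<xi> + (\<Sum>i\<in>I. A i \<xi>))"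
    using insert by simp
  also have "\<dots> \<le> fnorm (A i) + fnorm (\<lambda>\<xi>. \<Sum>i\<in>I. A i \<xi>)"
    using insert by (intro fnorm_add) auto
  also have "\<dots> \<le> fnorm (A i) + (\<Sum>i\<in>I. fnorm (A i))" using insert by (intro add_left_mono) auto
  finally show ?case using insert by simp
qed

lemma fnorm_rescale:
  assumes r: "0 < r" and [measurable]: "A \<in> borel_measurable borel"
  shows "fnorm (\<lambda>\<xi>. A (\<xi> / r)) = fnorm A"
proof -
  have "fint (\<lambda>\<xi>. A (\<xi> / r)) x = r *\<^sub>R fint A (r * x)" for x
    unfolding fint_def using r by (subst lborel_integral_real_affine[where c=r and t=0]) (auto simp: mult_ac)
  then have "fnorm (\<lambda>\<xi>. A (\<xi> / r)) = (\<integral>\<^sup>+x. ennreal r * ennreal (norm (fint A (r * x))) \<partial>lborel)"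
    unfolding fnorm_def using r by (simp add: ennreal_mult)
  also have "\<dots> = ennreal r * (\<integral>\<^sup>+x. ennreal (norm (fint A (r * x))) \<partial>lborel)"
    by (rule nn_integral_cmult) measurable
  also have "\<dots> = fnorm A"
    unfolding fnorm_def using r nn_integral_real_affine[of "\<lambda>x. ennreal (norm (fint A x))" r 0] by simp
  finally show ?thesis .
qed

text \<open>
  For a finite measure \<open>\<nu>\<close> of mass \<open>N\<close>, multiplication by \<open>B\<close> is convolution of the Fourier transform with the
  symmetrization of \<open>\<nu>\<close>, hence has norm at most \<open>N\<close>.  The function \<open>N - B\<close> is the exponent of the
  compound Poisson process whose jump measure is that symmetrization.
\<close>

context
  fixes \<nu> :: "real measure" and B :: "real \<Rightarrow> real" and N :: real
  assumes fin: "finite_measure \<nu>" and sets_nu[measurable_cong]: "sets \<nu> = sets borel"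
  defines "B \<equiv> \<lambda>\<xi>. \<integral>u. cos (\<xi> * u) \<partial>\<nu>" and "N \<equiv> measure \<nu> UNIV"
begin

interpretation finite_measure \<nu> by (rule fin)

lemma space_nu: "space \<nu> = UNIV"
  using sets_eq_imp_space_eq[OF sets_nu] by simp

lemma cosint_measurable: "B \<in> borel_measurable borel"
  unfolding B_def by measurable

lemma cosint_bound: "\<bar>B \<xi>\<bar> \<le> N"
proof -
  have i: "integrable \<nu> (\<lambda>u. cos (\<xi> * u))"
    by (rule integrable_const_bound[where B=1]) auto
  have "\<bar>B \<xi>\<bar> \<le> (\<integral>u. \<bar>cos (\<xi> * u)\<bar> \<partial>\<nu>)" unfolding B_def by (rule integral_abs_bound)
  also have "\<dots> \<le> (\<integral>u. 1 \<partial>\<nu>)" using i by (intro integral_mono integrable_abs) auto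
  also have "\<dots> = N" by (simp add: N_def space_nu)
  finally show ?thesis .
qed

lemma fnorm_mult_cosint:
  assumes A: "integrable lborel A"
  shows "fnorm (\<lambda>\<xi>. A \<xi> * B \<xi>) \<le> ennreal N * fnorm A"
proof -
  have [measurable]: "A \<in> borel_measurable borel" using A by auto
  interpret pair_sigma_finite lborel \<nu> ..
  have eq: "fint (\<lambda>\<xi>. A \<xi> * B \<xi>) x = (\<integral>u. (1/2) *\<^sub>R (fint A (x - u) + fint A (x + u)) \<partial>\<nu>)" for x
  proof -
    let ?g = "\<lambda>\<xi> u. (A \<xi> * cos (\<xi> * u)) *\<^sub>R cis (- (x * \<xi>))"
    have ci: "integrable \<nu> (\<lambda>u. cos (\<xi> * u))" for \<xi>
      by (rule integrable_const_bound[where B=1]) auto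
    have "fint (\<lambda>\<xi>. A \<xi> * B \<xi>) x = (\<integral>\<xi>. (\<integral>u. ?g \<xi> u \<partial>\<nu>) \<partial>lborel)"
      unfolding fint_def B_def
    proof (rule Bochner_Integration.integral_cong[OF refl])
      fix \<xi>
      have "(\<integral>u. ?g \<xi> u \<partial>\<nu>) = (\<integral>u. A \<xi> * cos (\<xi> * u) \<partial>\<nu>) *\<^sub>R cis (- (x * \<xi>))"
        using ci by (intro integral_scaleR_left) auto
      then show "(A \<xi> * (\<integral>u. cos (\<xi> * u) \<partial>\<nu>)) *\<^sub>R cis (- (x * \<xi>)) = (\<integral>u. ?g \<xi> u \<partial>\<nu>)" by simp
    qed
    also have "\<dots> = (\<integral>u. (\<integral>\<xi>. ?g \<xi> u \<partial>lborel) \<partial>\<nu>)"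
    proof (rule Fubini_integral[symmetric])
      show "integrable (lborel \<Otimes>\<^sub>M \<nu>) (case_prod ?g)"
      proof (rule Fubini_integrable)
        show "case_prod ?g \<in> borel_measurable (lborel \<Otimes>\<^sub>M \<nu>)" by measurable
        have gi: "integrable \<nu> (\<lambda>u. ?g \<xi> u)" for \<xi> using ci by (intro integrable_scaleR_left) auto
        then show "AE \<xi> in lborel. integrable \<nu> (\<lambda>u. case_prod ?g (\<xi>, u))" by simp
        show "integrable lborel (\<lambda>\<xi>. \<integral>u. norm (case_prod ?g (\<xi>, u)) \<partial>\<nu>)"
        proof (rule Bochner_Integration.integrable_bound[OF integrable_mult_right[OF A, of N]])
          show "AE \<xi> in lborel. norm (\<integral>u. norm (case_prod ?g (\<xi>, u)) \<partial>\<nu>) \<le> norm (N * A \<xi>)"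
          proof (rule AE_I2)
            fix \<xi>
            have "(\<integral>u. norm (?g \<xi> u) \<partial>\<nu>) \<le> (\<integral>u. \<bar>A \<xi>\<bar> \<partial>\<nu>)"
              using gi[of \<xi>] by (intro integral_mono integrable_norm) (auto simp: abs_mult mult_left_le)
            then show "norm (\<integral>u. norm (case_prod ?g (\<xi>, u)) \<partial>\<nu>) \<le> norm (N * A \<xi>)"
              by (simp add: N_def space_nu abs_mult integral_nonneg_AE)
          qed
        qed measurable
      qed
    qed
    also have "\<dots> = (\<integral>u. (1/2) *\<^sub>R (fint A (x - u) + fint A (x + u)) \<partial>\<nu>)"
    proof (rule Bochner_Integration.integral_cong[OF refl])
      fix u
      have "?g \<xi> u = (1/2) *\<^sub>R (A \<xi> *\<^sub>R cis (- ((x - u) * \<xi>)) + A \<xi> *\<^sub>R cis (- ((x + u) * \<xi>)))" for \<xi>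
      proof -
        have c: "cis a + cis (- a) = of_real (2 * cos a)" for a by (simp add: complex_eq_iff)
        have "cis (- ((x - u) * \<xi>)) + cis (- ((x + u) * \<xi>)) = cis (- (x * \<xi>)) * (cis (\<xi> * u) + cis (- (\<xi> * u)))"
          by (simp add: cis_mult distrib_left algebra_simps)
        also have "\<dots> = (2 * cos (\<xi> * u)) *\<^sub>R cis (- (x * \<xi>))" by (simp only: c scaleR_conv_of_real mult.commute)
        finally show ?thesis by (simp flip: scaleR_add_right)
      qed
      then show "(\<integral>\<xi>. ?g \<xi> u \<partial>lborel) = (1/2) *\<^sub>R (fint A (x - u) + fint A (x + u))"
        unfolding fint_def using fint_integrable[OF A] by simp
    qed
    finally show ?thesis .
  qed
  have fi: "\<And>a. (\<integral>\<^sup>+x. ennreal (norm (fint A (x - a))) \<partial>lborel) = fnorm A" "\<And>a. (\<integral>\<^sup>+x. ennreal (norm (fint A (x + a))) \<partial>lborel) = fnorm A"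
    unfolding fnorm_def using nn_integral_shift(2,3)[of "\<lambda>x. ennreal (norm (fint A x))"] by auto
  have "fnorm (\<lambda>\<xi>. A \<xi> * B \<xi>) \<le> (\<integral>\<^sup>+x. (\<integral>\<^sup>+u. ennreal (1/2) * (ennreal (norm (fint A (x - u))) + ennreal (norm (fint A (x + u)))) \<partial>\<nu>) \<partial>lborel)"
    unfolding fnorm_def eq
  proof (rule nn_integral_mono)
    fix x
    let ?h = "\<lambda>u. (1/2) *\<^sub>R (fint A (x - u) + fint A (x + u))"
    have "ennreal (norm (\<integral>u. ?h u \<partial>\<nu>)) \<le> (\<integral>\<^sup>+u. ennreal (norm (?h u)) \<partial>\<nu>)"
    proof (cases "integrable \<nu> ?h")
      case True
      then show ?thesis by (rule integral_norm_bound_ennreal)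
    next
      case False
      then have "(\<integral>u. ?h u \<partial>\<nu>) = 0" by (rule not_integrable_integral_eq)
      then show ?thesis by (simp only: norm_zero ennreal_0 zero_le)
    qed
    also have "\<dots> \<le> (\<integral>\<^sup>+u. ennreal (1/2) * (ennreal (norm (fint A (x - u))) + ennreal (norm (fint A (x + u)))) \<partial>\<nu>)"
    proof (rule nn_integral_mono)
      fix u
      have "norm (?h u) \<le> 1/2 * (norm (fint A (x - u)) + norm (fint A (x + u)))"
        using norm_triangle_ineq[of "fint A (x - u)" "fint A (x + u)"] by simp
      then have "ennreal (norm (?h u)) \<le> ennreal (1/2 * (norm (fint A (x - u)) + norm (fint A (x + u))))"
        by (rule ennreal_leI)
      also have "\<dots> = ennreal (1/2) * (ennreal (norm (fint A (x - u))) + ennreal (norm (fint A (x + u))))"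
        by (subst ennreal_mult) auto
      finally show "ennreal (norm (?h u)) \<le> ennreal (1/2) * (ennreal (norm (fint A (x - u))) + ennreal (norm (fint A (x + u))))" .
    qed
    finally show "ennreal (norm (\<integral>u. ?h u \<partial>\<nu>)) \<le> (\<integral>\<^sup>+u. ennreal (1/2) * (ennreal (norm (fint A (x - u))) + ennreal (norm (fint A (x + u)))) \<partial>\<nu>)" .
  qed
  also have "\<dots> = (\<integral>\<^sup>+u. (\<integral>\<^sup>+x. ennreal (1/2) * (ennreal (norm (fint A (x - u))) + ennreal (norm (fint A (x + u)))) \<partial>lborel) \<partial>\<nu>)"
    by (rule Fubini'[symmetric]) measurable
  also have "\<dots> = (\<integral>\<^sup>+u. ennreal (1/2) * (fnorm A + fnorm A) \<partial>\<nu>)"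
    by (intro nn_integral_cong) (simp add: nn_integral_cmult nn_integral_add fi)
  also have "ennreal (1/2) * (fnorm A + fnorm A) = fnorm A"
  proof -
    have "ennreal (1/2) * (fnorm A + fnorm A) = (ennreal (1/2) + ennreal (1/2)) * fnorm A"
      by (simp only: distrib_left distrib_right)
    also have "ennreal (1/2) + ennreal (1/2) = 1" by (subst ennreal_plus[symmetric]) (simp_all del: ennreal_plus)
    finally show ?thesis by simp
  qed
  also have "(\<integral>\<^sup>+u. fnorm A \<partial>\<nu>) = fnorm A * emeasure \<nu> (space \<nu>)" by (rule nn_integral_const)
  also have "emeasure \<nu> (space \<nu>) = ennreal N" by (simp add: N_def space_nu emeasure_eq_measure)
  finally show ?thesis by (simp only: mult.commute)
qed

lemma integrable_mult_cosint:
  assumes A: "integrable lborel A"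
  shows "integrable lborel (\<lambda>\<xi>. A \<xi> * B \<xi>)"
proof (rule Bochner_Integration.integrable_bound[OF integrable_mult_right[OF A, of N]])
  note [measurable] = cosint_measurable
  have [measurable]: "A \<in> borel_measurable borel" using A by auto
  show "(\<lambda>\<xi>. A \<xi> * B \<xi>) \<in> borel_measurable lborel" by measurable
  have "\<bar>A \<xi>\<bar> * \<bar>B \<xi>\<bar> \<le> \<bar>A \<xi>\<bar> * \<bar>N\<bar>" for \<xi> using cosint_bound[of \<xi>] by (intro mult_left_mono) auto
  then show "AE \<xi> in lborel. norm (A \<xi> * B \<xi>) \<le> norm (N * A \<xi>)" by (simp add: abs_mult mult.commute)
qed

lemma fnorm_mult_gap_power:
  assumes A: "integrable lborel A" and t: "0 \<le> t" "t * N \<le> 1"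
  shows "integrable lborel (\<lambda>\<xi>. A \<xi> * (t * (N - B \<xi>)) ^ k) \<and> fnorm (\<lambda>\<xi>. A \<xi> * (t * (N - B \<xi>)) ^ k) \<le> 2 ^ k * fnorm A"
proof (induction k)
  case 0
  then show ?case using A by simp
next
  case (Suc k)
  let ?A = "\<lambda>\<xi>. A \<xi> * (t * (N - B \<xi>)) ^ k"
  have i: "integrable lborel ?A" using Suc by simp
  have N: "0 \<le> N" by (simp add: N_def)
  have m: "?A \<in> borel_measurable borel" "(\<lambda>\<xi>. ?A \<xi> * B \<xi>) \<in> borel_measurable borel"
    using i integrable_mult_cosint[OF i] by auto
  have eq: "(\<lambda>\<xi>. A \<xi> * (t * (N - B \<xi>)) ^ Suc k) = (\<lambda>\<xi>. (t * N) * ?A \<xi> + (- t) * (?A \<xi> * B \<xi>))"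
    by (auto simp: algebra_simps)
  have i2: "integrable lborel (\<lambda>\<xi>. (t * N) * ?A \<xi>)" "integrable lborel (\<lambda>\<xi>. (- t) * (?A \<xi> * B \<xi>))"
    using i integrable_mult_cosint[OF i] by (auto intro: integrable_mult_right)
  have "fnorm (\<lambda>\<xi>. (t * N) * ?A \<xi> + (- t) * (?A \<xi> * B \<xi>)) \<le> fnorm (\<lambda>\<xi>. (t * N) * ?A \<xi>) + fnorm (\<lambda>\<xi>. (- t) * (?A \<xi> * B \<xi>))"
    by (rule fnorm_add[OF i2])
  also have "\<dots> = ennreal (t * N) * fnorm ?A + ennreal t * fnorm (\<lambda>\<xi>. ?A \<xi> * B \<xi>)"
    unfolding fnorm_cmult[OF m(1)] fnorm_cmult[OF m(2)] using t N by simp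
  also have "\<dots> \<le> ennreal (t * N) * fnorm ?A + ennreal t * (ennreal N * fnorm ?A)"
    by (intro add_left_mono mult_left_mono fnorm_mult_cosint[OF i]) auto
  also have "\<dots> = 2 * (ennreal (t * N) * fnorm ?A)"
    using t N by (simp add: ennreal_mult mult.assoc flip: mult_2)
  also have "\<dots> \<le> 2 * (1 * (2 ^ k * fnorm A))"
  proof (intro mult_left_mono mult_mono)
    show "ennreal (t * N) \<le> 1" using t ennreal_leI[of "t * N" 1] by simp
    show "fnorm ?A \<le> 2 ^ k * fnorm A" using Suc by simp
  qed auto
  finally show ?case unfolding eq using i2 by (simp add: mult.assoc)
qed

text \<open>
  \<open>exp (- t (N - B)) = exp (- t N) \<Sum>n. (t B)\<^sup>n / n!\<close> is an average of powers of a contraction: the two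
  exponentials cancel.
\<close>

lemma fnorm_mult_exp_gap:
  assumes A: "integrable lborel A" and t: "0 \<le> t"
  shows "fnorm (\<lambda>\<xi>. A \<xi> * exp (- (t * (N - B \<xi>)))) \<le> fnorm A"
    "integrable lborel (\<lambda>\<xi>. A \<xi> * exp (- (t * (N - B \<xi>))))"
proof -
  note [measurable] = cosint_measurable
  have [measurable]: "A \<in> borel_measurable borel" using A by auto
  have N: "0 \<le> N" by (simp add: N_def)
  have B1: "integrable lborel (\<lambda>\<xi>. A \<xi> * B \<xi> ^ n) \<and> fnorm (\<lambda>\<xi>. A \<xi> * B \<xi> ^ n) \<le> ennreal (N ^ n) * fnorm A" for n
  proof (induction n)
    case (Suc n)
    have "fnorm (\<lambda>\<xi>. A \<xi> * B \<xi> ^ n * B \<xi>) \<le> ennreal N * fnorm (\<lambda>\<xi>. A \<xi> * B \<xi> ^ n)"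
      using Suc by (intro fnorm_mult_cosint) simp
    also have "\<dots> \<le> ennreal N * (ennreal (N ^ n) * fnorm A)" using Suc by (intro mult_left_mono) auto
    also have "\<dots> = ennreal (N ^ Suc n) * fnorm A" using N by (simp add: ennreal_mult mult.assoc)
    finally show ?case using integrable_mult_cosint[of "\<lambda>\<xi>. A \<xi> * B \<xi> ^ n"] Suc by (simp add: mult_ac)
  qed (use A in simp)
  let ?a = "\<lambda>n \<xi>. (t ^ n / fact n) * (A \<xi> * B \<xi> ^ n)"
  have ia: "integrable lborel (?a n)" for n using B1[of n] by (intro integrable_mult_right) simp
  have na: "fnorm (?a n) \<le> ennreal ((t * N) ^ n / fact n) * fnorm A" for n
  proof -
    have "fnorm (?a n) = ennreal (t ^ n / fact n) * fnorm (\<lambda>\<xi>. A \<xi> * B \<xi> ^ n)"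
      using t by (subst fnorm_cmult) auto
    also have "\<dots> \<le> ennreal (t ^ n / fact n) * (ennreal (N ^ n) * fnorm A)"
      using B1[of n] by (intro mult_left_mono) auto
    also have "\<dots> = ennreal ((t * N) ^ n / fact n) * fnorm A"
      using t N by (simp add: mult.assoc[symmetric] ennreal_mult[symmetric] power_mult_distrib)
    finally show ?thesis .
  qed
  have expS: "(\<lambda>n. x ^ n / fact n) sums exp x" for x :: real
    using exp_converges[of x] by (simp add: divide_inverse mult.commute)
  have bound: "\<bar>?a n \<xi>\<bar> \<le> (t * N) ^ n / fact n * \<bar>A \<xi>\<bar>" for n \<xi>
  proof -
    have "\<bar>B \<xi>\<bar> ^ n \<le> N ^ n" using cosint_bound[of \<xi>] by (intro power_mono) auto
    then have "t ^ n / fact n * (\<bar>A \<xi>\<bar> * \<bar>B \<xi>\<bar> ^ n) \<le> t ^ n / fact n * (\<bar>A \<xi>\<bar> * N ^ n)"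
      using t by (intro mult_left_mono) auto
    then show ?thesis using t by (simp add: abs_mult power_abs power_mult_distrib mult_ac)
  qed
  have fs: "fint (\<lambda>\<xi>. A \<xi> * exp (t * B \<xi>)) x = (\<Sum>n. fint (?a n) x) \<and> summable (\<lambda>n. norm (fint (?a n) x))" for x
  proof -
    have e: "(A \<xi> * exp (t * B \<xi>)) *\<^sub>R cis (- (x * \<xi>)) = (\<Sum>n. ?a n \<xi> *\<^sub>R cis (- (x * \<xi>)))" for \<xi>
    proof -
      have "(\<lambda>n. A \<xi> * ((t * B \<xi>) ^ n / fact n)) sums (A \<xi> * exp (t * B \<xi>))"
        by (rule sums_mult[OF expS])
      then have "(\<lambda>n. (A \<xi> * ((t * B \<xi>) ^ n / fact n)) *\<^sub>R cis (- (x * \<xi>))) sums ((A \<xi> * exp (t * B \<xi>)) *\<^sub>R cis (- (x * \<xi>)))"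
        by (rule sums_scaleR_left)
      then have "(\<lambda>n. ?a n \<xi> *\<^sub>R cis (- (x * \<xi>))) sums ((A \<xi> * exp (t * B \<xi>)) *\<^sub>R cis (- (x * \<xi>)))"
        by (simp add: power_mult_distrib mult_ac)
      then show ?thesis by (rule sums_unique)
    qed
    have sn: "summable (\<lambda>n. \<integral>\<xi>. norm (?a n \<xi> *\<^sub>R cis (- (x * \<xi>))) \<partial>lborel)"
    proof (rule summable_comparison_test'[where N=0])
      show "summable (\<lambda>n. (t * N) ^ n / fact n * (\<integral>\<xi>. \<bar>A \<xi>\<bar> \<partial>lborel))"
        using expS by (intro summable_mult2) (auto simp: sums_iff)
      fix n
      have "(\<integral>\<xi>. \<bar>?a n \<xi>\<bar> \<partial>lborel) \<le> (\<integral>\<xi>. (t * N) ^ n / fact n * \<bar>A \<xi>\<bar> \<partial>lborel)"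
      proof (rule integral_mono)
        show "integrable lborel (\<lambda>\<xi>. \<bar>?a n \<xi>\<bar>)" by (rule integrable_abs[OF ia])
        show "integrable lborel (\<lambda>\<xi>. (t * N) ^ n / fact n * \<bar>A \<xi>\<bar>)"
          by (intro integrable_mult_right integrable_abs A)
      qed (rule bound)
      then show "norm (\<integral>\<xi>. norm (?a n \<xi> *\<^sub>R cis (- (x * \<xi>))) \<partial>lborel) \<le> (t * N) ^ n / fact n * (\<integral>\<xi>. \<bar>A \<xi>\<bar> \<partial>lborel)"
        by simp
    qed
    have sp: "AE \<xi> in lborel. summable (\<lambda>n. norm (?a n \<xi> *\<^sub>R cis (- (x * \<xi>))))"
    proof (rule AE_I2)
      fix \<xi>
      have "summable (\<lambda>n. (t * N) ^ n / fact n * \<bar>A \<xi>\<bar>)" using expS by (intro summable_mult2) (auto simp: sums_iff)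
      then show "summable (\<lambda>n. norm (?a n \<xi> *\<^sub>R cis (- (x * \<xi>))))"
        by (rule summable_comparison_test'[where N=0]) (use bound in simp)
    qed
    have "fint (\<lambda>\<xi>. A \<xi> * exp (t * B \<xi>)) x = (\<Sum>n. fint (?a n) x)"
      unfolding fint_def e by (intro integral_suminf fint_integrable ia sp sn) measurable
    moreover have "summable (\<lambda>n. norm (fint (?a n) x))"
      by (rule summable_comparison_test'[OF sn, of 0]) (unfold fint_def real_norm_def abs_norm_cancel, rule integral_norm_bound)
    ultimately show ?thesis by simp
  qed
  have "fnorm (\<lambda>\<xi>. A \<xi> * exp (t * B \<xi>)) \<le> (\<integral>\<^sup>+x. (\<Sum>n. ennreal (norm (fint (?a n) x))) \<partial>lborel)"
    unfolding fnorm_def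
  proof (rule nn_integral_mono)
    fix x
    have "norm (\<Sum>n. fint (?a n) x) \<le> (\<Sum>n. norm (fint (?a n) x))" using fs[of x] by (intro summable_norm) simp
    then have "ennreal (norm (\<Sum>n. fint (?a n) x)) \<le> ennreal (\<Sum>n. norm (fint (?a n) x))" by (rule ennreal_leI)
    also have "\<dots> = (\<Sum>n. ennreal (norm (fint (?a n) x)))" using fs[of x] by (intro suminf_ennreal2[symmetric]) auto
    finally show "ennreal (norm (fint (\<lambda>\<xi>. A \<xi> * exp (t * B \<xi>)) x)) \<le> (\<Sum>n. ennreal (norm (fint (?a n) x)))"
      using fs[of x] by simp
  qed
  also have "\<dots> = (\<Sum>n. fnorm (?a n))" unfolding fnorm_def by (rule nn_integral_suminf) measurable
  also have "\<dots> \<le> (\<Sum>n. ennreal ((t * N) ^ n / fact n) * fnorm A)" by (intro suminf_le summableI na)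
  also have "\<dots> = (\<Sum>n. ennreal ((t * N) ^ n / fact n)) * fnorm A" by (rule ennreal_suminf_multc)
  also have "(\<Sum>n. ennreal ((t * N) ^ n / fact n)) = ennreal (exp (t * N))"
    using t N by (intro suminf_ennreal_eq[OF _ expS]) auto
  finally have main: "fnorm (\<lambda>\<xi>. A \<xi> * exp (t * B \<xi>)) \<le> ennreal (exp (t * N)) * fnorm A" .
  have eq: "(\<lambda>\<xi>. A \<xi> * exp (- (t * (N - B \<xi>)))) = (\<lambda>\<xi>. exp (- (t * N)) * (A \<xi> * exp (t * B \<xi>)))"
    by (auto simp: algebra_simps exp_add[symmetric] simp flip: exp_add)
  have "fnorm (\<lambda>\<xi>. exp (- (t * N)) * (A \<xi> * exp (t * B \<xi>))) = ennreal (exp (- (t * N))) * fnorm (\<lambda>\<xi>. A \<xi> * exp (t * B \<xi>))"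
    by (subst fnorm_cmult) auto
  also have "\<dots> \<le> ennreal (exp (- (t * N))) * (ennreal (exp (t * N)) * fnorm A)" by (intro mult_left_mono main) simp
  also have "\<dots> = fnorm A" by (simp add: mult.assoc[symmetric] ennreal_mult[symmetric] exp_minus)
  finally show "fnorm (\<lambda>\<xi>. A \<xi> * exp (- (t * (N - B \<xi>)))) \<le> fnorm A" unfolding eq .
  show "integrable lborel (\<lambda>\<xi>. A \<xi> * exp (- (t * (N - B \<xi>))))"
  proof (rule Bochner_Integration.integrable_bound[OF A])
    have "0 \<le> t * (N - B \<xi>)" for \<xi> using t cosint_bound[of \<xi>] by (intro mult_nonneg_nonneg) auto
    then have "\<bar>A \<xi>\<bar> * exp (- (t * (N - B \<xi>))) \<le> \<bar>A \<xi>\<bar> * 1" for \<xi> by (intro mult_left_mono) auto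
    then show "AE \<xi> in lborel. norm (A \<xi> * exp (- (t * (N - B \<xi>)))) \<le> norm (A \<xi>)" by (simp add: abs_mult)
  qed measurable
qed

end

section \<open>Smooth symbols of polynomial growth\<close>

lemma integrable_Cauchy_bound:
  fixes f :: "real \<Rightarrow> real"
  assumes [measurable]: "f \<in> borel_measurable borel" and b: "\<And>x. \<bar>f x\<bar> \<le> K / (1 + x\<^sup>2)"
  shows "integrable lborel f" "(\<integral>x. \<bar>f x\<bar> \<partial>lborel) \<le> pi * K"
proof -
  have pos: "0 < 1 + x\<^sup>2" for x :: real by (intro add_pos_nonneg) auto
  have K: "0 \<le> K" using b[of 0] by simp
  have "(\<integral>\<^sup>+x. ennreal \<bar>f x\<bar> \<partial>lborel) \<le> (\<integral>\<^sup>+x. ennreal K * ennreal (1 / (1 + (1 * x)\<^sup>2)) \<partial>lborel)"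
    using b K by (intro nn_integral_mono) (auto simp: ennreal_mult[symmetric] intro!: ennreal_leI)
  also have "\<dots> = ennreal (pi * K)"
    using nn_integral_scaled_cauchy[of 1] K by (subst nn_integral_cmult) (auto simp: ennreal_mult[symmetric] mult.commute)
  finally have *: "(\<integral>\<^sup>+x. ennreal \<bar>f x\<bar> \<partial>lborel) \<le> ennreal (pi * K)" .
  show i: "integrable lborel f" by (rule integrable_of_nn_bound[OF _ *]) simp
  have "ennreal (\<integral>x. \<bar>f x\<bar> \<partial>lborel) \<le> ennreal (pi * K)"
    using * by (subst (asm) nn_integral_eq_integral) (auto intro: i)
  then show "(\<integral>x. \<bar>f x\<bar> \<partial>lborel) \<le> pi * K" using K by (simp add: ennreal_le_iff)
qed

lemma norm_fint_le: "norm (fint A x) \<le> (\<integral>\<xi>. \<bar>A \<xi>\<bar> \<partial>lborel)"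
  unfolding fint_def by (rule order_trans[OF integral_norm_bound]) simp

text \<open>
  Two integrations by parts give \<open>x\<^sup>2 fint B x = - fint B2 x\<close>, so that \<open>fint B\<close> decays like
  \<open>1 / (1 + x\<^sup>2)\<close>.
\<close>

lemma fnorm_C2:
  assumes d1: "\<And>x. (B has_real_derivative B1 x) (at x)" and d2: "\<And>x. (B1 has_real_derivative B2 x) (at x)"
    and c2: "continuous_on UNIV B2"
    and b: "\<And>x. \<bar>B x\<bar> \<le> K / (1 + x\<^sup>2)" and b1: "\<And>x. \<bar>B1 x\<bar> \<le> K / (1 + x\<^sup>2)" and b2: "\<And>x. \<bar>B2 x\<bar> \<le> K / (1 + x\<^sup>2)"
  shows "integrable lborel B" "fnorm B \<le> ennreal (2 * pi\<^sup>2 * K)"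
proof -
  have cB: "continuous_on UNIV B" "continuous_on UNIV B1"
    by (auto intro!: continuous_at_imp_continuous_on DERIV_isCont d1 d2)
  have [measurable]: "B \<in> borel_measurable borel" "B1 \<in> borel_measurable borel" "B2 \<in> borel_measurable borel"
    using cB c2 by (auto intro: borel_measurable_continuous_onI)
  note iB = integrable_Cauchy_bound[OF _ b, simplified] and iB2 = integrable_Cauchy_bound[OF _ b2, simplified]
  show "integrable lborel B" by (rule iB)
  have K: "0 \<le> K" using b[of 0] by simp
  have ibp: "fint B2 x = - (x\<^sup>2 *\<^sub>R fint B x)" for x
  proof -
    let ?e = "\<lambda>\<eta>. cis (- (x * \<eta>))"
    let ?F = "\<lambda>\<eta>. (complex_of_real (B1 \<eta>) + \<i> * complex_of_real (x * B \<eta>)) * ?e \<eta>"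
    let ?f = "\<lambda>\<eta>. (B2 \<eta> + x\<^sup>2 * B \<eta>) *\<^sub>R ?e \<eta>"
    have "(LBINT \<eta>=-\<infinity>..\<infinity>. ?f \<eta>) = 0 - 0"
    proof (rule interval_integral_FTC_integrable[where F="?F"])
      fix \<eta> :: real
      have e: "(?e has_vector_derivative (- x) *\<^sub>R (\<i> * ?e \<eta>)) (at \<eta>)"
        unfolding has_vector_derivative_def
        by (auto intro!: derivative_eq_intros simp: algebra_simps)
      have g: "((\<lambda>\<eta>. complex_of_real (B1 \<eta>) + \<i> * complex_of_real (x * B \<eta>)) has_vector_derivative
          (complex_of_real (B2 \<eta>) + \<i> * complex_of_real (x * B1 \<eta>))) (at \<eta>)"
        by (intro has_vector_derivative_add has_vector_derivative_mult_right has_vector_derivative_of_real d2 DERIV_cmult d1)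
      have "(?F has_vector_derivative
          (complex_of_real (B1 \<eta>) + \<i> * complex_of_real (x * B \<eta>)) * ((- x) *\<^sub>R (\<i> * ?e \<eta>))
          + (complex_of_real (B2 \<eta>) + \<i> * complex_of_real (x * B1 \<eta>)) * ?e \<eta>) (at \<eta>)"
        by (rule has_vector_derivative_mult[OF g e])
      then show "(?F has_vector_derivative ?f \<eta>) (at \<eta>)"
        by (simp add: scaleR_conv_of_real algebra_simps power2_eq_square)
      show "isCont ?f \<eta>"
      proof -
        have "continuous_on UNIV ?f" using cB c2 by (intro continuous_intros)
        then show ?thesis by (simp add: continuous_on_eq_continuous_at)
      qed
    next
      have "integrable lborel ?f"
        using iB(1) iB2(1) by (intro fint_integrable Bochner_Integration.integrable_add integrable_mult_right) auto
      then show "set_integrable lborel (einterval (-\<infinity>) \<infinity>) ?f" by (simp add: set_integrable_def)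
      have nF: "norm (?F \<eta>) \<le> (K * (1 + \<bar>x\<bar>)) / (1 + \<eta>\<^sup>2)" for \<eta>
      proof -
        have "norm (?F \<eta>) \<le> \<bar>B1 \<eta>\<bar> + \<bar>x\<bar> * \<bar>B \<eta>\<bar>"
          by (simp add: norm_mult norm_triangle_le abs_mult)
        also have "\<dots> \<le> K / (1 + \<eta>\<^sup>2) + \<bar>x\<bar> * (K / (1 + \<eta>\<^sup>2))"
          by (intro add_mono mult_left_mono b b1) auto
        finally show ?thesis by (simp add: algebra_simps add_divide_distrib)
      qed
      have l: "((\<lambda>\<eta>::real. (K * (1 + \<bar>x\<bar>)) / (1 + \<eta>\<^sup>2)) \<longlongrightarrow> 0) at_top" "((\<lambda>\<eta>::real. (K * (1 + \<bar>x\<bar>)) / (1 + \<eta>\<^sup>2)) \<longlongrightarrow> 0) at_bot"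
        by (intro tendsto_divide_0[OF tendsto_const] filterlim_at_top_imp_at_infinity
              filterlim_tendsto_add_at_top[OF tendsto_const] filterlim_pow_at_top filterlim_pow_at_bot_even filterlim_ident; simp)+
      have "(?F \<longlongrightarrow> 0) at_top" "(?F \<longlongrightarrow> 0) at_bot"
        using nF by (auto intro!: Lim_null_comparison[OF _ l(1)] Lim_null_comparison[OF _ l(2)] always_eventually)
      then show "((?F \<circ> real_of_ereal) \<longlongrightarrow> 0) (at_right (-\<infinity>))" "((?F \<circ> real_of_ereal) \<longlongrightarrow> 0) (at_left \<infinity>)"
        by (simp_all add: ereal_tendsto_simps)
    qed simp
    then have "(\<integral>\<eta>. ?f \<eta> \<partial>lborel) = 0"
      by (simp add: interval_lebesgue_integral_def set_lebesgue_integral_def)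
    moreover have "(\<integral>\<eta>. ?f \<eta> \<partial>lborel) = fint B2 x + x\<^sup>2 *\<^sub>R fint B x"
      unfolding fint_def using fint_integrable[OF iB(1)] fint_integrable[OF iB2(1)]
      by (simp add: scaleR_add_left flip: scaleR_scaleR)
    ultimately show ?thesis by (simp add: eq_neg_iff_add_eq_0)
  qed
  have bd: "norm (fint B x) \<le> (2 * pi * K) * (1 / (1 + (1 * x)\<^sup>2))" for x
  proof -
    have "norm (fint B x) \<le> pi * K" using norm_fint_le iB(2) by (rule order_trans)
    moreover have "x\<^sup>2 * norm (fint B x) \<le> pi * K"
      using order_trans[OF norm_fint_le iB2(2), of x] by (simp add: ibp)
    ultimately have "(1 + x\<^sup>2) * norm (fint B x) \<le> 2 * pi * K" by (simp add: algebra_simps)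
    moreover have "0 < 1 + x\<^sup>2" by (intro add_pos_nonneg) auto
    ultimately show ?thesis by (simp add: pos_le_divide_eq mult.commute)
  qed
  have "fnorm B \<le> (\<integral>\<^sup>+x. ennreal (2 * pi * K) * ennreal (1 / (1 + (1 * x)\<^sup>2)) \<partial>lborel)"
    unfolding fnorm_def
  proof (rule nn_integral_mono)
    fix x
    have "ennreal (norm (fint B x)) \<le> ennreal ((2 * pi * K) * (1 / (1 + (1 * x)\<^sup>2)))" by (rule ennreal_leI[OF bd])
    also have "\<dots> = ennreal (2 * pi * K) * ennreal (1 / (1 + (1 * x)\<^sup>2))" using K by (intro ennreal_mult) auto
    finally show "ennreal (norm (fint B x)) \<le> ennreal (2 * pi * K) * ennreal (1 / (1 + (1 * x)\<^sup>2))" .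
  qed
  also have "\<dots> = ennreal (2 * pi * K) * ennreal pi"
    using nn_integral_scaled_cauchy[of 1] by (subst nn_integral_cmult) auto
  also have "\<dots> = ennreal (2 * pi\<^sup>2 * K)" using K by (simp add: ennreal_mult[symmetric] power2_eq_square mult_ac)
  finally show "fnorm B \<le> ennreal (2 * pi\<^sup>2 * K)" .
qed

text \<open>
  Polynomial growth of a function and its first two derivatives with quantitative constants, so that
  estimates are uniform over a family of symbols.
\<close>

definition poly_bounded :: "real \<Rightarrow> nat \<Rightarrow> (real \<Rightarrow> real) \<Rightarrow> (real \<Rightarrow> real) \<Rightarrow> (real \<Rightarrow> real) \<Rightarrow> bool" where
  "poly_bounded K N f f1 f2 \<longleftrightarrow> 0 \<le> K \<and> (\<forall>x. (f has_real_derivative f1 x) (at x)) \<and> (\<forall>x. (f1 has_real_derivative f2 x) (at x)) \<and>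
     continuous_on UNIV f2 \<and>
     (\<forall>x. \<bar>f x\<bar> \<le> K * (1 + \<bar>x\<bar>) ^ N \<and> \<bar>f1 x\<bar> \<le> K * (1 + \<bar>x\<bar>) ^ N \<and> \<bar>f2 x\<bar> \<le> K * (1 + \<bar>x\<bar>) ^ N)"

lemma poly_boundedD:
  assumes "poly_bounded K N f f1 f2"
  shows "0 \<le> K" "(f has_real_derivative f1 x) (at x)" "(f1 has_real_derivative f2 x) (at x)" "continuous_on UNIV f2"
    "\<bar>f x\<bar> \<le> K * (1 + \<bar>x\<bar>) ^ N" "\<bar>f1 x\<bar> \<le> K * (1 + \<bar>x\<bar>) ^ N" "\<bar>f2 x\<bar> \<le> K * (1 + \<bar>x\<bar>) ^ N"
    "continuous_on UNIV f" "continuous_on UNIV f1"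
proof -
  show "continuous_on UNIV f" "continuous_on UNIV f1"
    using assms unfolding poly_bounded_def by (auto intro!: continuous_at_imp_continuous_on intro: DERIV_isCont)
qed (use assms in \<open>simp_all add: poly_bounded_def\<close>)

lemma poly_bounded_mult:
  assumes f: "poly_bounded K N f f1 f2" and g: "poly_bounded L M g g1 g2"
  shows "poly_bounded (4 * K * L) (N + M) (\<lambda>x. f x * g x) (\<lambda>x. f1 x * g x + f x * g1 x) (\<lambda>x. f2 x * g x + 2 * (f1 x * g1 x) + f x * g2 x)"
  unfolding poly_bounded_def
proof (intro conjI allI)
  note F = poly_boundedD[OF f] and G = poly_boundedD[OF g]
  show "0 \<le> 4 * K * L" using F(1) G(1) by simp
  show "((\<lambda>x. f x * g x) has_real_derivative f1 x * g x + f x * g1 x) (at x)" for x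
    using DERIV_mult[OF F(2)[of x] G(2)[of x]] by (simp add: mult.commute)
  show "((\<lambda>x. f1 x * g x + f x * g1 x) has_real_derivative f2 x * g x + 2 * (f1 x * g1 x) + f x * g2 x) (at x)" for x
    using DERIV_add[OF DERIV_mult[OF F(3)[of x] G(2)[of x]] DERIV_mult[OF F(2)[of x] G(3)[of x]]]
    by (simp add: algebra_simps)
  show "continuous_on UNIV (\<lambda>x. f2 x * g x + 2 * (f1 x * g1 x) + f x * g2 x)"
    using F(4,8,9) G(4,8,9) by (intro continuous_intros)
  fix x
  let ?P = "K * L * (1 + \<bar>x\<bar>) ^ (N + M)"
  have P0: "0 \<le> ?P" using F(1) G(1) by simp
  have pr: "\<bar>a * b\<bar> \<le> ?P" if "\<bar>a\<bar> \<le> K * (1 + \<bar>x\<bar>) ^ N" "\<bar>b\<bar> \<le> L * (1 + \<bar>x\<bar>) ^ M" for a b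
  proof -
    have "\<bar>a * b\<bar> \<le> (K * (1 + \<bar>x\<bar>) ^ N) * (L * (1 + \<bar>x\<bar>) ^ M)"
      unfolding abs_mult using that F(1) by (intro mult_mono) auto
    then show ?thesis by (simp add: power_add mult_ac)
  qed
  note p = pr[OF F(5) G(5)] pr[OF F(6) G(5)] pr[OF F(5) G(6)] pr[OF F(7) G(5)] pr[OF F(6) G(6)] pr[OF F(5) G(7)]
  have e: "4 * K * L * (1 + \<bar>x\<bar>) ^ (N + M) = 4 * ?P" by simp
  show "\<bar>f x * g x\<bar> \<le> 4 * K * L * (1 + \<bar>x\<bar>) ^ (N + M)" unfolding e using p P0 by linarith
  show "\<bar>f1 x * g x + f x * g1 x\<bar> \<le> 4 * K * L * (1 + \<bar>x\<bar>) ^ (N + M)" unfolding e using p P0 by linarith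
  show "\<bar>f2 x * g x + 2 * (f1 x * g1 x) + f x * g2 x\<bar> \<le> 4 * K * L * (1 + \<bar>x\<bar>) ^ (N + M)" unfolding e using p P0 by linarith
qed

lemma poly_bounded_power:
  fixes K :: real and N n :: nat
  assumes K: "0 \<le> K"
  shows "\<exists>L M. \<forall>f f1 f2. poly_bounded K N f f1 f2 \<longrightarrow> (\<exists>g1 g2. poly_bounded L M (\<lambda>x. f x ^ n) g1 g2)"
proof (induction n)
  case 0
  have "poly_bounded 1 0 (\<lambda>x. 1) (\<lambda>x. 0) (\<lambda>x. 0)"
    by (auto simp: poly_bounded_def intro!: derivative_eq_intros)
  then show ?case by (auto simp del: One_nat_def)
next
  case (Suc n)
  then obtain L M where *: "\<And>f f1 f2. poly_bounded K N f f1 f2 \<Longrightarrow> \<exists>g1 g2. poly_bounded L M (\<lambda>x. f x ^ n) g1 g2" by blast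
  show ?case
  proof (rule exI[of _ "4 * K * L"], rule exI[of _ "N + M"], intro allI impI)
    fix f f1 f2 assume f: "poly_bounded K N f f1 f2"
    from *[OF this] obtain g1 g2 where "poly_bounded L M (\<lambda>x. f x ^ n) g1 g2" by blast
    from poly_bounded_mult[OF f this] show "\<exists>g1 g2. poly_bounded (4 * K * L) (N + M) (\<lambda>x. f x ^ Suc n) g1 g2"
      by auto
  qed
qed

lemma power_div_fact_le_exp: "0 \<le> y \<Longrightarrow> y ^ n / fact n \<le> exp (y::real)"
proof -
  assume y: "0 \<le> y"
  have s: "(\<lambda>n. y ^ n / fact n) sums exp y"
    using exp_converges[of y] by (simp add: divide_inverse mult.commute)
  have "(\<Sum>k\<in>{n}. y ^ k / fact k) \<le> (\<Sum>k. y ^ k / fact k)"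
    using s y by (intro sum_le_suminf) (auto simp: sums_iff)
  then show ?thesis using s by (simp add: sums_iff)
qed

text \<open>
  The exponent enters only through its lower bound; \<open>y\<close> stands for the value of a symbol at \<open>\<eta>\<close>.
\<close>

lemma stretched_exp_decay:
  fixes c \<alpha> :: real
  assumes c: "0 < c" and \<alpha>: "0 < \<alpha>"
  obtains K where "0 \<le> K" "\<And>\<eta> y. 0 \<le> y \<Longrightarrow> (1 \<le> \<bar>\<eta>\<bar> \<Longrightarrow> c * \<bar>\<eta>\<bar> powr \<alpha> \<le> y) \<Longrightarrow> (1 + \<bar>\<eta>\<bar>) ^ N * exp (- y) \<le> K / (1 + \<eta>\<^sup>2)"
proof -
  obtain n :: nat where n: "real (N + 2) / \<alpha> < real n" using reals_Archimedean2 by blast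
  then have n': "real (N + 2) \<le> \<alpha> * real n" using \<alpha> by (simp add: field_simps)
  define K where "K = 2 ^ (N + 1) + 2 ^ (N + 1) * (fact n / c ^ n)"
  have K: "0 \<le> K" using c by (simp add: K_def)
  show thesis
  proof (rule that[OF K])
    fix \<eta> y :: real assume y: "0 \<le> y" and lb: "1 \<le> \<bar>\<eta>\<bar> \<Longrightarrow> c * \<bar>\<eta>\<bar> powr \<alpha> \<le> y"
    have pos: "0 < 1 + \<eta>\<^sup>2" by (intro add_pos_nonneg) auto
    have "(1 + \<bar>\<eta>\<bar>) ^ N * exp (- y) * (1 + \<eta>\<^sup>2) \<le> K"
    proof (cases "1 \<le> \<bar>\<eta>\<bar>")
      case False
      then have "\<eta>\<^sup>2 \<le> 1" by (simp add: abs_square_le_1)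
      then have "(1 + \<bar>\<eta>\<bar>) ^ N * exp (- y) * (1 + \<eta>\<^sup>2) \<le> 2 ^ N * 1 * 2"
        using False y by (intro mult_mono power_mono) auto
      also have "\<dots> \<le> K" using c by (simp add: K_def)
      finally show ?thesis .
    next
      case True
      define x where "x = \<bar>\<eta>\<bar>"
      have x: "1 \<le> x" using True by (simp add: x_def)
      let ?z = "c * x powr \<alpha>"
      have z: "0 < ?z" using c x by simp
      have "?z \<le> y" using lb[OF True] by (simp add: x_def)
      then have "exp ?z \<le> exp y" by simp
      with power_div_fact_le_exp[of ?z n] z have le: "?z ^ n / fact n \<le> exp y" by linarith
      have e: "exp (- y) \<le> fact n / ?z ^ n"
      proof -
        have "?z ^ n / fact n * fact n \<le> exp y * fact n" using le by (intro mult_right_mono) auto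
        then have "exp (- y) * ?z ^ n \<le> exp (- y) * (exp y * fact n)" by (intro mult_left_mono) auto
        also have "\<dots> = fact n" by (simp add: exp_minus)
        finally show ?thesis using z by (simp only: pos_le_divide_eq zero_less_power)
      qed
      have zn: "?z ^ n = c ^ n * x powr (\<alpha> * real n)"
      proof -
        have "(x powr \<alpha>) ^ n = (x powr \<alpha>) powr real n" using x by (intro powr_realpow[symmetric]) auto
        then show ?thesis by (simp add: power_mult_distrib powr_powr)
      qed
      have "x ^ (N + 2) = x powr real (N + 2)" using x by (intro powr_realpow[symmetric]) auto
      also have "\<dots> \<le> x powr (\<alpha> * real n)" using x n' by (intro powr_mono) auto
      finally have xp: "x ^ (N + 2) \<le> x powr (\<alpha> * real n)" .
      have "(1 + x) ^ N * exp (- y) * (1 + x\<^sup>2) \<le> (2 * x) ^ N * (fact n / ?z ^ n) * (2 * x\<^sup>2)"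
        using e x c by (intro mult_mono power_mono) (auto intro!: divide_nonneg_nonneg)
      also have "\<dots> = 2 ^ (N + 1) * (fact n / c ^ n) * (x ^ (N + 2) / x powr (\<alpha> * real n))"
        unfolding zn by (simp add: power_mult_distrib power_add power2_eq_square)
      also have "\<dots> \<le> 2 ^ (N + 1) * (fact n / c ^ n) * 1"
        using xp x c by (intro mult_left_mono) auto
      also have "\<dots> \<le> K" by (simp add: K_def)
      finally show ?thesis by (simp add: x_def)
    qed
    then show "(1 + \<bar>\<eta>\<bar>) ^ N * exp (- y) \<le> K / (1 + \<eta>\<^sup>2)" using pos by (simp add: pos_le_divide_eq)
  qed
qed

text \<open>
  The constant depends on the symbol \<open>\<sigma>\<close> only through its lower bound and its growth.  This uniformity is what
  makes the bounds for \<open>p\<^sup>0\<^sub>t\<close> scale correctly in \<open>t\<close>.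
\<close>

lemma fnorm_power_exp_bound:
  fixes c \<alpha> :: real and i j :: nat
  assumes c: "0 < c" and \<alpha>: "0 < \<alpha>"
  obtains C where "0 \<le> C" "\<And>\<sigma> \<sigma>1 \<sigma>2. poly_bounded 1 2 \<sigma> \<sigma>1 \<sigma>2 \<Longrightarrow> (\<And>\<eta>. 0 \<le> \<sigma> \<eta>) \<Longrightarrow>
     (\<And>\<eta>. 1 \<le> \<bar>\<eta>\<bar> \<Longrightarrow> c * \<bar>\<eta>\<bar> powr \<alpha> \<le> \<sigma> \<eta>) \<Longrightarrow>
     integrable lborel (\<lambda>\<eta>. \<eta> ^ j * \<sigma> \<eta> ^ i * exp (- \<sigma> \<eta>)) \<and>
     fnorm (\<lambda>\<eta>. \<eta> ^ j * \<sigma> \<eta> ^ i * exp (- \<sigma> \<eta>)) \<le> ennreal C"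
proof -
  obtain L M where LM0: "\<forall>f f1 f2. poly_bounded 1 2 f f1 f2 \<longrightarrow> (\<exists>g1 g2. poly_bounded L M (\<lambda>x. f x ^ i) g1 g2)"
    using poly_bounded_power[OF zero_le_one, of 2 i] by (elim exE)
  obtain L' M' where LM0': "\<forall>f f1 f2. poly_bounded 1 1 f f1 f2 \<longrightarrow> (\<exists>g1 g2. poly_bounded L' M' (\<lambda>x. f x ^ j) g1 g2)"
    using poly_bounded_power[OF zero_le_one, of 1 j] by (elim exE)
  note LM = LM0[rule_format] and LM' = LM0'[rule_format]
  have "poly_bounded 1 1 (\<lambda>x. x) (\<lambda>x. 1) (\<lambda>x. 0)"
    by (auto simp: poly_bounded_def intro!: derivative_eq_intros)
  from LM'[OF this] obtain h1 h2 where h: "poly_bounded L' M' (\<lambda>x. x ^ j) h1 h2" by blast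
  \<comment> \<open>The exponent \<open>?N + 4\<close> accounts for the square of \<open>\<sigma>1\<close> in the second derivative.\<close>
  let ?K = "4 * L' * L" and ?N = "M' + M"
  obtain E where E: "0 \<le> E" "\<And>\<eta> y. 0 \<le> y \<Longrightarrow> (1 \<le> \<bar>\<eta>\<bar> \<Longrightarrow> c * \<bar>\<eta>\<bar> powr \<alpha> \<le> y) \<Longrightarrow>
      (1 + \<bar>\<eta>\<bar>) ^ (?N + 4) * exp (- y) \<le> E / (1 + \<eta>\<^sup>2)"
    using stretched_exp_decay[OF c \<alpha>, of "?N + 4"] by blast
  define K where "K = 5 * \<bar>?K\<bar> * E"
  show thesis
  proof (rule that[of "2 * pi\<^sup>2 * K"])
    show "0 \<le> 2 * pi\<^sup>2 * K" using E by (simp add: K_def)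
    fix \<sigma> \<sigma>1 \<sigma>2 :: "real \<Rightarrow> real"
    assume \<sigma>: "poly_bounded 1 2 \<sigma> \<sigma>1 \<sigma>2" and \<sigma>0: "\<And>\<eta>. 0 \<le> \<sigma> \<eta>" and lb: "\<And>\<eta>. 1 \<le> \<bar>\<eta>\<bar> \<Longrightarrow> c * \<bar>\<eta>\<bar> powr \<alpha> \<le> \<sigma> \<eta>"
    from LM[OF \<sigma>] obtain g1 g2 where g: "poly_bounded L M (\<lambda>x. \<sigma> x ^ i) g1 g2" by blast
    obtain P1 P2 where P: "poly_bounded ?K ?N (\<lambda>x. x ^ j * \<sigma> x ^ i) P1 P2" using poly_bounded_mult[OF h g] by blast
    let ?P = "\<lambda>x. x ^ j * \<sigma> x ^ i"
    let ?A1 = "\<lambda>x. (P1 x - ?P x * \<sigma>1 x) * exp (- \<sigma> x)"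
    let ?A2 = "\<lambda>x. (P2 x - 2 * (P1 x * \<sigma>1 x) - ?P x * \<sigma>2 x + ?P x * (\<sigma>1 x * \<sigma>1 x)) * exp (- \<sigma> x)"
    note p = poly_boundedD[OF P] and s = poly_boundedD[OF \<sigma>]
    have K0: "0 \<le> ?K" by (rule p(1))
    have bnd: "\<bar>a * exp (- \<sigma> x)\<bar> \<le> K / (1 + x\<^sup>2)" if "\<bar>a\<bar> \<le> 5 * (?K * (1 + \<bar>x\<bar>) ^ (?N + 4))" for a x
    proof -
      have "\<bar>a * exp (- \<sigma> x)\<bar> \<le> 5 * (?K * (1 + \<bar>x\<bar>) ^ (?N + 4)) * exp (- \<sigma> x)"
        using that by (simp add: abs_mult mult_right_mono)
      also have "\<dots> = 5 * ?K * ((1 + \<bar>x\<bar>) ^ (?N + 4) * exp (- \<sigma> x))" by simp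
      also have "\<dots> \<le> 5 * ?K * (E / (1 + x\<^sup>2))" using E(2)[OF \<sigma>0 lb, of x] K0 by (intro mult_left_mono) auto
      also have "\<dots> = K / (1 + x\<^sup>2)" using K0 by (simp add: K_def)
      finally show ?thesis .
    qed
    have pw: "(1 + \<bar>x\<bar>) ^ m \<le> (1 + \<bar>x\<bar>) ^ (?N + 4)" if "m \<le> ?N + 4" for x :: real and m
      using that by (intro power_increasing) auto
    have b0: "\<bar>a\<bar> \<le> ?K * (1 + \<bar>x\<bar>) ^ (?N + 4)" if "\<bar>a\<bar> \<le> ?K * (1 + \<bar>x\<bar>) ^ ?N" for a x
      using that mult_left_mono[OF pw[of ?N x] K0] by linarith
    have b1: "\<bar>a * b\<bar> \<le> ?K * (1 + \<bar>x\<bar>) ^ (?N + 4)" if "\<bar>a\<bar> \<le> ?K * (1 + \<bar>x\<bar>) ^ ?N" "\<bar>b\<bar> \<le> 1 * (1 + \<bar>x\<bar>) ^ 2" for a b x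
    proof -
      have "\<bar>a * b\<bar> \<le> (?K * (1 + \<bar>x\<bar>) ^ ?N) * (1 * (1 + \<bar>x\<bar>) ^ 2)"
        unfolding abs_mult using that K0 by (intro mult_mono) auto
      also have "\<dots> = ?K * (1 + \<bar>x\<bar>) ^ (?N + 2)" by (simp add: power_add power2_eq_square)
      also have "\<dots> \<le> ?K * (1 + \<bar>x\<bar>) ^ (?N + 4)" by (intro mult_left_mono pw K0) auto
      finally show ?thesis .
    qed
    have b2: "\<bar>a * (b * b)\<bar> \<le> ?K * (1 + \<bar>x\<bar>) ^ (?N + 4)" if "\<bar>a\<bar> \<le> ?K * (1 + \<bar>x\<bar>) ^ ?N" "\<bar>b\<bar> \<le> 1 * (1 + \<bar>x\<bar>) ^ 2" for a b x
    proof -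
      have "\<bar>a * (b * b)\<bar> \<le> (?K * (1 + \<bar>x\<bar>) ^ ?N) * ((1 * (1 + \<bar>x\<bar>) ^ 2) * (1 * (1 + \<bar>x\<bar>) ^ 2))"
        unfolding abs_mult using that K0 by (intro mult_mono) auto
      also have "\<dots> = ?K * (1 + \<bar>x\<bar>) ^ (?N + 4)" by (simp add: power_add power2_eq_square power4_eq_xxxx)
      finally show ?thesis .
    qed
    have A0: "\<bar>?P x * exp (- \<sigma> x)\<bar> \<le> K / (1 + x\<^sup>2)" for x
      by (rule bnd) (use b0[OF p(5)[of x]] in linarith)
    have A1: "\<bar>?A1 x\<bar> \<le> K / (1 + x\<^sup>2)" for x
      by (rule bnd) (use b0[OF p(6)[of x]] b1[OF p(5)[of x] s(6)[of x]] in linarith)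
    have A2: "\<bar>?A2 x\<bar> \<le> K / (1 + x\<^sup>2)" for x
      by (rule bnd) (use b0[OF p(7)[of x]] b1[OF p(6)[of x] s(6)[of x]] b1[OF p(5)[of x] s(7)[of x]] b2[OF p(5)[of x] s(6)[of x]] in linarith)
    have dexp: "((\<lambda>x. exp (- \<sigma> x)) has_real_derivative exp (- \<sigma> x) * (- \<sigma>1 x)) (at x)" for x
      using s(2)[of x] by (auto intro!: derivative_eq_intros)
    have D1: "((\<lambda>x. ?P x * exp (- \<sigma> x)) has_real_derivative ?A1 x) (at x)" for x
      using DERIV_mult[OF p(2)[of x] dexp[of x]] by (simp add: algebra_simps)
    have D2: "(?A1 has_real_derivative ?A2 x) (at x)" for x
      using DERIV_mult[OF DERIV_diff[OF p(3)[of x] DERIV_mult[OF p(2)[of x] s(3)[of x]]] dexp[of x]]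
      by (simp add: algebra_simps)
    have cA: "continuous_on UNIV ?A2"
      using p(4,8,9) s(4,8,9) by (intro continuous_intros) auto
    note R = fnorm_C2[OF D1 D2 cA A0 A1 A2]
    then show "integrable lborel (\<lambda>\<eta>. \<eta> ^ j * \<sigma> \<eta> ^ i * exp (- \<sigma> \<eta>)) \<and>
     fnorm (\<lambda>\<eta>. \<eta> ^ j * \<sigma> \<eta> ^ i * exp (- \<sigma> \<eta>)) \<le> ennreal (2 * pi\<^sup>2 * K)" by simp
  qed
qed

section \<open>Integral bounds for the derivatives of the unperturbed density\<close>

lemma one_minus_cos_le: "1 - cos x \<le> x\<^sup>2" for x :: real
proof -
  have "cos x = 1 - 2 * (sin (x / 2))\<^sup>2" using cos_double_sin[of "x / 2"] by simp
  moreover have "(sin (x / 2))\<^sup>2 \<le> (x / 2)\<^sup>2"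
    using abs_sin_x_le_abs_x[of "x / 2"] by (rule abs_le_square_iff[THEN iffD1])
  moreover have "(x / 2)\<^sup>2 = x\<^sup>2 / 4" by (simp add: power_divide)
  ultimately show ?thesis using zero_le_power2[of x] by linarith
qed

lemma one_minus_cos_ge: "\<bar>x\<bar> \<le> 1 \<Longrightarrow> x\<^sup>2 / 4 \<le> 1 - cos x" for x :: real
proof -
  assume x: "\<bar>x\<bar> \<le> 1"
  define y where "y = \<bar>x\<bar> / 2"
  have y: "0 \<le> y" "y \<le> 1 / 2" using x by (auto simp: y_def)
  have "\<bar>sin y - (\<Sum>m<3. sin_coeff m * y ^ m)\<bar> \<le> inverse (fact 3) * \<bar>y\<bar> ^ 3"
    by (rule Maclaurin_sin_bound)
  moreover have "(\<Sum>m<3. sin_coeff m * y ^ m) = y"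
    by (simp add: numeral_3_eq_3 sin_coeff_def)
  moreover have "inverse (fact 3) * \<bar>y\<bar> ^ 3 \<le> y / 24"
  proof -
    have "y * y * y \<le> y * (1 / 2) * (1 / 2)" using y by (intro mult_mono) auto
    then show ?thesis using y by (simp add: fact_numeral power3_eq_cube)
  qed
  ultimately have "sin y \<ge> y - y / 24" by linarith
  then have s: "3 / 4 * y \<le> sin y" using y by linarith
  then have "(3 / 4 * y)\<^sup>2 \<le> (sin y)\<^sup>2" using y by (intro power_mono) auto
  then have "9 / 16 * y\<^sup>2 \<le> (sin y)\<^sup>2" by (simp add: power_mult_distrib power_divide)
  moreover have "y\<^sup>2 = x\<^sup>2 / 4" by (simp add: y_def power_divide)
  moreover have "cos x = 1 - 2 * (sin y)\<^sup>2"
    using cos_double_sin[of y] by (simp add: y_def)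
  ultimately show ?thesis using zero_le_power2[of x] by linarith
qed

text \<open>
  The derivative \<open>\<partial>\<^sub>t\<^sup>i \<partial>\<^sub>x\<^sup>j\<close> of the unperturbed density.  The phase shift \<open>j \<pi> / 2\<close> encodes the \<open>j\<close>-th
  derivative of the cosine.
\<close>

definition heat_deriv :: "real measure \<Rightarrow> nat \<Rightarrow> nat \<Rightarrow> real \<Rightarrow> real \<Rightarrow> real" where
  "heat_deriv \<mu> i j t x = 1 / (2 * pi) *
     (\<integral>\<xi>. \<xi> ^ j * cos (x * \<xi> + real j * (pi / 2)) * (- levy_q \<mu> \<xi>) ^ i * exp (- (t * levy_q \<mu> \<xi>)) \<partial>lborel)"

definition heat_symbol :: "real measure \<Rightarrow> nat \<Rightarrow> nat \<Rightarrow> real \<Rightarrow> real \<Rightarrow> real" where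
  "heat_symbol \<mu> i j t \<xi> = \<xi> ^ j * levy_q \<mu> \<xi> ^ i * exp (- (t * levy_q \<mu> \<xi>))"

context levy
begin

definition small_jumps :: "real \<Rightarrow> real \<Rightarrow> real" where
  "small_jumps r u = indicator {u. \<bar>u * r\<bar> \<le> 1} u"

lemma small_jumps_measurable[measurable]: "small_jumps r \<in> borel_measurable borel"
  unfolding small_jumps_def[abs_def] by measurable

lemma small_jumps_integrable:
  assumes [measurable]: "f \<in> borel_measurable borel" and b: "\<And>u. \<bar>f u\<bar> \<le> K * (r * u)\<^sup>2"
  shows "integrable \<mu> (\<lambda>u. small_jumps r u * f u)"
    "\<bar>\<integral>u. small_jumps r u * f u \<partial>\<mu>\<bar> \<le> K * levy_qL \<mu> r"
proof -
  have i: "integrable \<mu> (\<lambda>u. K * (small_jumps r u * (r * u)\<^sup>2))"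
    unfolding small_jumps_def by (intro integrable_mult_right qL_integrable)
  have le: "\<bar>small_jumps r u * f u\<bar> \<le> K * (small_jumps r u * (r * u)\<^sup>2)" for u
    using b[of u] by (auto simp: small_jumps_def indicator_def)
  show j: "integrable \<mu> (\<lambda>u. small_jumps r u * f u)"
    by (rule Bochner_Integration.integrable_bound[OF i]) (use le in \<open>auto intro!: AE_I2 order_trans[OF _ abs_ge_self]\<close>)
  have "\<bar>\<integral>u. small_jumps r u * f u \<partial>\<mu>\<bar> \<le> (\<integral>u. \<bar>small_jumps r u * f u\<bar> \<partial>\<mu>)" by (rule integral_abs_bound)
  also have "\<dots> \<le> (\<integral>u. K * (small_jumps r u * (r * u)\<^sup>2) \<partial>\<mu>)"
    by (intro integral_mono integrable_abs i j le)
  also have "\<dots> = K * levy_qL \<mu> r" by (simp add: qL_eq small_jumps_def)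
  finally show "\<bar>\<integral>u. small_jumps r u * f u \<partial>\<mu>\<bar> \<le> K * levy_qL \<mu> r" .
qed

text \<open>
  The part of \<open>t q\<close> that comes from the jumps \<open>\<bar>u\<bar> \<le> 1 / r\<close>, as a function of \<open>\<eta> = \<xi> / r\<close>.
\<close>

definition small_symbol :: "real \<Rightarrow> real \<Rightarrow> real \<Rightarrow> real" where
  "small_symbol t r \<eta> = t * (\<integral>u. small_jumps r u * (1 - cos (r * \<eta> * u)) \<partial>\<mu>)"

text \<open>
  As \<open>1 - cos x \<le> x\<^sup>2\<close> and \<open>\<bar>sin x\<bar> \<le> \<bar>x\<bar>\<close>, the integrands of the symbol and its first two derivatives are at
  most \<open>(r u)\<^sup>2\<close> times a power of \<open>\<bar>\<eta>\<bar>\<close>, and the integral of \<open>(r u)\<^sup>2\<close> over the small jumps is \<open>q\<^sup>L(r)\<close>.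
\<close>

lemma small_symbol_poly_bounded:
  assumes t: "0 < t" and tL: "t * levy_qL \<mu> r \<le> 1"
  shows "poly_bounded 1 2 (small_symbol t r)
    (\<lambda>\<eta>. t * (\<integral>u. small_jumps r u * (r * u * sin (r * \<eta> * u)) \<partial>\<mu>))
    (\<lambda>\<eta>. t * (\<integral>u. small_jumps r u * ((r * u)\<^sup>2 * cos (r * \<eta> * u)) \<partial>\<mu>))"
  unfolding poly_bounded_def
proof (intro conjI allI)
  have b0: "\<bar>1 - cos (r * \<eta> * u)\<bar> \<le> \<eta>\<^sup>2 * (r * u)\<^sup>2" for \<eta> u
    using one_minus_cos_le[of "r * \<eta> * u"] by (simp add: power_mult_distrib mult_ac)
  have b1: "\<bar>r * u * sin (r * \<eta> * u)\<bar> \<le> \<bar>\<eta>\<bar> * (r * u)\<^sup>2" for \<eta> u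
  proof -
    have "\<bar>r * u\<bar> * \<bar>sin (r * \<eta> * u)\<bar> \<le> \<bar>r * u\<bar> * \<bar>r * \<eta> * u\<bar>"
      by (intro mult_left_mono abs_sin_x_le_abs_x) auto
    also have "\<dots> = \<bar>\<eta>\<bar> * (\<bar>r * u\<bar> * \<bar>r * u\<bar>)" by (simp add: abs_mult mult_ac)
    also have "\<bar>r * u\<bar> * \<bar>r * u\<bar> = (r * u)\<^sup>2" by (simp only: power2_eq_square abs_mult_self_eq)
    finally show ?thesis by (simp only: abs_mult[of "r * u"])
  qed
  have b2: "\<bar>(r * u)\<^sup>2 * cos (r * \<eta> * u)\<bar> \<le> 1 * (r * u)\<^sup>2" for \<eta> u
    by (simp add: abs_mult mult_left_le)
  have I0: "integrable \<mu> (\<lambda>u. small_jumps r u * (1 - cos (r * \<eta> * u)))"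
    "\<bar>\<integral>u. small_jumps r u * (1 - cos (r * \<eta> * u)) \<partial>\<mu>\<bar> \<le> \<eta>\<^sup>2 * levy_qL \<mu> r" for \<eta>
    by (rule small_jumps_integrable[OF _ b0]; measurable)+
  have I1: "integrable \<mu> (\<lambda>u. small_jumps r u * (r * u * sin (r * \<eta> * u)))"
    "\<bar>\<integral>u. small_jumps r u * (r * u * sin (r * \<eta> * u)) \<partial>\<mu>\<bar> \<le> \<bar>\<eta>\<bar> * levy_qL \<mu> r" for \<eta>
    by (rule small_jumps_integrable[OF _ b1]; measurable)+
  have I2: "integrable \<mu> (\<lambda>u. small_jumps r u * ((r * u)\<^sup>2 * cos (r * \<eta> * u)))"
    "\<bar>\<integral>u. small_jumps r u * ((r * u)\<^sup>2 * cos (r * \<eta> * u)) \<partial>\<mu>\<bar> \<le> 1 * levy_qL \<mu> r" for \<eta>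
    by (rule small_jumps_integrable[OF _ b2]; measurable)+
  have w: "integrable \<mu> (\<lambda>u. K * (small_jumps r u * (r * u)\<^sup>2))" for K
    unfolding small_jumps_def by (intro integrable_mult_right qL_integrable)
  show "(0::real) \<le> 1" by simp
  fix x :: real
  show "(small_symbol t r has_real_derivative t * (\<integral>u. small_jumps r u * (r * u * sin (r * x * u)) \<partial>\<mu>)) (at x)"
    unfolding small_symbol_def[abs_def]
  proof (rule DERIV_cmult, rule has_real_derivative_integral[where a="x - 1" and b="x + 1" and w="\<lambda>u. (\<bar>x\<bar> + 1) * (small_jumps r u * (r * u)\<^sup>2)"])
    fix s u assume s: "x - 1 < s" "s < x + 1"
    have "((\<lambda>s. 1 - cos (r * s * u)) has_real_derivative r * u * sin (r * s * u)) (at s)"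
      by (auto intro!: derivative_eq_intros)
    then show "((\<lambda>s. small_jumps r u * (1 - cos (r * s * u))) has_real_derivative small_jumps r u * (r * u * sin (r * s * u))) (at s)"
      by (rule DERIV_cmult)
    have "\<bar>s\<bar> \<le> \<bar>x\<bar> + 1" using s by auto
    then have "\<bar>s\<bar> * (r * u)\<^sup>2 \<le> (\<bar>x\<bar> + 1) * (r * u)\<^sup>2" by (intro mult_right_mono) auto
    with b1[of u s] show "\<bar>small_jumps r u * (r * u * sin (r * s * u))\<bar> \<le> (\<bar>x\<bar> + 1) * (small_jumps r u * (r * u)\<^sup>2)"
      by (auto simp: small_jumps_def indicator_def)
  next
    show "integrable \<mu> (\<lambda>u. small_jumps r u * (1 - cos (r * s * u)))" for s by (rule I0(1))
    show "integrable \<mu> (\<lambda>u. (\<bar>x\<bar> + 1) * (small_jumps r u * (r * u)\<^sup>2))" by (rule w)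
  qed (auto simp: measurable_cong_sets[OF sets_mu refl])
  show "((\<lambda>\<eta>. t * (\<integral>u. small_jumps r u * (r * u * sin (r * \<eta> * u)) \<partial>\<mu>)) has_real_derivative
      t * (\<integral>u. small_jumps r u * ((r * u)\<^sup>2 * cos (r * x * u)) \<partial>\<mu>)) (at x)"
  proof (rule DERIV_cmult, rule has_real_derivative_integral[where a="x - 1" and b="x + 1" and w="\<lambda>u. 1 * (small_jumps r u * (r * u)\<^sup>2)"])
    fix s u assume s: "x - 1 < s" "s < x + 1"
    have "((\<lambda>s. r * u * sin (r * s * u)) has_real_derivative (r * u)\<^sup>2 * cos (r * s * u)) (at s)"
      by (auto intro!: derivative_eq_intros simp: power2_eq_square)
    then show "((\<lambda>s. small_jumps r u * (r * u * sin (r * s * u))) has_real_derivative small_jumps r u * ((r * u)\<^sup>2 * cos (r * s * u))) (at s)"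
      by (rule DERIV_cmult)
    show "\<bar>small_jumps r u * ((r * u)\<^sup>2 * cos (r * s * u))\<bar> \<le> 1 * (small_jumps r u * (r * u)\<^sup>2)"
      using b2[of u s] by (auto simp: small_jumps_def indicator_def)
  next
    show "integrable \<mu> (\<lambda>u. small_jumps r u * (r * u * sin (r * s * u)))" for s by (rule I1(1))
    show "integrable \<mu> (\<lambda>u. 1 * (small_jumps r u * (r * u)\<^sup>2))" by (rule w)
  qed (auto simp: measurable_cong_sets[OF sets_mu refl])
  have abs_t: "\<bar>t * y\<bar> \<le> K" if "\<bar>y\<bar> \<le> K * levy_qL \<mu> r" "0 \<le> K" for y K
  proof -
    have "t * \<bar>y\<bar> \<le> K * (t * levy_qL \<mu> r)" using that t by (simp add: mult_left_mono mult.left_commute)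
    also have "\<dots> \<le> K * 1" using that tL by (intro mult_left_mono) auto
    finally show ?thesis using t by (simp add: abs_mult)
  qed
  have "x\<^sup>2 \<le> (1 + \<bar>x\<bar>)\<^sup>2" by (rule abs_le_square_iff[THEN iffD1]) simp
  then show "\<bar>small_symbol t r x\<bar> \<le> 1 * (1 + \<bar>x\<bar>)\<^sup>2"
    unfolding small_symbol_def using abs_t[OF I0(2)[of x]] by simp
  have "\<bar>x\<bar> \<le> (1 + \<bar>x\<bar>)\<^sup>2" by (simp add: power2_eq_square algebra_simps)
  then show "\<bar>t * (\<integral>u. small_jumps r u * (r * u * sin (r * x * u)) \<partial>\<mu>)\<bar> \<le> 1 * (1 + \<bar>x\<bar>)\<^sup>2"
    using abs_t[OF I1(2)[of x]] by simp
  have "\<bar>t * (\<integral>u. small_jumps r u * ((r * u)\<^sup>2 * cos (r * x * u)) \<partial>\<mu>)\<bar> \<le> 1"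
    using abs_t[OF I2(2)[of x]] by simp
  also have "1 \<le> 1 * (1 + \<bar>x\<bar>)\<^sup>2" by simp
  finally show "\<bar>t * (\<integral>u. small_jumps r u * ((r * u)\<^sup>2 * cos (r * x * u)) \<partial>\<mu>)\<bar> \<le> 1 * (1 + \<bar>x\<bar>)\<^sup>2" .
next
  show "continuous_on UNIV (\<lambda>\<eta>. t * (\<integral>u. small_jumps r u * ((r * u)\<^sup>2 * cos (r * \<eta> * u)) \<partial>\<mu>))"
    unfolding continuous_on_sequentially
  proof (intro allI ballI impI, elim conjE)
    fix X :: "nat \<Rightarrow> real" and a assume X: "X \<longlonglongrightarrow> a"
    have "(\<lambda>n. \<integral>u. small_jumps r u * ((r * u)\<^sup>2 * cos (r * X n * u)) \<partial>\<mu>) \<longlonglongrightarrow> (\<integral>u. small_jumps r u * ((r * u)\<^sup>2 * cos (r * a * u)) \<partial>\<mu>)"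
    proof (rule integral_dominated_convergence[where w="\<lambda>u. small_jumps r u * (r * u)\<^sup>2"])
      show "integrable \<mu> (\<lambda>u. small_jumps r u * (r * u)\<^sup>2)"
        unfolding small_jumps_def by (rule qL_integrable)
      show "AE u in \<mu>. (\<lambda>n. small_jumps r u * ((r * u)\<^sup>2 * cos (r * X n * u))) \<longlonglongrightarrow> small_jumps r u * ((r * u)\<^sup>2 * cos (r * a * u))"
        using X by (intro AE_I2 tendsto_intros)
      show "AE u in \<mu>. norm (small_jumps r u * ((r * u)\<^sup>2 * cos (r * X n * u))) \<le> small_jumps r u * (r * u)\<^sup>2" for n
        by (intro AE_I2) (auto simp: small_jumps_def indicator_def abs_mult mult_left_le)
    qed (auto simp: measurable_cong_sets[OF sets_mu refl])
    then show "((\<lambda>\<eta>. t * (\<integral>u. small_jumps r u * ((r * u)\<^sup>2 * cos (r * \<eta> * u)) \<partial>\<mu>)) \<circ> X) \<longlonglongrightarrow> t * (\<integral>u. small_jumps r u * ((r * u)\<^sup>2 * cos (r * a * u)) \<partial>\<mu>)"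
      by (auto simp: comp_def intro: tendsto_mult_left)
  qed
qed

lemma small_symbol_nonneg: "0 \<le> t \<Longrightarrow> 0 \<le> small_symbol t r \<eta>"
  unfolding small_symbol_def by (intro mult_nonneg_nonneg integral_nonneg_AE AE_I2) (auto simp: small_jumps_def)

text \<open>
  Discarding the jumps with \<open>\<bar>r \<eta> u\<bar> > 1\<close> leaves the region where the cosine is comparable to its quadratic
  approximation.
\<close>

lemma small_symbol_ge:
  assumes t: "0 \<le> t" and r: "0 < r" and \<eta>: "1 \<le> \<bar>\<eta>\<bar>"
  shows "t / 4 * levy_qL \<mu> (\<bar>\<eta>\<bar> * r) \<le> small_symbol t r \<eta>"
proof -
  have "1 / 4 * levy_qL \<mu> (\<bar>\<eta>\<bar> * r) = (\<integral>u. 1 / 4 * (small_jumps (\<bar>\<eta>\<bar> * r) u * (\<bar>\<eta>\<bar> * r * u)\<^sup>2) \<partial>\<mu>)"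
    by (simp add: qL_eq small_jumps_def)
  also have "\<dots> \<le> (\<integral>u. small_jumps r u * (1 - cos (r * \<eta> * u)) \<partial>\<mu>)"
  proof (rule integral_mono)
    show "integrable \<mu> (\<lambda>u. 1 / 4 * (small_jumps (\<bar>\<eta>\<bar> * r) u * (\<bar>\<eta>\<bar> * r * u)\<^sup>2))"
      unfolding small_jumps_def by (intro integrable_mult_right qL_integrable)
    show "integrable \<mu> (\<lambda>u. small_jumps r u * (1 - cos (r * \<eta> * u)))"
      by (rule small_jumps_integrable(1)[where K="\<eta>\<^sup>2"])
         (use one_minus_cos_le[of "r * \<eta> * _"] in \<open>auto simp: power_mult_distrib mult_ac\<close>)
    fix u
    show "1 / 4 * (small_jumps (\<bar>\<eta>\<bar> * r) u * (\<bar>\<eta>\<bar> * r * u)\<^sup>2) \<le> small_jumps r u * (1 - cos (r * \<eta> * u))"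
    proof (cases "\<bar>u * (\<bar>\<eta>\<bar> * r)\<bar> \<le> 1")
      case True
      have "1 * \<bar>u * r\<bar> \<le> \<bar>\<eta>\<bar> * \<bar>u * r\<bar>" using \<eta> by (intro mult_right_mono) auto
      then have "\<bar>u * r\<bar> \<le> 1" using True by (simp add: abs_mult mult_ac)
      moreover have "\<bar>r * \<eta> * u\<bar> \<le> 1" using True by (simp add: abs_mult mult_ac)
      then have "(r * \<eta> * u)\<^sup>2 / 4 \<le> 1 - cos (r * \<eta> * u)" by (rule one_minus_cos_ge)
      moreover have "(\<bar>\<eta>\<bar> * r * u)\<^sup>2 = (r * \<eta> * u)\<^sup>2" by (simp add: power_mult_distrib mult_ac)
      ultimately show ?thesis using True by (simp add: small_jumps_def)
    next
      case False
      then show ?thesis by (auto simp: small_jumps_def)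
    qed
  qed
  finally show ?thesis unfolding small_symbol_def using t mult_left_mono by fastforce
qed

definition large_jumps :: "real \<Rightarrow> real measure" where
  "large_jumps r = density \<mu> (\<lambda>u. ennreal (1 - small_jumps r u))"

text \<open>
  The integrand of \<open>q\<^sup>U(r)\<close> equals \<open>1\<close> on the jumps with \<open>\<bar>r u\<bar> > 1\<close>, so their total mass is finite and
  their contribution to \<open>q\<close> is a compound Poisson exponent.
\<close>

lemma large_jumps:
  shows "finite_measure (large_jumps r)" "sets (large_jumps r) = sets borel" "measure (large_jumps r) UNIV \<le> levy_qU \<mu> r"
    "levy_q \<mu> \<xi> = (\<integral>u. small_jumps r u * (1 - cos (\<xi> * u)) \<partial>\<mu>) + (measure (large_jumps r) UNIV - (\<integral>u. cos (\<xi> * u) \<partial>large_jumps r))"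
proof -
  have nn: "0 \<le> 1 - small_jumps r u" for u by (simp add: small_jumps_def)
  have le: "1 - small_jumps r u \<le> min ((r * u)\<^sup>2) 1" for u
  proof (cases "\<bar>u * r\<bar> \<le> 1")
    case False
    then have "1 \<le> (u * r)\<^sup>2" by (metis abs_square_le_1 less_le not_le power2_eq_square nle_le)
    with False show ?thesis by (simp add: small_jumps_def mult.commute)
  qed (simp add: small_jumps_def)
  have i: "integrable \<mu> (\<lambda>u. 1 - small_jumps r u)"
    by (rule Bochner_Integration.integrable_bound[OF qU_integrable[of r]])
       (use le nn in \<open>auto intro!: AE_I2 simp: measurable_cong_sets[OF sets_mu refl]\<close>)
  have em: "emeasure (large_jumps r) UNIV = ennreal (\<integral>u. 1 - small_jumps r u \<partial>\<mu>)"
    unfolding large_jumps_def using nn_integral_eq_integral[OF i] nn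
    by (subst emeasure_density) (auto simp: measurable_cong_sets[OF sets_mu refl])
  show "sets (large_jumps r) = sets borel" by (simp add: large_jumps_def)
  have sp: "space (large_jumps r) = UNIV" by (simp add: large_jumps_def)
  show "finite_measure (large_jumps r)"
    by (rule finite_measureI) (simp add: sp em)
  have m: "measure (large_jumps r) UNIV = (\<integral>u. 1 - small_jumps r u \<partial>\<mu>)"
    unfolding measure_def em using nn by (simp add: integral_nonneg_AE)
  show "measure (large_jumps r) UNIV \<le> levy_qU \<mu> r"
    unfolding m levy_qU_def by (intro integral_mono i qU_integrable le)
  have c: "(\<integral>u. cos (\<xi> * u) \<partial>large_jumps r) = (\<integral>u. (1 - small_jumps r u) * cos (\<xi> * u) \<partial>\<mu>)"
    unfolding large_jumps_def using nn
    by (subst integral_density) (auto simp: measurable_cong_sets[OF sets_mu refl])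
  have ic: "integrable \<mu> (\<lambda>u. (1 - small_jumps r u) * cos (\<xi> * u))"
    by (rule Bochner_Integration.integrable_bound[OF i])
       (auto intro!: AE_I2 mult_left_le simp: measurable_cong_sets[OF sets_mu refl] abs_mult)
  have full: "integrable \<mu> (\<lambda>u. 1 - cos (\<xi> * u))"
  proof (rule integrable_levy[where K="2 * max 1 (\<xi>\<^sup>2)"])
    fix u
    have "1 - cos (\<xi> * u) \<le> 2" using cos_ge_minus_one[of "\<xi> * u"] by linarith
    note b2 = this
    define s where "s = (\<xi> * u)\<^sup>2"
    have s0: "0 \<le> s" "1 - cos (\<xi> * u) \<le> s" using one_minus_cos_le[of "\<xi> * u"] by (simp_all add: s_def)
    then have "1 - cos (\<xi> * u) \<le> 2 * min s 1"
      using b2 by (auto simp: min_def)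
    then have "1 - cos (\<xi> * u) \<le> 2 * min ((\<xi> * u)\<^sup>2) 1" by (simp add: s_def)
    then show "\<bar>1 - cos (\<xi> * u)\<bar> \<le> 2 * max 1 (\<xi>\<^sup>2) * min 1 (u\<^sup>2)" using min_scaled_le[of \<xi> u] by simp
  qed measurable
  have isj: "integrable \<mu> (\<lambda>u. small_jumps r u * (1 - cos (\<xi> * u)))"
    by (rule Bochner_Integration.integrable_bound[OF full])
       (auto intro!: AE_I2 simp: measurable_cong_sets[OF sets_mu refl] abs_mult small_jumps_def indicator_def)
  have "levy_q \<mu> \<xi> = (\<integral>u. small_jumps r u * (1 - cos (\<xi> * u)) + ((1 - small_jumps r u) - (1 - small_jumps r u) * cos (\<xi> * u)) \<partial>\<mu>)"
    unfolding levy_q_def by (intro Bochner_Integration.integral_cong) (auto simp: algebra_simps)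
  also have "\<dots> = (\<integral>u. small_jumps r u * (1 - cos (\<xi> * u)) \<partial>\<mu>) + (measure (large_jumps r) UNIV - (\<integral>u. cos (\<xi> * u) \<partial>large_jumps r))"
    unfolding c m using i ic isj by (simp only: Bochner_Integration.integral_add Bochner_Integration.integral_diff Bochner_Integration.integrable_diff)
  finally show "levy_q \<mu> \<xi> = (\<integral>u. small_jumps r u * (1 - cos (\<xi> * u)) \<partial>\<mu>) + (measure (large_jumps r) UNIV - (\<integral>u. cos (\<xi> * u) \<partial>large_jumps r))" .
qed

lemma levy_q_measurable[measurable]: "levy_q \<mu> \<in> borel_measurable borel"
  unfolding levy_q_def[abs_def] by measurable

lemma levy_q_nonneg: "0 \<le> levy_q \<mu> \<xi>"
  unfolding levy_q_def by (intro integral_nonneg_AE) auto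

end

context levy_A1
begin

text \<open>
  With \<open>r = \<rho>\<^sub>t\<close> and \<open>t q(\<xi>) = \<sigma>(\<xi> / r) + t (N - B(\<xi>))\<close>, the factor \<open>(t q)\<^sup>i\<close> is expanded by the binomial
  theorem.  Each term is a rescaled smooth symbol, to which the jump multipliers are applied; they are
  bounded because \<open>t N \<le> t q\<^sup>U(\<rho>\<^sub>t) = 1\<close>.
\<close>

lemma fnorm_heat_symbol:
  assumes T: "0 < T"
  obtains C where "0 \<le> C" "\<And>t. 0 < t \<Longrightarrow> t \<le> T \<Longrightarrow> integrable lborel (heat_symbol \<mu> i j t) \<and>
     fnorm (heat_symbol \<mu> i j t) \<le> ennreal (levy_rho \<mu> t ^ j * (1 / t) ^ i * C)"
proof -
  define a where "a = levy_rho \<mu> T"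
  have a: "0 < a" using rho_root(1)[OF T] by (simp add: a_def)
  obtain c \<alpha> where c: "0 < c" "0 < \<alpha>"
    "\<And>l \<xi>. a \<le> \<xi> \<Longrightarrow> 1 \<le> l \<Longrightarrow> c * l powr \<alpha> * levy_qU \<mu> \<xi> \<le> levy_qU \<mu> (l * \<xi>)"
    using qU_growth[OF a] by metis
  obtain \<beta> where \<beta>: "1 < \<beta>" "\<And>\<xi>. a \<le> \<xi> \<Longrightarrow> levy_qU \<mu> \<xi> \<le> \<beta> * levy_qL \<mu> \<xi>"
    using qU_le_qL_on[OF a] by metis
  define c' where "c' = c / (4 * \<beta>)"
  have c': "0 < c'" using c \<beta> by (simp add: c'_def)
  have "\<forall>k. \<exists>C. 0 \<le> C \<and> (\<forall>\<sigma> \<sigma>1 \<sigma>2. poly_bounded 1 2 \<sigma> \<sigma>1 \<sigma>2 \<longrightarrow> (\<forall>\<eta>. 0 \<le> \<sigma> \<eta>) \<longrightarrow>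
     (\<forall>\<eta>. 1 \<le> \<bar>\<eta>\<bar> \<longrightarrow> c' * \<bar>\<eta>\<bar> powr \<alpha> \<le> \<sigma> \<eta>) \<longrightarrow>
     integrable lborel (\<lambda>\<eta>. \<eta> ^ j * \<sigma> \<eta> ^ k * exp (- \<sigma> \<eta>)) \<and>
     fnorm (\<lambda>\<eta>. \<eta> ^ j * \<sigma> \<eta> ^ k * exp (- \<sigma> \<eta>)) \<le> ennreal C)"
  proof
    fix k
    show "\<exists>C. 0 \<le> C \<and> (\<forall>\<sigma> \<sigma>1 \<sigma>2. poly_bounded 1 2 \<sigma> \<sigma>1 \<sigma>2 \<longrightarrow> (\<forall>\<eta>. 0 \<le> \<sigma> \<eta>) \<longrightarrow>
     (\<forall>\<eta>. 1 \<le> \<bar>\<eta>\<bar> \<longrightarrow> c' * \<bar>\<eta>\<bar> powr \<alpha> \<le> \<sigma> \<eta>) \<longrightarrow>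
     integrable lborel (\<lambda>\<eta>. \<eta> ^ j * \<sigma> \<eta> ^ k * exp (- \<sigma> \<eta>)) \<and>
     fnorm (\<lambda>\<eta>. \<eta> ^ j * \<sigma> \<eta> ^ k * exp (- \<sigma> \<eta>)) \<le> ennreal C)"
      by (rule fnorm_power_exp_bound[OF c' c(2), of j k]) (intro exI conjI allI impI; blast)
  qed
  from choice[OF this] obtain C where C: "\<And>k. 0 \<le> C k"
    "\<And>k \<sigma> \<sigma>1 \<sigma>2. poly_bounded 1 2 \<sigma> \<sigma>1 \<sigma>2 \<Longrightarrow> (\<And>\<eta>. 0 \<le> \<sigma> \<eta>) \<Longrightarrow>
     (\<And>\<eta>. 1 \<le> \<bar>\<eta>\<bar> \<Longrightarrow> c' * \<bar>\<eta>\<bar> powr \<alpha> \<le> \<sigma> \<eta>) \<Longrightarrow>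
     integrable lborel (\<lambda>\<eta>. \<eta> ^ j * \<sigma> \<eta> ^ k * exp (- \<sigma> \<eta>)) \<and>
     fnorm (\<lambda>\<eta>. \<eta> ^ j * \<sigma> \<eta> ^ k * exp (- \<sigma> \<eta>)) \<le> ennreal (C k)" by blast
  show thesis
  proof (rule that[of "\<Sum>k\<le>i. real (i choose k) * (2 ^ (i - k) * C k)"])
    show "0 \<le> (\<Sum>k\<le>i. real (i choose k) * (2 ^ (i - k) * C k))" using C(1) by (intro sum_nonneg) auto
    fix t assume t: "0 < t" "t \<le> T"
    define r where "r = levy_rho \<mu> t"
    have r: "0 < r" "a \<le> r" "levy_qU \<mu> r = 1 / t" using rho_root[OF t(1)] rho_anti[OF t] by (auto simp: r_def a_def)
    let ?\<sigma> = "small_symbol t r"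
    let ?\<nu> = "large_jumps r"
    define N where "N = measure ?\<nu> UNIV"
    define B where "B \<xi> = (\<integral>u. cos (\<xi> * u) \<partial>?\<nu>)" for \<xi>
    note \<nu> = large_jumps(1,2)[of r]
    have tN: "t * N \<le> 1"
    proof -
      have "t * N \<le> t * (1 / t)" unfolding N_def using large_jumps(3)[of r] r(3) t by (intro mult_left_mono) auto
      then show ?thesis using t by simp
    qed
    have "t * levy_qL \<mu> r \<le> t * (1 / t)" using qL_le_qU[of r] r(3) t by (intro mult_left_mono) auto
    then have "t * levy_qL \<mu> r \<le> 1" using t by simp
    note pb = small_symbol_poly_bounded[OF t(1) this]
    have \<sigma>0: "0 \<le> ?\<sigma> \<eta>" for \<eta> using t by (intro small_symbol_nonneg) auto
    have lb: "c' * \<bar>\<eta>\<bar> powr \<alpha> \<le> ?\<sigma> \<eta>" if \<eta>: "1 \<le> \<bar>\<eta>\<bar>" for \<eta>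
    proof -
      have "1 * a \<le> \<bar>\<eta>\<bar> * r" using \<eta> r a by (intro mult_mono) auto
      then have ar: "a \<le> \<bar>\<eta>\<bar> * r" by simp
      have "c * \<bar>\<eta>\<bar> powr \<alpha> * (1 / t) \<le> levy_qU \<mu> (\<bar>\<eta>\<bar> * r)" using c(3)[OF r(2) \<eta>] r(3) by simp
      also have "\<dots> \<le> \<beta> * levy_qL \<mu> (\<bar>\<eta>\<bar> * r)" by (rule \<beta>(2)[OF ar])
      finally have "t / (4 * \<beta>) * (c * \<bar>\<eta>\<bar> powr \<alpha> * (1 / t)) \<le> t / (4 * \<beta>) * (\<beta> * levy_qL \<mu> (\<bar>\<eta>\<bar> * r))"
        using t \<beta> by (intro mult_left_mono) auto
      then have "c' * \<bar>\<eta>\<bar> powr \<alpha> \<le> t / 4 * levy_qL \<mu> (\<bar>\<eta>\<bar> * r)" using t \<beta> by (simp add: c'_def)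
      also have "\<dots> \<le> ?\<sigma> \<eta>" using t r by (intro small_symbol_ge \<eta>) auto
      finally show ?thesis .
    qed
    let ?b = "\<lambda>k \<eta>. \<eta> ^ j * ?\<sigma> \<eta> ^ k * exp (- ?\<sigma> \<eta>)"
    have base: "integrable lborel (?b k)" "fnorm (?b k) \<le> ennreal (C k)" for k
      using C(2)[OF pb \<sigma>0 lb, of k] by auto
    have bm: "?b k \<in> borel_measurable borel" for k using base(1)[of k] by auto
    \<comment> \<open>The terms are built up from the smooth symbol \<open>A\<close>, through the factor \<open>exp (- t (N - B))\<close> in \<open>E\<close>, to the power of \<open>t (N - B)\<close> in \<open>F\<close>.\<close>
    define A where "A k \<xi> = ?b k (\<xi> / r)" for k \<xi>
    have A: "integrable lborel (A k)" "fnorm (A k) \<le> ennreal (C k)" for k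
    proof -
      show "integrable lborel (A k)"
        using lborel_integrable_real_affine[OF base(1)[of k], of "1 / r" 0] r by (simp add: A_def[abs_def])
      show "fnorm (A k) \<le> ennreal (C k)"
        unfolding A_def[abs_def] using fnorm_rescale[OF r(1) bm[of k]] base(2)[of k] by simp
    qed
    define E where "E k \<xi> = A k \<xi> * exp (- (t * (N - B \<xi>)))" for k \<xi>
    have E: "integrable lborel (E k)" "fnorm (E k) \<le> ennreal (C k)" for k
      using fnorm_mult_exp_gap[OF \<nu> A(1)[of k], of t] A(2)[of k] t unfolding E_def[abs_def] N_def B_def by auto
    define F where "F k \<xi> = E k \<xi> * (t * (N - B \<xi>)) ^ (i - k)" for k \<xi>
    have F: "integrable lborel (F k)" "fnorm (F k) \<le> ennreal (2 ^ (i - k) * C k)" for k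
    proof -
      have *: "integrable lborel (F k) \<and> fnorm (F k) \<le> 2 ^ (i - k) * fnorm (E k)"
        using fnorm_mult_gap_power[OF \<nu> E(1)[of k], of t "i - k"] t tN unfolding F_def[abs_def] N_def B_def by auto
      then show "integrable lborel (F k)" by simp
      have "fnorm (F k) \<le> 2 ^ (i - k) * fnorm (E k)" using * by simp
      also have "\<dots> \<le> 2 ^ (i - k) * ennreal (C k)" by (intro mult_left_mono E(2)) simp
      also have "\<dots> = ennreal (2 ^ (i - k) * C k)" using C(1)[of k] by (simp add: ennreal_mult ennreal_power[symmetric])
      finally show "fnorm (F k) \<le> ennreal (2 ^ (i - k) * C k)" .
    qed
    have q: "t * levy_q \<mu> \<xi> = ?\<sigma> (\<xi> / r) + t * (N - B \<xi>)" for \<xi>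
      unfolding small_symbol_def N_def B_def large_jumps(4)[of \<xi> r] using r by (simp add: algebra_simps)
    have sym: "heat_symbol \<mu> i j t = (\<lambda>\<xi>. (r ^ j * (1 / t) ^ i) * (\<Sum>k\<le>i. real (i choose k) * F k \<xi>))"
    proof
      fix \<xi>
      have "(\<Sum>k\<le>i. real (i choose k) * F k \<xi>) = (\<xi> / r) ^ j * exp (- (t * levy_q \<mu> \<xi>)) * (\<Sum>k\<le>i. real (i choose k) * ?\<sigma> (\<xi> / r) ^ k * (t * (N - B \<xi>)) ^ (i - k))"
        unfolding sum_distrib_left F_def E_def A_def q minus_add_distrib exp_add by (intro sum.cong refl) (simp only: mult_ac)
      also have "(\<Sum>k\<le>i. real (i choose k) * ?\<sigma> (\<xi> / r) ^ k * (t * (N - B \<xi>)) ^ (i - k)) = (t * levy_q \<mu> \<xi>) ^ i"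
        unfolding q by (rule binomial_ring[symmetric])
      finally show "heat_symbol \<mu> i j t \<xi> = (r ^ j * (1 / t) ^ i) * (\<Sum>k\<le>i. real (i choose k) * F k \<xi>)"
        using r t by (simp add: heat_symbol_def power_divide power_mult_distrib)
    qed
    have iF: "integrable lborel (\<lambda>\<xi>. real (i choose k) * F k \<xi>)" for k using F(1) by (intro integrable_mult_right)
    have iS: "integrable lborel (\<lambda>\<xi>. \<Sum>k\<le>i. real (i choose k) * F k \<xi>)"
      by (intro Bochner_Integration.integrable_sum iF)
    have K0: "0 \<le> r ^ j * (1 / t) ^ i" using r t by simp
    have Fm: "F k \<in> borel_measurable borel" for k using F(1)[of k] by auto
    have "fnorm (heat_symbol \<mu> i j t) = ennreal (r ^ j * (1 / t) ^ i) * fnorm (\<lambda>\<xi>. \<Sum>k\<le>i. real (i choose k) * F k \<xi>)"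
      unfolding sym using iS K0 by (subst fnorm_cmult) auto
    also have "\<dots> \<le> ennreal (r ^ j * (1 / t) ^ i) * (\<Sum>k\<le>i. fnorm (\<lambda>\<xi>. real (i choose k) * F k \<xi>))"
      by (intro mult_left_mono fnorm_sum iF) auto
    also have "\<dots> \<le> ennreal (r ^ j * (1 / t) ^ i) * (\<Sum>k\<le>i. ennreal (real (i choose k) * (2 ^ (i - k) * C k)))"
    proof (intro mult_left_mono sum_mono)
      fix k
      have "fnorm (\<lambda>\<xi>. real (i choose k) * F k \<xi>) = ennreal (real (i choose k)) * fnorm (F k)"
        using fnorm_cmult[OF Fm[of k], of "real (i choose k)"] by simp
      also have "\<dots> \<le> ennreal (real (i choose k)) * ennreal (2 ^ (i - k) * C k)"
        by (intro mult_left_mono F(2)) auto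
      also have "\<dots> = ennreal (real (i choose k) * (2 ^ (i - k) * C k))"
        using C(1)[of k] by (intro ennreal_mult[symmetric]) auto
      finally show "fnorm (\<lambda>\<xi>. real (i choose k) * F k \<xi>) \<le> ennreal (real (i choose k) * (2 ^ (i - k) * C k))" .
    qed simp
    also have "(\<Sum>k\<le>i. ennreal (real (i choose k) * (2 ^ (i - k) * C k))) = ennreal (\<Sum>k\<le>i. real (i choose k) * (2 ^ (i - k) * C k))"
      using C(1) by (intro sum_ennreal) auto
    also have "ennreal (r ^ j * (1 / t) ^ i) * \<dots> = ennreal (r ^ j * (1 / t) ^ i * (\<Sum>k\<le>i. real (i choose k) * (2 ^ (i - k) * C k)))"
      using K0 C(1) by (intro ennreal_mult[symmetric] sum_nonneg) auto
    finally have fin: "fnorm (heat_symbol \<mu> i j t) \<le> ennreal (r ^ j * (1 / t) ^ i * (\<Sum>k\<le>i. real (i choose k) * (2 ^ (i - k) * C k)))" .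
    have "integrable lborel (heat_symbol \<mu> i j t)"
      unfolding sym using iS by (rule integrable_mult_right)
    with fin show "integrable lborel (heat_symbol \<mu> i j t) \<and>
      fnorm (heat_symbol \<mu> i j t) \<le> ennreal (levy_rho \<mu> t ^ j * (1 / t) ^ i * (\<Sum>k\<le>i. real (i choose k) * (2 ^ (i - k) * C k)))"
      by (simp add: r_def)
  qed
qed

lemma heat_symbol_integrable: "0 < t \<Longrightarrow> integrable lborel (heat_symbol \<mu> i j t)"
  by (rule fnorm_heat_symbol[of t i j]) auto

lemma heat_deriv_L1:
  assumes T: "0 < T"
  obtains C where "0 \<le> C" "\<And>t. 0 < t \<Longrightarrow> t \<le> T \<Longrightarrow>
     (\<integral>\<^sup>+x. ennreal \<bar>heat_deriv \<mu> i j t x\<bar> \<partial>lborel) \<le> ennreal (C * levy_rho \<mu> t ^ j * (1 / t) ^ i)"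
proof -
  obtain C where C: "0 \<le> C" "\<And>t. 0 < t \<Longrightarrow> t \<le> T \<Longrightarrow> integrable lborel (heat_symbol \<mu> i j t) \<and>
     fnorm (heat_symbol \<mu> i j t) \<le> ennreal (levy_rho \<mu> t ^ j * (1 / t) ^ i * C)"
    using fnorm_heat_symbol[OF T, of i j] by blast
  show thesis
  proof (rule that[OF C(1)])
    fix t assume t: "0 < t" "t \<le> T"
    let ?S = "heat_symbol \<mu> i j t"
    have iS: "integrable lborel ?S" using C(2)[OF t] by simp
    have le: "\<bar>heat_deriv \<mu> i j t x\<bar> \<le> norm (fint ?S x)" for x
    proof -
      let ?th = "cis (- (real j * (pi / 2)))"
      have i: "integrable lborel (\<lambda>\<xi>. ?th * (?S \<xi> *\<^sub>R cis (- (x * \<xi>))))"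
        by (intro integrable_mult_right fint_integrable iS) measurable
      have "?th * fint ?S x = (\<integral>\<xi>. ?th * (?S \<xi> *\<^sub>R cis (- (x * \<xi>))) \<partial>lborel)"
        unfolding fint_def by (rule integral_mult_right_zero[symmetric])
      then have "Re (?th * fint ?S x) = (\<integral>\<xi>. Re (?th * (?S \<xi> *\<^sub>R cis (- (x * \<xi>)))) \<partial>lborel)"
        using integral_Re[OF i] by simp
      also have "\<dots> = (\<integral>\<xi>. ?S \<xi> * cos (x * \<xi> + real j * (pi / 2)) \<partial>lborel)"
      proof (rule Bochner_Integration.integral_cong[OF refl])
        fix \<xi>
        have "?th * (?S \<xi> *\<^sub>R cis (- (x * \<xi>))) = ?S \<xi> *\<^sub>R cis (- (x * \<xi> + real j * (pi / 2)))"
          by (simp add: cis_mult add.commute)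
        then show "Re (?th * (?S \<xi> *\<^sub>R cis (- (x * \<xi>)))) = ?S \<xi> * cos (x * \<xi> + real j * (pi / 2))"
          by (simp only: scaleR_complex.sel cis.sel cos_minus)
      qed
      finally have R: "Re (?th * fint ?S x) = (\<integral>\<xi>. ?S \<xi> * cos (x * \<xi> + real j * (pi / 2)) \<partial>lborel)" .
      have "(\<integral>\<xi>. \<xi> ^ j * cos (x * \<xi> + real j * (pi / 2)) * (- levy_q \<mu> \<xi>) ^ i * exp (- (t * levy_q \<mu> \<xi>)) \<partial>lborel)
        = (\<integral>\<xi>. (-1) ^ i * (?S \<xi> * cos (x * \<xi> + real j * (pi / 2))) \<partial>lborel)"
        by (intro Bochner_Integration.integral_cong refl) (simp add: heat_symbol_def power_minus[of "levy_q \<mu> _"] mult_ac)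
      also have "\<dots> = (-1) ^ i * Re (?th * fint ?S x)" unfolding R by simp
      finally have "\<bar>heat_deriv \<mu> i j t x\<bar> = 1 / (2 * pi) * \<bar>Re (?th * fint ?S x)\<bar>"
        by (simp add: heat_deriv_def abs_mult)
      also have "\<dots> \<le> 1 * \<bar>Re (?th * fint ?S x)\<bar>"
        using pi_gt3 by (intro mult_right_mono) auto
      also have "\<dots> \<le> norm (fint ?S x)" using abs_Re_le_cmod[of "?th * fint ?S x"] by (simp add: norm_mult)
      finally show ?thesis .
    qed
    have "(\<integral>\<^sup>+x. ennreal \<bar>heat_deriv \<mu> i j t x\<bar> \<partial>lborel) \<le> fnorm ?S"
      unfolding fnorm_def by (intro nn_integral_mono ennreal_leI le)
    also have "\<dots> \<le> ennreal (C * levy_rho \<mu> t ^ j * (1 / t) ^ i)" using C(2)[OF t] by (simp add: mult_ac)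
    finally show "(\<integral>\<^sup>+x. ennreal \<bar>heat_deriv \<mu> i j t x\<bar> \<partial>lborel) \<le> ennreal (C * levy_rho \<mu> t ^ j * (1 / t) ^ i)" .
  qed
qed

end

section \<open>A pointwise envelope of the unperturbed density\<close>

context levy_A1
begin

lemma heat_integrand_le:
  assumes "t0 \<le> t"
  shows "\<bar>\<xi> ^ j * cos a * (- levy_q \<mu> \<xi>) ^ i * exp (- (t * levy_q \<mu> \<xi>))\<bar> \<le> \<bar>heat_symbol \<mu> i j t0 \<xi>\<bar>"
proof -
  let ?q = "levy_q \<mu> \<xi>"
  have "\<bar>\<xi> ^ j * cos a * (- ?q) ^ i * exp (- (t * ?q))\<bar> = (\<bar>\<xi>\<bar> ^ j * ?q ^ i) * (\<bar>cos a\<bar> * exp (- (t * ?q)))"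
    using levy_q_nonneg[of \<xi>] by (simp add: abs_mult power_abs mult_ac)
  also have "\<dots> \<le> (\<bar>\<xi>\<bar> ^ j * ?q ^ i) * (1 * exp (- (t0 * ?q)))"
    using levy_q_nonneg[of \<xi>] assms by (intro mult_left_mono mult_mono) (auto intro: mult_right_mono)
  also have "\<dots> = \<bar>heat_symbol \<mu> i j t0 \<xi>\<bar>"
    using levy_q_nonneg[of \<xi>] by (simp add: heat_symbol_def abs_mult power_abs)
  finally show ?thesis .
qed

lemma heat_integrand_integrable:
  assumes "0 < t"
  shows "integrable lborel (\<lambda>\<xi>. \<xi> ^ j * cos (x * \<xi> + b) * (- levy_q \<mu> \<xi>) ^ i * exp (- (t * levy_q \<mu> \<xi>)))"
proof (rule Bochner_Integration.integrable_bound[OF heat_symbol_integrable[OF assms, of i j]])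
  show "AE \<xi> in lborel. norm (\<xi> ^ j * cos (x * \<xi> + b) * (- levy_q \<mu> \<xi>) ^ i * exp (- (t * levy_q \<mu> \<xi>))) \<le> norm (heat_symbol \<mu> i j t \<xi>)"
    using heat_integrand_le[of t t] by simp
qed measurable

lemma heat_deriv_x:
  assumes t: "0 < t"
  shows "((\<lambda>x. heat_deriv \<mu> i j t x) has_real_derivative heat_deriv \<mu> i (Suc j) t x) (at x)"
  unfolding heat_deriv_def
proof (rule DERIV_cmult, rule has_real_derivative_integral[where a="x - 1" and b="x + 1" and w="\<lambda>\<xi>. \<bar>heat_symbol \<mu> i (Suc j) t \<xi>\<bar>"])
  fix y \<xi>
  have c: "cos (y * \<xi> + real (Suc j) * (pi / 2)) = - sin (y * \<xi> + real j * (pi / 2))"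
  proof -
    have "y * \<xi> + real (Suc j) * (pi / 2) = (y * \<xi> + real j * (pi / 2)) + pi / 2" by (simp add: distrib_right)
    then show ?thesis by (simp only: cos_add) simp
  qed
  have "((\<lambda>y. cos (y * \<xi> + real j * (pi / 2))) has_real_derivative - sin (y * \<xi> + real j * (pi / 2)) * \<xi>) (at y)"
    by (auto intro!: derivative_eq_intros)
  then have "((\<lambda>y. (\<xi> ^ j * (- levy_q \<mu> \<xi>) ^ i * exp (- (t * levy_q \<mu> \<xi>))) * cos (y * \<xi> + real j * (pi / 2))) has_real_derivative
      (\<xi> ^ j * (- levy_q \<mu> \<xi>) ^ i * exp (- (t * levy_q \<mu> \<xi>))) * (- sin (y * \<xi> + real j * (pi / 2)) * \<xi>)) (at y)"
    by (rule DERIV_cmult)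
  then show "((\<lambda>y. \<xi> ^ j * cos (y * \<xi> + real j * (pi / 2)) * (- levy_q \<mu> \<xi>) ^ i * exp (- (t * levy_q \<mu> \<xi>))) has_real_derivative
      \<xi> ^ Suc j * cos (y * \<xi> + real (Suc j) * (pi / 2)) * (- levy_q \<mu> \<xi>) ^ i * exp (- (t * levy_q \<mu> \<xi>))) (at y)"
    unfolding c by (simp add: mult_ac)
  show "\<bar>\<xi> ^ Suc j * cos (y * \<xi> + real (Suc j) * (pi / 2)) * (- levy_q \<mu> \<xi>) ^ i * exp (- (t * levy_q \<mu> \<xi>))\<bar> \<le> \<bar>heat_symbol \<mu> i (Suc j) t \<xi>\<bar>"
    by (rule heat_integrand_le) simp
next
  show "integrable lborel (\<lambda>\<xi>. \<bar>heat_symbol \<mu> i (Suc j) t \<xi>\<bar>)" using heat_symbol_integrable[OF t] by (rule integrable_abs)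
qed (use heat_integrand_integrable[OF t] in auto)

lemma heat_deriv_t:
  assumes t: "0 < t"
  shows "((\<lambda>t. heat_deriv \<mu> i j t x) has_real_derivative heat_deriv \<mu> (Suc i) j t x) (at t)"
  unfolding heat_deriv_def
proof (rule DERIV_cmult, rule has_real_derivative_integral[where a="t / 2" and b="2 * t" and w="\<lambda>\<xi>. \<bar>heat_symbol \<mu> (Suc i) j (t / 2) \<xi>\<bar>"])
  fix s \<xi> assume s: "t / 2 < s"
  have "((\<lambda>s. exp (- (s * levy_q \<mu> \<xi>))) has_real_derivative exp (- (s * levy_q \<mu> \<xi>)) * (- levy_q \<mu> \<xi>)) (at s)"
    by (auto intro!: derivative_eq_intros)
  then have "((\<lambda>s. (\<xi> ^ j * cos (x * \<xi> + real j * (pi / 2)) * (- levy_q \<mu> \<xi>) ^ i) * exp (- (s * levy_q \<mu> \<xi>))) has_real_derivative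
      (\<xi> ^ j * cos (x * \<xi> + real j * (pi / 2)) * (- levy_q \<mu> \<xi>) ^ i) * (exp (- (s * levy_q \<mu> \<xi>)) * (- levy_q \<mu> \<xi>))) (at s)"
    by (rule DERIV_cmult)
  then show "((\<lambda>s. \<xi> ^ j * cos (x * \<xi> + real j * (pi / 2)) * (- levy_q \<mu> \<xi>) ^ i * exp (- (s * levy_q \<mu> \<xi>))) has_real_derivative
      \<xi> ^ j * cos (x * \<xi> + real j * (pi / 2)) * (- levy_q \<mu> \<xi>) ^ Suc i * exp (- (s * levy_q \<mu> \<xi>))) (at s)"
    by (simp add: mult_ac)
  show "\<bar>\<xi> ^ j * cos (x * \<xi> + real j * (pi / 2)) * (- levy_q \<mu> \<xi>) ^ Suc i * exp (- (s * levy_q \<mu> \<xi>))\<bar> \<le> \<bar>heat_symbol \<mu> (Suc i) j (t / 2) \<xi>\<bar>"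
    by (rule heat_integrand_le) (use s in simp)
next
  show "integrable lborel (\<lambda>\<xi>. \<bar>heat_symbol \<mu> (Suc i) j (t / 2) \<xi>\<bar>)"
    by (rule integrable_abs, rule heat_symbol_integrable) (use t in simp)
next
  fix s assume "t / 2 < s"
  then show "integrable lborel (\<lambda>\<xi>. \<xi> ^ j * cos (x * \<xi> + real j * (pi / 2)) * (- levy_q \<mu> \<xi>) ^ i * exp (- (s * levy_q \<mu> \<xi>)))"
    using t by (intro heat_integrand_integrable) auto
qed (use t in auto)

lemma heat_deriv_tendsto:
  assumes t: "0 < t" and lim: "tn \<longlonglongrightarrow> t" "xn \<longlonglongrightarrow> x" and tn: "\<And>n. t / 2 \<le> tn n"
  shows "(\<lambda>n. heat_deriv \<mu> i j (tn n) (xn n)) \<longlonglongrightarrow> heat_deriv \<mu> i j t x"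
  unfolding heat_deriv_def
proof (rule tendsto_mult_left, rule integral_dominated_convergence[where w="\<lambda>\<xi>. \<bar>heat_symbol \<mu> i j (t / 2) \<xi>\<bar>"])
  show "integrable lborel (\<lambda>\<xi>. \<bar>heat_symbol \<mu> i j (t / 2) \<xi>\<bar>)"
    by (rule integrable_abs, rule heat_symbol_integrable) (use t in simp)
  show "AE \<xi> in lborel. norm (\<xi> ^ j * cos (xn n * \<xi> + real j * (pi / 2)) * (- levy_q \<mu> \<xi>) ^ i * exp (- (tn n * levy_q \<mu> \<xi>))) \<le> \<bar>heat_symbol \<mu> i j (t / 2) \<xi>\<bar>" for n
    using heat_integrand_le[OF tn] by simp
  show "AE \<xi> in lborel. (\<lambda>n. \<xi> ^ j * cos (xn n * \<xi> + real j * (pi / 2)) * (- levy_q \<mu> \<xi>) ^ i * exp (- (tn n * levy_q \<mu> \<xi>)))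
      \<longlonglongrightarrow> \<xi> ^ j * cos (x * \<xi> + real j * (pi / 2)) * (- levy_q \<mu> \<xi>) ^ i * exp (- (t * levy_q \<mu> \<xi>))"
    by (intro AE_I2 tendsto_intros lim)
qed measurable

lemma heat_deriv_bounded:
  assumes t: "0 < t"
  obtains K where "0 \<le> K" "\<And>s x. t / 2 \<le> s \<Longrightarrow> \<bar>heat_deriv \<mu> i j s x\<bar> \<le> K"
proof -
  let ?K = "1 / (2 * pi) * (\<integral>\<xi>. \<bar>heat_symbol \<mu> i j (t / 2) \<xi>\<bar> \<partial>lborel)"
  show thesis
  proof (rule that[of ?K])
    show "0 \<le> ?K" by (intro mult_nonneg_nonneg integral_nonneg_AE) auto
    fix s x assume s: "t / 2 \<le> s"
    have "\<bar>\<integral>\<xi>. \<xi> ^ j * cos (x * \<xi> + real j * (pi / 2)) * (- levy_q \<mu> \<xi>) ^ i * exp (- (s * levy_q \<mu> \<xi>)) \<partial>lborel\<bar>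
      \<le> (\<integral>\<xi>. \<bar>\<xi> ^ j * cos (x * \<xi> + real j * (pi / 2)) * (- levy_q \<mu> \<xi>) ^ i * exp (- (s * levy_q \<mu> \<xi>))\<bar> \<partial>lborel)"
      by (rule integral_abs_bound)
    also have "\<dots> \<le> (\<integral>\<xi>. \<bar>heat_symbol \<mu> i j (t / 2) \<xi>\<bar> \<partial>lborel)"
      using s t by (intro integral_mono integrable_abs heat_integrand_integrable heat_symbol_integrable heat_integrand_le) auto
    finally show "\<bar>heat_deriv \<mu> i j s x\<bar> \<le> ?K"
      unfolding heat_deriv_def abs_mult by (intro mult_mono) auto
  qed
qed

lemma heat_deriv_measurable[measurable (raw)]:
  assumes [measurable]: "f \<in> borel_measurable M" "g \<in> borel_measurable M"
  shows "(\<lambda>p. heat_deriv \<mu> i j (f p) (g p)) \<in> borel_measurable M"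
  unfolding heat_deriv_def by measurable

lemma levy_density_measurable[measurable (raw)]:
  assumes [measurable]: "f \<in> borel_measurable M" "g \<in> borel_measurable M"
  shows "(\<lambda>p. levy_density \<mu> (f p) (g p)) \<in> borel_measurable M"
  unfolding levy_density_def by measurable

lemma levy_density_eq:
  assumes t: "0 < t"
  shows "levy_density \<mu> t x = heat_deriv \<mu> 0 0 t x"
proof -
  let ?S = "heat_symbol \<mu> 0 0 t"
  have e: "exp (- (\<i> * of_real (x * \<xi>)) - of_real (t * levy_q \<mu> \<xi>)) = ?S \<xi> *\<^sub>R cis (- (x * \<xi>))" for \<xi>
    by (simp add: heat_symbol_def exp_diff cis_conv_exp scaleR_conv_of_real exp_minus exp_of_real[symmetric] divide_inverse mult.commute)
  have i: "integrable lborel (\<lambda>\<xi>. ?S \<xi> *\<^sub>R cis (- (x * \<xi>)))"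
    by (intro fint_integrable heat_symbol_integrable t) measurable
  have "Re (\<integral>\<xi>. ?S \<xi> *\<^sub>R cis (- (x * \<xi>)) \<partial>lborel) = (\<integral>\<xi>. Re (?S \<xi> *\<^sub>R cis (- (x * \<xi>))) \<partial>lborel)"
    by (rule integral_Re[OF i, symmetric])
  also have "\<dots> = (\<integral>\<xi>. cos (x * \<xi>) * exp (- (t * levy_q \<mu> \<xi>)) \<partial>lborel)"
    by (intro Bochner_Integration.integral_cong refl) (simp add: heat_symbol_def)
  finally have R: "Re (\<integral>\<xi>. ?S \<xi> *\<^sub>R cis (- (x * \<xi>)) \<partial>lborel) = (\<integral>\<xi>. cos (x * \<xi>) * exp (- (t * levy_q \<mu> \<xi>)) \<partial>lborel)" .
  have "1 / (2 * of_real pi) = complex_of_real (1 / (2 * pi))" by simp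
  then have "levy_density \<mu> t x = 1 / (2 * pi) * Re (\<integral>\<xi>. ?S \<xi> *\<^sub>R cis (- (x * \<xi>)) \<partial>lborel)"
    unfolding levy_density_def e by (simp only: times_complex.sel Re_complex_of_real Im_complex_of_real)
  then show ?thesis unfolding R heat_deriv_def by simp
qed

end

locale levy_scale = levy_A1 \<mu> + time_scale T "levy_A1.rho0 \<mu>" A for \<mu> T A
begin

lemma rho0_eq: "0 < t \<Longrightarrow> rho0 t = levy_rho \<mu> t"
  by (simp add: rho0_def)

text \<open>
  All derivatives up to order \<open>2\<close> in time and \<open>3\<close> in space, scaled so that their integrals are bounded: one
  order more, in each variable, than is to be estimated pointwise.
\<close>

definition heat_jet :: "real \<Rightarrow> real \<Rightarrow> real \<Rightarrow> real" where
  "heat_jet t s z = (\<Sum>i\<le>2. \<Sum>j\<le>3. s ^ i * (1 / rho0 t) ^ j * \<bar>heat_deriv \<mu> i j s z\<bar>)"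

text \<open>
  The measure \<open>ds / s\<close> on the window of times is dimensionless, so that the integral of the average over space
  stays bounded.
\<close>

definition heat_average :: "real \<Rightarrow> real \<Rightarrow> ennreal" where
  "heat_average t z = (\<integral>\<^sup>+s. ennreal (1 / s * heat_jet t s z) * indicator {t / 2..2 * t} s \<partial>lborel)"

text \<open>
  The constant leaves a factor \<open>2\<close> to spare in \<open>heat_deriv_le_envelope\<close>, which pays for \<open>t' \<le> 2 t\<close> when
  \<open>t' \<partial>\<^sub>t p\<^sup>0\<close> is estimated.
\<close>

definition heat_envelope :: "real \<Rightarrow> real \<Rightarrow> ennreal" where
  "heat_envelope t v = ennreal (16 * 8) * mollify (rho0 t) (heat_average t) v"

lemma heat_jet_nonneg: "0 < t \<Longrightarrow> 0 \<le> s \<Longrightarrow> 0 \<le> heat_jet t s z"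
  unfolding heat_jet_def using \<rho>_pos[of t] by (intro sum_nonneg mult_nonneg_nonneg) auto

lemma heat_average_measurable[measurable (raw)]:
  assumes [measurable]: "f \<in> borel_measurable M" "g \<in> borel_measurable M"
  shows "(\<lambda>p. heat_average (f p) (g p)) \<in> borel_measurable M"
  unfolding heat_average_def heat_jet_def indicator_def atLeastAtMost_iff by measurable

lemma kern_heat_envelope:
  obtains C where "kern 1 C heat_envelope"
proof -
  have T2: "0 < 2 * T" using T_pos by simp
  have "\<forall>p::nat \<times> nat. \<exists>C. 0 \<le> C \<and> (\<forall>t. 0 < t \<longrightarrow> t \<le> 2 * T \<longrightarrow>
     (\<integral>\<^sup>+x. ennreal \<bar>heat_deriv \<mu> (fst p) (snd p) t x\<bar> \<partial>lborel) \<le> ennreal (C * levy_rho \<mu> t ^ snd p * (1 / t) ^ fst p))"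
  proof
    fix p :: "nat \<times> nat"
    show "\<exists>C. 0 \<le> C \<and> (\<forall>t. 0 < t \<longrightarrow> t \<le> 2 * T \<longrightarrow>
     (\<integral>\<^sup>+x. ennreal \<bar>heat_deriv \<mu> (fst p) (snd p) t x\<bar> \<partial>lborel) \<le> ennreal (C * levy_rho \<mu> t ^ snd p * (1 / t) ^ fst p))"
      by (rule heat_deriv_L1[OF T2, of "fst p" "snd p"]) blast
  qed
  from choice[OF this] obtain Cp where Cp: "\<And>p. 0 \<le> Cp p" "\<And>p t. 0 < t \<Longrightarrow> t \<le> 2 * T \<Longrightarrow>
     (\<integral>\<^sup>+x. ennreal \<bar>heat_deriv \<mu> (fst p) (snd p) t x\<bar> \<partial>lborel) \<le> ennreal (Cp p * levy_rho \<mu> t ^ snd p * (1 / t) ^ fst p)" by blast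
  define CW where "CW = (\<Sum>i\<le>(2::nat). \<Sum>j\<le>(3::nat). Cp (i, j) * A ^ j)"
  have CW: "0 \<le> CW" unfolding CW_def using Cp(1) A_ge by (intro sum_nonneg mult_nonneg_nonneg) auto
  have jet: "(\<integral>\<^sup>+z. ennreal (heat_jet t s z) \<partial>lborel) \<le> ennreal CW"
    if t: "0 < t" "t \<le> T" and s: "t / 2 \<le> s" "s \<le> 2 * t" for t s
  proof -
    have s0: "0 < s" "s \<le> 2 * T" using t s by auto
    have r: "0 < rho0 t" "0 < rho0 s" using \<rho>_pos t s0 by auto
    have rs: "rho0 s \<le> A * rho0 t" using \<rho>_anti[of "t / 2" s] \<rho>_half[of t] t s by auto
    have one: "(\<integral>\<^sup>+z. ennreal (s ^ i * (1 / rho0 t) ^ j * \<bar>heat_deriv \<mu> i j s z\<bar>) \<partial>lborel) \<le> ennreal (Cp (i, j) * A ^ j)" for i j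
    proof -
      have "(\<integral>\<^sup>+z. ennreal (s ^ i * (1 / rho0 t) ^ j * \<bar>heat_deriv \<mu> i j s z\<bar>) \<partial>lborel)
        = ennreal (s ^ i * (1 / rho0 t) ^ j) * (\<integral>\<^sup>+z. ennreal \<bar>heat_deriv \<mu> i j s z\<bar> \<partial>lborel)"
        using s0 r by (subst nn_integral_cmult[symmetric]) (auto simp: ennreal_mult)
      also have "\<dots> \<le> ennreal (s ^ i * (1 / rho0 t) ^ j) * ennreal (Cp (i, j) * rho0 s ^ j * (1 / s) ^ i)"
        using Cp(2)[OF s0, of "(i, j)"] s0 by (intro mult_left_mono) (auto simp: rho0_eq)
      also have "\<dots> = ennreal ((s ^ i * (1 / rho0 t) ^ j) * (Cp (i, j) * rho0 s ^ j * (1 / s) ^ i))"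
        using s0 r Cp(1) by (intro ennreal_mult[symmetric]) auto
      also have "(s ^ i * (1 / rho0 t) ^ j) * (Cp (i, j) * rho0 s ^ j * (1 / s) ^ i) = Cp (i, j) * (rho0 s / rho0 t) ^ j"
        using s0 r by (simp add: power_divide)
      also have "ennreal \<dots> \<le> ennreal (Cp (i, j) * A ^ j)"
        using Cp(1) r rs by (intro ennreal_leI mult_left_mono power_mono) (auto simp: field_simps)
      finally show ?thesis .
    qed
    have nn: "0 \<le> s ^ i * (1 / rho0 t) ^ j * \<bar>heat_deriv \<mu> i j s z\<bar>" for i j z using s0 r by simp
    have "(\<integral>\<^sup>+z. ennreal (heat_jet t s z) \<partial>lborel) = (\<integral>\<^sup>+z. (\<Sum>i\<le>2. \<Sum>j\<le>3. ennreal (s ^ i * (1 / rho0 t) ^ j * \<bar>heat_deriv \<mu> i j s z\<bar>)) \<partial>lborel)"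
      unfolding heat_jet_def using nn by (intro nn_integral_cong) (simp add: sum_ennreal sum_nonneg)
    also have "\<dots> = (\<Sum>i\<le>2. \<Sum>j\<le>3. \<integral>\<^sup>+z. ennreal (s ^ i * (1 / rho0 t) ^ j * \<bar>heat_deriv \<mu> i j s z\<bar>) \<partial>lborel)"
      by (subst nn_integral_sum, measurable, intro sum.cong refl, subst nn_integral_sum, measurable)
    also have "\<dots> \<le> (\<Sum>i\<le>2. \<Sum>j\<le>3. ennreal (Cp (i, j) * A ^ j))" by (intro sum_mono one)
    also have "\<dots> = ennreal CW" unfolding CW_def using Cp(1) A_ge
      by (simp add: sum_ennreal sum_nonneg)
    finally show ?thesis .
  qed
  have m: "(\<lambda>(t, v). heat_average t v) \<in> borel_measurable borel"
  proof -
    have "(\<lambda>p. heat_average (fst p) (snd p)) \<in> borel_measurable (borel \<Otimes>\<^sub>M borel)" by measurable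
    then show ?thesis by (simp add: case_prod_unfold borel_prod)
  qed
  have "kern 1 (64 * 8 * (3 * CW)) (\<lambda>t v. ennreal (16 * 8) * mollify (rho0 t) (heat_average t) v)"
  proof (rule kern_mollify[OF m])
    fix t assume t: "0 < t" "t \<le> T"
    have "(\<integral>\<^sup>+z. heat_average t z \<partial>lborel) = (\<integral>\<^sup>+s. \<integral>\<^sup>+z. ennreal (1 / s * heat_jet t s z) * indicator {t / 2..2 * t} s \<partial>lborel \<partial>lborel)"
      unfolding heat_average_def heat_jet_def by (rule lborel_pair.Fubini') measurable
    also have "\<dots> \<le> (\<integral>\<^sup>+s. ennreal (2 / t * CW) * indicator {t / 2..2 * t} s \<partial>lborel)"
    proof (rule nn_integral_mono)
      fix s
      show "(\<integral>\<^sup>+z. ennreal (1 / s * heat_jet t s z) * indicator {t / 2..2 * t} s \<partial>lborel) \<le> ennreal (2 / t * CW) * indicator {t / 2..2 * t} s"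
      proof (cases "s \<in> {t / 2..2 * t}")
        case True
        then have s: "t / 2 \<le> s" "s \<le> 2 * t" "0 < s" using t by auto
        have [measurable]: "(\<lambda>z. heat_jet t s z) \<in> borel_measurable borel" unfolding heat_jet_def by measurable
        have "(\<integral>\<^sup>+z. ennreal (1 / s * heat_jet t s z) \<partial>lborel) = (\<integral>\<^sup>+z. ennreal (1 / s) * ennreal (heat_jet t s z) \<partial>lborel)"
          using s t by (intro nn_integral_cong ennreal_mult heat_jet_nonneg) auto
        also have "\<dots> = ennreal (1 / s) * (\<integral>\<^sup>+z. ennreal (heat_jet t s z) \<partial>lborel)"
          by (rule nn_integral_cmult) measurable
        also have "\<dots> \<le> ennreal (2 / t) * ennreal CW"
          using s t by (intro mult_mono jet ennreal_leI) (auto simp: field_simps)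
        also have "\<dots> = ennreal (2 / t * CW)" using t CW by (intro ennreal_mult[symmetric]) auto
        finally show ?thesis using True by simp
      qed simp
    qed
    also have "\<dots> = ennreal (2 / t * CW) * ennreal (3 / 2 * t)"
      using t by (subst nn_integral_cmult_indicator) auto
    also have "\<dots> = ennreal (3 * CW * t powr (1 - 1))" using t CW by (simp add: ennreal_mult[symmetric])
    finally show "(\<integral>\<^sup>+z. heat_average t z \<partial>lborel) \<le> ennreal (3 * CW * t powr (1 - 1))" .
  qed (use CW in auto)
  then have "kern 1 (64 * 8 * (3 * CW)) heat_envelope" unfolding heat_envelope_def[abs_def] .
  then show thesis by (rule that)
qed

text \<open>
  The Sobolev inequality is applied in space on \<open>{v..v + 1 / \<rho>\<^sub>t}\<close> and in time on \<open>{t / 2..2 * t}\<close>.  Each of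
  them trades the reciprocal of the window length against one derivative, which have the same size.
\<close>

lemma heat_deriv_le_envelope:
  assumes ij: "i \<le> 1" "j \<le> 2" and t: "0 < t" "t \<le> T" and t': "t / 2 \<le> t'" "t' \<le> 2 * t"
  shows "ennreal \<bar>heat_deriv \<mu> i j t' v\<bar> \<le> ennreal ((1 / t) ^ i * rho0 t ^ j / 2) * heat_envelope t v"
proof -
  define r where "r = rho0 t"
  have r: "0 < r" using \<rho>_pos t by (simp add: r_def)
  have time: "ennreal \<bar>heat_deriv \<mu> i l t' z\<bar> \<le>
      (\<integral>\<^sup>+s\<in>{t / 2..2 * t}. ennreal (\<bar>heat_deriv \<mu> i l s z\<bar> / (2 * t - t / 2) + \<bar>heat_deriv \<mu> (Suc i) l s z\<bar>) \<partial>lborel)" for l z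
  proof (rule sobolev_Icc)
    show "((\<lambda>s. heat_deriv \<mu> i l s z) has_real_derivative heat_deriv \<mu> (Suc i) l s z) (at s)" if "s \<in> {t / 2..2 * t}" for s
      by (rule heat_deriv_t) (use that t in auto)
    show "continuous_on {t / 2..2 * t} (\<lambda>s. heat_deriv \<mu> (Suc i) l s z)"
      by (rule continuous_at_imp_continuous_on) (use t in \<open>auto intro!: DERIV_isCont[OF heat_deriv_t]\<close>)
  qed (use t t' in auto)
  have space: "ennreal \<bar>heat_deriv \<mu> i j t' v\<bar> \<le>
      (\<integral>\<^sup>+z\<in>{v..v + 1 / r}. ennreal (\<bar>heat_deriv \<mu> i j t' z\<bar> / (v + 1 / r - v) + \<bar>heat_deriv \<mu> i (Suc j) t' z\<bar>) \<partial>lborel)"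
  proof (rule sobolev_Icc)
    show "((\<lambda>z. heat_deriv \<mu> i j t' z) has_real_derivative heat_deriv \<mu> i (Suc j) t' z) (at z)" for z
      by (rule heat_deriv_x) (use t t' in auto)
    show "continuous_on {v..v + 1 / r} (\<lambda>z. heat_deriv \<mu> i (Suc j) t' z)"
      by (rule continuous_at_imp_continuous_on) (use t t' in \<open>auto intro!: DERIV_isCont[OF heat_deriv_x]\<close>)
  qed (use r in auto)
  define B where "B = (1 / t) ^ i * r ^ j"
  have B: "0 \<le> B" using t r by (simp add: B_def)
  have inner: "ennreal (\<bar>heat_deriv \<mu> i j t' z\<bar> / (v + 1 / r - v) + \<bar>heat_deriv \<mu> i (Suc j) t' z\<bar>) \<le> ennreal (16 * B * r) * heat_average t z" for z
  proof -
    let ?I = "{t / 2..2 * t}"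
    let ?a = "\<lambda>l s. \<bar>heat_deriv \<mu> i l s z\<bar> / (2 * t - t / 2) + \<bar>heat_deriv \<mu> (Suc i) l s z\<bar>"
    have "ennreal (\<bar>heat_deriv \<mu> i j t' z\<bar> / (v + 1 / r - v) + \<bar>heat_deriv \<mu> i (Suc j) t' z\<bar>)
      = ennreal r * ennreal \<bar>heat_deriv \<mu> i j t' z\<bar> + ennreal \<bar>heat_deriv \<mu> i (Suc j) t' z\<bar>"
      using r by (simp add: ennreal_mult[symmetric] mult.commute flip: ennreal_plus)
    also have "\<dots> \<le> ennreal r * (\<integral>\<^sup>+s\<in>?I. ennreal (?a j s) \<partial>lborel) + (\<integral>\<^sup>+s\<in>?I. ennreal (?a (Suc j) s) \<partial>lborel)"
      by (intro add_mono mult_left_mono time) auto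
    also have "\<dots> = (\<integral>\<^sup>+s. ennreal r * (ennreal (?a j s) * indicator ?I s) + ennreal (?a (Suc j) s) * indicator ?I s \<partial>lborel)"
      by (subst nn_integral_add, measurable, subst nn_integral_cmult, measurable)
    also have "\<dots> \<le> (\<integral>\<^sup>+s. ennreal (16 * B * r) * (ennreal (1 / s * heat_jet t s z) * indicator ?I s) \<partial>lborel)"
    proof (rule nn_integral_mono)
      fix s
      show "ennreal r * (ennreal (?a j s) * indicator ?I s) + ennreal (?a (Suc j) s) * indicator ?I s
        \<le> ennreal (16 * B * r) * (ennreal (1 / s * heat_jet t s z) * indicator ?I s)"
      proof (cases "s \<in> ?I")
        case True
        then have s: "t / 2 \<le> s" "s \<le> 2 * t" "0 < s" using t by auto
        let ?J = "heat_jet t s z"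
        have J0: "0 \<le> ?J" using heat_jet_nonneg t s by simp
        have nn: "0 \<le> s ^ k * (1 / r) ^ l * \<bar>heat_deriv \<mu> k l s z\<bar>" for k l using s r by simp
        have trm: "\<bar>heat_deriv \<mu> k l s z\<bar> \<le> (1 / s) ^ k * r ^ l * ?J" if "k \<le> 2" "l \<le> 3" for k l
        proof -
          have "s ^ k * (1 / r) ^ l * \<bar>heat_deriv \<mu> k l s z\<bar> \<le> (\<Sum>l\<le>3. s ^ k * (1 / r) ^ l * \<bar>heat_deriv \<mu> k l s z\<bar>)"
            using that nn by (intro member_le_sum[of l "{..3}" "\<lambda>l. s ^ k * (1 / r) ^ l * \<bar>heat_deriv \<mu> k l s z\<bar>"]) auto
          also have "\<dots> \<le> ?J" unfolding heat_jet_def r_def[symmetric]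
            using that nn by (intro member_le_sum[of k "{..2}" "\<lambda>k. \<Sum>l\<le>3. s ^ k * (1 / r) ^ l * \<bar>heat_deriv \<mu> k l s z\<bar>"] sum_nonneg) auto
          finally have "(1 / s) ^ k * r ^ l * (s ^ k * (1 / r) ^ l * \<bar>heat_deriv \<mu> k l s z\<bar>) \<le> (1 / s) ^ k * r ^ l * ?J"
            using s r by (intro mult_left_mono) auto
          then show ?thesis using s r by (simp add: power_divide)
        qed
        have tp: "(1 / s) ^ i \<le> 2 * (1 / t) ^ i"
        proof -
          have "1 / s \<le> 2 * (1 / t)" using s t by (simp add: field_simps)
          moreover have "i = 0 \<or> i = 1" using ij by auto
          ultimately show ?thesis by auto
        qed
        have q: "?a l s \<le> 4 * (1 / s) * ((1 / t) ^ i * r ^ l * ?J) + 2 * (1 / s) * ((1 / t) ^ i * r ^ l * ?J)" if l: "l \<le> 3" for l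
        proof (rule add_mono)
          have b: "(1 / s) ^ i * r ^ l * ?J \<le> 2 * (1 / t) ^ i * r ^ l * ?J"
            using tp r J0 by (intro mult_right_mono) auto
          have "\<bar>heat_deriv \<mu> i l s z\<bar> \<le> 2 * (1 / t) ^ i * r ^ l * ?J" using trm[of i l] ij l b by simp
          moreover have "1 / (2 * t - t / 2) \<le> 2 * (1 / s)" using s t by (simp add: field_simps)
          ultimately have "\<bar>heat_deriv \<mu> i l s z\<bar> * (1 / (2 * t - t / 2)) \<le> (2 * (1 / t) ^ i * r ^ l * ?J) * (2 * (1 / s))"
            using t r J0 by (intro mult_mono) auto
          then show "\<bar>heat_deriv \<mu> i l s z\<bar> / (2 * t - t / 2) \<le> 4 * (1 / s) * ((1 / t) ^ i * r ^ l * ?J)" by (simp add: mult_ac)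
          have "\<bar>heat_deriv \<mu> (Suc i) l s z\<bar> \<le> (1 / s) * ((1 / s) ^ i * r ^ l * ?J)" using trm[of "Suc i" l] ij l by (simp add: mult_ac)
          also have "\<dots> \<le> (1 / s) * (2 * (1 / t) ^ i * r ^ l * ?J)" using b s by (intro mult_left_mono) auto
          finally show "\<bar>heat_deriv \<mu> (Suc i) l s z\<bar> \<le> 2 * (1 / s) * ((1 / t) ^ i * r ^ l * ?J)" by (simp add: mult_ac)
        qed
        have "r * ?a j s + ?a (Suc j) s \<le> r * (6 * (1 / s) * (B * ?J)) + 6 * (1 / s) * (B * r * ?J)"
        proof (rule add_mono)
          have "?a j s \<le> 6 * (1 / s) * (B * ?J)" using q[of j] ij by (simp add: B_def algebra_simps)
          then show "r * ?a j s \<le> r * (6 * (1 / s) * (B * ?J))" using r by (intro mult_left_mono) auto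
          show "?a (Suc j) s \<le> 6 * (1 / s) * (B * r * ?J)" using q[of "Suc j"] ij by (simp add: B_def algebra_simps)
        qed
        also have "\<dots> = 12 * (B * r * (1 / s * ?J))" by simp
        also have "\<dots> \<le> 16 * (B * r * (1 / s * ?J))" using B r s J0 by (intro mult_right_mono mult_nonneg_nonneg) auto
        also have "\<dots> = 16 * B * r * (1 / s * ?J)" by simp
        finally have le: "r * ?a j s + ?a (Suc j) s \<le> 16 * B * r * (1 / s * ?J)" .
        have a0: "0 \<le> ?a l s" for l using t by simp
        have "ennreal r * ennreal (?a j s) + ennreal (?a (Suc j) s) = ennreal (r * ?a j s + ?a (Suc j) s)"
          using r a0 by (simp only: ennreal_plus ennreal_mult less_imp_le mult_nonneg_nonneg)
        also have "\<dots> \<le> ennreal (16 * B * r * (1 / s * ?J))" by (rule ennreal_leI[OF le])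
        also have "\<dots> = ennreal (16 * B * r) * ennreal (1 / s * ?J)"
          using B r s J0 by (intro ennreal_mult) auto
        finally show ?thesis using True by simp
      qed simp
    qed
    also have "\<dots> = ennreal (16 * B * r) * heat_average t z"
      unfolding heat_average_def heat_jet_def by (rule nn_integral_cmult) measurable
    finally show ?thesis .
  qed
  have "ennreal \<bar>heat_deriv \<mu> i j t' v\<bar> \<le> (\<integral>\<^sup>+z. ennreal (64 * B) * (ennreal (bump r (v - z)) * heat_average t z) \<partial>lborel)"
  proof (rule order_trans[OF space], rule nn_integral_mono)
    fix z
    show "ennreal (\<bar>heat_deriv \<mu> i j t' z\<bar> / (v + 1 / r - v) + \<bar>heat_deriv \<mu> i (Suc j) t' z\<bar>) * indicator {v..v + 1 / r} z
      \<le> ennreal (64 * B) * (ennreal (bump r (v - z)) * heat_average t z)"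
    proof (cases "z \<in> {v..v + 1 / r}")
      case True
      then have "\<bar>v - z\<bar> \<le> 1 / r" by auto
      then have r1: "r * \<bar>v - z\<bar> \<le> 1" using r by (simp add: field_simps)
      have "r \<le> 4 * bump r (v - z)" by (rule bump_near[OF r r1])
      then have "16 * B * r \<le> 16 * B * (4 * bump r (v - z))" using B by (intro mult_left_mono) auto
      then have "ennreal (16 * B * r) * heat_average t z \<le> ennreal (64 * B * bump r (v - z)) * heat_average t z"
        by (intro mult_right_mono ennreal_leI) auto
      also have "ennreal (64 * B * bump r (v - z)) = ennreal (64 * B) * ennreal (bump r (v - z))"
        using B bump_nonneg[OF r] by (intro ennreal_mult) auto
      finally show ?thesis using True order_trans[OF inner[of z]] by (simp add: mult.assoc)
    qed simp
  qed
  also have "\<dots> = ennreal (64 * B) * mollify r (heat_average t) v"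
    unfolding mollify_def by (rule nn_integral_cmult) measurable
  also have "\<dots> = ennreal (B / 2) * heat_envelope t v"
  proof -
    have "ennreal (64 * B) = ennreal (B / 2) * ennreal (16 * 8)" using B by (subst ennreal_mult[symmetric]) auto
    then show ?thesis by (simp only: heat_envelope_def r_def mult.assoc)
  qed
  finally show ?thesis by (simp add: B_def r_def)
qed

lemma heat_le_envelope:
  assumes "j \<le> 2" "0 < t" "t \<le> T" "t / 2 \<le> t'" "t' \<le> 2 * t"
  shows "ennreal \<bar>heat_deriv \<mu> 0 j t' v\<bar> \<le> ennreal (rho0 t ^ j) * heat_envelope t v"
    "ennreal \<bar>t' * heat_deriv \<mu> 1 j t' v\<bar> \<le> ennreal (rho0 t ^ j) * heat_envelope t v"
proof -
  have r: "0 < rho0 t" using \<rho>_pos assms by simp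
  have "ennreal \<bar>heat_deriv \<mu> 0 j t' v\<bar> \<le> ennreal ((1 / t) ^ 0 * rho0 t ^ j / 2) * heat_envelope t v"
    by (rule heat_deriv_le_envelope) (use assms in auto)
  also have "\<dots> \<le> ennreal (rho0 t ^ j) * heat_envelope t v"
    using r by (intro mult_right_mono ennreal_leI) auto
  finally show "ennreal \<bar>heat_deriv \<mu> 0 j t' v\<bar> \<le> ennreal (rho0 t ^ j) * heat_envelope t v" .
  have "ennreal \<bar>t' * heat_deriv \<mu> 1 j t' v\<bar> = ennreal t' * ennreal \<bar>heat_deriv \<mu> 1 j t' v\<bar>"
    using assms by (simp add: abs_mult ennreal_mult)
  also have "\<dots> \<le> ennreal (2 * t) * (ennreal ((1 / t) ^ 1 * rho0 t ^ j / 2) * heat_envelope t v)"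
    using assms by (intro mult_mono ennreal_leI heat_deriv_le_envelope) auto
  also have "\<dots> = ennreal (2 * t * ((1 / t) ^ 1 * rho0 t ^ j / 2)) * heat_envelope t v"
    using assms r by (subst ennreal_mult) (auto simp: mult.assoc)
  also have "2 * t * ((1 / t) ^ 1 * rho0 t ^ j / 2) = rho0 t ^ j" using assms by simp
  finally show "ennreal \<bar>t' * heat_deriv \<mu> 1 j t' v\<bar> \<le> ennreal (rho0 t ^ j) * heat_envelope t v" .
qed

lemma kernel_pair_heat:
  "kernel_pair True heat_envelope (levy_p0 \<mu>) (\<lambda>t x y. t * heat_deriv \<mu> 1 0 t (y - x))"
  unfolding kernel_pair_def
proof (intro conjI allI impI)
  show "measurable3 (levy_p0 \<mu>)" unfolding levy_p0_def[abs_def] by (rule measurable3I) measurable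
  show "measurable3 (\<lambda>t x y. t * heat_deriv \<mu> 1 0 t (y - x))" by (rule measurable3I) measurable
  show "dominated heat_envelope (levy_p0 \<mu>)"
    unfolding dominated_def levy_p0_def
    using heat_le_envelope(1)[of 0] by (auto simp: levy_density_eq)
  show "dominated heat_envelope (\<lambda>t x y. t * heat_deriv \<mu> 1 0 t (y - x))"
    unfolding dominated_def using heat_le_envelope(2)[of 0] by auto
  show "seqcont True (levy_p0 \<mu>)"
    unfolding seqcont_def levy_p0_def
  proof (intro allI impI, elim conjE)
    fix t x y :: real and tn xn yn :: "nat \<Rightarrow> real"
    assume t: "0 < t" and lim: "tn \<longlonglongrightarrow> t" "xn \<longlonglongrightarrow> x" "yn \<longlonglongrightarrow> y"
      and near: "\<forall>n. t / 2 \<le> tn n \<and> tn n \<le> 2 * t \<and> \<bar>xn n - x\<bar> \<le> 1 \<and> \<bar>yn n - y\<bar> \<le> 1 \<and> (True \<or> xn n = x)"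
    have "0 < tn n" for n using near t by (metis half_gt_zero less_le_trans)
    then show "(\<lambda>n. levy_density \<mu> (tn n) (yn n - xn n)) \<longlonglongrightarrow> levy_density \<mu> t (y - x)"
      using t near by (simp add: levy_density_eq) (intro heat_deriv_tendsto tendsto_diff lim; simp)
  qed
  show "seqcont True (\<lambda>t x y. t * heat_deriv \<mu> 1 0 t (y - x))"
    unfolding seqcont_def
    by (intro allI impI, elim conjE, intro tendsto_mult heat_deriv_tendsto tendsto_diff) auto
  fix t x y assume "0 < t \<and> t < T"
  then have t: "0 < t" by simp
  have "((\<lambda>s. heat_deriv \<mu> 0 0 s (y - x)) has_real_derivative heat_deriv \<mu> 1 0 t (y - x)) (at t)"
    using heat_deriv_t[OF t, of 0] by simp
  then have "((\<lambda>s. levy_density \<mu> s (y - x)) has_real_derivative heat_deriv \<mu> 1 0 t (y - x)) (at t)"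
    by (rule has_field_derivative_transform_within_open[where S="{0<..}"]) (use t in \<open>auto simp: levy_density_eq\<close>)
  then show "((\<lambda>s. levy_p0 \<mu> s x y) has_real_derivative t * heat_deriv \<mu> 1 0 t (y - x) / t) (at t)"
    using t by (simp add: levy_p0_def)
qed

end

section \<open>The perturbation term\<close>

locale levy_perturbed = levy_scale +
  fixes m :: "real \<Rightarrow> real \<Rightarrow> real" and c \<epsilon> :: real
  assumes m_borel: "(\<lambda>(x, u). m x u) \<in> borel_measurable borel"
    and m_nonneg: "0 \<le> m x u"
    and m_le: "m x u \<le> c * min 1 (\<bar>u\<bar> powr \<epsilon>)"
    and c_pos: "0 < c" and \<epsilon>_pos: "0 < \<epsilon>"
begin

lemma m_measurable[measurable (raw)]:
  assumes "f \<in> borel_measurable M" "g \<in> borel_measurable M"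
  shows "(\<lambda>p. m (f p) (g p)) \<in> borel_measurable M"
proof -
  have "(\<lambda>(x, u). m x u) \<in> borel_measurable (borel \<Otimes>\<^sub>M borel)" using m_borel by (simp add: borel_prod)
  from measurable_compose[OF measurable_Pair[OF assms] this] show ?thesis by simp
qed

lemma m_le_c: "m x u \<le> c"
proof -
  have "c * min 1 (\<bar>u\<bar> powr \<epsilon>) \<le> c * 1" using c_pos by (intro mult_left_mono) auto
  with m_le[of x u] show ?thesis by simp
qed

definition second_diff :: "(real \<Rightarrow> real) \<Rightarrow> real \<Rightarrow> real \<Rightarrow> real" where
  "second_diff D v u = D (v - u) + D (v + u) - 2 * D v"

lemma perturbation_op_translate:
  "perturbation_op \<mu> m (\<lambda>x'. D (y - x')) x = 1 / 2 * (\<integral>u. second_diff D (y - x) u * m x u \<partial>\<mu>)"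
proof -
  have "D (y - (x + u)) + D (y - (x - u)) - 2 * D (y - x) = second_diff D (y - x) u" for u
  proof -
    have "y - (x + u) = (y - x) - u" "y - (x - u) = (y - x) + u" by auto
    then show ?thesis by (simp only: second_diff_def)
  qed
  then show ?thesis by (simp only: perturbation_op_def)
qed

text \<open>
  The perturbation operator applied to a translation invariant kernel \<open>D\<^sub>t(y - x)\<close>, for \<open>D\<close> the density as well as
  its time derivative.
\<close>

definition perturbed :: "(real \<Rightarrow> real \<Rightarrow> real) \<Rightarrow> real \<Rightarrow> real \<Rightarrow> real \<Rightarrow> real" where
  "perturbed D t x y = 1 / 2 * (\<integral>u. second_diff (D t) (y - x) u * m x u \<partial>\<mu>)"

lemma parametrix_Phi_eq: "parametrix_Phi \<mu> m = perturbed (levy_density \<mu>)"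
  by (intro ext) (simp only: parametrix_Phi_def levy_p0_def perturbation_op_translate perturbed_def)

lemma measurable3_perturbed:
  assumes [measurable]: "\<And>M f g. f \<in> borel_measurable M \<Longrightarrow> g \<in> borel_measurable M \<Longrightarrow> (\<lambda>p. D (f p) (g p)) \<in> borel_measurable (M :: (((real \<times> real \<times> real) \<times> real) measure))"
  shows "measurable3 (perturbed D)"
proof (rule measurable3I)
  show "(\<lambda>p. perturbed D (fst p) (fst (snd p)) (snd (snd p))) \<in> borel_measurable (borel \<Otimes>\<^sub>M borel \<Otimes>\<^sub>M borel)"
    unfolding perturbed_def second_diff_def by measurable
qed

lemma second_diff_measurable[measurable]:
  "(\<lambda>u. second_diff (heat_deriv \<mu> i j t) v u) \<in> borel_measurable borel"
  unfolding second_diff_def by measurable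

lemma second_diff_heat_le:
  assumes t: "0 < t"
  obtains K where "0 \<le> K" "\<And>s v u. t / 2 \<le> s \<Longrightarrow> \<bar>second_diff (heat_deriv \<mu> i 0 s) v u\<bar> \<le> K * min 1 (u\<^sup>2)"
proof -
  obtain K0 where K0: "0 \<le> K0" "\<And>s x. t / 2 \<le> s \<Longrightarrow> \<bar>heat_deriv \<mu> i 0 s x\<bar> \<le> K0"
    using heat_deriv_bounded[OF t] by metis
  obtain K2 where K2: "0 \<le> K2" "\<And>s x. t / 2 \<le> s \<Longrightarrow> \<bar>heat_deriv \<mu> i (Suc (Suc 0)) s x\<bar> \<le> K2"
    using heat_deriv_bounded[OF t] by metis
  show thesis
  proof (rule that[of "4 * K0 + 2 * K2"])
    show "0 \<le> 4 * K0 + 2 * K2" using K0 K2 by simp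
    fix s v u assume s: "t / 2 \<le> s"
    then have s0: "0 < s" using t by auto
    have "\<bar>heat_deriv \<mu> i 0 s (v + u) + heat_deriv \<mu> i 0 s (v - u) - 2 * heat_deriv \<mu> i 0 s v\<bar> \<le> 2 * K2 * u\<^sup>2"
      by (rule second_difference_bound[OF heat_deriv_x[OF s0] heat_deriv_x[OF s0] K2(2)[OF s]])
    then have a: "\<bar>second_diff (heat_deriv \<mu> i 0 s) v u\<bar> \<le> 2 * K2 * u\<^sup>2" by (simp add: second_diff_def add.commute)
    have b: "\<bar>second_diff (heat_deriv \<mu> i 0 s) v u\<bar> \<le> 4 * K0"
      unfolding second_diff_def using K0(2)[OF s, of "v + u"] K0(2)[OF s, of "v - u"] K0(2)[OF s, of v] by linarith
    show "\<bar>second_diff (heat_deriv \<mu> i 0 s) v u\<bar> \<le> (4 * K0 + 2 * K2) * min 1 (u\<^sup>2)"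
    proof (cases "u\<^sup>2 \<le> 1")
      case True
      have "2 * K2 * u\<^sup>2 \<le> (4 * K0 + 2 * K2) * u\<^sup>2" using K0 by (intro mult_right_mono) auto
      with a True show ?thesis by simp
    next
      case False
      with b K2 show ?thesis by simp
    qed
  qed
qed

lemma integrable_second_diff_m:
  assumes "0 < t"
  shows "integrable \<mu> (\<lambda>u. second_diff (heat_deriv \<mu> i 0 t) v u * m x u)"
proof -
  obtain K where K: "0 \<le> K" "\<And>s v u. t / 2 \<le> s \<Longrightarrow> \<bar>second_diff (heat_deriv \<mu> i 0 s) v u\<bar> \<le> K * min 1 (u\<^sup>2)"
    using second_diff_heat_le[OF assms] by metis
  show ?thesis
  proof (rule integrable_levy[where K="K * c"])
    fix u
    have "\<bar>second_diff (heat_deriv \<mu> i 0 t) v u\<bar> * \<bar>m x u\<bar> \<le> (K * min 1 (u\<^sup>2)) * c"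
      using assms K m_nonneg[of x u] m_le_c[of x u] by (intro mult_mono) auto
    then show "\<bar>second_diff (heat_deriv \<mu> i 0 t) v u * m x u\<bar> \<le> K * c * min 1 (u\<^sup>2)"
      by (simp add: abs_mult mult_ac)
  qed measurable
qed

text \<open>
  Continuity in \<open>x\<close> is not claimed: \<open>m\<close> is only measurable.
\<close>

lemma seqcont_perturbed:
  "seqcont False (perturbed (heat_deriv \<mu> i 0))"
  unfolding seqcont_def
proof (intro allI impI, elim conjE)
  fix t x y :: real and tn xn yn :: "nat \<Rightarrow> real"
  assume t: "0 < t" and lim: "tn \<longlonglongrightarrow> t" "xn \<longlonglongrightarrow> x" "yn \<longlonglongrightarrow> y"
    and near: "\<forall>n. t / 2 \<le> tn n \<and> tn n \<le> 2 * t \<and> \<bar>xn n - x\<bar> \<le> 1 \<and> \<bar>yn n - y\<bar> \<le> 1 \<and> (False \<or> xn n = x)"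
  then have xn: "xn n = x" and tn: "t / 2 \<le> tn n" for n by auto
  obtain K where K: "0 \<le> K" "\<And>s v u. t / 2 \<le> s \<Longrightarrow> \<bar>second_diff (heat_deriv \<mu> i 0 s) v u\<bar> \<le> K * min 1 (u\<^sup>2)"
    using second_diff_heat_le[OF t] by metis
  have "(\<lambda>n. \<integral>u. second_diff (heat_deriv \<mu> i 0 (tn n)) (yn n - x) u * m x u \<partial>\<mu>) \<longlonglongrightarrow> (\<integral>u. second_diff (heat_deriv \<mu> i 0 t) (y - x) u * m x u \<partial>\<mu>)"
  proof (rule integral_dominated_convergence[where w="\<lambda>u. K * c * min 1 (u\<^sup>2)"])
    show "integrable \<mu> (\<lambda>u. K * c * min 1 (u\<^sup>2))" by (intro integrable_mult_right integrable_min)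
    show "AE u in \<mu>. (\<lambda>n. second_diff (heat_deriv \<mu> i 0 (tn n)) (yn n - x) u * m x u) \<longlonglongrightarrow> second_diff (heat_deriv \<mu> i 0 t) (y - x) u * m x u"
      unfolding second_diff_def
      by (intro AE_I2 tendsto_mult tendsto_diff tendsto_add tendsto_const heat_deriv_tendsto t lim tn)
    show "AE u in \<mu>. norm (second_diff (heat_deriv \<mu> i 0 (tn n)) (yn n - x) u * m x u) \<le> K * c * min 1 (u\<^sup>2)" for n
    proof (rule AE_I2)
      fix u
      have "\<bar>second_diff (heat_deriv \<mu> i 0 (tn n)) (yn n - x) u\<bar> * \<bar>m x u\<bar> \<le> (K * min 1 (u\<^sup>2)) * c"
        using K tn m_nonneg[of x u] m_le_c[of x u] by (intro mult_mono) auto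
      then show "norm (second_diff (heat_deriv \<mu> i 0 (tn n)) (yn n - x) u * m x u) \<le> K * c * min 1 (u\<^sup>2)"
        by (simp add: abs_mult mult_ac)
    qed
  qed (auto simp: measurable_cong_sets[OF sets_mu refl])
  then show "(\<lambda>n. perturbed (heat_deriv \<mu> i 0) (tn n) (xn n) (yn n)) \<longlonglongrightarrow> perturbed (heat_deriv \<mu> i 0) t x y"
    unfolding perturbed_def xn by (rule tendsto_mult_left)
qed

lemma perturbed_deriv:
  assumes t: "0 < t"
  shows "((\<lambda>s. perturbed (heat_deriv \<mu> 0 0) s x y) has_real_derivative perturbed (heat_deriv \<mu> 1 0) t x y) (at t)"
  unfolding perturbed_def
proof -
  obtain K where K: "0 \<le> K" "\<And>s v u. t / 2 \<le> s \<Longrightarrow> \<bar>second_diff (heat_deriv \<mu> 1 0 s) v u\<bar> \<le> K * min 1 (u\<^sup>2)"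
    using second_diff_heat_le[OF t] by metis
  show "((\<lambda>s. 1 / 2 * (\<integral>u. second_diff (heat_deriv \<mu> 0 0 s) (y - x) u * m x u \<partial>\<mu>)) has_real_derivative
      1 / 2 * (\<integral>u. second_diff (heat_deriv \<mu> 1 0 t) (y - x) u * m x u \<partial>\<mu>)) (at t)"
  proof (rule DERIV_cmult, rule has_real_derivative_integral[where a="t / 2" and b="2 * t" and w="\<lambda>u. K * c * min 1 (u\<^sup>2)"])
    fix s u assume s: "t / 2 < s"
    then have s0: "0 < s" using t by auto
    have d: "((\<lambda>s. heat_deriv \<mu> 0 0 s v) has_real_derivative heat_deriv \<mu> 1 0 s v) (at s)" for v
      using heat_deriv_t[OF s0, of 0] by simp
    have "((\<lambda>s. second_diff (heat_deriv \<mu> 0 0 s) (y - x) u) has_real_derivative second_diff (heat_deriv \<mu> 1 0 s) (y - x) u) (at s)"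
      unfolding second_diff_def by (intro DERIV_diff DERIV_add DERIV_cmult d)
    then show "((\<lambda>s. second_diff (heat_deriv \<mu> 0 0 s) (y - x) u * m x u) has_real_derivative second_diff (heat_deriv \<mu> 1 0 s) (y - x) u * m x u) (at s)"
      by (rule DERIV_cmult_right)
    have "\<bar>second_diff (heat_deriv \<mu> 1 0 s) (y - x) u\<bar> * \<bar>m x u\<bar> \<le> (K * min 1 (u\<^sup>2)) * c"
      using K s m_nonneg[of x u] m_le_c[of x u] by (intro mult_mono) auto
    then show "\<bar>second_diff (heat_deriv \<mu> 1 0 s) (y - x) u * m x u\<bar> \<le> K * c * min 1 (u\<^sup>2)"
      by (simp add: abs_mult mult_ac)
  next
    fix s assume "t / 2 < s"
    then show "integrable \<mu> (\<lambda>u. second_diff (heat_deriv \<mu> 0 0 s) (y - x) u * m x u)"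
      using t by (intro integrable_second_diff_m) auto
  next
    show "integrable \<mu> (\<lambda>u. K * c * min 1 (u\<^sup>2))" by (intro integrable_mult_right integrable_min)
  qed (use t in \<open>auto simp: measurable_cong_sets[OF sets_mu refl]\<close>)
qed

definition perturbed_envelope :: "real \<Rightarrow> real \<Rightarrow> ennreal" where
  "perturbed_envelope t v = (\<integral>\<^sup>+u. ennreal (4 * c * (min 1 (\<bar>u\<bar> powr \<epsilon>) * min ((rho0 t * u)\<^sup>2) 1)) *
     (heat_envelope t v + (heat_envelope t (v + u) + heat_envelope t (v - u))) \<partial>\<mu>)"

lemma heat_envelope_measurable[measurable (raw)]:
  assumes "f \<in> borel_measurable M" "g \<in> borel_measurable M"
  shows "(\<lambda>p. heat_envelope (f p) (g p)) \<in> borel_measurable M"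
proof -
  obtain C where "kern 1 C heat_envelope" by (rule kern_heat_envelope)
  from kern_measurable[OF this assms] show ?thesis .
qed

text \<open>
  Translations do not change the integral, so the \<open>\<mu>\<close>-mass of the weight is all that counts.
\<close>

lemma kern_perturbed_envelope:
  obtains \<delta> C where "0 < \<delta>" "kern \<delta> C perturbed_envelope"
proof -
  obtain CG where G: "kern 1 CG heat_envelope" by (rule kern_heat_envelope)
  have CG: "0 \<le> CG" using G by (simp add: kern_def)
  obtain C \<delta> where C: "0 < \<delta>" "0 \<le> C" "\<And>t. 0 < t \<Longrightarrow> t \<le> T \<Longrightarrow>
    (\<integral>\<^sup>+u. ennreal (min 1 (\<bar>u\<bar> powr \<epsilon>) * min ((levy_rho \<mu> t * u)\<^sup>2) 1) \<partial>\<mu>) \<le> ennreal (C * t powr (\<delta> - 1))"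
    by (rule perturbation_mass[OF T_pos \<epsilon>_pos]) (rule that)
  interpret P: pair_sigma_finite lborel \<mu> ..
  have "kern \<delta> (4 * c * C * (3 * CG)) perturbed_envelope"
    unfolding kern_def
  proof (intro conjI allI impI)
    show "0 \<le> 4 * c * C * (3 * CG)" using c_pos C CG by simp
    have "(\<lambda>p. perturbed_envelope (fst p) (snd p)) \<in> borel_measurable (borel \<Otimes>\<^sub>M borel)"
      unfolding perturbed_envelope_def by measurable
    then show "(\<lambda>(t, v). perturbed_envelope t v) \<in> borel_measurable borel" by (simp add: borel_prod case_prod_unfold)
    fix t assume "0 < t \<and> t \<le> T"
    then have t: "0 < t" "t \<le> T" by auto
    have hG: "harnack (rho0 t) 1 (heat_envelope t)" by (rule kernD(2)[OF G t])
    show "harnack (rho0 t) 1 (perturbed_envelope t)"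
      unfolding perturbed_envelope_def[abs_def]
    proof (rule harnack_nn_integral)
      fix u
      show "harnack (rho0 t) 1 (\<lambda>v. ennreal (4 * c * (min 1 (\<bar>u\<bar> powr \<epsilon>) * min ((rho0 t * u)\<^sup>2) 1)) *
         (heat_envelope t v + (heat_envelope t (v + u) + heat_envelope t (v - u))))"
        using harnack_translate[OF hG, of u] harnack_translate[OF hG, of "- u"] hG
        by (intro harnack_cmult harnack_add) auto
    qed (auto simp: measurable_cong_sets[OF sets_mu refl])
    let ?w = "\<lambda>u. 4 * c * (min 1 (\<bar>u\<bar> powr \<epsilon>) * min ((rho0 t * u)\<^sup>2) 1)"
    define I where "I = (\<integral>\<^sup>+v. heat_envelope t v \<partial>lborel)"
    have I: "I \<le> ennreal CG" using kernD(1)[OF G t] t by (simp add: I_def)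
    have sh: "(\<integral>\<^sup>+v. heat_envelope t (v + u) \<partial>lborel) = I" "(\<integral>\<^sup>+v. heat_envelope t (v - u) \<partial>lborel) = I" for u
      unfolding I_def by (auto intro!: nn_integral_shift)
    have "(\<integral>\<^sup>+v. perturbed_envelope t v \<partial>lborel)
       = (\<integral>\<^sup>+u. (\<integral>\<^sup>+v. ennreal (?w u) * (heat_envelope t v + (heat_envelope t (v + u) + heat_envelope t (v - u))) \<partial>lborel) \<partial>\<mu>)"
      unfolding perturbed_envelope_def by (rule P.Fubini'[symmetric]) measurable
    also have "\<dots> = (\<integral>\<^sup>+u. ennreal (?w u) * (I + (I + I)) \<partial>\<mu>)"
    proof (rule nn_integral_cong)
      fix u
      have "(\<integral>\<^sup>+v. ennreal (?w u) * (heat_envelope t v + (heat_envelope t (v + u) + heat_envelope t (v - u))) \<partial>lborel)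
         = ennreal (?w u) * (\<integral>\<^sup>+v. heat_envelope t v + (heat_envelope t (v + u) + heat_envelope t (v - u)) \<partial>lborel)"
        by (rule nn_integral_cmult) measurable
      also have "(\<integral>\<^sup>+v. heat_envelope t v + (heat_envelope t (v + u) + heat_envelope t (v - u)) \<partial>lborel) = I + (I + I)"
        by (subst nn_integral_add, measurable, subst nn_integral_add, measurable) (simp add: sh I_def)
      finally show "(\<integral>\<^sup>+v. ennreal (?w u) * (heat_envelope t v + (heat_envelope t (v + u) + heat_envelope t (v - u))) \<partial>lborel) = ennreal (?w u) * (I + (I + I))" .
    qed
    also have "\<dots> = (\<integral>\<^sup>+u. ennreal (?w u) \<partial>\<mu>) * (I + (I + I))"
      by (rule nn_integral_multc) measurable
    also have "(\<integral>\<^sup>+u. ennreal (?w u) \<partial>\<mu>) = ennreal (4 * c) * (\<integral>\<^sup>+u. ennreal (min 1 (\<bar>u\<bar> powr \<epsilon>) * min ((rho0 t * u)\<^sup>2) 1) \<partial>\<mu>)"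
      using c_pos by (subst nn_integral_cmult[symmetric]) (auto simp: ennreal_mult measurable_cong_sets[OF sets_mu refl])
    also have "\<dots> * (I + (I + I)) \<le> (ennreal (4 * c) * ennreal (C * t powr (\<delta> - 1))) * (ennreal CG + (ennreal CG + ennreal CG))"
      using C(3)[OF t] I t by (intro mult_mono add_mono) (auto simp: rho0_eq)
    also have "ennreal CG + (ennreal CG + ennreal CG) = ennreal (3 * CG)" using CG by (simp flip: ennreal_plus)
    also have "ennreal (4 * c) * ennreal (C * t powr (\<delta> - 1)) * ennreal (3 * CG) = ennreal (4 * c * (C * t powr (\<delta> - 1)) * (3 * CG))"
    proof -
      have "0 \<le> 4 * c" "0 \<le> C * t powr (\<delta> - 1)" "0 \<le> 3 * CG" using c_pos C CG by auto
      then show ?thesis by (simp only: ennreal_mult mult_nonneg_nonneg)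
    qed
    also have "4 * c * (C * t powr (\<delta> - 1)) * (3 * CG) = 4 * c * C * (3 * CG) * t powr (\<delta> - 1)" by simp
    finally show "(\<integral>\<^sup>+v. perturbed_envelope t v \<partial>lborel) \<le> ennreal (4 * c * C * (3 * CG) * t powr (\<delta> - 1))" .
  qed
  with C(1) show thesis by (rule that)
qed

text \<open>
  For \<open>\<bar>\<rho>\<^sub>t u\<bar> \<le> 1\<close> the second derivative is at most \<open>\<rho>\<^sub>t\<^sup>2\<close> times the envelope at a nearby point, hence at
  \<open>v\<close>; for larger \<open>u\<close> the three values are estimated separately.
\<close>

lemma second_diff_le_envelope:
  assumes t: "0 < t" "t \<le> T"
    and D1: "\<And>x. (D has_real_derivative D1 x) (at x)" and D2: "\<And>x. (D1 has_real_derivative D2 x) (at x)"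
    and b0: "\<And>v. ennreal \<bar>D v\<bar> \<le> heat_envelope t v" and b2: "\<And>v. ennreal \<bar>D2 v\<bar> \<le> ennreal ((rho0 t)\<^sup>2) * heat_envelope t v"
  shows "ennreal \<bar>second_diff D v u\<bar> \<le> ennreal (8 * min ((rho0 t * u)\<^sup>2) 1) * (heat_envelope t v + (heat_envelope t (v + u) + heat_envelope t (v - u)))"
proof -
  obtain CG where G: "kern 1 CG heat_envelope" by (rule kern_heat_envelope)
  have r: "0 < rho0 t" using \<rho>_pos t by simp
  have hG: "harnack (rho0 t) 1 (heat_envelope t)" by (rule kernD(2)[OF G t])
  show ?thesis
  proof (cases "\<bar>rho0 t * u\<bar> \<le> 1")
    case True
    define g where "g = enn2real (heat_envelope t v)"
    have "heat_envelope t v < top" using kern_sup[OF G t, of v] by (auto intro: le_less_trans)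
    then have g: "heat_envelope t v = ennreal g" "0 \<le> g" by (auto simp: g_def)
    have "\<bar>D2 (v + w)\<bar> \<le> (rho0 t)\<^sup>2 * (4 * g)" if w: "\<bar>w\<bar> \<le> \<bar>u\<bar>" for w
    proof -
      have "rho0 t * \<bar>w\<bar> \<le> rho0 t * \<bar>u\<bar>" using w r by (intro mult_left_mono) auto
      also have "rho0 t * \<bar>u\<bar> \<le> 1" using True r by (simp add: abs_mult)
      finally have near: "rho0 t * \<bar>(v + w) - v\<bar> \<le> 1" by simp
      have "ennreal \<bar>D2 (v + w)\<bar> \<le> ennreal ((rho0 t)\<^sup>2) * (ennreal (4 * 1) * heat_envelope t v)"
        by (rule order_trans[OF b2]) (intro mult_left_mono harnack_near[OF hG _ r near]; simp)
      also have "\<dots> = ennreal ((rho0 t)\<^sup>2 * (4 * g))" unfolding g(1) using g(2) by (simp add: ennreal_mult)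
      finally show ?thesis using g by (simp add: ennreal_le_iff)
    qed
    then have "\<bar>D (v + u) + D (v - u) - 2 * D v\<bar> \<le> 2 * ((rho0 t)\<^sup>2 * (4 * g)) * u\<^sup>2"
      by (rule second_difference_bound[OF D1 D2])
    then have "\<bar>second_diff D v u\<bar> \<le> 8 * (rho0 t * u)\<^sup>2 * g" by (simp add: second_diff_def power_mult_distrib add.commute mult_ac)
    moreover have "min ((rho0 t * u)\<^sup>2) 1 = (rho0 t * u)\<^sup>2" using True by (simp add: abs_square_le_1)
    ultimately have "ennreal \<bar>second_diff D v u\<bar> \<le> ennreal (8 * min ((rho0 t * u)\<^sup>2) 1 * g)" by (intro ennreal_leI) simp
    also have "\<dots> = ennreal (8 * min ((rho0 t * u)\<^sup>2) 1) * heat_envelope t v" unfolding g(1) using g(2) by (intro ennreal_mult) auto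
    also have "\<dots> \<le> ennreal (8 * min ((rho0 t * u)\<^sup>2) 1) * (heat_envelope t v + (heat_envelope t (v + u) + heat_envelope t (v - u)))"
      by (intro mult_left_mono) auto
    finally show ?thesis .
  next
    case False
    then have "1 < \<bar>rho0 t * u\<bar>" by simp
    then have "1 \<le> \<bar>rho0 t * u\<bar>\<^sup>2" by (intro one_le_power) auto
    then have m1: "min ((rho0 t * u)\<^sup>2) 1 = 1" by simp
    have "ennreal \<bar>second_diff D v u\<bar> \<le> ennreal (\<bar>D v\<bar> + \<bar>D v\<bar> + (\<bar>D (v + u)\<bar> + \<bar>D (v - u)\<bar>))"
      unfolding second_diff_def by (intro ennreal_leI) linarith
    also have "\<dots> = ennreal \<bar>D v\<bar> + ennreal \<bar>D v\<bar> + (ennreal \<bar>D (v + u)\<bar> + ennreal \<bar>D (v - u)\<bar>)"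
      by (simp only: ennreal_plus abs_ge_zero add_nonneg_nonneg)
    also have "\<dots> \<le> heat_envelope t v + heat_envelope t v + (heat_envelope t (v + u) + heat_envelope t (v - u))"
      by (intro add_mono b0)
    also have "\<dots> \<le> 2 * (heat_envelope t v + (heat_envelope t (v + u) + heat_envelope t (v - u)))"
      unfolding mult_2 by (simp add: algebra_simps add_increasing add_increasing2 add_left_mono)
    also have "\<dots> \<le> ennreal 8 * (heat_envelope t v + (heat_envelope t (v + u) + heat_envelope t (v - u)))"
      by (intro mult_right_mono) auto
    finally show ?thesis unfolding m1 by simp
  qed
qed

lemma perturbed_le_envelope:
  assumes t: "0 < t" "t \<le> T"
    and D1: "\<And>x. (D t' has_real_derivative D1 x) (at x)" and D2: "\<And>x. (D1 has_real_derivative D2 x) (at x)"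
    and b0: "\<And>v. ennreal \<bar>D t' v\<bar> \<le> heat_envelope t v" and b2: "\<And>v. ennreal \<bar>D2 v\<bar> \<le> ennreal ((rho0 t)\<^sup>2) * heat_envelope t v"
  shows "ennreal \<bar>perturbed D t' x y\<bar> \<le> perturbed_envelope t (y - x)"
proof -
  let ?E = "\<lambda>u. heat_envelope t (y - x) + (heat_envelope t (y - x + u) + heat_envelope t (y - x - u))"
  have "ennreal \<bar>perturbed D t' x y\<bar> = ennreal (1 / 2) * ennreal \<bar>\<integral>u. second_diff (D t') (y - x) u * m x u \<partial>\<mu>\<bar>"
    unfolding perturbed_def abs_mult by (subst ennreal_mult) auto
  also have "\<dots> \<le> ennreal (1 / 2) * (\<integral>\<^sup>+u. ennreal \<bar>second_diff (D t') (y - x) u * m x u\<bar> \<partial>\<mu>)"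
    by (intro mult_left_mono abs_integral_le_nn_integral) auto
  also have "\<dots> \<le> ennreal (1 / 2) * (\<integral>\<^sup>+u. ennreal (8 * c * (min 1 (\<bar>u\<bar> powr \<epsilon>) * min ((rho0 t * u)\<^sup>2) 1)) * ?E u \<partial>\<mu>)"
  proof (intro mult_left_mono nn_integral_mono)
    fix u
    have "ennreal \<bar>second_diff (D t') (y - x) u * m x u\<bar> = ennreal \<bar>second_diff (D t') (y - x) u\<bar> * ennreal (m x u)"
      using m_nonneg[of x u] by (simp add: abs_mult ennreal_mult)
    also have "\<dots> \<le> (ennreal (8 * min ((rho0 t * u)\<^sup>2) 1) * ?E u) * ennreal (c * min 1 (\<bar>u\<bar> powr \<epsilon>))"
      by (intro mult_mono second_diff_le_envelope[OF t D1 D2 b0 b2] ennreal_leI m_le) auto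
    also have "\<dots> = (ennreal (8 * min ((rho0 t * u)\<^sup>2) 1) * ennreal (c * min 1 (\<bar>u\<bar> powr \<epsilon>))) * ?E u" by (simp only: mult_ac)
    also have "ennreal (8 * min ((rho0 t * u)\<^sup>2) 1) * ennreal (c * min 1 (\<bar>u\<bar> powr \<epsilon>)) = ennreal (8 * min ((rho0 t * u)\<^sup>2) 1 * (c * min 1 (\<bar>u\<bar> powr \<epsilon>)))"
      using c_pos by (intro ennreal_mult[symmetric]) auto
    also have "8 * min ((rho0 t * u)\<^sup>2) 1 * (c * min 1 (\<bar>u\<bar> powr \<epsilon>)) = 8 * c * (min 1 (\<bar>u\<bar> powr \<epsilon>) * min ((rho0 t * u)\<^sup>2) 1)" by simp
    finally show "ennreal \<bar>second_diff (D t') (y - x) u * m x u\<bar> \<le> ennreal (8 * c * (min 1 (\<bar>u\<bar> powr \<epsilon>) * min ((rho0 t * u)\<^sup>2) 1)) * ?E u" .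
  qed simp
  also have "\<dots> = (\<integral>\<^sup>+u. ennreal (1 / 2) * (ennreal (8 * c * (min 1 (\<bar>u\<bar> powr \<epsilon>) * min ((rho0 t * u)\<^sup>2) 1)) * ?E u) \<partial>\<mu>)"
    by (rule nn_integral_cmult[symmetric]) measurable
  also have "\<dots> = perturbed_envelope t (y - x)"
    unfolding perturbed_envelope_def
  proof (rule nn_integral_cong)
    fix u
    have "ennreal (1 / 2) * ennreal (8 * c * (min 1 (\<bar>u\<bar> powr \<epsilon>) * min ((rho0 t * u)\<^sup>2) 1)) = ennreal (1 / 2 * (8 * c * (min 1 (\<bar>u\<bar> powr \<epsilon>) * min ((rho0 t * u)\<^sup>2) 1)))"
      using c_pos by (intro ennreal_mult[symmetric]) auto
    also have "1 / 2 * (8 * c * (min 1 (\<bar>u\<bar> powr \<epsilon>) * min ((rho0 t * u)\<^sup>2) 1)) = 4 * c * (min 1 (\<bar>u\<bar> powr \<epsilon>) * min ((rho0 t * u)\<^sup>2) 1)" by simp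
    finally show "ennreal (1 / 2) * (ennreal (8 * c * (min 1 (\<bar>u\<bar> powr \<epsilon>) * min ((rho0 t * u)\<^sup>2) 1)) * ?E u)
      = ennreal (4 * c * (min 1 (\<bar>u\<bar> powr \<epsilon>) * min ((rho0 t * u)\<^sup>2) 1)) * ?E u" by (simp only: mult.assoc[symmetric])
  qed
  finally show ?thesis .
qed

lemma perturbed_cmult: "perturbed (\<lambda>t v. a t * D t v) t x y = a t * perturbed D t x y"
proof -
  have "second_diff (\<lambda>v. a t * D t v) v u = a t * second_diff (D t) v u" for v u
    by (simp add: second_diff_def algebra_simps)
  then show ?thesis by (simp add: perturbed_def mult.assoc)
qed

lemma perturbed_density_eq: "0 < t \<Longrightarrow> perturbed (levy_density \<mu>) t x y = perturbed (heat_deriv \<mu> 0 0) t x y"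
  by (simp add: perturbed_def second_diff_def levy_density_eq)

lemma kernel_pair_Phi:
  "kernel_pair False perturbed_envelope (parametrix_Phi \<mu> m) (\<lambda>t x y. t * perturbed (heat_deriv \<mu> 1 0) t x y)"
  unfolding kernel_pair_def parametrix_Phi_eq
proof (intro conjI allI impI)
  show "measurable3 (perturbed (levy_density \<mu>))" by (rule measurable3_perturbed) measurable
  have "measurable3 (perturbed (heat_deriv \<mu> 1 0))" by (rule measurable3_perturbed) measurable
  note [measurable] = measurable3D[OF this]
  show "measurable3 (\<lambda>t x y. t * perturbed (heat_deriv \<mu> 1 0) t x y)" by (rule measurable3I) measurable
  show "dominated perturbed_envelope (perturbed (levy_density \<mu>))"
    unfolding dominated_def
  proof (intro allI impI, elim conjE)
    fix t t' x y assume t: "0 < t" "t \<le> T" "t / 2 \<le> t'" "t' \<le> 2 * t"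
    then have t'0: "0 < t'" by auto
    have "ennreal \<bar>perturbed (heat_deriv \<mu> 0 0) t' x y\<bar> \<le> perturbed_envelope t (y - x)"
    proof (rule perturbed_le_envelope[OF t(1,2)])
      show "(heat_deriv \<mu> 0 0 t' has_real_derivative heat_deriv \<mu> 0 (Suc 0) t' v) (at v)"
        "(heat_deriv \<mu> 0 (Suc 0) t' has_real_derivative heat_deriv \<mu> 0 (Suc (Suc 0)) t' v) (at v)" for v
        by (rule heat_deriv_x[OF t'0])+
      show "ennreal \<bar>heat_deriv \<mu> 0 0 t' v\<bar> \<le> heat_envelope t v" for v using heat_le_envelope(1)[OF _ t, of 0] by simp
      show "ennreal \<bar>heat_deriv \<mu> 0 (Suc (Suc 0)) t' v\<bar> \<le> ennreal ((rho0 t)\<^sup>2) * heat_envelope t v" for v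
        using heat_le_envelope(1)[OF _ t, of 2] by (simp add: numeral_2_eq_2)
    qed
    then show "ennreal \<bar>perturbed (levy_density \<mu>) t' x y\<bar> \<le> perturbed_envelope t (y - x)"
      using t'0 by (simp add: perturbed_density_eq)
  qed
  show "dominated perturbed_envelope (\<lambda>t x y. t * perturbed (heat_deriv \<mu> 1 0) t x y)"
    unfolding dominated_def
  proof (intro allI impI, elim conjE)
    fix t t' x y assume t: "0 < t" "t \<le> T" "t / 2 \<le> t'" "t' \<le> 2 * t"
    then have t'0: "0 < t'" by auto
    have "ennreal \<bar>perturbed (\<lambda>t v. t * heat_deriv \<mu> 1 0 t v) t' x y\<bar> \<le> perturbed_envelope t (y - x)"
    proof (rule perturbed_le_envelope[OF t(1,2)])
      show "((\<lambda>v. t' * heat_deriv \<mu> 1 0 t' v) has_real_derivative t' * heat_deriv \<mu> 1 (Suc 0) t' v) (at v)" for v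
        by (intro DERIV_cmult heat_deriv_x[OF t'0])
      show "((\<lambda>v. t' * heat_deriv \<mu> 1 (Suc 0) t' v) has_real_derivative t' * heat_deriv \<mu> 1 (Suc (Suc 0)) t' v) (at v)" for v
        by (intro DERIV_cmult heat_deriv_x[OF t'0])
      show "ennreal \<bar>t' * heat_deriv \<mu> 1 0 t' v\<bar> \<le> heat_envelope t v" for v using heat_le_envelope(2)[OF _ t, of 0] by simp
      show "ennreal \<bar>t' * heat_deriv \<mu> 1 (Suc (Suc 0)) t' v\<bar> \<le> ennreal ((rho0 t)\<^sup>2) * heat_envelope t v" for v
        using heat_le_envelope(2)[OF _ t, of 2] by (simp add: numeral_2_eq_2)
    qed
    then show "ennreal \<bar>t' * perturbed (heat_deriv \<mu> 1 0) t' x y\<bar> \<le> perturbed_envelope t (y - x)"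
      unfolding perturbed_cmult[of "\<lambda>t. t"] .
  qed
  show "seqcont False (perturbed (levy_density \<mu>))"
    unfolding seqcont_def
  proof (intro allI impI, elim conjE)
    fix t x y :: real and tn xn yn :: "nat \<Rightarrow> real"
    assume t: "0 < t" "t < T" and lim: "tn \<longlonglongrightarrow> t" "xn \<longlonglongrightarrow> x" "yn \<longlonglongrightarrow> y"
      and near: "\<forall>n. t / 2 \<le> tn n \<and> tn n \<le> 2 * t \<and> \<bar>xn n - x\<bar> \<le> 1 \<and> \<bar>yn n - y\<bar> \<le> 1 \<and> (False \<or> xn n = x)"
    have "0 < tn n" for n using near t by (metis half_gt_zero less_le_trans)
    moreover have "(\<lambda>n. perturbed (heat_deriv \<mu> 0 0) (tn n) (xn n) (yn n)) \<longlonglongrightarrow> perturbed (heat_deriv \<mu> 0 0) t x y"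
      by (rule seqcontD[OF seqcont_perturbed t lim]) (use near in blast)+
    ultimately show "(\<lambda>n. perturbed (levy_density \<mu>) (tn n) (xn n) (yn n)) \<longlonglongrightarrow> perturbed (levy_density \<mu>) t x y"
      using t by (simp add: perturbed_density_eq)
  qed
  show "seqcont False (\<lambda>t x y. t * perturbed (heat_deriv \<mu> 1 0) t x y)"
    unfolding seqcont_def
  proof (intro allI impI, elim conjE)
    fix t x y :: real and tn xn yn :: "nat \<Rightarrow> real"
    assume t: "0 < t" "t < T" and lim: "tn \<longlonglongrightarrow> t" "xn \<longlonglongrightarrow> x" "yn \<longlonglongrightarrow> y"
      and near: "\<forall>n. t / 2 \<le> tn n \<and> tn n \<le> 2 * t \<and> \<bar>xn n - x\<bar> \<le> 1 \<and> \<bar>yn n - y\<bar> \<le> 1 \<and> (False \<or> xn n = x)"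
    have "(\<lambda>n. perturbed (heat_deriv \<mu> 1 0) (tn n) (xn n) (yn n)) \<longlonglongrightarrow> perturbed (heat_deriv \<mu> 1 0) t x y"
      by (rule seqcontD[OF seqcont_perturbed t lim]) (use near in blast)+
    with lim(1) show "(\<lambda>n. tn n * perturbed (heat_deriv \<mu> 1 0) (tn n) (xn n) (yn n)) \<longlonglongrightarrow> t * perturbed (heat_deriv \<mu> 1 0) t x y"
      by (rule tendsto_mult)
  qed
  fix t x y assume "0 < t \<and> t < T"
  then have t: "0 < t" by simp
  have "((\<lambda>s. perturbed (levy_density \<mu>) s x y) has_real_derivative perturbed (heat_deriv \<mu> 1 0) t x y) (at t)"
    by (rule has_field_derivative_transform_within_open[OF perturbed_deriv[OF t], where S="{0<..}"])
       (use t in \<open>auto simp: perturbed_density_eq\<close>)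
  then show "((\<lambda>s. perturbed (levy_density \<mu>) s x y) has_real_derivative t * perturbed (heat_deriv \<mu> 1 0) t x y / t) (at t)"
    using t by simp
qed

theorem kernel_pair_parametrix_p:
  obtains C H p' where "kern 1 C H" "kernel_pair True H (parametrix_p \<mu> m) p'"
proof -
  obtain \<delta> C\<Phi> where \<Phi>: "0 < \<delta>" "kern \<delta> C\<Phi> perturbed_envelope" by (rule kern_perturbed_envelope)
  obtain CG where G: "kern 1 CG heat_envelope" by (rule kern_heat_envelope)
  have eq: "(\<lambda>t x y. levy_p0 \<mu> t x y + spacetime_conv (levy_p0 \<mu>) (\<lambda>t x y. \<Sum>k. spacetime_conv_pow (parametrix_Phi \<mu> m) k t x y) t x y) = parametrix_p \<mu> m"
    by (intro ext) (simp add: parametrix_p_def parametrix_Psi_def[abs_def])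
  show thesis
    by (rule kernel_pair_parametrix[OF \<Phi>(2,1) kernel_pair_Phi G kernel_pair_heat]) (rule that, simp_all only: eq)
qed

end

section \<open>The perturbed transition density\<close>

text \<open>
  If \<open>q\<^sup>U(1) = 0\<close>, then \<open>\<mu>\<close> is concentrated at \<open>0\<close>, where \<open>\<bar>u\<bar>\<^sup>\<epsilon>\<close> vanishes.
\<close>

lemma qU_pos_of_infinite_mass:
  assumes levy: "levy_measure \<mu>" and inf: "(\<integral>\<^sup>+u. ennreal (min (\<bar>u\<bar> powr \<epsilon>) 1) \<partial>\<mu>) = \<infinity>"
  shows "0 < levy_qU \<mu> 1"
proof (rule ccontr)
  interpret levy \<mu> by standard (rule levy)
  assume "\<not> 0 < levy_qU \<mu> 1"
  then have "levy_qU \<mu> 1 = 0" using qU_nonneg[of 1] by simp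
  then have "AE u in \<mu>. min ((1 * u)\<^sup>2) 1 = 0"
    unfolding levy_qU_def by (subst (asm) integral_nonneg_eq_0_iff_AE[OF qU_integrable]) auto
  then have "AE u in \<mu>. ennreal (min (\<bar>u\<bar> powr \<epsilon>) 1) = 0"
    by eventually_elim (auto simp: min_def split: if_splits)
  then have "(\<integral>\<^sup>+u. ennreal (min (\<bar>u\<bar> powr \<epsilon>) 1) \<partial>\<mu>) = 0"
    by (subst nn_integral_0_iff_AE) (auto simp: measurable_cong_sets[OF sets_mu refl])
  with inf show False by simp
qed

text \<open>
  The estimates are applied on \<open>{0<..<T}\<close> for every \<open>T\<close> to obtain continuity and differentiability on all of
  \<open>{0<..}\<close>.
\<close>

theorem proposition2p3:
  fixes \<mu> :: "real measure" and m :: "real \<Rightarrow> real \<Rightarrow> real"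
  assumes "levy_measure \<mu>" and "symmetric_measure \<mu>"
    and "(\<lambda>(x, u). m x u) \<in> borel_measurable borel"
    and A1: "\<exists>\<beta>>1. \<forall>\<^sub>F \<xi> in at_infinity. levy_qU \<mu> \<xi> \<le> \<beta> * levy_qL \<mu> \<xi>"
    and A2: "\<forall>x u. m x u \<ge> 0 \<and> m x (- u) = m x u"
    and A3: "\<exists>c>0. \<exists>\<epsilon>>0. (\<forall>x u. m x u \<le> c * min 1 (\<bar>u\<bar> powr \<epsilon>)) \<and>
               (\<integral>\<^sup>+u. ennreal (min (\<bar>u\<bar> powr \<epsilon>) 1) \<partial>\<mu>) = \<infinity>"
  shows "continuous_on ({0<..} \<times> UNIV \<times> UNIV) (\<lambda>(t, x, y). parametrix_p \<mu> m t x y)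
    \<and> (\<exists>d1>0. \<exists>d2>0. \<exists>Q :: real \<Rightarrow> real measure.
          (\<forall>t\<ge>0. prob_space (Q t) \<and> sets (Q t) = sets borel) \<and>
          (\<forall>t\<in>{0<..1}. \<forall>x y. parametrix_p \<mu> m t x y \<le>
             levy_rho \<mu> t * conv_measure (\<lambda>z. f_up d1 d2 (levy_rho \<mu> t * z)) (Q t) (y - x)))
    \<and> (\<forall>t>0. \<forall>x y. (\<lambda>s. parametrix_p \<mu> m s x y) field_differentiable at t)
    \<and> continuous_on ({0<..} \<times> UNIV \<times> UNIV) (\<lambda>(t, x, y). deriv (\<lambda>s. parametrix_p \<mu> m s x y) t)
    \<and> (\<exists>C>0. \<exists>d1>0. \<exists>d2>0. \<exists>Q :: real \<Rightarrow> real measure.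
          (\<forall>t\<ge>0. prob_space (Q t) \<and> sets (Q t) = sets borel) \<and>
          (\<forall>t\<in>{0<..1}. \<forall>x y. \<bar>deriv (\<lambda>s. parametrix_p \<mu> m s x y) t\<bar> \<le>
             C * inverse t * levy_rho \<mu> t *
               conv_measure (\<lambda>z. f_up d1 d2 (levy_rho \<mu> t * z)) (Q t) (y - x)))"
proof -
  obtain c \<epsilon> where c: "0 < c" "0 < \<epsilon>" "\<And>x u. m x u \<le> c * min 1 (\<bar>u\<bar> powr \<epsilon>)"
    and inf: "(\<integral>\<^sup>+u. ennreal (min (\<bar>u\<bar> powr \<epsilon>) 1) \<partial>\<mu>) = \<infinity>"
    using A3 by blast
  interpret L: levy_A1 \<mu>
    by standard (use assms(1) A1 qU_pos_of_infinite_mass[OF assms(1) inf] in auto)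
  let ?p = "parametrix_p \<mu> m"
  have loc: "\<exists>A. levy_perturbed \<mu> T A m c \<epsilon>" if T: "0 < T" for T
  proof -
    obtain A where "time_scale T (levy_A1.rho0 \<mu>) A" using L.time_scale_rho[OF T] by blast
    then interpret time_scale T "levy_A1.rho0 \<mu>" A .
    have "levy_perturbed \<mu> T A m c \<epsilon>"
      by standard (use assms(3) A2 c in auto)
    then show ?thesis ..
  qed
  have cont: "continuous_on ({0<..<T} \<times> UNIV \<times> UNIV) (\<lambda>(t, x, y). ?p t x y)"
    "continuous_on ({0<..<T} \<times> UNIV \<times> UNIV) (\<lambda>(t, x, y). deriv (\<lambda>s. ?p s x y) t)"
    "\<And>t x y. 0 < t \<Longrightarrow> t < T \<Longrightarrow> (\<lambda>s. ?p s x y) field_differentiable at t" if T: "0 < T" for T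
  proof -
    obtain A where "levy_perturbed \<mu> T A m c \<epsilon>" using loc[OF T] by blast
    then interpret levy_perturbed \<mu> T A m c \<epsilon> .
    obtain C H p' where "kern 1 C H" "kernel_pair True H ?p p'" by (rule kernel_pair_parametrix_p)
    note k = kernel_pair_continuous[OF this(2)]
    show "continuous_on ({0<..<T} \<times> UNIV \<times> UNIV) (\<lambda>(t, x, y). ?p t x y)"
      "continuous_on ({0<..<T} \<times> UNIV \<times> UNIV) (\<lambda>(t, x, y). deriv (\<lambda>s. ?p s x y) t)"
      "\<And>t x y. 0 < t \<Longrightarrow> t < T \<Longrightarrow> (\<lambda>s. ?p s x y) field_differentiable at t"
      by (fact k(1), fact k(2), fact k(3))
  qed
  have glob: "continuous_on ({0<..} \<times> UNIV \<times> UNIV) F"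
    if F: "\<And>T. 0 < T \<Longrightarrow> continuous_on ({0<..<T} \<times> UNIV \<times> UNIV) F" for F :: "real \<times> real \<times> real \<Rightarrow> real"
  proof (rule continuous_at_imp_continuous_on, rule ballI)
    fix p :: "real \<times> real \<times> real" assume p: "p \<in> {0<..} \<times> UNIV \<times> UNIV"
    let ?U = "{0<..<fst p + 1} \<times> (UNIV :: real set) \<times> (UNIV :: real set)"
    have "0 < fst p" using p by auto
    then have "continuous_on ?U F" by (intro F) simp
    moreover have "open ?U" by (intro open_Times) auto
    moreover have "p \<in> ?U" using p by (cases p) auto
    ultimately show "isCont F p" using continuous_on_eq_continuous_at by blast
  qed
  \<comment> \<open>With \<open>T = 2\<close> the interval \<open>{0<..1}\<close>, including its endpoint, is interior, so that \<open>p' = t \<partial>\<^sub>t p\<close> holds on it.\<close>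
  obtain A where "levy_perturbed \<mu> 2 A m c \<epsilon>" using loc[of 2] by auto
  then interpret levy_perturbed \<mu> 2 A m c \<epsilon> .
  obtain C H p' where H: "kern 1 C H" "kernel_pair True H ?p p'" by (rule kernel_pair_parametrix_p)
  obtain d Q where d: "0 < d" "\<And>t. prob_space (Q t)" "\<And>t. sets (Q t) = sets borel"
    "\<And>t x y. 0 < t \<Longrightarrow> t \<le> 1 \<Longrightarrow> \<bar>?p t x y\<bar> \<le> L.rho0 t * conv_measure (\<lambda>z. f_up d 1 (L.rho0 t * z)) (Q t) (y - x)"
    "\<And>t x y. 0 < t \<Longrightarrow> t \<le> 1 \<Longrightarrow> \<bar>p' t x y\<bar> \<le> L.rho0 t * conv_measure (\<lambda>z. f_up d 1 (L.rho0 t * z)) (Q t) (y - x)"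
    by (rule kernel_pair_conv_measure_bound[OF H one_le_numeral]) (rule that)
  have b1: "?p t x y \<le> levy_rho \<mu> t * conv_measure (\<lambda>z. f_up d 1 (levy_rho \<mu> t * z)) (Q t) (y - x)"
    if "t \<in> {0<..1}" for t x y
    using d(4)[of t x y] that by (simp add: rho0_eq)
  have b2: "\<bar>deriv (\<lambda>s. ?p s x y) t\<bar> \<le> 1 * inverse t * levy_rho \<mu> t * conv_measure (\<lambda>z. f_up d 1 (levy_rho \<mu> t * z)) (Q t) (y - x)"
    if t: "t \<in> {0<..1}" for t x y
  proof -
    have t': "0 < t" "t < 2" "t \<le> 1" using t by auto
    have "\<bar>deriv (\<lambda>s. ?p s x y) t\<bar> = inverse t * \<bar>p' t x y\<bar>"
      unfolding kernel_pair_continuous(4)[OF H(2) t'(1,2)] using t' by (simp add: abs_mult divide_inverse mult.commute)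
    also have "\<dots> \<le> inverse t * (levy_rho \<mu> t * conv_measure (\<lambda>z. f_up d 1 (levy_rho \<mu> t * z)) (Q t) (y - x))"
      using d(5)[of t x y] t' by (intro mult_left_mono) (auto simp: rho0_eq)
    finally show ?thesis by (simp add: mult.assoc)
  qed
  have fd: "(\<lambda>s. ?p s x y) field_differentiable at t" if "0 < t" for t x y
    by (rule cont(3)[of "t + 1"]) (use that in auto)
  show ?thesis
  proof (intro conjI allI impI)
    show "continuous_on ({0<..} \<times> UNIV \<times> UNIV) (\<lambda>(t, x, y). ?p t x y)" by (intro glob cont(1))
    show "continuous_on ({0<..} \<times> UNIV \<times> UNIV) (\<lambda>(t, x, y). deriv (\<lambda>s. ?p s x y) t)" by (intro glob cont(2))
    show "\<exists>d1>0. \<exists>d2>0. \<exists>Q :: real \<Rightarrow> real measure.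
          (\<forall>t\<ge>0. prob_space (Q t) \<and> sets (Q t) = sets borel) \<and>
          (\<forall>t\<in>{0<..1}. \<forall>x y. ?p t x y \<le>
             levy_rho \<mu> t * conv_measure (\<lambda>z. f_up d1 d2 (levy_rho \<mu> t * z)) (Q t) (y - x))"
      by (rule exI[of _ d], rule conjI[OF d(1)], rule exI[of _ 1], rule conjI[OF zero_less_one], rule exI[of _ Q])
         (use d(2,3) b1 in blast)
    show "\<exists>C>0. \<exists>d1>0. \<exists>d2>0. \<exists>Q :: real \<Rightarrow> real measure.
          (\<forall>t\<ge>0. prob_space (Q t) \<and> sets (Q t) = sets borel) \<and>
          (\<forall>t\<in>{0<..1}. \<forall>x y. \<bar>deriv (\<lambda>s. ?p s x y) t\<bar> \<le>
             C * inverse t * levy_rho \<mu> t *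
               conv_measure (\<lambda>z. f_up d1 d2 (levy_rho \<mu> t * z)) (Q t) (y - x))"
      by (rule exI[of _ 1], rule conjI[OF zero_less_one], rule exI[of _ d], rule conjI[OF d(1)],
          rule exI[of _ 1], rule conjI[OF zero_less_one], rule exI[of _ Q])
         (use d(2,3) b2 in blast)
  qed (rule fd)
qed

end
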